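(* Let $\mathcal{F}$ be a saturated fusion system over a discrete $p$-toral group $S$, and let $\mathcal{L}$ be a centric linking system associated to $\mathcal{F}$. Let $\mathcal{H}$ be a collection of $\mathcal{F}$-centric subgroups of $S$ that is closed under $\mathcal{F}$-conjugacy and contains all subgroups of $S$ that are both $\mathcal{F}$-centric and $\mathcal{F}$-radical. Let $\mathcal{H}^\bullet=\{P^\bullet \mid P\in\mathcal{H}\}$ and assume that $\mathcal{H}^\bullet\subseteq\mathcal{H}$. Let $\mathcal{L}^{\mathcal{H}}\subseteq\mathcal{L}$ denote the full subcategory of $\mathcal{L}$ whose objects are in $\mathcal{H}$. Then the inclusion of $\mathcal{L}^{\mathcal{H}}$ in $\mathcal{L}$ induces a homotopy equivalence of nerves $|\mathcal{L}^{\mathcal{H}}|\simeq|\mathcal{L}|$.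
   Context: Fix a prime $p$. A discrete $p$-toral group is a group $P$ given by an extension $1\to(\mathbb{Z}/p^\infty)^k\to P\to\pi_0P\to1$ with $k\ge0$ an integer (the rank) and $\pi_0P$ a finite $p$-group; the subgroup $P_0=(\mathbb{Z}/p^\infty)^k$ is the identity component. The size of $P$ is the pair $\mathrm{size}(P)=(k,|\pi_0P|)$, and sizes are ordered lexicographically. Write $c_g(x)=gxg^{-1}$. A fusion system $\mathcal{F}$ over a discrete $p$-toral group $S$ is a subcategory of the category of groups whose objects are all subgroups of $S$ and whose morphism sets $\mathrm{Hom}_{\mathcal{F}}(P,Q)$ consist of group monomorphisms such that (a) $\mathrm{Hom}_S(P,Q)\subseteq\mathrm{Hom}_{\mathcal{F}}(P,Q)$, where $\mathrm{Hom}_S(P,Q)$ is the set of homomorphisms $P\to Q$ of the form $c_g$ with $g\in S$, and (b) every morphism of $\mathcal{F}$ is an isomorphism in $\mathcal{F}$ followed by a subgroup inclusion. Subgroups are $\mathcal{F}$-conjugate if they are isomorphic in $\mathcal{F}$. A subgroup $P\subseteq S$ is fully centralized (resp. fully normalized) if $\mathrm{size}(C_SP)\ge\mathrm{size}(C_SQ)$ (resp. $\mathrm{size}(N_SP)\ge\mathrm{size}(N_SQ)$) for every $Q$ that is $\mathcal{F}$-conjugate to $P$. Write $\mathrm{Aut}_S(P)=\mathrm{Hom}_S(P,P)$, let $\mathrm{Aut}_P(P)$ be the group of inner automorphisms of $P$, and put $\mathrm{Out}_{\mathcal{F}}(P)=\mathrm{Aut}_{\mathcal{F}}(P)/\mathrm{Aut}_P(P)$,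 $\mathrm{Out}_S(P)=\mathrm{Aut}_S(P)/\mathrm{Aut}_P(P)$. $\mathcal{F}$ is saturated if: (I) whenever $P$ is fully normalized, $P$ is fully centralized, $\mathrm{Out}_{\mathcal{F}}(P)$ is finite, and $\mathrm{Out}_S(P)$ is a Sylow $p$-subgroup of $\mathrm{Out}_{\mathcal{F}}(P)$; (II) if $\phi\in\mathrm{Hom}_{\mathcal{F}}(P,S)$ and $\phi(P)$ is fully centralized, then for $N_\phi=\{g\in N_SP\mid\phi c_g\phi^{-1}\in\mathrm{Aut}_S(\phi(P))\}$ there is $\bar\phi\in\mathrm{Hom}_{\mathcal{F}}(N_\phi,S)$ with $\bar\phi|_P=\phi$; (III) if $P_1\subseteq P_2\subseteq\cdots$ are subgroups of $S$ with union $P_\infty$ and $\phi\in\mathrm{Hom}(P_\infty,S)$ satisfies $\phi|_{P_n}\in\mathrm{Hom}_{\mathcal{F}}(P_n,S)$ for all $n$, then $\phi\in\mathrm{Hom}_{\mathcal{F}}(P_\infty,S)$. A subgroup $P\subseteq S$ is $\mathcal{F}$-centric if $P$ and all its $\mathcal{F}$-conjugates contain their centralizers in $S$. It is $\mathcal{F}$-radical if $\mathrm{Out}_{\mathcal{F}}(P)$ contains no nontrivial normal $p$-subgroup. A centric linking system associated to $\mathcal{F}$ is a category $\mathcal{L}$ whose objects are the $\mathcal{F}$-centric subgroups of $S$, with a functor $\pi:\mathcal{L}\to\mathcal{F}$ and monomorphisms $\delta_P:P\to\mathrm{Aut}_{\mathcal{L}}(P)$ for each $\mathcal{F}$-centric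 $P$, such that: (A) $\pi$ is the identity on objects, and for all $P,Q$ the center $Z(P)$ acts freely on $\mathrm{Hom}_{\mathcal{L}}(P,Q)$ by composition via $\delta_P$ and $\pi$ induces a bijection $\mathrm{Hom}_{\mathcal{L}}(P,Q)/Z(P)\cong\mathrm{Hom}_{\mathcal{F}}(P,Q)$; (B) $\pi(\delta_P(g))=c_g$ for $g\in P$; (C) $f\circ\delta_P(g)=\delta_Q(\pi(f)(g))\circ f$ for $f\in\mathrm{Hom}_{\mathcal{L}}(P,Q)$, $g\in P$. The bullet construction $P\mapsto P^\bullet$ (Broto–Levi–Oliver): let $T=S_0$ be the identity component of $S$, $W=\mathrm{Aut}_{\mathcal{F}}(T)$, and let $p^m$ be the exponent of $S/T$. For $A\subseteq T$ let $I(A)=\{t\in T\mid w(t)=t\text{ for all }w\in W\text{ with }w|_A=\mathrm{id}_A\}$ and let $I(A)_0$ be its identity component. For $P\subseteq S$ let $P^{[m]}=\langle g^{p^m}\mid g\in P\rangle\subseteq T$, and define $P^\bullet=P\cdot I(P^{[m]})_0$, a subgroup of $S$ containing $P$. $|\mathcal{C}|$ denotes (the geometric realization of) the nerve of a category $\mathcal{C}$. *)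

theory Defs
  imports "HOL-Homology.Homology" "HOL-Algebra.Group_Action" "HOL-Computational_Algebra.Primes"
begin

section \<open>Categories\<close>

text \<open>Hom sets are indexed by source and target and need not be disjoint, so the same function may
  be a morphism between several pairs of objects. \<open>Comp C X Y Z g f\<close> is \<open>g \<circ> f\<close> for
  \<open>f : X \<rightarrow> Y\<close> and \<open>g : Y \<rightarrow> Z\<close>.\<close>

record ('o, 'm) cat =
  Obj :: "'o set"
  Hom :: "'o \<Rightarrow> 'o \<Rightarrow> 'm set"
  Comp :: "'o \<Rightarrow> 'o \<Rightarrow> 'o \<Rightarrow> 'm \<Rightarrow> 'm \<Rightarrow> 'm"
  Ident :: "'o \<Rightarrow> 'm"

locale category =
  fixes C :: "('o, 'm) cat"
  assumes Ident_in: "X \<in> Obj C \<Longrightarrow> Ident C X \<in> Hom C X X"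
    and Comp_in: "\<lbrakk>X \<in> Obj C; Y \<in> Obj C; Z \<in> Obj C; f \<in> Hom C X Y; g \<in> Hom C Y Z\<rbrakk>
      \<Longrightarrow> Comp C X Y Z g f \<in> Hom C X Z"
    and Comp_Ident_left: "\<lbrakk>X \<in> Obj C; Y \<in> Obj C; f \<in> Hom C X Y\<rbrakk> \<Longrightarrow> Comp C X Y Y (Ident C Y) f = f"
    and Comp_Ident_right: "\<lbrakk>X \<in> Obj C; Y \<in> Obj C; f \<in> Hom C X Y\<rbrakk> \<Longrightarrow> Comp C X X Y f (Ident C X) = f"
    and Comp_assoc: "\<lbrakk>W \<in> Obj C; X \<in> Obj C; Y \<in> Obj C; Z \<in> Obj C;
        f \<in> Hom C W X; g \<in> Hom C X Y; h \<in> Hom C Y Z\<rbrakk>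
      \<Longrightarrow> Comp C W X Z (Comp C X Y Z h g) f = Comp C W Y Z h (Comp C W X Y g f)"

definition is_functor ::
  "('o, 'm) cat \<Rightarrow> ('p, 'n) cat \<Rightarrow> ('o \<Rightarrow> 'p) \<Rightarrow> ('o \<Rightarrow> 'o \<Rightarrow> 'm \<Rightarrow> 'n) \<Rightarrow> bool" where
  "is_functor C D Fo Fm \<longleftrightarrow> category C \<and> category D \<and>
     (\<forall>X\<in>Obj C. Fo X \<in> Obj D \<and> Fm X X (Ident C X) = Ident D (Fo X)) \<and>
     (\<forall>X\<in>Obj C. \<forall>Y\<in>Obj C. \<forall>f\<in>Hom C X Y. Fm X Y f \<in> Hom D (Fo X) (Fo Y)) \<and>
     (\<forall>X\<in>Obj C. \<forall>Y\<in>Obj C. \<forall>Z\<in>Obj C. \<forall>f\<in>Hom C X Y. \<forall>g\<in>Hom C Y Z.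
        Fm X Z (Comp C X Y Z g f) = Comp D (Fo X) (Fo Y) (Fo Z) (Fm Y Z g) (Fm X Y f))"

definition subcategory :: "('o, 'm) cat \<Rightarrow> ('o, 'm) cat \<Rightarrow> bool" where
  "subcategory D C \<longleftrightarrow> category D \<and> category C \<and> Obj D \<subseteq> Obj C \<and>
     (\<forall>X\<in>Obj D. Ident D X = Ident C X) \<and>
     (\<forall>X\<in>Obj D. \<forall>Y\<in>Obj D. Hom D X Y \<subseteq> Hom C X Y) \<and>
     (\<forall>X\<in>Obj D. \<forall>Y\<in>Obj D. \<forall>Z\<in>Obj D. \<forall>f\<in>Hom D X Y. \<forall>g\<in>Hom D Y Z.
        Comp D X Y Z g f = Comp C X Y Z g f)"

definition full_subcategory :: "('o, 'm) cat \<Rightarrow> 'o set \<Rightarrow> ('o, 'm) cat" where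
  "full_subcategory C \<H> = C\<lparr>Obj := Obj C \<inter> \<H>\<rparr>"

definition isos :: "('o, 'm) cat \<Rightarrow> 'o \<Rightarrow> 'o \<Rightarrow> 'm set" where
  "isos C X Y = {f \<in> Hom C X Y. \<exists>g\<in>Hom C Y X.
     Comp C X Y X g f = Ident C X \<and> Comp C Y X Y f g = Ident C Y}"

definition isomorphic_in :: "('o, 'm) cat \<Rightarrow> 'o \<Rightarrow> 'o \<Rightarrow> bool" where
  "isomorphic_in C X Y \<longleftrightarrow> X \<in> Obj C \<and> Y \<in> Obj C \<and> isos C X Y \<noteq> {}"

definition aut_group :: "('o, 'm) cat \<Rightarrow> 'o \<Rightarrow> 'm monoid" where
  "aut_group C X = \<lparr>carrier = isos C X X, monoid.mult = Comp C X X X, one = Ident C X\<rparr>"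


section \<open>Geometric realization of the nerve\<close>

text \<open>\<open>Act X m n \<alpha> : X\<^sub>n \<rightarrow> X\<^sub>m\<close> is the operator induced by a monotone map \<open>\<alpha> : [m] \<rightarrow> [n]\<close>, where
  \<open>[n] = {0,\<dots>,n}\<close>.\<close>

record 'x simplicial =
  Simp :: "nat \<Rightarrow> 'x set"
  Act :: "nat \<Rightarrow> nat \<Rightarrow> (nat \<Rightarrow> nat) \<Rightarrow> 'x \<Rightarrow> 'x"

definition simplex_op :: "nat \<Rightarrow> nat \<Rightarrow> (nat \<Rightarrow> nat) set" where
  "simplex_op m n = {\<alpha>. mono_on {..m} \<alpha> \<and> \<alpha> \<in> {..m} \<rightarrow> {..n}}"

text \<open>The \<open>n\<close>-simplices of the nerve are the functors \<open>[n] \<rightarrow> C\<close>: a family of objects \<open>x i\<close> (\<open>i \<le> n\<close>)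
  together with morphisms \<open>u i j : x i \<rightarrow> x j\<close> (\<open>i \<le> j \<le> n\<close>). Outside these index ranges the
  families are \<open>undefined\<close>, so that equal functors are equal simplices.\<close>

type_synonym ('o, 'm) nerve_simplex = "(nat \<Rightarrow> 'o) \<times> (nat \<Rightarrow> nat \<Rightarrow> 'm)"

definition nerve :: "('o, 'm) cat \<Rightarrow> ('o, 'm) nerve_simplex simplicial" where
  "nerve C = \<lparr>
     Simp = (\<lambda>n. {(x, u).
        x \<in> {..n} \<rightarrow>\<^sub>E Obj C \<and>
        (\<forall>i j. i \<le> j \<and> j \<le> n \<longrightarrow> u i j \<in> Hom C (x i) (x j)) \<and>
        (\<forall>i j. \<not> (i \<le> j \<and> j \<le> n) \<longrightarrow> u i j = undefined) \<and>
        (\<forall>i\<le>n. u i i = Ident C (x i)) \<and>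
        (\<forall>i j k. i \<le> j \<and> j \<le> k \<and> k \<le> n \<longrightarrow> u i k = Comp C (x i) (x j) (x k) (u j k) (u i j))}),
     Act = (\<lambda>m n \<alpha> (x, u).
        (\<lambda>i\<in>{..m}. x (\<alpha> i), \<lambda>i j. if i \<le> j \<and> j \<le> m then u (\<alpha> i) (\<alpha> j) else undefined))\<rparr>"

definition nerve_map :: "('o \<Rightarrow> 'p) \<Rightarrow> ('o \<Rightarrow> 'o \<Rightarrow> 'm \<Rightarrow> 'n) \<Rightarrow>
    nat \<Rightarrow> ('o, 'm) nerve_simplex \<Rightarrow> ('p, 'n) nerve_simplex" where
  "nerve_map Fo Fm n = (\<lambda>(x, u).
     (\<lambda>i\<in>{..n}. Fo (x i), \<lambda>i j. if i \<le> j \<and> j \<le> n then Fm (x i) (x j) (u i j) else undefined))"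

definition simplex_push :: "nat \<Rightarrow> (nat \<Rightarrow> nat) \<Rightarrow> (nat \<Rightarrow> real) \<Rightarrow> (nat \<Rightarrow> real)" where
  "simplex_push m \<alpha> t = (\<lambda>j. \<Sum>i | i \<le> m \<and> \<alpha> i = j. t i)"

definition quotient_topology :: "'a topology \<Rightarrow> ('a \<times> 'a) set \<Rightarrow> 'a set topology" where
  "quotient_topology X R = topology (\<lambda>\<U>. \<U> \<subseteq> topspace X // R \<and> openin X (\<Union>\<U>))"

text \<open>\<open>|X|\<close> is the quotient of the disjoint union of the spaces \<open>{x} \<times> \<Delta>\<^sup>n\<close>, \<open>x \<in> X\<^sub>n\<close>, by the
  equivalence relation generated by \<open>(\<alpha>\<^sup>*x, t) \<sim> (x, \<alpha>\<^sub>*t)\<close>.\<close>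

definition simplex_sum :: "'x simplicial \<Rightarrow> ((nat \<times> 'x) \<times> (nat \<Rightarrow> real)) topology" where
  "simplex_sum X = sum_topology
     (\<lambda>(n, x). subtopology (powertop_real UNIV) (standard_simplex n)) (Sigma UNIV (Simp X))"

definition glue :: "'x simplicial \<Rightarrow> (((nat \<times> 'x) \<times> (nat \<Rightarrow> real)) \<times> ((nat \<times> 'x) \<times> (nat \<Rightarrow> real))) set"
  where
  "glue X = {(((m, Act X m n \<alpha> x), t), ((n, x), simplex_push m \<alpha> t)) | m n \<alpha> x t.
     x \<in> Simp X n \<and> \<alpha> \<in> simplex_op m n \<and> t \<in> standard_simplex m}"

definition realization_equiv ::
  "'x simplicial \<Rightarrow> (((nat \<times> 'x) \<times> (nat \<Rightarrow> real)) \<times> ((nat \<times> 'x) \<times> (nat \<Rightarrow> real))) set" where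
  "realization_equiv X =
     (glue X \<union> (glue X)\<inverse>)\<^sup>* \<inter> (topspace (simplex_sum X) \<times> topspace (simplex_sum X))"

definition realization :: "'x simplicial \<Rightarrow> ((nat \<times> 'x) \<times> (nat \<Rightarrow> real)) set topology" where
  "realization X = quotient_topology (simplex_sum X) (realization_equiv X)"

text \<open>The map \<open>[x, t] \<mapsto> [h x, t]\<close>, for a simplicial map \<open>h\<close> into \<open>Y\<close>.\<close>

definition realization_map :: "'y simplicial \<Rightarrow> (nat \<Rightarrow> 'x \<Rightarrow> 'y) \<Rightarrow>
    ((nat \<times> 'x) \<times> (nat \<Rightarrow> real)) set \<Rightarrow> ((nat \<times> 'y) \<times> (nat \<Rightarrow> real)) set" where
  "realization_map Y h c = realization_equiv Y `` ((\<lambda>((n, x), t). ((n, h n x), t)) ` c)"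

definition homotopy_equivalence_map :: "'a topology \<Rightarrow> 'b topology \<Rightarrow> ('a \<Rightarrow> 'b) \<Rightarrow> bool" where
  "homotopy_equivalence_map X Y f \<longleftrightarrow> continuous_map X Y f \<and>
     (\<exists>g. continuous_map Y X g \<and> homotopic_with (\<lambda>x. True) X X (g \<circ> f) id \<and>
          homotopic_with (\<lambda>x. True) Y Y (f \<circ> g) id)"

definition inclusion_nerve_map :: "('o, 'm) cat \<Rightarrow>
    ((nat \<times> ('o, 'm) nerve_simplex) \<times> (nat \<Rightarrow> real)) set \<Rightarrow>
    ((nat \<times> ('o, 'm) nerve_simplex) \<times> (nat \<Rightarrow> real)) set" where
  "inclusion_nerve_map C = realization_map (nerve C) (nerve_map (\<lambda>X. X) (\<lambda>X Y f. f))"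

lemma istopology_quotient:
  assumes "equiv (topspace X) R"
  shows "istopology (\<lambda>\<U>. \<U> \<subseteq> topspace X // R \<and> openin X (\<Union>\<U>))"
proof -
  have "\<Union>(\<U> \<inter> \<V>) = \<Union>\<U> \<inter> \<Union>\<V>" if "\<U> \<subseteq> topspace X // R" "\<V> \<subseteq> topspace X // R" for \<U> \<V>
    using that quotient_disj[OF assms] by blast
  moreover have "\<Union>(\<Union>\<K>) = (\<Union>\<U>\<in>\<K>. \<Union>\<U>)" for \<K> :: "'a set set set"
    by blast
  ultimately show ?thesis
    unfolding istopology_def
    by (intro conjI allI impI) (simp_all add: le_infI1 Sup_le_iff openin_Int openin_clauses(3))
qed

lemma openin_quotient_topology:
  assumes "equiv (topspace X) R"
  shows "openin (quotient_topology X R) \<U> \<longleftrightarrow> \<U> \<subseteq> topspace X // R \<and> openin X (\<Union>\<U>)"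
  using istopology_quotient[OF assms] by (simp add: quotient_topology_def)

lemma topspace_quotient_topology:
  assumes "equiv (topspace X) R"
  shows "topspace (quotient_topology X R) = topspace X // R"
proof -
  have "openin (quotient_topology X R) (topspace X // R)"
    by (simp add: openin_quotient_topology[OF assms] Union_quotient[OF assms])
  then show ?thesis
    using openin_quotient_topology[OF assms] by (metis openin_subset openin_topspace subset_antisym)
qed

lemma standard_simplex_push:
  assumes "\<alpha> \<in> simplex_op m n" "t \<in> standard_simplex m"
  shows "simplex_push m \<alpha> t \<in> standard_simplex n"
proof -
  have t: "\<And>i. 0 \<le> t i" "(\<Sum>i\<le>m. t i) = 1"
    using assms(2) by (auto simp: standard_simplex_def)
  have eq: "{i. i \<le> m \<and> \<alpha> i = j} = {i \<in> {..m}. \<alpha> i = j}" for j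
    by auto
  have ge: "0 \<le> simplex_push m \<alpha> t j" for j
    unfolding simplex_push_def by (rule sum_nonneg) (use t in auto)
  moreover have le: "simplex_push m \<alpha> t j \<le> 1" for j
    unfolding simplex_push_def t(2)[symmetric] by (rule sum_mono2) (use t in auto)
  moreover have "simplex_push m \<alpha> t j = 0" if "j > n" for j
  proof -
    have "{i. i \<le> m \<and> \<alpha> i = j} = {}"
      using assms(1) that by (force simp: simplex_op_def)
    then show ?thesis by (simp add: simplex_push_def del: Collect_empty_eq)
  qed
  moreover have "(\<Sum>j\<le>n. simplex_push m \<alpha> t j) = 1"
    unfolding simplex_push_def eq t(2)[symmetric]
    by (rule sum.group) (use assms(1) in \<open>auto simp: simplex_op_def\<close>)
  ultimately show ?thesis
    by (auto simp: standard_simplex_def)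
qed

lemma equiv_realization_equiv: "equiv (topspace (simplex_sum X)) (realization_equiv X)"
proof (rule equivI)
  show "realization_equiv X \<subseteq> topspace (simplex_sum X) \<times> topspace (simplex_sum X)"
    by (auto simp: realization_equiv_def)
  show "refl_on (topspace (simplex_sum X)) (realization_equiv X)"
    by (auto simp: refl_on_def realization_equiv_def)
  have "sym ((glue X \<union> (glue X)\<inverse>)\<^sup>*)"
    by (rule sym_rtrancl) (auto simp: sym_def)
  then show "sym (realization_equiv X)"
    by (auto simp: sym_def realization_equiv_def)
  show "trans (realization_equiv X)"
    by (auto simp: trans_def realization_equiv_def)
qed


section \<open>Discrete \<open>p\<close>-toral groups\<close>

text \<open>\<open>\<int>/p\<^sup>\<infinity> = \<int>[1/p]/\<int>\<close>.\<close>

definition prufer_group :: "nat \<Rightarrow> rat set monoid" where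
  "prufer_group p =
     \<lparr>carrier = {of_int a / of_nat (p ^ n) | a n. True}, monoid.mult = (+), one = 0\<rparr> Mod \<int>"

definition p_group :: "nat \<Rightarrow> ('a, 'b) monoid_scheme \<Rightarrow> bool" where
  "p_group p G \<longleftrightarrow> group G \<and> (\<forall>x\<in>carrier G. \<exists>n. x [^]\<^bsub>G\<^esub> (p ^ n :: nat) = \<one>\<^bsub>G\<^esub>)"

definition toral_extension :: "nat \<Rightarrow> ('a, 'b) monoid_scheme \<Rightarrow> nat \<Rightarrow> 'a set \<Rightarrow> bool" where
  "toral_extension p G k T \<longleftrightarrow> T \<lhd> G \<and>
     G\<lparr>carrier := T\<rparr> \<cong> product_group {..<k} (\<lambda>_. prufer_group p) \<and>
     finite (carrier (G Mod T)) \<and> p_group p (G Mod T)"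

definition discrete_p_toral :: "nat \<Rightarrow> ('a, 'b) monoid_scheme \<Rightarrow> bool" where
  "discrete_p_toral p G \<longleftrightarrow> group G \<and> (\<exists>k T. toral_extension p G k T)"

text \<open>The identity component and the rank are determined by the group.\<close>

definition identity_component :: "nat \<Rightarrow> ('a, 'b) monoid_scheme \<Rightarrow> 'a set" where
  "identity_component p G = (THE T. \<exists>k. toral_extension p G k T)"

definition toral_rank :: "nat \<Rightarrow> ('a, 'b) monoid_scheme \<Rightarrow> nat" where
  "toral_rank p G = (THE k. \<exists>T. toral_extension p G k T)"

definition toral_size :: "nat \<Rightarrow> ('a, 'b) monoid_scheme \<Rightarrow> nat \<times> nat" where
  "toral_size p G = (toral_rank p G, order (G Mod identity_component p G))"

definition size_le :: "nat \<times> nat \<Rightarrow> nat \<times> nat \<Rightarrow> bool" where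
  "size_le s t \<longleftrightarrow> fst s < fst t \<or> (fst s = fst t \<and> snd s \<le> snd t)"


section \<open>Fusion systems\<close>

definition conj_map :: "('a, 'b) monoid_scheme \<Rightarrow> 'a \<Rightarrow> 'a \<Rightarrow> 'a" where
  "conj_map S g x = g \<otimes>\<^bsub>S\<^esub> x \<otimes>\<^bsub>S\<^esub> inv\<^bsub>S\<^esub> g"

definition centralizer :: "('a, 'b) monoid_scheme \<Rightarrow> 'a set \<Rightarrow> 'a set" where
  "centralizer S P = {g \<in> carrier S. \<forall>x\<in>P. g \<otimes>\<^bsub>S\<^esub> x = x \<otimes>\<^bsub>S\<^esub> g}"

text \<open>Homomorphisms defined on a subgroup \<open>P\<close> are represented by functions that are \<open>undefined\<close>
  outside \<open>P\<close>, so that equality of functions is equality of morphisms.\<close>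

definition subgroup_category :: "('a, 'b) monoid_scheme \<Rightarrow> ('a set, 'a \<Rightarrow> 'a) cat" where
  "subgroup_category S = \<lparr>
     Obj = {P. subgroup P S},
     Hom = (\<lambda>P Q. hom (S\<lparr>carrier := P\<rparr>) (S\<lparr>carrier := Q\<rparr>) \<inter> extensional P),
     Comp = (\<lambda>P Q R g f. compose P g f),
     Ident = (\<lambda>P. \<lambda>x\<in>P. x)\<rparr>"

text \<open>\<open>conj_hom S A P Q\<close> is the set of homomorphisms \<open>P \<rightarrow> Q\<close> of the form \<open>c\<^sub>g\<close> with \<open>g \<in> A\<close>;
  thus \<open>Hom\<^sub>S(P,Q)\<close> is \<open>A = carrier S\<close>, and \<open>Aut\<^sub>P(P)\<close> is \<open>A = P = Q\<close>.\<close>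

definition conj_hom :: "('a, 'b) monoid_scheme \<Rightarrow> 'a set \<Rightarrow> 'a set \<Rightarrow> 'a set \<Rightarrow> ('a \<Rightarrow> 'a) set" where
  "conj_hom S A P Q = {restrict (conj_map S g) P | g. g \<in> A \<and> conj_map S g ` P \<subseteq> Q}"

definition fusion_system :: "('a, 'b) monoid_scheme \<Rightarrow> ('a set, 'a \<Rightarrow> 'a) cat \<Rightarrow> bool" where
  "fusion_system S F \<longleftrightarrow>
     subcategory F (subgroup_category S) \<and>
     Obj F = {P. subgroup P S} \<and>
     (\<forall>P\<in>Obj F. \<forall>Q\<in>Obj F. \<forall>\<phi>\<in>Hom F P Q. inj_on \<phi> P) \<and>
     (\<forall>P\<in>Obj F. \<forall>Q\<in>Obj F. conj_hom S (carrier S) P Q \<subseteq> Hom F P Q) \<and>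
     (\<forall>P\<in>Obj F. \<forall>Q\<in>Obj F. \<forall>\<phi>\<in>Hom F P Q.
        \<exists>R\<in>Obj F. R \<subseteq> Q \<and> (\<exists>\<psi>\<in>isos F P R. \<phi> = Comp F P R Q (\<lambda>x\<in>R. x) \<psi>))"

definition fully_centralized ::
  "nat \<Rightarrow> ('a, 'b) monoid_scheme \<Rightarrow> ('a set, 'a \<Rightarrow> 'a) cat \<Rightarrow> 'a set \<Rightarrow> bool" where
  "fully_centralized p S F P \<longleftrightarrow> P \<in> Obj F \<and> (\<forall>Q. isomorphic_in F P Q \<longrightarrow>
     size_le (toral_size p (S\<lparr>carrier := centralizer S Q\<rparr>))
             (toral_size p (S\<lparr>carrier := centralizer S P\<rparr>)))"

definition fully_normalized ::
  "nat \<Rightarrow> ('a, 'b) monoid_scheme \<Rightarrow> ('a set, 'a \<Rightarrow> 'a) cat \<Rightarrow> 'a set \<Rightarrow> bool" where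
  "fully_normalized p S F P \<longleftrightarrow> P \<in> Obj F \<and> (\<forall>Q. isomorphic_in F P Q \<longrightarrow>
     size_le (toral_size p (S\<lparr>carrier := normalizer S Q\<rparr>))
             (toral_size p (S\<lparr>carrier := normalizer S P\<rparr>)))"

definition out_group ::
  "('a, 'b) monoid_scheme \<Rightarrow> ('a set, 'a \<Rightarrow> 'a) cat \<Rightarrow> 'a set \<Rightarrow> ('a \<Rightarrow> 'a) set monoid" where
  "out_group S F P = aut_group F P Mod conj_hom S P P P"

definition out_S ::
  "('a, 'b) monoid_scheme \<Rightarrow> ('a set, 'a \<Rightarrow> 'a) cat \<Rightarrow> 'a set \<Rightarrow> ('a \<Rightarrow> 'a) set set" where
  "out_S S F P =
     carrier ((aut_group F P)\<lparr>carrier := conj_hom S (carrier S) P P\<rparr> Mod conj_hom S P P P)"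

definition sylow_subgroup :: "nat \<Rightarrow> 'a set \<Rightarrow> ('a, 'b) monoid_scheme \<Rightarrow> bool" where
  "sylow_subgroup p Q G \<longleftrightarrow> subgroup Q G \<and> card Q = p ^ multiplicity p (order G)"

text \<open>For \<open>\<phi>\<close> injective on \<open>P\<close>, \<open>inv_into P \<phi>\<close> is the inverse \<open>\<phi>(P) \<rightarrow> P\<close>.\<close>

definition N_phi :: "('a, 'b) monoid_scheme \<Rightarrow> 'a set \<Rightarrow> ('a \<Rightarrow> 'a) \<Rightarrow> 'a set" where
  "N_phi S P \<phi> = {g \<in> normalizer S P.
     (\<lambda>x\<in>\<phi> ` P. \<phi> (conj_map S g (inv_into P \<phi> x))) \<in> conj_hom S (carrier S) (\<phi> ` P) (\<phi> ` P)}"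

definition saturated_fusion_system ::
  "nat \<Rightarrow> ('a, 'b) monoid_scheme \<Rightarrow> ('a set, 'a \<Rightarrow> 'a) cat \<Rightarrow> bool" where
  "saturated_fusion_system p S F \<longleftrightarrow> fusion_system S F \<and>
     (\<forall>P\<in>Obj F. fully_normalized p S F P \<longrightarrow>
        fully_centralized p S F P \<and> finite (carrier (out_group S F P)) \<and>
        sylow_subgroup p (out_S S F P) (out_group S F P)) \<and>
     (\<forall>P\<in>Obj F. \<forall>\<phi>\<in>Hom F P (carrier S). fully_centralized p S F (\<phi> ` P) \<longrightarrow>
        (\<exists>\<psi>\<in>Hom F (N_phi S P \<phi>) (carrier S). restrict \<psi> P = \<phi>)) \<and>
     (\<forall>P :: nat \<Rightarrow> 'a set. \<forall>\<phi>\<in>Hom (subgroup_category S) (\<Union>n. P n) (carrier S).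
        (\<forall>n. P n \<in> Obj F \<and> P n \<subseteq> P (Suc n) \<and> restrict \<phi> (P n) \<in> Hom F (P n) (carrier S)) \<longrightarrow>
        \<phi> \<in> Hom F (\<Union>n. P n) (carrier S))"

definition F_centric :: "('a, 'b) monoid_scheme \<Rightarrow> ('a set, 'a \<Rightarrow> 'a) cat \<Rightarrow> 'a set \<Rightarrow> bool" where
  "F_centric S F P \<longleftrightarrow> P \<in> Obj F \<and> (\<forall>Q. isomorphic_in F P Q \<longrightarrow> centralizer S Q \<subseteq> Q)"

definition F_radical ::
  "nat \<Rightarrow> ('a, 'b) monoid_scheme \<Rightarrow> ('a set, 'a \<Rightarrow> 'a) cat \<Rightarrow> 'a set \<Rightarrow> bool" where
  "F_radical p S F P \<longleftrightarrow> P \<in> Obj F \<and>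
     (\<forall>N. N \<lhd> out_group S F P \<and> p_group p ((out_group S F P)\<lparr>carrier := N\<rparr>) \<longrightarrow>
        N = {\<one>\<^bsub>out_group S F P\<^esub>})"


section \<open>Centric linking systems\<close>

text \<open>The orbit of \<open>f : P \<rightarrow> Q\<close> under the right action of \<open>Z(P) = P \<inter> C\<^sub>S(P)\<close> by \<open>f \<mapsto> f \<circ> \<delta>\<^sub>P(z)\<close>.\<close>

definition center_orbit :: "('a, 'b) monoid_scheme \<Rightarrow> ('a set, 'm) cat \<Rightarrow>
    ('a set \<Rightarrow> 'a \<Rightarrow> 'm) \<Rightarrow> 'a set \<Rightarrow> 'a set \<Rightarrow> 'm \<Rightarrow> 'm set" where
  "center_orbit S L \<delta> P Q f = {Comp L P P Q f (\<delta> P z) | z. z \<in> P \<inter> centralizer S P}"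

text \<open>\<open>\<pi>\<close> is the morphism part of the functor \<open>L \<rightarrow> F\<close>, which is the identity on objects.\<close>

definition centric_linking_system ::
  "('a, 'b) monoid_scheme \<Rightarrow> ('a set, 'a \<Rightarrow> 'a) cat \<Rightarrow> ('a set, 'm) cat \<Rightarrow>
   ('a set \<Rightarrow> 'a set \<Rightarrow> 'm \<Rightarrow> 'a \<Rightarrow> 'a) \<Rightarrow> ('a set \<Rightarrow> 'a \<Rightarrow> 'm) \<Rightarrow> bool" where
  "centric_linking_system S F L \<pi> \<delta> \<longleftrightarrow>
     category L \<and> Obj L = {P. F_centric S F P} \<and>
     is_functor L F (\<lambda>P. P) \<pi> \<and>
     (\<forall>P\<in>Obj L. \<delta> P \<in> hom (S\<lparr>carrier := P\<rparr>) (aut_group L P) \<and> inj_on (\<delta> P) P) \<and>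
     (\<forall>P\<in>Obj L. \<forall>Q\<in>Obj L.
        (\<forall>f\<in>Hom L P Q. \<forall>z\<in>P \<inter> centralizer S P. Comp L P P Q f (\<delta> P z) = f \<longrightarrow> z = \<one>\<^bsub>S\<^esub>) \<and>
        (\<exists>h. bij_betw h (center_orbit S L \<delta> P Q ` Hom L P Q) (Hom F P Q) \<and>
             (\<forall>f\<in>Hom L P Q. h (center_orbit S L \<delta> P Q f) = \<pi> P Q f))) \<and>
     (\<forall>P\<in>Obj L. \<forall>g\<in>P. \<pi> P P (\<delta> P g) = restrict (conj_map S g) P) \<and>
     (\<forall>P\<in>Obj L. \<forall>Q\<in>Obj L. \<forall>f\<in>Hom L P Q. \<forall>g\<in>P.
        Comp L P P Q f (\<delta> P g) = Comp L P Q Q (\<delta> Q (\<pi> P Q f g)) f)"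


section \<open>The bullet construction\<close>

definition group_exponent :: "('a, 'b) monoid_scheme \<Rightarrow> nat" where
  "group_exponent G = (LEAST e. 0 < e \<and> (\<forall>x\<in>carrier G. x [^]\<^bsub>G\<^esub> e = \<one>\<^bsub>G\<^esub>))"

definition bullet_I ::
  "nat \<Rightarrow> ('a, 'b) monoid_scheme \<Rightarrow> ('a set, 'a \<Rightarrow> 'a) cat \<Rightarrow> 'a set \<Rightarrow> 'a set" where
  "bullet_I p S F A = {t \<in> identity_component p S.
     \<forall>w \<in> carrier (aut_group F (identity_component p S)). (\<forall>a\<in>A. w a = a) \<longrightarrow> w t = t}"

text \<open>\<open>power_subgroup p S P\<close> is \<open>P\<^sup>[\<^sup>m\<^sup>]\<close>, where \<open>p\<^sup>m\<close> is the exponent of \<open>S / S\<^sub>0\<close>.\<close>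

definition power_subgroup :: "nat \<Rightarrow> ('a, 'b) monoid_scheme \<Rightarrow> 'a set \<Rightarrow> 'a set" where
  "power_subgroup p S P =
     generate S {g [^]\<^bsub>S\<^esub> group_exponent (S Mod identity_component p S) | g. g \<in> P}"

definition bullet ::
  "nat \<Rightarrow> ('a, 'b) monoid_scheme \<Rightarrow> ('a set, 'a \<Rightarrow> 'a) cat \<Rightarrow> 'a set \<Rightarrow> 'a set" where
  "bullet p S F P =
     P <#>\<^bsub>S\<^esub> identity_component p (S\<lparr>carrier := bullet_I p S F (power_subgroup p S P)\<rparr>)"

end

theory Submission
  imports Defs "HOL-Analysis.Abstract_Topological_Spaces" "HOL-Algebra.Sylow" "HOL-Algebra.Left_Coset" "HOL-Algebra.Zassenhaus"
begin

text \<open>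
  A point of \<open>|C|\<close> is a step functor \<open>[0, 1) \<rightarrow> C\<close>, a natural transformation sweeps one map of step
  functors into another, and contractible fibres \<open>P \<down> L\<^sup>H\<close> allow pushing \<open>|L|\<close> into \<open>|L\<^sup>H|\<close> skeleton by
  skeleton (Quillen's Theorem A). Since \<open>P \<mapsto> P\<^sup>\<bullet>\<close> is functorial, \<open>P \<down> L\<^sup>H\<close> deforms onto \<open>P\<^sup>\<bullet> \<down> L\<^sup>H\<close>, and
  sizes of bullet subgroups are bounded, so descending induction on size is possible for \<open>P = P\<^sup>\<bullet>\<close>. If
  \<open>P \<notin> H\<close>, then \<open>P\<close> is not radical. By induction \<open>P \<down> L\<^sup>H\<close> may be replaced by the poset of all \<open>(Q, f)\<close>
  with \<open>f(P) \<noteq> Q\<close>. Replacing \<open>Q\<close> by \<open>N\<^sub>Q(f P)\<close> makes \<open>(Q, f)\<close> comparable with the subgroup of \<open>Aut\<^sub>F(P)\<close>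
  that it induces; multiplying this with a nontrivial normal \<open>p\<close>-subgroup of \<open>Out\<^sub>F(P)\<close> stays inside
  a conjugate of the Sylow subgroup \<open>Out\<^sub>S(P)\<close>, so that the poset is conically contractible.
\<close>

section \<open>The nerve as a space of step functors\<close>

type_synonym ('o, 'm) step = "(real \<Rightarrow> 'o) \<times> (real \<Rightarrow> real \<Rightarrow> 'm)"

definition cidx :: "(nat \<Rightarrow> real) \<Rightarrow> real \<Rightarrow> nat" where
  "cidx t s = (LEAST j. s < (\<Sum>i\<le>j. t i))"

definition pull :: "(real \<Rightarrow> nat) \<Rightarrow> ('o, 'm) nerve_simplex \<Rightarrow> ('o, 'm) step" where
  "pull c = (\<lambda>(x, u). (\<lambda>s. if 0 \<le> s \<and> s < 1 then x (c s) else undefined,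
     \<lambda>r s. if 0 \<le> r \<and> r \<le> s \<and> s < 1 then u (c r) (c s) else undefined))"

definition stp :: "(nat \<times> ('o, 'm) nerve_simplex) \<times> (nat \<Rightarrow> real) \<Rightarrow> ('o, 'm) step" where
  "stp = (\<lambda>((n, \<sigma>), t). pull (cidx t) \<sigma>)"

abbreviation pt where "pt n \<sigma> t \<equiv> stp ((n, \<sigma>), t)"

abbreviation full where "full \<equiv> full_subcategory"

abbreviation geo where "geo C \<equiv> realization (nerve C)"

abbreviation std_simplex ("\<Delta>") where "\<Delta> \<equiv> standard_simplex"

abbreviation splx where "splx C \<equiv> Simp (nerve C)"

abbreviation cells where "cells C \<equiv> topspace (simplex_sum (nerve C))"

definition steps :: "('o, 'm) cat \<Rightarrow> ('o, 'm) step topology" where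
  "steps C = topology (\<lambda>U. U \<subseteq> stp ` cells C \<and>
     openin (simplex_sum (nerve C)) {z \<in> cells C. stp z \<in> U})"

abbreviation pts where "pts C \<equiv> topspace (steps C)"

abbreviation homotopic where "homotopic C D \<equiv> homotopic_with (\<lambda>_. True) (steps C) (steps D)"

abbreviation simplex_top :: "nat \<Rightarrow> (nat \<Rightarrow> real) topology" where
  "simplex_top n \<equiv> subtopology (powertop_real UNIV) (\<Delta> n)"

lemma standard_simplexD:
  assumes "t \<in> \<Delta> n"
  shows "0 \<le> t i" "t i \<le> 1" "i > n \<Longrightarrow> t i = 0" "sum t {..n} = 1"
  using assms by (auto simp: standard_simplex_def)

lemma standard_simplexI:
  assumes "\<And>i. i \<le> n \<Longrightarrow> 0 \<le> t i" "\<And>i. i > n \<Longrightarrow> t i = 0" "sum t {..n} = 1"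
  shows "t \<in> \<Delta> n"
proof -
  have "t i \<le> 1" for i
  proof (cases "i \<le> n")
    case True
    have "t i \<le> sum t {..n}"
      by (rule member_le_sum) (use assms(1) True in auto)
    then show ?thesis using assms(3) by simp
  qed (use assms(2)[of i] in auto)
  moreover have "0 \<le> t i" for i
    using assms(1,2)[of i] by (cases "i \<le> n") auto
  ultimately show ?thesis
    using assms by (auto simp: standard_simplex_def)
qed

lemma cidx_bounds:
  assumes "t \<in> \<Delta> n" "0 \<le> s" "s < 1"
  shows "cidx t s \<le> n" "sum t {..<cidx t s} \<le> s" "s < sum t {..cidx t s}"
proof -
  have n: "s < sum t {..n}"
    using assms by (simp add: standard_simplexD)
  show "cidx t s \<le> n" "s < sum t {..cidx t s}"
    unfolding cidx_def using n by (auto intro: Least_le LeastI)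
  show "sum t {..<cidx t s} \<le> s"
  proof (cases "cidx t s")
    case 0 then show ?thesis using assms by simp
  next
    case (Suc k)
    then have "\<not> s < sum t {..k}"
      unfolding cidx_def using not_less_Least by (metis lessI)
    then show ?thesis using Suc by (simp add: lessThan_Suc_atMost)
  qed
qed

lemma cidx_eqI:
  assumes "\<And>i. 0 \<le> t i" "sum t {..<j} \<le> s" "s < sum t {..j}"
  shows "cidx t s = j"
  unfolding cidx_def
proof (rule Least_equality)
  fix k assume k: "s < sum t {..k}"
  show "j \<le> k"
  proof (rule ccontr)
    assume "\<not> j \<le> k"
    then have "sum t {..k} \<le> sum t {..<j}"
      by (intro sum_mono2) (use assms in auto)
    then show False using k assms by linarith
  qed
qed (use assms in auto)

lemma cidx_mono:
  assumes "t \<in> \<Delta> n" "0 \<le> r" "r \<le> s" "s < 1"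
  shows "cidx t r \<le> cidx t s"
  using assms cidx_bounds[of t n s] unfolding cidx_def[of t r]
  by (intro Least_le) auto

lemma simplex_opD:
  assumes "\<alpha> \<in> simplex_op m n"
  shows "i \<le> m \<Longrightarrow> \<alpha> i \<le> n" "i \<le> j \<Longrightarrow> j \<le> m \<Longrightarrow> \<alpha> i \<le> \<alpha> j"
  using assms by (auto simp: simplex_op_def mono_on_def)

lemma sum_simplex_push:
  "finite J \<Longrightarrow> sum (simplex_push m \<alpha> t) J = (\<Sum>i | i \<le> m \<and> \<alpha> i \<in> J. t i)"
proof (induction rule: finite_induct)
  case (insert j J)
  have "(\<Sum>i | i \<le> m \<and> \<alpha> i \<in> insert j J. t i) =
      (\<Sum>i\<in>{i. i \<le> m \<and> \<alpha> i = j} \<union> {i. i \<le> m \<and> \<alpha> i \<in> J}. t i)"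
    by (rule sum.cong) auto
  also have "\<dots> = (\<Sum>i | i \<le> m \<and> \<alpha> i = j. t i) + (\<Sum>i | i \<le> m \<and> \<alpha> i \<in> J. t i)"
    by (rule sum.union_disjoint) (use insert in auto)
  finally show ?case using insert by (simp add: simplex_push_def)
qed simp

lemma cidx_push:
  assumes t: "t \<in> \<Delta> m" and a: "\<alpha> \<in> simplex_op m n" and s: "0 \<le> s" "s < 1"
  shows "cidx (simplex_push m \<alpha> t) s = \<alpha> (cidx t s)"
proof (rule cidx_eqI)
  let ?c = "cidx t s"
  note b = cidx_bounds[OF t s]
  show "0 \<le> simplex_push m \<alpha> t i" for i
    using standard_simplexD(1)[OF standard_simplex_push[OF a t]] .
  have "sum (simplex_push m \<alpha> t) {..<\<alpha> ?c} = (\<Sum>i | i \<le> m \<and> \<alpha> i \<in> {..<\<alpha> ?c}. t i)"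
    by (rule sum_simplex_push) simp
  also have "\<dots> \<le> sum t {..<?c}"
  proof (rule sum_mono2)
    show "{i. i \<le> m \<and> \<alpha> i \<in> {..<\<alpha> ?c}} \<subseteq> {..<?c}"
      using simplex_opD[OF a] by (auto simp: not_less[symmetric])
  qed (use standard_simplexD[OF t] in auto)
  finally show "sum (simplex_push m \<alpha> t) {..<\<alpha> ?c} \<le> s" using b by linarith
  have "sum t {..?c} \<le> (\<Sum>i | i \<le> m \<and> \<alpha> i \<in> {..\<alpha> ?c}. t i)"
  proof (rule sum_mono2)
    show "{..?c} \<subseteq> {i. i \<le> m \<and> \<alpha> i \<in> {..\<alpha> ?c}}"
      using simplex_opD[OF a] b(1) by auto
    show "finite {i. i \<le> m \<and> \<alpha> i \<in> {..\<alpha> ?c}}" by (rule finite_subset[of _ "{..m}"]) auto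
  qed (use standard_simplexD[OF t] in auto)
  also have "\<dots> = sum (simplex_push m \<alpha> t) {..\<alpha> ?c}"
    by (rule sum_simplex_push[symmetric]) simp
  finally show "s < sum (simplex_push m \<alpha> t) {..\<alpha> ?c}" using b by linarith
qed

lemma nerve_simps:
  "(x, u) \<in> splx C n \<longleftrightarrow>
     x \<in> {..n} \<rightarrow>\<^sub>E Obj C \<and>
        (\<forall>i j. i \<le> j \<and> j \<le> n \<longrightarrow> u i j \<in> Hom C (x i) (x j)) \<and>
        (\<forall>i j. \<not> (i \<le> j \<and> j \<le> n) \<longrightarrow> u i j = undefined) \<and>
        (\<forall>i\<le>n. u i i = Ident C (x i)) \<and>
        (\<forall>i j k. i \<le> j \<and> j \<le> k \<and> k \<le> n \<longrightarrow> u i k = Comp C (x i) (x j) (x k) (u j k) (u i j))"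
  "Act (nerve C) m n \<alpha> (x, u) =
     (\<lambda>i\<in>{..m}. x (\<alpha> i), \<lambda>i j. if i \<le> j \<and> j \<le> m then u (\<alpha> i) (\<alpha> j) else undefined)"
  by (simp_all add: nerve_def)

lemma nerveD:
  assumes "(x, u) \<in> splx C n"
  shows "i \<le> n \<Longrightarrow> x i \<in> Obj C" "i \<le> j \<Longrightarrow> j \<le> n \<Longrightarrow> u i j \<in> Hom C (x i) (x j)"
    "i \<le> n \<Longrightarrow> u i i = Ident C (x i)"
    "i \<le> j \<Longrightarrow> j \<le> k \<Longrightarrow> k \<le> n \<Longrightarrow> u i k = Comp C (x i) (x j) (x k) (u j k) (u i j)"
  using assms by (auto simp: nerve_simps)

definition trunc :: "nat \<Rightarrow> ('o, 'm) nerve_simplex \<Rightarrow> ('o, 'm) nerve_simplex" where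
  "trunc n = (\<lambda>(x, u). (\<lambda>i\<in>{..n}. x i, \<lambda>i j. if i \<le> j \<and> j \<le> n then u i j else undefined))"

lemma trunc_in_nerve:
  assumes "\<And>i. i \<le> n \<Longrightarrow> x i \<in> Obj C"
    and "\<And>i j. i \<le> j \<Longrightarrow> j \<le> n \<Longrightarrow> u i j \<in> Hom C (x i) (x j)"
    and "\<And>i. i \<le> n \<Longrightarrow> u i i = Ident C (x i)"
    and "\<And>i j k. i \<le> j \<Longrightarrow> j \<le> k \<Longrightarrow> k \<le> n \<Longrightarrow> u i k = Comp C (x i) (x j) (x k) (u j k) (u i j)"
  shows "trunc n (x, u) \<in> splx C n"
  unfolding trunc_def prod.case nerve_simps
proof (intro conjI allI impI)
  show "(if i \<le> k \<and> k \<le> n then u i k else undefined) =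
      Comp C ((\<lambda>i\<in>{..n}. x i) i) ((\<lambda>i\<in>{..n}. x i) j) ((\<lambda>i\<in>{..n}. x i) k)
       (if j \<le> k \<and> k \<le> n then u j k else undefined) (if i \<le> j \<and> j \<le> n then u i j else undefined)"
    if "i \<le> j \<and> j \<le> k \<and> k \<le> n" for i j k
    using that assms(4)[of i j k] by simp
qed (use assms(1-3) in auto)

lemma Act_in_nerve:
  assumes "\<sigma> \<in> splx C n" "\<alpha> \<in> simplex_op m n"
  shows "Act (nerve C) m n \<alpha> \<sigma> \<in> splx C m"
proof (cases \<sigma>)
  case (Pair x u)
  note d = nerveD[OF assms(1)[unfolded Pair]] and o = simplex_opD[OF assms(2)]
  have "Act (nerve C) m n \<alpha> \<sigma> = trunc m (\<lambda>i. x (\<alpha> i), \<lambda>i j. u (\<alpha> i) (\<alpha> j))"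
    by (simp add: Pair nerve_simps trunc_def)
  also have "\<dots> \<in> splx C m"
  proof (rule trunc_in_nerve)
    show "u (\<alpha> i) (\<alpha> k) = Comp C (x (\<alpha> i)) (x (\<alpha> j)) (x (\<alpha> k)) (u (\<alpha> j) (\<alpha> k)) (u (\<alpha> i) (\<alpha> j))"
      if "i \<le> j" "j \<le> k" "k \<le> m" for i j k
      using that by (intro d(4) o) auto
  qed (simp_all add: d(1-3) o)
  finally show ?thesis .
qed

lemma pull_cong:
  assumes "\<And>s. 0 \<le> s \<Longrightarrow> s < 1 \<Longrightarrow> fst \<sigma> (c s) = fst \<tau> (d s)"
    "\<And>r s. 0 \<le> r \<Longrightarrow> r \<le> s \<Longrightarrow> s < 1 \<Longrightarrow> snd \<sigma> (c r) (c s) = snd \<tau> (d r) (d s)"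
  shows "pull c \<sigma> = pull d \<tau>"
  unfolding pull_def prod.case_eq_if by (intro prod_eqI ext) (simp_all add: assms)

lemma pull_trunc:
  assumes "t \<in> \<Delta> n"
  shows "pull (cidx t) (trunc n \<sigma>) = pull (cidx t) \<sigma>"
proof (cases \<sigma>)
  case (Pair x u)
  show ?thesis
    by (rule pull_cong) (simp_all add: trunc_def Pair cidx_bounds(1)[OF assms] cidx_mono[OF assms])
qed

lemma stp_Act:
  assumes "t \<in> \<Delta> m" "\<alpha> \<in> simplex_op m n"
  shows "pt m (Act (nerve C) m n \<alpha> \<sigma>) t = pt n \<sigma> (simplex_push m \<alpha> t)"
proof (cases \<sigma>)
  case (Pair x u)
  show ?thesis
    unfolding stp_def Pair prod.case
    by (rule pull_cong)
      (simp_all add: nerve_simps cidx_push[OF assms] cidx_bounds(1)[OF assms(1)] cidx_mono[OF assms(1)])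
qed

lemma topspace_simplex_sum:
  "((n, \<sigma>), t) \<in> topspace (simplex_sum X) \<longleftrightarrow> \<sigma> \<in> Simp X n \<and> t \<in> \<Delta> n"
  by (auto simp: simplex_sum_def)

lemma openin_steps:
  "openin (steps C) U \<longleftrightarrow> U \<subseteq> stp ` cells C \<and>
     openin (simplex_sum (nerve C)) {z \<in> cells C. stp z \<in> U}"
proof -
  let ?X = "simplex_sum (nerve C)"
  have "istopology (\<lambda>U. U \<subseteq> stp ` topspace ?X \<and> openin ?X {z \<in> topspace ?X. stp z \<in> U})"
    unfolding istopology_def
  proof (intro conjI allI impI)
    fix U V
    assume "U \<subseteq> stp ` topspace ?X \<and> openin ?X {z \<in> topspace ?X. stp z \<in> U}"
      "V \<subseteq> stp ` topspace ?X \<and> openin ?X {z \<in> topspace ?X. stp z \<in> V}"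
    moreover have "{z \<in> topspace ?X. stp z \<in> U \<inter> V} =
      {z \<in> topspace ?X. stp z \<in> U} \<inter> {z \<in> topspace ?X. stp z \<in> V}" by auto
    ultimately show "U \<inter> V \<subseteq> stp ` topspace ?X" "openin ?X {z \<in> topspace ?X. stp z \<in> U \<inter> V}"
      by (auto simp only: openin_Int)
  next
    fix K
    assume K: "\<forall>U\<in>K. U \<subseteq> stp ` topspace ?X \<and> openin ?X {z \<in> topspace ?X. stp z \<in> U}"
    then show "\<Union>K \<subseteq> stp ` topspace ?X" by blast
    have "{z \<in> topspace ?X. stp z \<in> \<Union>K} = (\<Union>U\<in>K. {z \<in> topspace ?X. stp z \<in> U})" by auto
    then show "openin ?X {z \<in> topspace ?X. stp z \<in> \<Union>K}" using K by auto
  qed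
  then show ?thesis unfolding steps_def by simp
qed

lemma topspace_steps: "pts C = stp ` cells C"
proof -
  let ?X = "simplex_sum (nerve C)"
  have "{z \<in> topspace ?X. stp z \<in> stp ` topspace ?X} = topspace ?X" by blast
  then have "openin (steps C) (stp ` topspace ?X)"
    unfolding openin_steps by (simp only: subset_refl openin_topspace simp_thms)
  then show ?thesis
    using openin_topspace[of "steps C"] openin_subset[of "steps C"] unfolding openin_steps by blast
qed

lemma quotient_map_stp: "quotient_map (simplex_sum (nerve C)) (steps C) stp"
  unfolding quotient_map_def topspace_steps by (auto simp: openin_steps)

lemma stp_in_steps:
  "\<sigma> \<in> splx C n \<Longrightarrow> t \<in> \<Delta> n \<Longrightarrow> pt n \<sigma> t \<in> pts C"
  unfolding topspace_steps by (rule imageI) (simp add: topspace_simplex_sum)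

lemma stepsE:
  assumes "p \<in> pts C"
  obtains n \<sigma> t where "\<sigma> \<in> splx C n" "t \<in> \<Delta> n" "p = pt n \<sigma> t"
  using assms unfolding topspace_steps by (auto simp: topspace_simplex_sum)

lemma continuous_map_sum_topology:
  "continuous_map (sum_topology X I) Y f \<longleftrightarrow> (\<forall>i\<in>I. continuous_map (X i) Y (\<lambda>t. f (i, t)))"
proof -
  have eq: "{t. (i, t) \<in> {z \<in> topspace (sum_topology X I). f z \<in> U}} = {t \<in> topspace (X i). f (i, t) \<in> U}"
    if "i \<in> I" for i U
    using that by auto
  show ?thesis
    unfolding continuous_map_def openin_sum_topology
    by (auto simp: eq Pi_iff simp del: topspace_sum_topology) (auto)
qed

lemma continuous_map_simplex_sum:
  "continuous_map (simplex_sum X) Y f \<longleftrightarrow>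
     (\<forall>n. \<forall>\<sigma>\<in>Simp X n. continuous_map (simplex_top n) Y (\<lambda>t. f ((n, \<sigma>), t)))"
proof -
  have "continuous_map (simplex_sum X) Y f \<longleftrightarrow>
      (\<forall>i\<in>Sigma UNIV (Simp X). continuous_map (simplex_top (fst i)) Y (\<lambda>t. f (i, t)))"
    unfolding simplex_sum_def continuous_map_sum_topology by (simp add: prod.case_eq_if)
  then show ?thesis by auto
qed

lemma continuous_map_steps:
  "continuous_map (steps C) Y f \<longleftrightarrow>
     (\<forall>n. \<forall>\<sigma>\<in>splx C n. continuous_map (simplex_top n) Y (\<lambda>t. f (pt n \<sigma> t)))"
proof -
  have "continuous_map (steps C) Y f \<longleftrightarrow> continuous_map (simplex_sum (nerve C)) Y (f \<circ> stp)"
    using continuous_compose_quotient_map_eq[OF quotient_map_stp] by blast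
  then show ?thesis by (simp add: continuous_map_simplex_sum)
qed

lemma continuous_map_stp:
  "\<sigma> \<in> splx C n \<Longrightarrow> continuous_map (simplex_top n) (steps C) (\<lambda>t. pt n \<sigma> t)"
  using continuous_map_steps[of C "steps C" id] by auto

lemma cidx_less_iff:
  assumes "t \<in> \<Delta> n" "0 \<le> s" "s < 1"
  shows "cidx t s < j \<longleftrightarrow> s < sum t {..<j}"
proof
  assume "cidx t s < j"
  then have "sum t {..cidx t s} \<le> sum t {..<j}"
    by (intro sum_mono2) (use standard_simplexD[OF assms(1)] in auto)
  then show "s < sum t {..<j}"
    using cidx_bounds[OF assms] by linarith
next
  assume s: "s < sum t {..<j}"
  show "cidx t s < j"
  proof (rule ccontr)
    assume "\<not> cidx t s < j"
    then have "sum t {..<j} \<le> sum t {..<cidx t s}"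
      by (intro sum_mono2) (use standard_simplexD[OF assms(1)] in auto)
    then show False using cidx_bounds[OF assms] s by linarith
  qed
qed

lemma simplex_eqI:
  fixes t t' :: "nat \<Rightarrow> real"
  assumes "\<And>j. sum t {..<j} = sum t' {..<j}"
  shows "t = t'"
proof
  fix j show "t j = t' j" using assms[of "Suc j"] assms[of j] by simp
qed

lemma strict_enumeration:
  fixes J :: "real set"
  assumes "finite J" "0 \<in> J" "J \<subseteq> {0..<1}"
  obtains N s where "strict_mono_on {..Suc N} s" "s 0 = 0" "s (Suc N) = 1" "s ` {..N} = J"
proof -
  define l where "l = sorted_list_of_set J"
  define s where "s = (\<lambda>k. if k < card J then l ! k else 1)"
  have l: "length l = card J" "set l = J" "sorted_wrt (<) l"
    unfolding l_def using assms by auto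
  have pos: "0 < card J" using assms by (auto simp: card_gt_0_iff)
  then have N: "card J = Suc (card J - 1)" by simp
  have mem: "k < card J \<Longrightarrow> l ! k \<in> J" for k using l by (metis nth_mem)
  have sm: "strict_mono_on {..Suc (card J - 1)} s"
  proof (rule strict_mono_onI)
    fix i j assume "i \<in> {..Suc (card J - 1)}" "j \<in> {..Suc (card J - 1)}" "i < j"
    then show "s i < s j"
      using N mem[of i] assms(3) sorted_wrt_nth_less[OF l(3), of i j] l(1)
      by (auto simp: s_def subset_iff)
  qed
  have im: "s ` {..card J - 1} = J"
  proof -
    have "s ` {..card J - 1} = (\<lambda>k. l ! k) ` {..<length l}"
      using N l(1) by (intro image_cong) (auto simp: s_def)
    also have "\<dots> = J" using l(2) by (auto simp: set_conv_nth)
    finally show ?thesis .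
  qed
  obtain k where k: "k \<le> card J - 1" "s k = 0"
    using assms(2) im by (metis atMost_iff imageE)
  have "s 0 \<in> J" using im by auto
  then have "0 \<le> s 0" using assms(3) by auto
  moreover have "s 0 \<le> s k"
    using strict_mono_on_leD[OF sm, of 0 k] k by auto
  ultimately have "s 0 = 0" using k by simp
  moreover have "s (Suc (card J - 1)) = 1" using N by (simp add: s_def)
  ultimately show thesis using that sm im by blast
qed

lemma simplex_of_cuts:
  assumes s: "strict_mono_on {..Suc N} s" "s 0 = 0" "s (Suc N) = (1::real)"
  defines "w \<equiv> \<lambda>k. if k \<le> N then s (Suc k) - s k else 0"
  shows "w \<in> \<Delta> N"
    and "\<And>t n. \<lbrakk>t \<in> \<Delta> n; \<And>j. sum t {..<j} < 1 \<Longrightarrow> sum t {..<j} \<in> s ` {..N}\<rbrakk>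
      \<Longrightarrow> (\<lambda>k. cidx t (s k)) \<in> simplex_op N n \<and> simplex_push N (\<lambda>k. cidx t (s k)) w = t"
proof -
  note lt = strict_mono_onD[OF s(1)]
  have sums: "sum w {..<K} = s K" if "K \<le> Suc N" for K
    using that
  proof (induction K)
    case (Suc K) then show ?case by (simp add: w_def)
  qed (simp add: s)
  show "w \<in> \<Delta> N"
  proof (rule standard_simplexI)
    show "0 \<le> w i" if "i \<le> N" for i
      using that lt[of i "Suc i"] by (simp add: w_def)
    show "sum w {..N} = 1" using sums[of "Suc N"] s by (simp add: lessThan_Suc_atMost)
  qed (simp add: w_def)
  fix t n assume t: "t \<in> \<Delta> n"
    and cuts: "\<And>j. sum t {..<j} < 1 \<Longrightarrow> sum t {..<j} \<in> s ` {..N}"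
  have s01: "0 \<le> s k" "s k < 1" if "k \<le> N" for k
    using that lt[of 0 k] lt[of k "Suc N"] s by (cases "k = 0"; force)+
  have op: "(\<lambda>k. cidx t (s k)) \<in> simplex_op N n"
    unfolding simplex_op_def mono_on_def
  proof (intro CollectI conjI allI impI)
    fix i j assume ij: "i \<in> {..N} \<and> j \<in> {..N} \<and> i \<le> j"
    then have "s i \<le> s j" using lt[of i j] by (cases "i = j") auto
    then show "cidx t (s i) \<le> cidx t (s j)" using ij s01 by (intro cidx_mono[OF t]) auto
  qed (use cidx_bounds(1)[OF t] s01 in auto)
  moreover have "simplex_push N (\<lambda>k. cidx t (s k)) w = t"
  proof (rule simplex_eqI)
    fix j
    have "sum t {..<j} \<le> sum t {..<max j (Suc n)}"
      by (intro sum_mono2) (use standard_simplexD[OF t] in auto)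
    also have "\<dots> = sum t {..n}"
      by (rule sum.mono_neutral_right) (use standard_simplexD[OF t] in auto)
    also have "\<dots> = 1" using standard_simplexD[OF t] by simp
    finally have "sum t {..<j} < 1 \<or> sum t {..<j} = 1" by linarith
    then obtain K where K: "K \<le> Suc N" "s K = sum t {..<j}"
      using cuts[of j] s(3) by (metis (no_types, lifting) atMost_iff imageE le_Suc_eq order_refl)
    have "sum (simplex_push N (\<lambda>k. cidx t (s k)) w) {..<j} = (\<Sum>k | k \<le> N \<and> cidx t (s k) \<in> {..<j}. w k)"
      by (rule sum_simplex_push) simp
    also have "{k. k \<le> N \<and> cidx t (s k) \<in> {..<j}} = {k. k \<le> N \<and> s k < s K}"
      using cidx_less_iff[OF t s01] K by auto
    also have "\<dots> = {..<K}"
    proof -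
      have "s k < s K \<longleftrightarrow> k < K" if "k \<le> N" for k
        using that K lt[of k K] lt[of K k] by (cases k K rule: linorder_cases) auto
      then show ?thesis using K by auto
    qed
    also have "sum w {..<K} = sum t {..<j}" using sums K by simp
    finally show "sum (simplex_push N (\<lambda>k. cidx t (s k)) w) {..<j} = sum t {..<j}" .
  qed
  ultimately show "(\<lambda>k. cidx t (s k)) \<in> simplex_op N n \<and> simplex_push N (\<lambda>k. cidx t (s k)) w = t" ..
qed

lemma partial_sums_simplex:
  assumes "t \<in> \<Delta> n" "sum t {..<j} < 1"
  shows "j \<le> n" "0 \<le> sum t {..<j}"
proof -
  show "j \<le> n"
  proof (rule ccontr)
    assume "\<not> j \<le> n"
    then have "sum t {..n} \<le> sum t {..<j}"
      by (intro sum_mono2) (use standard_simplexD[OF assms(1)] in auto)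
    then show False using assms(2) standard_simplexD(4)[OF assms(1)] by linarith
  qed
qed (use standard_simplexD[OF assms(1)] in \<open>auto intro: sum_nonneg\<close>)

lemma stp_eqD:
  assumes z: "\<sigma> \<in> splx C n" "t \<in> \<Delta> n"
    and z': "\<sigma>' \<in> splx C n'" "t' \<in> \<Delta> n'"
    and eq: "pt n \<sigma> t = pt n' \<sigma>' t'"
  shows "(((n, \<sigma>), t), ((n', \<sigma>'), t')) \<in> realization_equiv (nerve C)"
proof -
  obtain x u x' u' where xu: "\<sigma> = (x, u)" "\<sigma>' = (x', u')" by force
  define J where "J = {r \<in> (\<lambda>j. sum t {..<j}) ` {..n} \<union> (\<lambda>j. sum t' {..<j}) ` {..n'}. r < 1}"
  have J: "finite J" "0 \<in> J" "J \<subseteq> {0..<1}"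
    unfolding J_def using partial_sums_simplex(2)[OF z(2)] partial_sums_simplex(2)[OF z'(2)]
    by (auto intro: image_eqI[of _ _ 0])
  obtain N s where s: "strict_mono_on {..Suc N} s" "s 0 = 0" "s (Suc N) = 1" "s ` {..N} = J"
    using strict_enumeration[OF J] by metis
  define w where "w = (\<lambda>k. if k \<le> N then s (Suc k) - s k else 0)"
  define \<alpha> where "\<alpha> = (\<lambda>k. cidx t (s k))"
  define \<beta> where "\<beta> = (\<lambda>k. cidx t' (s k))"
  have w: "w \<in> \<Delta> N"
    using simplex_of_cuts(1)[OF s(1-3)] by (simp add: w_def)
  have "sum t {..<j} \<in> s ` {..N}" if "sum t {..<j} < 1" for j
    using that partial_sums_simplex(1)[OF z(2) that] s(4) by (auto simp: J_def)
  then have a: "\<alpha> \<in> simplex_op N n" "simplex_push N \<alpha> w = t"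
    using simplex_of_cuts(2)[OF s(1-3) z(2)] by (simp_all add: \<alpha>_def w_def)
  have "sum t' {..<j} \<in> s ` {..N}" if "sum t' {..<j} < 1" for j
    using that partial_sums_simplex(1)[OF z'(2) that] s(4) by (auto simp: J_def)
  then have b: "\<beta> \<in> simplex_op N n'" "simplex_push N \<beta> w = t'"
    using simplex_of_cuts(2)[OF s(1-3) z'(2)] by (simp_all add: \<beta>_def w_def)
  have s01: "0 \<le> s k \<and> s k < 1" if "k \<le> N" for k
    using that s(4) J(3) by fastforce
  have sle: "s i \<le> s j" if "i \<le> j" "j \<le> N" for i j
    using strict_mono_on_leD[OF s(1), of i j] that by auto
  have e1: "x (cidx t r) = x' (cidx t' r)" if "0 \<le> r \<and> r < 1" for r
    using fun_cong[OF arg_cong[OF eq, of fst], of r] that by (simp add: stp_def pull_def xu)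
  have e2: "u (cidx t q) (cidx t r) = u' (cidx t' q) (cidx t' r)" if "0 \<le> q" "q \<le> r" "r < 1" for q r
    using fun_cong[OF fun_cong[OF arg_cong[OF eq, of snd], of q], of r] that by (simp add: stp_def pull_def xu)
  have "Act (nerve C) N n \<alpha> \<sigma> = Act (nerve C) N n' \<beta> \<sigma>'"
    unfolding xu nerve_simps \<alpha>_def \<beta>_def
    by (intro arg_cong2[of _ _ _ _ Pair] ext) (use e1 e2 s01 sle in auto)
  then have "(((N, Act (nerve C) N n \<alpha> \<sigma>), w), ((n, \<sigma>), t)) \<in> glue (nerve C)"
    "(((N, Act (nerve C) N n \<alpha> \<sigma>), w), ((n', \<sigma>'), t')) \<in> glue (nerve C)"
    unfolding glue_def using a b w z z' by blast+
  then have "(((n, \<sigma>), t), ((n', \<sigma>'), t')) \<in> (glue (nerve C) \<union> (glue (nerve C))\<inverse>)\<^sup>*"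
    by (meson UnI1 UnI2 converseI converse_rtrancl_into_rtrancl r_into_rtrancl)
  then show ?thesis
    using z z' by (simp add: realization_equiv_def topspace_simplex_sum)
qed

lemma realization_equiv_nerve:
  "(z, z') \<in> realization_equiv (nerve C) \<longleftrightarrow>
     z \<in> cells C \<and> z' \<in> cells C \<and> stp z = stp z'"
proof
  assume "(z, z') \<in> realization_equiv (nerve C)"
  then have *: "(z, z') \<in> (glue (nerve C) \<union> (glue (nerve C))\<inverse>)\<^sup>*"
    "z \<in> cells C" "z' \<in> cells C"
    by (auto simp: realization_equiv_def)
  from *(1) have "stp z = stp z'"
  proof (induction rule: rtrancl_induct)
    case (step y y')
    have "stp y = stp y'" if "(y, y') \<in> glue (nerve C)" for y y'
      using that unfolding glue_def by (auto intro!: stp_Act)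
    then show ?case using step by (metis UnE converseD)
  qed simp
  then show "z \<in> cells C \<and> z' \<in> cells C \<and> stp z = stp z'"
    using * by blast
next
  assume *: "z \<in> cells C \<and> z' \<in> cells C \<and> stp z = stp z'"
  obtain n \<sigma> t n' \<sigma>' t' where "z = ((n, \<sigma>), t)" "z' = ((n', \<sigma>'), t')" by (metis surj_pair)
  then show "(z, z') \<in> realization_equiv (nerve C)"
    using stp_eqD * by (metis topspace_simplex_sum)
qed

definition fib :: "('o, 'm) cat \<Rightarrow> ('o, 'm) step \<Rightarrow> ((nat \<times> ('o, 'm) nerve_simplex) \<times> (nat \<Rightarrow> real)) set" where
  "fib C p = {z \<in> cells C. stp z = p}"

lemma realization_class:
  "z \<in> cells C \<Longrightarrow> realization_equiv (nerve C) `` {z} = fib C (stp z)"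
  by (auto simp: fib_def realization_equiv_nerve)

lemma homeomorphic_map_fib: "homeomorphic_map (steps C) (geo C) (fib C)"
proof -
  let ?X = "simplex_sum (nerve C)" and ?R = "realization_equiv (nerve C)"
  note eqv = equiv_realization_equiv[of "nerve C"]
  have top: "topspace (geo C) = topspace ?X // ?R"
    by (simp add: realization_def topspace_quotient_topology[OF eqv])
  have quot: "topspace ?X // ?R = fib C ` pts C"
    unfolding quotient_def topspace_steps using realization_class by fastforce
  have inj: "inj_on (fib C) (pts C)"
  proof (rule inj_onI)
    fix p q assume "p \<in> pts C" "fib C p = fib C q"
    moreover from this obtain z where "z \<in> fib C p"
      unfolding topspace_steps fib_def by blast
    ultimately show "p = q" by (auto simp: fib_def)
  qed
  have Un: "\<Union>(fib C ` U) = {z \<in> topspace ?X. stp z \<in> U}" for U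
    by (auto simp: fib_def)
  have "continuous_map (steps C) (geo C) (fib C)"
    unfolding continuous_map_def
  proof (intro conjI allI impI)
    show "fib C \<in> pts C \<rightarrow> topspace (geo C)"
      using top quot by auto
    fix U assume "openin (geo C) U"
    then have U: "U \<subseteq> fib C ` pts C" "openin ?X (\<Union>U)"
      unfolding realization_def openin_quotient_topology[OF eqv] quot by auto
    then have "U = fib C ` {p \<in> pts C. fib C p \<in> U}" by blast
    then have "openin ?X {z \<in> topspace ?X. stp z \<in> {p \<in> pts C. fib C p \<in> U}}"
      using U(2) Un by metis
    then show "openin (steps C) {p \<in> pts C. fib C p \<in> U}"
      unfolding openin_steps by (auto simp: topspace_steps)
  qed
  moreover have "open_map (steps C) (geo C) (fib C)"
    unfolding open_map_def realization_def openin_quotient_topology[OF eqv] quot Un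
    using openin_subset openin_steps by blast
  ultimately show ?thesis
    using inj top quot by (intro bijective_open_imp_homeomorphic_map) auto
qed

lemma inclusion_nerve_map_fib:
  assumes "Obj A \<subseteq> Obj C" "Hom A = Hom C" "Comp A = Comp C" "Ident A = Ident C"
    and p: "p \<in> pts A"
  shows "p \<in> pts C" "inclusion_nerve_map C (fib A p) = fib C p"
proof -
  have sub: "\<sigma> \<in> splx C n" if "\<sigma> \<in> splx A n" for \<sigma> n
    using that assms by (cases \<sigma>) (auto simp: nerve_simps)
  then have top: "z \<in> cells C" if "z \<in> cells A" for z
    using that by (metis surj_pair topspace_simplex_sum)
  have id: "nerve_map (\<lambda>X. X) (\<lambda>X Y f. f) n \<sigma> = \<sigma>" if "\<sigma> \<in> splx A n" for \<sigma> n
    using that by (cases \<sigma>) (auto simp: nerve_map_def nerve_simps fun_eq_iff PiE_def extensional_def)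
  have im: "(\<lambda>((n, x), t). ((n, nerve_map (\<lambda>X. X) (\<lambda>X Y f. f) n x), t)) ` fib A p = fib A p"
  proof -
    have "(\<lambda>((n, x), t). ((n, nerve_map (\<lambda>X. X) (\<lambda>X Y f. f) n x), t)) z = z" if "z \<in> fib A p" for z
    proof -
      obtain n \<sigma> t where z: "z = ((n, \<sigma>), t)" by (metis surj_pair)
      then have "\<sigma> \<in> splx A n" using that by (simp add: fib_def topspace_simplex_sum)
      then show ?thesis using id z by simp
    qed
    then show ?thesis by force
  qed
  obtain z where z: "z \<in> fib A p"
    using p by (auto simp: topspace_steps fib_def)
  then have zC: "z \<in> cells C" "stp z = p" using top by (auto simp: fib_def)
  then show "p \<in> pts C" by (auto simp: topspace_steps)
  have "inclusion_nerve_map C (fib A p) = realization_equiv (nerve C) `` fib A p"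
    by (simp add: inclusion_nerve_map_def realization_map_def im)
  also have "\<dots> = fib C p"
  proof (intro equalityI subsetI)
    fix z' assume "z' \<in> realization_equiv (nerve C) `` fib A p"
    then show "z' \<in> fib C p"
      unfolding Image_iff realization_equiv_nerve fib_def by auto
  next
    fix z' assume "z' \<in> fib C p"
    then have "(z, z') \<in> realization_equiv (nerve C)"
      using zC unfolding realization_equiv_nerve fib_def by simp
    then show "z' \<in> realization_equiv (nerve C) `` fib A p" using z by blast
  qed
  finally show "inclusion_nerve_map C (fib A p) = fib C p" .
qed

lemma continuous_map_in_topspace:
  "continuous_map X Y f \<Longrightarrow> x \<in> topspace X \<Longrightarrow> f x \<in> topspace Y"
  by (auto simp: continuous_map_def)

lemma homotopy_equivalence_of_deformation_retraction:
  assumes "Obj A \<subseteq> Obj C" "Hom A = Hom C" "Comp A = Comp C" "Ident A = Ident C"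
    and r: "continuous_map (steps C) (steps A) r" "\<And>p. p \<in> pts A \<Longrightarrow> r p = p"
    and h: "homotopic C C r id"
  shows "homotopy_equivalence_map (geo A) (geo C) (inclusion_nerve_map C)"
proof -
  note incl = inclusion_nerve_map_fib[OF assms(1-4)]
  obtain kA where kA: "homeomorphic_maps (steps A) (geo A) (fib A) kA"
    using homeomorphic_map_fib[of A] unfolding homeomorphic_map_maps by blast
  obtain kC where kC: "homeomorphic_maps (steps C) (geo C) (fib C) kC"
    using homeomorphic_map_fib[of C] unfolding homeomorphic_map_maps by blast
  note A = kA[unfolded homeomorphic_maps_def] and C = kC[unfolded homeomorphic_maps_def]
  have kAin: "kA y \<in> pts A" if "y \<in> topspace (geo A)" for y
    using A that by (auto intro: continuous_map_in_topspace)
  have kCin: "kC y \<in> pts C" if "y \<in> topspace (geo C)" for y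
    using C that by (auto intro: continuous_map_in_topspace)
  have i: "continuous_map (steps A) (steps C) id"
    unfolding continuous_map_steps
  proof (intro allI ballI)
    fix n \<sigma> assume "\<sigma> \<in> splx A n"
    then have "\<sigma> \<in> splx C n" using assms(1-4) by (cases \<sigma>) (auto simp: nerve_simps)
    then show "continuous_map (simplex_top n) (steps C) (\<lambda>t. id (pt n \<sigma> t))"
      unfolding id_apply by (rule continuous_map_stp)
  qed
  have eq: "inclusion_nerve_map C y = (fib C \<circ> id \<circ> kA) y" if "y \<in> topspace (geo A)" for y
    using incl(2)[OF kAin[OF that]] A that by simp
  have c: "continuous_map (geo A) (geo C) (inclusion_nerve_map C)"
  proof (rule continuous_map_eq)
    show "continuous_map (geo A) (geo C) (fib C \<circ> id \<circ> kA)"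
      by (rule continuous_map_compose[OF _ continuous_map_compose[OF i]]) (use A C in auto)
  qed (rule eq[symmetric])
  define g where "g = fib A \<circ> r \<circ> kC"
  have g: "continuous_map (geo C) (geo A) g"
    unfolding g_def by (rule continuous_map_compose[OF _ continuous_map_compose[OF r(1)]]) (use A C in auto)
  have "homotopic_with (\<lambda>x. True) (geo A) (geo A) (g \<circ> inclusion_nerve_map C) id"
  proof (rule homotopic_with_id2)
    fix y assume y: "y \<in> topspace (geo A)"
    have "g (inclusion_nerve_map C y) = fib A (r (kC (fib C (kA y))))"
      using eq[OF y] by (simp add: g_def)
    also have "\<dots> = y"
      using incl(1)[OF kAin[OF y]] C A y r(2)[OF kAin[OF y]] by simp
    finally show "g (inclusion_nerve_map C y) = y" .
  qed
  moreover have "homotopic_with (\<lambda>x. True) (geo C) (geo C) (inclusion_nerve_map C \<circ> g) id"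
  proof (rule homotopic_with_eq)
    have "homotopic_with (\<lambda>x. True) (geo C) (steps C) (r \<circ> kC) (id \<circ> kC)"
      by (rule homotopic_with_compose_continuous_map_right[OF h]) (use C in auto)
    then show "homotopic_with (\<lambda>x. True) (geo C) (geo C) (fib C \<circ> (r \<circ> kC)) (fib C \<circ> (id \<circ> kC))"
      by (rule homotopic_with_compose_continuous_map_left) (use C in auto)
  next
    fix y assume y: "y \<in> topspace (geo C)"
    have ry: "r (kC y) \<in> pts A"
      using r(1) kCin[OF y] by (rule continuous_map_in_topspace)
    then have "fib A (r (kC y)) \<in> topspace (geo A)"
      using A by (auto intro: continuous_map_in_topspace)
    then show "(inclusion_nerve_map C \<circ> g) y = (fib C \<circ> (r \<circ> kC)) y"
      using eq[of "g y"] A ry by (simp add: g_def)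
    show "id y = (fib C \<circ> (id \<circ> kC)) y" using C y by simp
  qed auto
  ultimately show ?thesis
    unfolding homotopy_equivalence_map_def using c g by blast
qed

definition fstep :: "('o \<Rightarrow> 'p) \<Rightarrow> ('o \<Rightarrow> 'o \<Rightarrow> 'm \<Rightarrow> 'n) \<Rightarrow> ('o, 'm) step \<Rightarrow> ('p, 'n) step" where
  "fstep Fo Fm = (\<lambda>(x, u). (\<lambda>s. if 0 \<le> s \<and> s < 1 then Fo (x s) else undefined,
     \<lambda>r s. if 0 \<le> r \<and> r \<le> s \<and> s < 1 then Fm (x r) (x s) (u r s) else undefined))"

lemma is_functorD:
  assumes "is_functor C D Fo Fm"
  shows "category C" "category D" "X \<in> Obj C \<Longrightarrow> Fo X \<in> Obj D"
    "X \<in> Obj C \<Longrightarrow> Fm X X (Ident C X) = Ident D (Fo X)"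
    "\<lbrakk>X \<in> Obj C; Y \<in> Obj C; f \<in> Hom C X Y\<rbrakk> \<Longrightarrow> Fm X Y f \<in> Hom D (Fo X) (Fo Y)"
    "\<lbrakk>X \<in> Obj C; Y \<in> Obj C; Z \<in> Obj C; f \<in> Hom C X Y; g \<in> Hom C Y Z\<rbrakk> \<Longrightarrow>
       Fm X Z (Comp C X Y Z g f) = Comp D (Fo X) (Fo Y) (Fo Z) (Fm Y Z g) (Fm X Y f)"
  using assms unfolding is_functor_def by blast+

lemma fstep_stp:
  assumes "is_functor C D Fo Fm" "(x, u) \<in> splx C n" "t \<in> \<Delta> n"
  defines "\<tau> \<equiv> trunc n (\<lambda>i. Fo (x i), \<lambda>i j. Fm (x i) (x j) (u i j))"
  shows "\<tau> \<in> splx D n" "fstep Fo Fm (pt n (x, u) t) = pt n \<tau> t"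
proof -
  note f = is_functorD[OF assms(1)] and d = nerveD[OF assms(2)]
  show "\<tau> \<in> splx D n"
    unfolding \<tau>_def
  proof (rule trunc_in_nerve)
    show "Fm (x i) (x k) (u i k) = Comp D (Fo (x i)) (Fo (x j)) (Fo (x k)) (Fm (x j) (x k) (u j k)) (Fm (x i) (x j) (u i j))"
      if "i \<le> j" "j \<le> k" "k \<le> n" for i j k
      unfolding d(4)[OF that] by (rule f(6)) (use that d(1,2) in auto)
    show "Fm (x i) (x j) (u i j) \<in> Hom D (Fo (x i)) (Fo (x j))" if "i \<le> j" "j \<le> n" for i j
      by (rule f(5)) (use that d(1,2) in auto)
  qed (simp_all add: d(1,3) f(3,4))
  show "fstep Fo Fm (pt n (x, u) t) = pt n \<tau> t"
    unfolding stp_def \<tau>_def prod.case pull_trunc[OF assms(3)]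
    by (auto simp: fstep_def pull_def fun_eq_iff)
qed

lemma continuous_map_fstep:
  assumes "is_functor C D Fo Fm"
  shows "continuous_map (steps C) (steps D) (fstep Fo Fm)"
  unfolding continuous_map_steps
proof (intro allI ballI)
  fix n and \<sigma> :: "('a, 'b) nerve_simplex" assume s: "\<sigma> \<in> splx C n"
  obtain x u where xu: "\<sigma> = (x, u)" by force
  note f = fstep_stp[OF assms s[unfolded xu]]
  obtain t0 where "t0 \<in> \<Delta> n" using nonempty_standard_simplex by blast
  from continuous_map_stp[OF f(1)[OF this]] show "continuous_map (simplex_top n) (steps D) (\<lambda>t. fstep Fo Fm (pt n \<sigma> t))"
    by (rule continuous_map_eq) (simp add: f(2) xu)
qed

definition cyl :: "('o, 'm) cat \<Rightarrow> ('o \<times> bool, 'm) cat" where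
  "cyl C = \<lparr>Obj = Obj C \<times> UNIV,
     Hom = (\<lambda>X Y. if snd X \<le> snd Y then Hom C (fst X) (fst Y) else {}),
     Comp = (\<lambda>X Y Z. Comp C (fst X) (fst Y) (fst Z)),
     Ident = (\<lambda>X. Ident C (fst X))\<rparr>"

lemma cyl_simps [simp]:
  "Obj (cyl C) = Obj C \<times> UNIV" "Ident (cyl C) X = Ident C (fst X)"
  "Hom (cyl C) X Y = (if snd X \<le> snd Y then Hom C (fst X) (fst Y) else {})"
  "Comp (cyl C) X Y Z = Comp C (fst X) (fst Y) (fst Z)"
  by (simp_all add: cyl_def)

lemma category_cyl:
  assumes "category C" shows "category (cyl C)"
proof -
  interpret category C by fact
  show ?thesis
    by unfold_locales (auto simp: Ident_in Comp_in Comp_Ident_left Comp_Ident_right Comp_assoc split: if_splits)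
qed

definition at_level :: "bool \<Rightarrow> ('o, 'm) step \<Rightarrow> ('o \<times> bool, 'm) step" where
  "at_level b = fstep (\<lambda>x. (x, b)) (\<lambda>x y f. f)"

lemma is_functor_at_level:
  "category C \<Longrightarrow> is_functor C (cyl C) (\<lambda>x. (x, b)) (\<lambda>x y f. f)"
  by (auto simp: is_functor_def category_cyl)

text \<open>At time \<open>s\<close>, the part of the step function over \<open>[0, 1 - s)\<close> lies at the bottom and the rest
  at the top of the cylinder.\<close>

definition sweep :: "real \<times> ('o, 'm) step \<Rightarrow> ('o \<times> bool, 'm) step" where
  "sweep = (\<lambda>(s, (x, u)). (\<lambda>r. if 0 \<le> r \<and> r < 1 then (x r, 1 - s \<le> r) else undefined, u))"

lemma partial_sum_prism:
  fixes t :: "nat \<Rightarrow> real"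
  defines "w \<equiv> \<lambda>z i k. if k < i then t k else if k = i then z - sum t {..<i}
    else if k = Suc i then sum t {..i} - z else t (k - 1)"
  shows "sum (w z i) {..<k} = (if k \<le> i then sum t {..<k} else if k = Suc i then z else sum t {..<k - 1})"
proof (induction k)
  case (Suc k)
  have wk: "w z i k = (if k < i then t k else if k = i then z - sum t {..<i}
    else if k = Suc i then sum t {..i} - z else t (k - 1))"
    by (simp add: w_def)
  consider "k < i" | "k = i" | "k = Suc i" | l where "k = Suc l" "l > i"
    by (metis Suc_lessI linorder_neqE_nat not0_implies_Suc not_less0 Suc_less_eq)
  then show ?case
    unfolding sum.lessThan_Suc Suc.IH wk
    by cases (simp_all add: lessThan_Suc_atMost[symmetric])
qed simp

lemma prism_step:
  fixes t :: "nat \<Rightarrow> real"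
  assumes C: "category C" and xu: "(x, u) \<in> splx C n"
    and t: "t \<in> \<Delta> n" and i: "i \<le> n"
    and z: "sum t {..<i} \<le> 1 - s" "1 - s \<le> sum t {..i}"
  defines "\<tau> \<equiv> trunc (Suc n) (\<lambda>k. if k \<le> i then (x k, False) else (x (k - 1), True),
     \<lambda>k l. u (if k \<le> i then k else k - 1) (if l \<le> i then l else l - 1))"
    and "w \<equiv> \<lambda>k. if k < i then t k else if k = i then (1 - s) - sum t {..<i}
    else if k = Suc i then sum t {..i} - (1 - s) else t (k - 1)"
  shows "\<tau> \<in> splx (cyl C) (Suc n)" "w \<in> \<Delta> (Suc n)"
    "sweep (s, pt n (x, u) t) = pt (Suc n) \<tau> w"
proof -
  note d = nerveD[OF xu] and t' = standard_simplexD[OF t]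
  have ps: "sum w {..<k} = (if k \<le> i then sum t {..<k} else if k = Suc i then 1 - s else sum t {..<k - 1})" for k
    unfolding w_def by (rule partial_sum_prism)
  show "\<tau> \<in> splx (cyl C) (Suc n)"
    unfolding \<tau>_def
  proof (rule trunc_in_nerve)
    fix j k l assume l: "j \<le> k" "k \<le> l" "l \<le> Suc n"
    show "u (if j \<le> i then j else j - 1) (if l \<le> i then l else l - 1) = Comp (cyl C)
        (if j \<le> i then (x j, False) else (x (j - 1), True))
        (if k \<le> i then (x k, False) else (x (k - 1), True))
        (if l \<le> i then (x l, False) else (x (l - 1), True))
        (u (if k \<le> i then k else k - 1) (if l \<le> i then l else l - 1))
        (u (if j \<le> i then j else j - 1) (if k \<le> i then k else k - 1))"
      using d(4)[of "if j \<le> i then j else j - 1" "if k \<le> i then k else k - 1" "if l \<le> i then l else l - 1"] l i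
      by (simp add: if_distrib[of fst] if_distrib[of x] cong: if_cong) (auto split: if_splits)
  next
    fix j k assume l: "j \<le> k" "k \<le> Suc n"
    show "u (if j \<le> i then j else j - 1) (if k \<le> i then k else k - 1)
      \<in> Hom (cyl C) (if j \<le> i then (x j, False) else (x (j - 1), True)) (if k \<le> i then (x k, False) else (x (k - 1), True))"
      using l i d(2)[of "if j \<le> i then j else j - 1" "if k \<le> i then k else k - 1"] by auto
  qed (use i d(1,3) in auto)
  show w: "w \<in> \<Delta> (Suc n)"
  proof (rule standard_simplexI)
    show "0 \<le> w k" for k using t'(1) z by (simp add: w_def)
    show "w k = 0" if "k > Suc n" for k using that i t'(3) by (simp add: w_def)
    show "sum w {..Suc n} = 1"
      unfolding lessThan_Suc_atMost[symmetric] ps using i t'(4) z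
      by (simp add: lessThan_Suc_atMost)
  qed
  have c: "cidx w r = (if 1 - s \<le> r then Suc (cidx t r) else cidx t r) \<and>
      (if 1 - s \<le> r then i \<le> cidx t r else cidx t r \<le> i)" if r: "0 \<le> r" "r < 1" for r
  proof -
    note b = cidx_bounds[OF t r]
    have mono: "sum t {..<a} \<le> sum t {..<a'}" if "a \<le> a'" for a a'
      by (intro sum_mono2) (use that t' in auto)
    show ?thesis
    proof (cases "1 - s \<le> r")
      case True
      have "i \<le> cidx t r"
      proof (rule ccontr)
        assume "\<not> i \<le> cidx t r"
        then have "sum t {..cidx t r} \<le> sum t {..<i}"
          using mono[of "Suc (cidx t r)" i] by (simp add: lessThan_Suc_atMost)
        then show False using b z True by linarith
      qed
      moreover have "cidx w r = Suc (cidx t r)"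
      proof (rule cidx_eqI)
        show "sum w {..<Suc (cidx t r)} \<le> r" using ps[of "Suc (cidx t r)"] b True calculation by auto
        show "r < sum w {..Suc (cidx t r)}"
          using ps[of "Suc (Suc (cidx t r))"] b True calculation by (simp add: lessThan_Suc_atMost)
      qed (use standard_simplexD[OF w] in auto)
      ultimately show ?thesis using True by simp
    next
      case False
      have "cidx t r \<le> i"
      proof (rule ccontr)
        assume "\<not> cidx t r \<le> i"
        then have "sum t {..i} \<le> sum t {..<cidx t r}"
          using mono[of "Suc i" "cidx t r"] by (simp add: lessThan_Suc_atMost)
        then show False using b z False by linarith
      qed
      moreover have "cidx w r = cidx t r"
      proof (rule cidx_eqI)
        show "sum w {..<cidx t r} \<le> r" using ps[of "cidx t r"] b calculation by auto
        show "r < sum w {..cidx t r}"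
          using ps[of "Suc (cidx t r)"] b False calculation by (auto simp: lessThan_Suc_atMost)
      qed (use standard_simplexD[OF w] in auto)
      ultimately show ?thesis using False by simp
    qed
  qed
  have c1: "cidx w r = Suc (cidx t r)" "i \<le> cidx t r" if "0 \<le> r" "r < 1" "1 - s \<le> r" for r
    using c[OF that(1,2)] that by auto
  have c2: "cidx w r = cidx t r" "cidx t r \<le> i" if "0 \<le> r" "r < 1" "\<not> 1 - s \<le> r" for r
    using c[OF that(1,2)] that by auto
  have k3: "cidx w r \<le> i \<longleftrightarrow> \<not> 1 - s \<le> r" if "0 \<le> r" "r < 1" for r
    using c1[OF that] c2[OF that] by (cases "1 - s \<le> r") auto
  have k1: "cidx w r = cidx t r" if "0 \<le> r" "r < 1" "\<not> 1 - s \<le> r" for r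
    using c2 that by auto
  have k2: "cidx w r - Suc 0 = cidx t r" if "0 \<le> r" "r < 1" "1 - s \<le> r" for r
    using c1 that by auto
  show "sweep (s, pt n (x, u) t) = pt (Suc n) \<tau> w"
    unfolding stp_def \<tau>_def prod.case pull_trunc[OF w] unfolding sweep_def pull_def prod.case
    by (intro prod_eqI ext) (auto simp: k1 k2 k3)
qed

lemma continuous_map_prod_sum:
  assumes "\<And>i. i \<in> I \<Longrightarrow> continuous_map (prod_topology Z (X i)) Y (\<lambda>(z, t). f (z, (i, t)))"
  shows "continuous_map (prod_topology Z (sum_topology X I)) Y f"
  unfolding continuous_map_def
proof (intro conjI allI impI)
  show "f \<in> topspace (prod_topology Z (sum_topology X I)) \<rightarrow> topspace Y"
  proof
    fix p assume "p \<in> topspace (prod_topology Z (sum_topology X I))"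
    then obtain z i t where p: "p = (z, (i, t))" "i \<in> I" "(z, t) \<in> topspace (prod_topology Z (X i))" by auto
    then show "f p \<in> topspace Y"
      using continuous_map_in_topspace[OF assms[OF p(2)] p(3)] by simp
  qed
  fix U assume U: "openin Y U"
  let ?P = "{p \<in> topspace (prod_topology Z (sum_topology X I)). f p \<in> U}"
  show "openin (prod_topology Z (sum_topology X I)) ?P"
    unfolding openin_prod_topology_alt
  proof (intro allI impI)
    fix z it assume *: "(z, it) \<in> ?P"
    obtain i t where it: "it = (i, t)" by force
    have i: "i \<in> I" "t \<in> topspace (X i)" "z \<in> topspace Z" "f (z, (i, t)) \<in> U" using * it by auto
    let ?Q = "{p \<in> topspace (prod_topology Z (X i)). (\<lambda>(z, t). f (z, (i, t))) p \<in> U}"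
    have "openin (prod_topology Z (X i)) ?Q"
      using assms[OF i(1)] U unfolding continuous_map_def by blast
    moreover have "(z, t) \<in> ?Q" using i by auto
    ultimately obtain V W where VW: "openin Z V" "openin (X i) W" "z \<in> V" "t \<in> W" "V \<times> W \<subseteq> ?Q"
      unfolding openin_prod_topology_alt by meson
    have "openin (sum_topology X I) ({i} \<times> W)"
      unfolding openin_sum_topology
    proof (intro conjI ballI)
      show "{i} \<times> W \<subseteq> Sigma I (topspace \<circ> X)" using i VW(2) openin_subset by fastforce
      show "openin (X j) {x. (j, x) \<in> {i} \<times> W}" for j
        using VW(2) by (cases "j = i") auto
    qed
    moreover have "V \<times> ({i} \<times> W) \<subseteq> ?P" using VW(5) i(1) by auto
    ultimately show "\<exists>U V'. openin Z U \<and> openin (sum_topology X I) V' \<and> z \<in> U \<and> it \<in> V' \<and> U \<times> V' \<subseteq> ?P"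
      using VW it by blast
  qed
qed

lemma continuous_map_simplex_coord:
  "continuous_map (simplex_top n) euclideanreal (\<lambda>t. t k)"
  by (rule continuous_map_from_subtopology, rule continuous_map_product_projection) simp

lemma continuous_map_into_simplex:
  assumes "\<And>k. continuous_map X euclideanreal (\<lambda>p. f p k)" "\<And>p. p \<in> topspace X \<Longrightarrow> f p \<in> \<Delta> n"
  shows "continuous_map X (simplex_top n) f"
  unfolding continuous_map_in_subtopology continuous_map_componentwise_UNIV
  using assms by auto

lemma continuous_map_sweep:
  assumes C: "category C"
  shows "continuous_map (prod_topology (top_of_set {0..1}) (steps C)) (steps (cyl C)) sweep"
proof -
  let ?I = "top_of_set {0..1::real}" and ?X = "simplex_sum (nerve C)"
  have simp: "continuous_map (prod_topology ?I (simplex_top n)) (steps (cyl C))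
      (\<lambda>(s, t). sweep (s, pt n \<sigma> t))" if s: "\<sigma> \<in> splx C n" for n \<sigma>
  proof -
    obtain x u where xu: "\<sigma> = (x, u)" by force
    let ?P = "prod_topology ?I (simplex_top n)"
    define T where "T i = {p \<in> topspace ?P. sum (snd p) {..<i} \<le> 1 - fst p \<and> 1 - fst p \<le> sum (snd p) {..i}}" for i
    define \<tau> where "\<tau> i = trunc (Suc n) (\<lambda>k. if k \<le> i then (x k, False) else (x (k - 1), True),
       \<lambda>k l. u (if k \<le> i then k else k - 1) (if l \<le> i then l else l - 1))" for i
    define w where "w i = (\<lambda>p k. if k < i then snd p k else if k = i then (1 - fst p) - sum (snd p) {..<i}
      else if k = Suc i then sum (snd p) {..i} - (1 - fst p) else (snd p (k - 1) :: real))" for i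
    have cf: "continuous_map ?P euclideanreal fst"
      using continuous_map_fst continuous_map_into_fulltopology by blast
    have cs: "continuous_map ?P euclideanreal (\<lambda>p. snd p k)" for k
      using continuous_map_compose[OF continuous_map_snd continuous_map_simplex_coord] by (simp add: o_def)
    have csum: "continuous_map ?P euclideanreal (\<lambda>p. sum (snd p) K)" if "finite K" for K
      by (rule continuous_map_sum) (use that cs in auto)
    have c1: "continuous_map ?P euclideanreal (\<lambda>p. 1 - fst p)"
      by (intro continuous_map_diff cf) auto
    show ?thesis
    proof (rule pasting_lemma_closed[where I = "{..n}" and T = T and f = "\<lambda>i p. pt (Suc n) (\<tau> i) (w i p)"])
      fix i assume i: "i \<in> {..n}"
      have "T i = {p \<in> topspace ?P. (1 - fst p) - sum (snd p) {..<i} \<in> {0..}} \<inter>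
         {p \<in> topspace ?P. sum (snd p) {..i} - (1 - fst p) \<in> {0..}}"
        by (auto simp: T_def)
      also have "closedin ?P \<dots>"
        by (intro closedin_Int closedin_continuous_map_preimage[where Y = euclideanreal] continuous_map_diff c1 csum) auto
      finally show "closedin ?P (T i)" .
      have T: "sum (snd p) {..<i} \<le> 1 - fst p" "1 - fst p \<le> sum (snd p) {..i}" "snd p \<in> \<Delta> n"
        if "p \<in> topspace (subtopology ?P (T i))" for p
        using that by (auto simp: T_def)
      have "continuous_map (subtopology ?P (T i)) (simplex_top (Suc n)) (w i)"
      proof (rule continuous_map_into_simplex)
        fix k
        have "continuous_map ?P euclideanreal (\<lambda>p. w i p k)"
          unfolding w_def by (auto intro!: continuous_map_diff c1 csum cs)
        then show "continuous_map (subtopology ?P (T i)) euclideanreal (\<lambda>p. w i p k)"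
          by (rule continuous_map_from_subtopology)
      next
        fix p assume p: "p \<in> topspace (subtopology ?P (T i))"
        show "w i p \<in> \<Delta> (Suc n)"
          unfolding w_def using prism_step(2)[OF C s[unfolded xu] T(3)[OF p] _ T(1,2)[OF p]] i by simp
      qed
      moreover have "\<tau> i \<in> splx (cyl C) (Suc n)"
      proof -
        define t0 where "t0 = (\<lambda>j. if j = i then 1 else 0 :: real)"
        have "t0 \<in> \<Delta> n" "sum t0 {..<i} = 0" "sum t0 {..i} = 1"
          using i by (auto simp: t0_def)
        then show ?thesis
          unfolding \<tau>_def using prism_step(1)[OF C s[unfolded xu], of t0 i 0] i by simp
      qed
      ultimately show "continuous_map (subtopology ?P (T i)) (steps (cyl C)) (\<lambda>p. pt (Suc n) (\<tau> i) (w i p))"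
        by (rule continuous_map_compose[OF _ continuous_map_stp, unfolded o_def])
    next
      have eq: "pt (Suc n) (\<tau> i) (w i p) = sweep (fst p, pt n \<sigma> (snd p))" if "i \<le> n" "p \<in> T i" for i p
        unfolding w_def \<tau>_def xu
        by (rule prism_step(3)[OF C s[unfolded xu], symmetric]) (use that in \<open>auto simp: T_def\<close>)
      show "pt (Suc n) (\<tau> i) (w i p) = pt (Suc n) (\<tau> j) (w j p)"
        if "i \<in> {..n}" "j \<in> {..n}" "p \<in> topspace ?P \<inter> T i \<inter> T j" for i j p
        using eq[of i p] eq[of j p] that by simp
      fix p assume p: "p \<in> topspace ?P"
      then have t: "snd p \<in> \<Delta> n" and f: "0 \<le> fst p" "fst p \<le> 1" by auto
      have "\<exists>i\<le>n. sum (snd p) {..<i} \<le> 1 - fst p \<and> 1 - fst p \<le> sum (snd p) {..i}"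
      proof (cases "1 - fst p < 1")
        case True
        then show ?thesis using cidx_bounds[OF t, of "1 - fst p"] f by (intro exI[of _ "cidx (snd p) (1 - fst p)"]) auto
      next
        case False
        have "sum (snd p) {..<n} \<le> sum (snd p) {..n}"
          by (intro sum_mono2) (use standard_simplexD[OF t] in auto)
        then show ?thesis using False f standard_simplexD(4)[OF t] by (intro exI[of _ n]) auto
      qed
      then obtain i where "i \<le> n" "p \<in> T i" using p by (auto simp: T_def)
      then show "\<exists>j. j \<in> {..n} \<and> p \<in> T j \<and> (case p of (s, t) \<Rightarrow> sweep (s, pt n \<sigma> t)) = pt (Suc n) (\<tau> j) (w j p)"
        using eq[of i p] by (intro exI[of _ i]) (simp add: prod.case_eq_if)
    qed auto
  qed
  have "continuous_map (prod_topology ?I ?X) (steps (cyl C)) (sweep \<circ> (\<lambda>(s, z). (s, stp z)))"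
    unfolding simplex_sum_def
    by (rule continuous_map_prod_sum) (use simp in \<open>auto simp: prod.case_eq_if\<close>)
  moreover have "quotient_map (prod_topology ?I ?X) (prod_topology ?I (steps C)) (\<lambda>(s, z). (s, stp z))"
  proof (rule quotient_map_prod_right[OF _ _ quotient_map_stp])
    show "locally_compact_space ?I"
      by (rule compact_imp_locally_compact_space) (simp add: compact_space_subtopology compactin_euclidean_iff)
    show "Hausdorff_space ?I \<or> regular_space ?I"
      by (simp add: Hausdorff_space_subtopology)
  qed
  ultimately show ?thesis
    using continuous_compose_quotient_map_eq by blast
qed

lemma pull_stepsD:
  assumes "p \<in> pts C"
  shows "0 \<le> s \<Longrightarrow> s < 1 \<Longrightarrow> fst p s \<in> Obj C"
    "\<not> (0 \<le> s \<and> s < 1) \<Longrightarrow> fst p s = undefined"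
    "0 \<le> r \<Longrightarrow> r \<le> s \<Longrightarrow> s < 1 \<Longrightarrow> snd p r s \<in> Hom C (fst p r) (fst p s)"
    "\<not> (0 \<le> r \<and> r \<le> s \<and> s < 1) \<Longrightarrow> snd p r s = undefined"
    "0 \<le> s \<Longrightarrow> s < 1 \<Longrightarrow> snd p s s = Ident C (fst p s)"
    "0 \<le> q \<Longrightarrow> q \<le> r \<Longrightarrow> r \<le> s \<Longrightarrow> s < 1 \<Longrightarrow>
       snd p q s = Comp C (fst p q) (fst p r) (fst p s) (snd p r s) (snd p q r)"
proof -
  obtain n \<sigma> t where p: "\<sigma> \<in> splx C n" "t \<in> \<Delta> n" "p = pt n \<sigma> t"
    using assms by (rule stepsE)
  obtain x u where xu: "\<sigma> = (x, u)" by force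
  note d = nerveD[OF p(1)[unfolded xu]] and b = cidx_bounds(1)[OF p(2)] and m = cidx_mono[OF p(2)]
  show "0 \<le> s \<Longrightarrow> s < 1 \<Longrightarrow> fst p s \<in> Obj C"
    "\<not> (0 \<le> s \<and> s < 1) \<Longrightarrow> fst p s = undefined"
    "0 \<le> r \<Longrightarrow> r \<le> s \<Longrightarrow> s < 1 \<Longrightarrow> snd p r s \<in> Hom C (fst p r) (fst p s)"
    "\<not> (0 \<le> r \<and> r \<le> s \<and> s < 1) \<Longrightarrow> snd p r s = undefined"
    "0 \<le> s \<Longrightarrow> s < 1 \<Longrightarrow> snd p s s = Ident C (fst p s)"
    by (auto simp: p(3) xu stp_def pull_def d(1-3) b m)
  assume "0 \<le> q" "q \<le> r" "r \<le> s" "s < 1"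
  then show "snd p q s = Comp C (fst p q) (fst p r) (fst p s) (snd p r s) (snd p q r)"
    using d(4)[of "cidx t q" "cidx t r" "cidx t s"] b m by (simp add: p(3) xu stp_def pull_def)
qed

lemma homotopic_at_level:
  assumes C: "category C"
  shows "homotopic C (cyl C) (at_level False) (at_level True)"
  unfolding homotopic_with
proof -
  have "sweep (0, p) = at_level False p" "sweep (1, p) = at_level True p" if "p \<in> pts C" for p
    using pull_stepsD(4)[OF that] by (auto simp: sweep_def at_level_def fstep_def prod.case_eq_if fun_eq_iff)
  then show ?thesis
    using continuous_map_sweep[OF C] by (subst homotopic_with) auto
qed

definition natural ::
  "('o, 'm) cat \<Rightarrow> ('p, 'n) cat \<Rightarrow> ('o \<Rightarrow> 'p) \<Rightarrow> ('o \<Rightarrow> 'o \<Rightarrow> 'm \<Rightarrow> 'n) \<Rightarrow>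
    ('o \<Rightarrow> 'p) \<Rightarrow> ('o \<Rightarrow> 'o \<Rightarrow> 'm \<Rightarrow> 'n) \<Rightarrow> ('o \<Rightarrow> 'n) \<Rightarrow> bool" where
  "natural C D Fo Fm Go Gm \<eta> \<longleftrightarrow> is_functor C D Fo Fm \<and> is_functor C D Go Gm \<and>
     (\<forall>X\<in>Obj C. \<eta> X \<in> Hom D (Fo X) (Go X)) \<and>
     (\<forall>X\<in>Obj C. \<forall>Y\<in>Obj C. \<forall>f\<in>Hom C X Y.
        Comp D (Fo X) (Fo Y) (Go Y) (\<eta> Y) (Fm X Y f) = Comp D (Fo X) (Go X) (Go Y) (Gm X Y f) (\<eta> X))"

lemma homotopic_natural:
  assumes nat: "natural C D Fo Fm Go Gm \<eta>"
  shows "homotopic C D (fstep Fo Fm) (fstep Go Gm)"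
proof -
  have F: "is_functor C D Fo Fm" and G: "is_functor C D Go Gm"
    and e: "X \<in> Obj C \<Longrightarrow> \<eta> X \<in> Hom D (Fo X) (Go X)"
    and sq: "\<lbrakk>X \<in> Obj C; Y \<in> Obj C; f \<in> Hom C X Y\<rbrakk> \<Longrightarrow>
        Comp D (Fo X) (Fo Y) (Go Y) (\<eta> Y) (Fm X Y f) = Comp D (Fo X) (Go X) (Go Y) (Gm X Y f) (\<eta> X)" for X Y f
    using nat unfolding natural_def by blast+
  note f = is_functorD[OF F] and g = is_functorD[OF G]
  interpret C: category C by (rule f)
  interpret D: category D by (rule f)
  define Ho where "Ho = (\<lambda>(x, b). if b then Go x else Fo x)"
  define Hm where "Hm = (\<lambda>(x, b) (y, c) h. if b then Gm x y h
     else if c then Comp D (Fo x) (Fo y) (Go y) (\<eta> y) (Fm x y h) else Fm x y h)"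
  have H: "is_functor (cyl C) D Ho Hm"
    unfolding is_functor_def
  proof (intro conjI ballI)
    show "category (cyl C)" using category_cyl f(1) .
    show "category D" by (rule f)
    fix X assume X: "X \<in> Obj (cyl C)"
    show "Ho X \<in> Obj D" "Hm X X (Ident (cyl C) X) = Ident D (Ho X)"
      using X by (auto simp: Ho_def Hm_def f g)
    fix Y assume Y: "Y \<in> Obj (cyl C)"
    {
      fix h assume h: "h \<in> Hom (cyl C) X Y"
      show "Hm X Y h \<in> Hom D (Ho X) (Ho Y)"
        using X Y h by (auto simp: Ho_def Hm_def f g e D.Comp_in split: if_splits)
    }
    fix Z h k assume Z: "Z \<in> Obj (cyl C)" and h: "h \<in> Hom (cyl C) X Y" and k: "k \<in> Hom (cyl C) Y Z"
    obtain x a y b z c where xyz: "X = (x, a)" "Y = (y, b)" "Z = (z, c)" by force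
    have o: "x \<in> Obj C" "y \<in> Obj C" "z \<in> Obj C" "h \<in> Hom C x y" "k \<in> Hom C y z" "a \<le> b" "b \<le> c"
      using X Y Z h k xyz by (auto split: if_splits)
    note FF = f(3,5)[of x] f(3,5)[of y] f(3,5)[of z] g(3,5)[of x] g(3,5)[of y] g(3,5)[of z] e
    have "Comp D (Fo x) (Fo z) (Go z) (\<eta> z) (Comp D (Fo x) (Fo y) (Fo z) (Fm y z k) (Fm x y h)) =
       Comp D (Fo x) (Fo y) (Go z) (Comp D (Fo y) (Fo z) (Go z) (\<eta> z) (Fm y z k)) (Fm x y h)"
      by (rule D.Comp_assoc[symmetric]) (use o FF in auto)
    moreover have "Comp D (Fo x) (Fo y) (Go z) (Comp D (Fo y) (Go y) (Go z) (Gm y z k) (\<eta> y)) (Fm x y h) =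
       Comp D (Fo x) (Go y) (Go z) (Gm y z k) (Comp D (Fo x) (Fo y) (Go y) (\<eta> y) (Fm x y h))"
      by (rule D.Comp_assoc) (use o FF in auto)
    ultimately show "Hm X Z (Comp (cyl C) X Y Z k h) = Comp D (Ho X) (Ho Y) (Ho Z) (Hm Y Z k) (Hm X Y h)"
      using o by (auto simp: xyz Ho_def Hm_def f(6) g(6) sq)
  qed
  have at: "fstep Ho Hm (at_level b p) = fstep (\<lambda>x. Ho (x, b)) (\<lambda>x y h. Hm (x, b) (y, b) h) p" for b p
    by (auto simp: fstep_def at_level_def prod.case_eq_if fun_eq_iff)
  have "homotopic C D (fstep Ho Hm \<circ> at_level False) (fstep Ho Hm \<circ> at_level True)"
    by (rule homotopic_with_compose_continuous_map_left[OF homotopic_at_level[OF f(1)] continuous_map_fstep[OF H]]) simp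
  moreover have "fstep Ho Hm \<circ> at_level False = fstep Fo Fm" "fstep Ho Hm \<circ> at_level True = fstep Go Gm"
    by (simp_all add: fun_eq_iff o_def at del: split_paired_All) (simp_all add: Ho_def Hm_def)
  ultimately show ?thesis by simp
qed

definition is_id :: "('o, 'm) cat \<Rightarrow> 'o \<Rightarrow> 'o \<Rightarrow> 'm \<Rightarrow> bool" where
  "is_id C X Y f \<longleftrightarrow> X = Y \<and> f = Ident C X"

definition nondeg :: "('o, 'm) cat \<Rightarrow> nat \<Rightarrow> ('o, 'm) nerve_simplex \<Rightarrow> bool" where
  "nondeg C n = (\<lambda>(x, u). \<forall>k<n. \<not> is_id C (x k) (x (Suc k)) (u k (Suc k)))"

definition jumps :: "('o, 'm) cat \<Rightarrow> ('o, 'm) step \<Rightarrow> real set" where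
  "jumps C p = {s. 0 < s \<and> s < 1 \<and>
     (\<forall>r. 0 \<le> r \<and> r < s \<longrightarrow> (\<exists>q. r \<le> q \<and> q < s \<and> \<not> is_id C (fst p q) (fst p s) (snd p q s)))}"

definition objs :: "('o, 'm) step \<Rightarrow> 'o set" where
  "objs p = fst p ` {0..<1}"

lemma fst_stp: "0 \<le> s \<Longrightarrow> s < 1 \<Longrightarrow> fst (pt n (x, u) t) s = x (cidx t s)"
  by (simp add: stp_def pull_def)

lemma snd_stp: "0 \<le> r \<Longrightarrow> r \<le> s \<Longrightarrow> s < 1 \<Longrightarrow> snd (pt n (x, u) t) r s = u (cidx t r) (cidx t s)"
  by (simp add: stp_def pull_def)

lemma cidx_partial_sum:
  assumes t: "t \<in> \<Delta> n" and k: "0 < t k"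
  shows "0 \<le> sum t {..<k}" "sum t {..<k} < 1" "cidx t (sum t {..<k}) = k"
proof -
  note d = standard_simplexD[OF t]
  show "0 \<le> sum t {..<k}" by (intro sum_nonneg) (use d in auto)
  have "k \<le> n" using d(3)[of k] k by (cases "k \<le> n") auto
  then have "sum t {..k} \<le> sum t {..n}"
    by (intro sum_mono2) (use d in auto)
  then show "sum t {..<k} < 1" using k d(4) by (simp flip: lessThan_Suc_atMost)
  show "cidx t (sum t {..<k}) = k"
    by (rule cidx_eqI) (use d k in \<open>auto simp flip: lessThan_Suc_atMost\<close>)
qed

lemma jumps_stp_subset:
  assumes xu: "(x, u) \<in> splx C n" and t: "t \<in> \<Delta> n"
  shows "jumps C (pt n (x, u) t) \<subseteq> (\<lambda>k. sum t {..<k}) ` {1..n}"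
proof
  fix s assume s: "s \<in> jumps C (pt n (x, u) t)"
  then have s01: "0 < s" "s < 1" by (auto simp: jumps_def)
  let ?c = "cidx t s"
  have b: "?c \<le> n" "sum t {..<?c} \<le> s" "s < sum t {..?c}"
    using cidx_bounds[OF t, of s] s01 by auto
  show "s \<in> (\<lambda>k. sum t {..<k}) ` {1..n}"
  proof (cases "sum t {..<?c} = s")
    case True
    then have "?c \<noteq> 0" using s01 by (metis lessThan_0 less_irrefl sum.empty)
    then show ?thesis using True b(1) by (intro image_eqI[of _ _ ?c]) auto
  next
    case False
    then have lt: "sum t {..<?c} < s" using b by simp
    have r0: "0 \<le> sum t {..<?c}"
      by (intro sum_nonneg) (use standard_simplexD[OF t] in auto)
    have q: "is_id C (fst (pt n (x, u) t) q) (fst (pt n (x, u) t) s) (snd (pt n (x, u) t) q s)"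
      if "sum t {..<?c} \<le> q" "q < s" for q
    proof -
      have "cidx t q = ?c"
        by (rule cidx_eqI) (use that b standard_simplexD[OF t] in auto)
      then show ?thesis
        using that r0 s01 nerveD(3)[OF xu b(1)] by (simp add: fst_stp snd_stp is_id_def)
    qed
    then show ?thesis using s lt r0 by (auto simp: jumps_def)
  qed
qed

lemma jumps_stp_nondeg:
  assumes xu: "(x, u) \<in> splx C n" and t: "t \<in> \<Delta> n"
    and nd: "nondeg C n (x, u)" and pos: "\<And>k. k \<le> n \<Longrightarrow> 0 < t k"
  shows "jumps C (pt n (x, u) t) = (\<lambda>k. sum t {..<k}) ` {1..n}"
proof
  show "(\<lambda>k. sum t {..<k}) ` {1..n} \<subseteq> jumps C (pt n (x, u) t)"
  proof
    fix s assume "s \<in> (\<lambda>k. sum t {..<k}) ` {1..n}"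
    then obtain k' where k': "s = sum t {..<k'}" "1 \<le> k'" "k' \<le> n" by auto
    then obtain k where k: "s = sum t {..<Suc k}" "Suc k \<le> n" by (cases k') auto
    have s: "0 \<le> s" "s < 1" "cidx t s = Suc k"
      unfolding k by (intro cidx_partial_sum[OF t] pos k(2))+
    have pk: "0 \<le> sum t {..<k}" "sum t {..<k} < s"
      using cidx_partial_sum(1)[OF t pos[of k]] k pos[of k] by auto
    have q: "\<not> is_id C (fst (pt n (x, u) t) q) (fst (pt n (x, u) t) s) (snd (pt n (x, u) t) q s)"
      if "sum t {..<k} \<le> q" "q < s" for q
    proof -
      have "cidx t q = k"
        by (rule cidx_eqI) (use that k standard_simplexD[OF t] in \<open>auto simp flip: lessThan_Suc_atMost\<close>)
      then show ?thesis
        using that pk s nd k(2) by (auto simp: fst_stp snd_stp nondeg_def)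
    qed
    show "s \<in> jumps C (pt n (x, u) t)"
      unfolding jumps_def
    proof (intro CollectI conjI allI impI)
      fix r assume r: "0 \<le> r \<and> r < s"
      show "\<exists>q\<ge>r. q < s \<and> \<not> is_id C (fst (pt n (x, u) t) q) (fst (pt n (x, u) t) s) (snd (pt n (x, u) t) q s)"
        using q[of "max r (sum t {..<k})"] r pk by (intro exI[of _ "max r (sum t {..<k})"]) auto
    qed (use s pk in auto)
  qed
qed (rule jumps_stp_subset[OF xu t])

lemma card_jumps_le:
  assumes "(x, u) \<in> splx C n" "t \<in> \<Delta> n"
  shows "card (jumps C (pt n (x, u) t)) \<le> n"
  using card_mono[OF _ jumps_stp_subset[OF assms]] card_image_le[of "{1..n}" "\<lambda>k. sum t {..<k}"] by simp

lemma strict_mono_partial_sums: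
  fixes t :: "nat \<Rightarrow> real"
  assumes "\<And>k. k \<le> n \<Longrightarrow> 0 < t k"
  shows "strict_mono_on {1..n} (\<lambda>k. sum t {..<k})"
proof (rule strict_mono_onI)
  fix j k assume jk: "j \<in> {1..n}" "k \<in> {1..n}" "j < k"
  have "0 \<le> t i" if "i < k" for i by (rule less_imp_le[OF assms]) (use jk that in simp)
  then have "sum t {..<Suc j} \<le> sum t {..<k}"
    by (intro sum_mono2) (use jk in auto)
  then show "sum t {..<j} < sum t {..<k}" using assms[of j] jk by simp
qed

lemma strict_mono_on_image_index:
  fixes f :: "nat \<Rightarrow> real"
  assumes f: "strict_mono_on {1..n} f" and k: "k \<in> {1..n}"
  shows "card {s \<in> f ` {1..n}. s < f k} = k - 1"
proof -
  have "{s \<in> f ` {1..n}. s < f k} = f ` {1..<k}"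
    using k strict_mono_on_less[OF f] by force
  moreover have "inj_on f {1..<k}"
    using strict_mono_on_imp_inj_on[OF f] k by (rule_tac inj_on_subset) auto
  ultimately show ?thesis by (simp add: card_image)
qed

lemma nondeg_rep_unique:
  assumes xu: "(x, u) \<in> splx C n" and t: "t \<in> \<Delta> n"
    and nd: "nondeg C n (x, u)" and pos: "\<And>k. k \<le> n \<Longrightarrow> 0 < t k"
    and xu': "(x', u') \<in> splx C n'" and t': "t' \<in> \<Delta> n'"
    and nd': "nondeg C n' (x', u')" and pos': "\<And>k. k \<le> n' \<Longrightarrow> 0 < t' k"
    and eq: "pt n (x, u) t = pt n' (x', u') t'"
  shows "n = card (jumps C (pt n (x, u) t))" "n' = n" "x' = x" "u' = u" "t' = t"
proof -
  let ?J = "jumps C (pt n (x, u) t)"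
  note sm = strict_mono_partial_sums[of n t, OF pos] and sm' = strict_mono_partial_sums[of n' t', OF pos']
  have J: "?J = (\<lambda>k. sum t {..<k}) ` {1..n}" and J': "?J = (\<lambda>k. sum t' {..<k}) ` {1..n'}"
    using jumps_stp_nondeg[OF xu t nd pos] jumps_stp_nondeg[OF xu' t' nd' pos'] eq by auto
  show n: "n = card ?J"
    unfolding J using strict_mono_on_imp_inj_on[OF sm] by (simp add: card_image)
  have "n' = card ?J"
    unfolding J' using strict_mono_on_imp_inj_on[OF sm'] by (simp add: card_image)
  then show nn: "n' = n" using n by simp
  have sums: "sum t {..<k} = sum t' {..<k}" if "k \<le> n" for k
  proof (cases "k = 0")
    case False
    then have k: "k \<in> {1..n}" using that by simp
    then have "sum t {..<k} \<in> (\<lambda>k. sum t' {..<k}) ` {1..n'}" using J J' by blast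
    then obtain l where l: "l \<in> {1..n'}" "sum t {..<k} = sum t' {..<l}" by blast
    have "k - 1 = card {s \<in> ?J. s < sum t {..<k}}"
      using strict_mono_on_image_index[OF sm k] J by simp
    also have "\<dots> = l - 1"
      using strict_mono_on_image_index[OF sm' l(1)] J' l(2) by simp
    finally have "k = l" using k l by auto
    then show ?thesis using l by simp
  qed simp
  have sums': "sum t {..<k} = sum t' {..<k}" for k
  proof (cases "k \<le> n")
    case False
    have "sum t {..<k} = sum t {..n}" "sum t' {..<k} = sum t' {..n}"
      by (rule sum.mono_neutral_right; use False standard_simplexD[OF t] standard_simplexD[OF t'] nn in auto)+
    then show ?thesis using standard_simplexD(4)[OF t] standard_simplexD(4)[OF t'] nn by simp
  qed (rule sums)
  show tt: "t' = t" by (rule simplex_eqI) (simp add: sums')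
  have c: "0 \<le> sum t {..<k}" "sum t {..<k} < 1" "cidx t (sum t {..<k}) = k" if "k \<le> n" for k
    using cidx_partial_sum[OF t pos[OF that]] by auto
  have mono: "sum t {..<k} \<le> sum t {..<l}" if "k \<le> l" for k l
    by (intro sum_mono2) (use that standard_simplexD[OF t] in auto)
  show "x' = x"
  proof
    fix k show "x' k = x k"
    proof (cases "k \<le> n")
      case True
      then show ?thesis
        using fst_stp[OF c(1,2)[OF True], of n x u t] fst_stp[OF c(1,2)[OF True], of n' x' u' t'] c(3)[OF True] eq tt
        by simp
    next
      case False
      then show ?thesis using xu xu' nn by (auto simp: nerve_simps PiE_def extensional_def)
    qed
  qed
  show "u' = u"
  proof (intro ext)
    fix k l show "u' k l = u k l"
    proof (cases "k \<le> l \<and> l \<le> n")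
      case True
      then have kl: "k \<le> n" "l \<le> n" "k \<le> l" by auto
      then show ?thesis
        using snd_stp[OF c(1)[OF kl(1)] mono[OF kl(3)] c(2)[OF kl(2)], of n x u t]
          snd_stp[OF c(1)[OF kl(1)] mono[OF kl(3)] c(2)[OF kl(2)], of n' x' u' t'] c(3) eq tt
        by simp
    next
      case False
      then show ?thesis using xu xu' nn by (auto simp: nerve_simps)
    qed
  qed
qed

definition face_op :: "nat \<Rightarrow> nat \<Rightarrow> nat" where
  "face_op i k = (if k < i then k else Suc k)"

definition degen_op :: "nat \<Rightarrow> nat \<Rightarrow> nat" where
  "degen_op i k = (if k \<le> i then k else k - 1)"

lemma face_op_simplex_op: "face_op i \<in> simplex_op n (Suc n)"
  by (auto simp: simplex_op_def face_op_def mono_on_def)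

lemma degen_op_simplex_op: "i \<le> n \<Longrightarrow> degen_op i \<in> simplex_op (Suc n) n"
  by (auto simp: simplex_op_def degen_op_def mono_on_def)

lemma push_face_op:
  assumes t: "t \<in> \<Delta> (Suc n)" and i: "i \<le> Suc n" "t i = 0"
  shows "t \<circ> face_op i \<in> \<Delta> n" "simplex_push n (face_op i) (t \<circ> face_op i) = t"
proof -
  note d = standard_simplexD[OF t]
  have inj: "inj_on (face_op i) {..n}" by (auto simp: inj_on_def face_op_def split: if_splits)
  have im: "face_op i ` {..n} = {..Suc n} - {i}"
  proof (intro equalityI subsetI)
    fix k assume k: "k \<in> {..Suc n} - {i}"
    show "k \<in> face_op i ` {..n}"
      by (rule image_eqI[of _ _ "if k < i then k else k - 1"]) (use k i in \<open>auto simp: face_op_def\<close>)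
  qed (use i in \<open>auto simp: face_op_def split: if_splits\<close>)
  show "t \<circ> face_op i \<in> \<Delta> n"
  proof (rule standard_simplexI)
    have "sum (t \<circ> face_op i) {..n} = sum t ({..Suc n} - {i})"
      using sum.reindex[OF inj, of t] im by simp
    also have "\<dots> = sum t {..Suc n}" using i by (intro sum.mono_neutral_left) auto
    finally show "sum (t \<circ> face_op i) {..n} = 1" using d(4) by simp
    show "(t \<circ> face_op i) k = 0" if "k > n" for k
      using that i d(3) by (auto simp: face_op_def)
  qed (use d in auto)
  show "simplex_push n (face_op i) (t \<circ> face_op i) = t"
  proof
    fix j
    consider "j = i" | "j > Suc n" | k where "j = face_op i k" "k \<le> n"
      using im by (metis DiffI atMost_iff imageE not_less singletonD)
    then show "simplex_push n (face_op i) (t \<circ> face_op i) j = t j"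
    proof cases
      case 1
      then have "{k. k \<le> n \<and> face_op i k = j} = {}" by (auto simp: face_op_def split: if_splits)
      then show ?thesis using i 1 by (simp add: simplex_push_def del: Collect_empty_eq)
    next
      case 2
      then have "{k. k \<le> n \<and> face_op i k = j} = {}" by (auto simp: face_op_def split: if_splits)
      then show ?thesis using d(3) 2 by (simp add: simplex_push_def del: Collect_empty_eq)
    next
      case 3
      then have "{k'. k' \<le> n \<and> face_op i k' = j} = {k}" using inj by (auto simp: inj_on_def)
      then show ?thesis using 3 by (simp add: simplex_push_def)
    qed
  qed
qed

lemma degenerate_simplex:
  assumes xu: "(x, u) \<in> splx C (Suc n)" and k: "k \<le> n" "is_id C (x k) (x (Suc k)) (u k (Suc k))"
    and C: "category C"
  shows "Act (nerve C) (Suc n) n (degen_op k) (Act (nerve C) n (Suc n) (face_op k) (x, u)) = (x, u)"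
proof -
  interpret category C by fact
  note d = nerveD[OF xu]
  have fd: "face_op k (degen_op k i) = (if i = k then Suc k else i)" for i
    by (auto simp: face_op_def degen_op_def)
  have xe: "x (if i = k then Suc k else i) = x i" for i
    using k by (simp add: is_id_def)
  have dl: "degen_op k i \<le> n" if "i \<le> Suc n" for i using that k by (auto simp: degen_op_def)
  have mono: "degen_op k i \<le> degen_op k j" if "i \<le> j" for i j using that by (auto simp: degen_op_def)
  have ue: "u (if i = k then Suc k else i) (if j = k then Suc k else j) = u i j" if ij: "i \<le> j" "j \<le> Suc n" for i j
  proof -
    have uid: "u k (Suc k) = Ident C (x k)" "x (Suc k) = x k" using k by (auto simp: is_id_def)
    have 1: "u (Suc k) j = u k j" if "Suc k \<le> j"
      using d(4)[of k "Suc k" j] that ij uid Comp_Ident_right[of "x k" "x j" "u (Suc k) j"] d(1)[of k] d(1)[of j] d(2)[of "Suc k" j] k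
      by simp
    have 2: "u i (Suc k) = u i k" if "i \<le> k"
      using d(4)[of i k "Suc k"] that uid Comp_Ident_left[of "x i" "x k" "u i k"] d(1)[of i] d(1)[of k] d(2)[of i k] k
      by simp
    have 3: "u (Suc k) (Suc k) = u k k" using d(3)[of k] d(3)[of "Suc k"] uid k by simp
    show ?thesis
      using 1 2 3 ij by (cases "i = k"; cases "j = k") auto
  qed
  show ?thesis
    unfolding nerve_simps
    using xu by (intro arg_cong2[of _ _ _ _ Pair] ext)
      (auto simp: fd xe ue dl mono nerve_simps PiE_def extensional_def)
qed

definition gmap :: "('o \<Rightarrow> 'o \<Rightarrow> 'm \<Rightarrow> 'y \<Rightarrow> 'y) \<Rightarrow> (('o, 'm) step \<Rightarrow> 'y) \<Rightarrow>
    nat \<Rightarrow> ('o, 'm) nerve_simplex \<Rightarrow> (nat \<Rightarrow> real) \<Rightarrow> 'y" where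
  "gmap tr G n = (\<lambda>(x, u) t. tr (x 0) (x (cidx t 0)) (u 0 (cidx t 0)) (G (pt n (x, u) t)))"

definition canonical_rep :: "('o, 'm) cat \<Rightarrow> ('o, 'm) step \<Rightarrow> ('o, 'm) nerve_simplex \<times> (nat \<Rightarrow> real)" where
  "canonical_rep C p = (SOME (\<sigma>, t). \<exists>n. \<sigma> \<in> splx C n \<and> t \<in> \<Delta> n \<and>
     nondeg C n \<sigma> \<and> (\<forall>k\<le>n. 0 < t k) \<and> p = pt n \<sigma> t)"

lemma canonical_rep_eq:
  assumes "\<sigma> \<in> splx C n" "t \<in> \<Delta> n" "nondeg C n \<sigma>" "\<And>k. k \<le> n \<Longrightarrow> 0 < t k"
  shows "canonical_rep C (pt n \<sigma> t) = (\<sigma>, t)"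
proof -
  obtain x u where xu: "\<sigma> = (x, u)" by force
  show ?thesis
    unfolding canonical_rep_def
  proof (rule some_equality)
    fix a assume *: "case a of (\<sigma>', t') \<Rightarrow> \<exists>n'. \<sigma>' \<in> splx C n' \<and> t' \<in> \<Delta> n' \<and>
        nondeg C n' \<sigma>' \<and> (\<forall>k\<le>n'. 0 < t' k) \<and> pt n \<sigma> t = pt n' \<sigma>' t'"
    obtain x' u' t' where a1: "a = ((x', u'), t')" by (metis surj_pair)
    then obtain n' where a: "a = ((x', u'), t')" "(x', u') \<in> splx C n'"
      "t' \<in> \<Delta> n'" "nondeg C n' (x', u')" "\<And>k. k \<le> n' \<Longrightarrow> 0 < t' k"
      "pt n \<sigma> t = pt n' (x', u') t'"
      using * by auto
    show "a = (\<sigma>, t)"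
      using nondeg_rep_unique(3-5)[OF assms(1)[unfolded xu] assms(2) assms(3)[unfolded xu] assms(4) a(2-5) a(6)[unfolded xu]]
      by (simp add: a(1) xu)
  qed (use assms in auto)
qed

text \<open>Maps from step functors on \<open>C\<close> to contractible spaces \<open>Y\<close> depending on the initial object, given
  by \<open>G0\<close> where the objects satisfy \<open>P0\<close>. Elsewhere the map is built by induction on the number of
  jumps: from its value at the radial projection to the boundary of the simplex, by means of \<open>H\<close>.
  On a face of a simplex the initial object may differ, which \<open>gmap\<close> compensates by transport.\<close>

locale carrier_system =
  fixes C :: "('o, 'm) cat" and Y :: "'o \<Rightarrow> 'y topology" and tr :: "'o \<Rightarrow> 'o \<Rightarrow> 'm \<Rightarrow> 'y \<Rightarrow> 'y"
    and H :: "'o \<Rightarrow> real \<times> 'y \<Rightarrow> 'y" and a :: "'o \<Rightarrow> 'y"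
    and P0 :: "'o set \<Rightarrow> bool" and G0 :: "('o, 'm) step \<Rightarrow> 'y"
  assumes C: "category C"
    and H_cont: "b \<in> Obj C \<Longrightarrow> continuous_map (prod_topology (top_of_set {0..1}) (Y b)) (Y b) (H b)"
    and H0: "b \<in> Obj C \<Longrightarrow> y \<in> topspace (Y b) \<Longrightarrow> H b (0, y) = y"
    and H1: "b \<in> Obj C \<Longrightarrow> y \<in> topspace (Y b) \<Longrightarrow> H b (1, y) = a b"
    and a_in: "b \<in> Obj C \<Longrightarrow> a b \<in> topspace (Y b)"
    and tr_cont: "\<lbrakk>b \<in> Obj C; c \<in> Obj C; f \<in> Hom C b c\<rbrakk> \<Longrightarrow> continuous_map (Y c) (Y b) (tr b c f)"
    and tr_id: "\<lbrakk>b \<in> Obj C; y \<in> topspace (Y b)\<rbrakk> \<Longrightarrow> tr b b (Ident C b) y = y"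
    and tr_comp: "\<lbrakk>b \<in> Obj C; c \<in> Obj C; d \<in> Obj C; f \<in> Hom C b c; g \<in> Hom C c d; y \<in> topspace (Y d)\<rbrakk>
      \<Longrightarrow> tr b d (Comp C b c d g f) y = tr b c f (tr c d g y)"
    and G0_in: "\<lbrakk>(x, u) \<in> splx C n; P0 (x ` {..n}); t \<in> \<Delta> n\<rbrakk>
      \<Longrightarrow> G0 (pt n (x, u) t) \<in> topspace (Y (x (cidx t 0)))"
    and G0_cont: "\<lbrakk>(x, u) \<in> splx C n; P0 (x ` {..n})\<rbrakk> \<Longrightarrow>
      continuous_map (simplex_top n) (Y (x 0)) (gmap tr G0 n (x, u))"
    and P0_mono: "P0 U \<Longrightarrow> V \<subseteq> U \<Longrightarrow> P0 V"
begin

definition radial :: "nat \<Rightarrow> (nat \<Rightarrow> real) \<Rightarrow> nat \<Rightarrow> real" where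
  "radial n t = (\<lambda>k. if k \<le> n then (t k - Min (t ` {..n})) / (1 - real (Suc n) * Min (t ` {..n})) else 0)"

primrec Gn :: "nat \<Rightarrow> ('o, 'm) step \<Rightarrow> 'y" where
  "Gn 0 p = (if P0 (objs p) then G0 p else a (fst p 0))"
| "Gn (Suc k) p = (if P0 (objs p) then G0 p
     else if card (jumps C p) \<le> k then Gn k p
     else let (\<sigma>, t) = canonical_rep C p; \<rho> = real (Suc (Suc k)) * Min (t ` {..Suc k})
       in if \<rho> = 1 then a (fst p 0) else H (fst p 0) (\<rho>, gmap tr (Gn k) (Suc k) \<sigma> (radial (Suc k) t)))"

definition G :: "('o, 'm) step \<Rightarrow> 'y" where "G p = Gn (card (jumps C p)) p"

lemma Gn_P0: "P0 (objs p) \<Longrightarrow> Gn k p = G0 p"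
  by (cases k) auto

lemma G_P0: "P0 (objs p) \<Longrightarrow> G p = G0 p"
  by (simp add: G_def Gn_P0)

lemma Gn_eq_G: "card (jumps C p) \<le> k \<Longrightarrow> Gn k p = G p"
proof (induction k)
  case (Suc k)
  show ?case
  proof (cases "P0 (objs p) \<or> card (jumps C p) = Suc k")
    case True then show ?thesis unfolding G_def by (metis Gn_P0)
  next
    case False
    then have "card (jumps C p) \<le> k" using Suc.prems by simp
    then show ?thesis using False Suc.IH by simp
  qed
qed (simp add: G_def)

lemma vertices:
  assumes "(x, u) \<in> splx C n" "t \<in> \<Delta> n"
  shows "cidx t 0 \<le> n" "x 0 \<in> Obj C" "x (cidx t 0) \<in> Obj C" "u 0 (cidx t 0) \<in> Hom C (x 0) (x (cidx t 0))"
    "fst (pt n (x, u) t) 0 = x (cidx t 0)"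
  using nerveD(1,2)[OF assms(1)] cidx_bounds(1)[OF assms(2), of 0] by (auto simp: fst_stp)

lemma gmap_Act:
  assumes xu: "(x, u) \<in> splx C n" and \<alpha>: "\<alpha> \<in> simplex_op m n" and t: "t \<in> \<Delta> m"
    and G: "G (pt m (Act (nerve C) m n \<alpha> (x, u)) t) \<in> topspace (Y (x (\<alpha> (cidx t 0))))"
  shows "gmap tr G n (x, u) (simplex_push m \<alpha> t) =
    tr (x 0) (x (\<alpha> 0)) (u 0 (\<alpha> 0)) (gmap tr G m (Act (nerve C) m n \<alpha> (x, u)) t)"
proof -
  let ?c = "cidx t 0"
  have c: "?c \<le> m" using cidx_bounds(1)[OF t, of 0] by simp
  note o = simplex_opD[OF \<alpha>] and d = nerveD[OF xu]
  have "gmap tr G n (x, u) (simplex_push m \<alpha> t) =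
      tr (x 0) (x (\<alpha> ?c)) (u 0 (\<alpha> ?c)) (G (pt m (Act (nerve C) m n \<alpha> (x, u)) t))"
    by (simp add: gmap_def cidx_push[OF t \<alpha>] stp_Act[OF t \<alpha>])
  also have "u 0 (\<alpha> ?c) = Comp C (x 0) (x (\<alpha> 0)) (x (\<alpha> ?c)) (u (\<alpha> 0) (\<alpha> ?c)) (u 0 (\<alpha> 0))"
    by (rule d(4)) (use o c in auto)
  also have "tr (x 0) (x (\<alpha> ?c)) \<dots> (G (pt m (Act (nerve C) m n \<alpha> (x, u)) t)) =
     tr (x 0) (x (\<alpha> 0)) (u 0 (\<alpha> 0)) (tr (x (\<alpha> 0)) (x (\<alpha> ?c)) (u (\<alpha> 0) (\<alpha> ?c)) (G (pt m (Act (nerve C) m n \<alpha> (x, u)) t)))"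
    by (rule tr_comp) (use o c d(1,2) G in auto)
  finally show ?thesis
    using c by (simp add: gmap_def nerve_simps)
qed

definition good :: "nat \<Rightarrow> bool" where
  "good n \<longleftrightarrow> (\<forall>x u. (x, u) \<in> splx C n \<longrightarrow>
     (\<forall>t\<in>\<Delta> n. G (pt n (x, u) t) \<in> topspace (Y (x (cidx t 0)))) \<and>
     continuous_map (simplex_top n) (Y (x 0)) (gmap tr G n (x, u)))"

lemma good_Act:
  assumes good: "good m" and xu: "(x, u) \<in> splx C n" and \<alpha>: "\<alpha> \<in> simplex_op m n"
  shows "t \<in> \<Delta> m \<Longrightarrow> G (pt n (x, u) (simplex_push m \<alpha> t)) \<in> topspace (Y (x (cidx (simplex_push m \<alpha> t) 0)))"
    and "t \<in> \<Delta> m \<Longrightarrow> gmap tr G n (x, u) (simplex_push m \<alpha> t) =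
    tr (x 0) (x (\<alpha> 0)) (u 0 (\<alpha> 0)) (gmap tr G m (Act (nerve C) m n \<alpha> (x, u)) t)"
    and "continuous_map (simplex_top m) (Y (x 0)) (\<lambda>t. gmap tr G n (x, u) (simplex_push m \<alpha> t))"
proof -
  obtain x' u' where A: "Act (nerve C) m n \<alpha> (x, u) = (x', u')" by force
  have A': "(x', u') \<in> splx C m" using Act_in_nerve[OF xu \<alpha>] A by simp
  have x': "x' k = x (\<alpha> k)" if "k \<le> m" for k using A that by (auto simp: nerve_simps)
  have G: "G (pt m (Act (nerve C) m n \<alpha> (x, u)) t) \<in> topspace (Y (x (\<alpha> (cidx t 0))))"
    if t: "t \<in> \<Delta> m" for t
  proof -
    have "G (pt m (x', u') t) \<in> topspace (Y (x' (cidx t 0)))"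
      using good A' t unfolding good_def by blast
    then show ?thesis using x'[of "cidx t 0"] cidx_bounds(1)[OF t, of 0] by (simp add: A)
  qed
  show "t \<in> \<Delta> m \<Longrightarrow> G (pt n (x, u) (simplex_push m \<alpha> t)) \<in> topspace (Y (x (cidx (simplex_push m \<alpha> t) 0)))"
    using G[of t] stp_Act[OF _ \<alpha>, of t C "(x, u)"] cidx_push[OF _ \<alpha>, of t 0] by simp
  show eq: "t \<in> \<Delta> m \<Longrightarrow> gmap tr G n (x, u) (simplex_push m \<alpha> t) =
      tr (x 0) (x (\<alpha> 0)) (u 0 (\<alpha> 0)) (gmap tr G m (Act (nerve C) m n \<alpha> (x, u)) t)" for t
    by (rule gmap_Act[OF xu \<alpha> _ G])
  have "continuous_map (simplex_top m) (Y (x (\<alpha> 0))) (gmap tr G m (x', u'))"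
    using good A' x'[of 0] unfolding good_def by (metis le0)
  moreover have "continuous_map (Y (x (\<alpha> 0))) (Y (x 0)) (tr (x 0) (x (\<alpha> 0)) (u 0 (\<alpha> 0)))"
    by (rule tr_cont) (use nerveD(1,2)[OF xu] simplex_opD[OF \<alpha>] in auto)
  ultimately have "continuous_map (simplex_top m) (Y (x 0)) (tr (x 0) (x (\<alpha> 0)) (u 0 (\<alpha> 0)) \<circ> gmap tr G m (x', u'))"
    by (rule continuous_map_compose)
  then show "continuous_map (simplex_top m) (Y (x 0)) (\<lambda>t. gmap tr G n (x, u) (simplex_push m \<alpha> t))"
    by (rule continuous_map_eq) (simp add: eq A)
qed

lemma good_degenerate:
  assumes good: "good n" and xu: "(x, u) \<in> splx C (Suc n)" and nd: "\<not> nondeg C (Suc n) (x, u)"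
  shows "t \<in> \<Delta> (Suc n) \<Longrightarrow> G (pt (Suc n) (x, u) t) \<in> topspace (Y (x (cidx t 0)))"
    and "continuous_map (simplex_top (Suc n)) (Y (x 0)) (gmap tr G (Suc n) (x, u))"
proof -
  obtain k where k: "k \<le> n" "is_id C (x k) (x (Suc k)) (u k (Suc k))"
    using nd by (auto simp: nondeg_def less_Suc_eq_le)
  obtain x' u' where A: "Act (nerve C) n (Suc n) (face_op k) (x, u) = (x', u')" by force
  have A': "(x', u') \<in> splx C n"
    using Act_in_nerve[OF xu face_op_simplex_op] A by metis
  have B: "Act (nerve C) (Suc n) n (degen_op k) (x', u') = (x, u)"
    using degenerate_simplex[OF xu k C] A by simp
  note op = degen_op_simplex_op[OF k(1)]
  have x: "x j = x' (degen_op k j)" if "j \<le> Suc n" for j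
    using B that by (auto simp: nerve_simps)
  have G: "G (pt (Suc n) (x, u) t) \<in> topspace (Y (x (cidx t 0)))" if t: "t \<in> \<Delta> (Suc n)" for t
  proof -
    have "G (pt n (x', u') (simplex_push (Suc n) (degen_op k) t)) \<in>
        topspace (Y (x' (cidx (simplex_push (Suc n) (degen_op k) t) 0)))"
      using good A' standard_simplex_push[OF op t] unfolding good_def by blast
    then show ?thesis
      using stp_Act[OF t op, of C "(x', u')"] cidx_push[OF t op, of 0] cidx_bounds(1)[OF t, of 0] B by (simp add: x)
  qed
  then show "t \<in> \<Delta> (Suc n) \<Longrightarrow> G (pt (Suc n) (x, u) t) \<in> topspace (Y (x (cidx t 0)))" .
  have x0: "x 0 = x' 0" using x[of 0] by (simp add: degen_op_def)
  have u0: "u' 0 0 = Ident C (x' 0)" using nerveD(3)[OF A'] by simp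
  have inY: "gmap tr G (Suc n) (x, u) t \<in> topspace (Y (x 0))" if t: "t \<in> \<Delta> (Suc n)" for t
    unfolding gmap_def prod.case
    by (rule continuous_map_in_topspace[OF tr_cont[OF vertices(2-4)[OF xu t]] G[OF t]])
  have eq: "gmap tr G n (x', u') (simplex_push (Suc n) (degen_op k) t) = gmap tr G (Suc n) (x, u) t"
    if t: "t \<in> \<Delta> (Suc n)" for t
  proof -
    have "gmap tr G n (x', u') (simplex_push (Suc n) (degen_op k) t) =
        tr (x' 0) (x' (degen_op k 0)) (u' 0 (degen_op k 0)) (gmap tr G (Suc n) (x, u) t)"
      using gmap_Act[OF A' op t] G[OF t] cidx_bounds(1)[OF t, of 0] by (simp add: B x)
    also have "\<dots> = gmap tr G (Suc n) (x, u) t"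
      using inY[OF t] vertices(2)[OF xu t] x0 u0 tr_id by (simp add: degen_op_def)
    finally show ?thesis .
  qed
  have "continuous_map (simplex_top (Suc n)) (simplex_top n) (simplex_push (Suc n) (degen_op k))"
  proof (rule continuous_map_into_simplex)
    show "continuous_map (simplex_top (Suc n)) euclideanreal (\<lambda>p. simplex_push (Suc n) (degen_op k) p j)" for j
      unfolding simplex_push_def by (rule continuous_map_sum) (auto intro: continuous_map_simplex_coord)
  qed (use standard_simplex_push[OF op] in auto)
  moreover have "continuous_map (simplex_top n) (Y (x 0)) (gmap tr G n (x', u'))"
    using good A' x0 unfolding good_def by metis
  ultimately have "continuous_map (simplex_top (Suc n)) (Y (x 0)) (gmap tr G n (x', u') \<circ> simplex_push (Suc n) (degen_op k))"
    by (rule continuous_map_compose)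
  then show "continuous_map (simplex_top (Suc n)) (Y (x 0)) (gmap tr G (Suc n) (x, u))"
    by (rule continuous_map_eq) (simp add: eq)
qed

lemma good_P0:
  assumes xu: "(x, u) \<in> splx C n" and P0: "P0 (x ` {..n})"
  shows "t \<in> \<Delta> n \<Longrightarrow> G (pt n (x, u) t) \<in> topspace (Y (x (cidx t 0)))"
    and "continuous_map (simplex_top n) (Y (x 0)) (gmap tr G n (x, u))"
proof -
  have ob: "P0 (objs (pt n (x, u) t))" if t: "t \<in> \<Delta> n" for t
    by (rule P0_mono[OF P0]) (use cidx_bounds(1)[OF t] in \<open>auto simp: objs_def fst_stp\<close>)
  show "t \<in> \<Delta> n \<Longrightarrow> G (pt n (x, u) t) \<in> topspace (Y (x (cidx t 0)))"
    using G0_in[OF xu P0] by (simp add: G_P0 ob)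
  show "continuous_map (simplex_top n) (Y (x 0)) (gmap tr G n (x, u))"
    by (rule continuous_map_eq[OF G0_cont[OF xu P0]]) (simp add: gmap_def G_P0 ob)
qed

lemma objs_interior:
  assumes "t \<in> \<Delta> n" "\<And>k. k \<le> n \<Longrightarrow> 0 < t k"
  shows "objs (pt n (x, u) t) = x ` {..n}"
proof -
  have "x k \<in> objs (pt n (x, u) t)" if "k \<le> n" for k
    unfolding objs_def using cidx_partial_sum[OF assms(1) assms(2)[OF that]]
    by (intro image_eqI[of _ _ "sum t {..<k}"]) (auto simp: fst_stp)
  then show ?thesis
    using cidx_bounds(1)[OF assms(1)] by (auto simp: objs_def fst_stp)
qed

lemma good_0: "good 0"
  unfolding good_def
proof (intro allI impI)
  fix x u assume xu: "(x, u) \<in> splx C 0"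
  show "(\<forall>t\<in>\<Delta> 0. G (pt 0 (x, u) t) \<in> topspace (Y (x (cidx t 0)))) \<and>
     continuous_map (simplex_top 0) (Y (x 0)) (gmap tr G 0 (x, u))"
  proof (cases "P0 (x ` {..0})")
    case True then show ?thesis using good_P0[OF xu] by blast
  next
    case False
    have G: "G (pt 0 (x, u) t) = a (x 0)" and c: "cidx t 0 = 0" if t: "t \<in> \<Delta> 0" for t
    proof -
      show c: "cidx t 0 = 0" using cidx_bounds(1)[OF t, of 0] by simp
      have "t 0 = 1" using standard_simplexD(4)[OF t] by simp
      then have "objs (pt 0 (x, u) t) = x ` {..0}"
        by (intro objs_interior[OF t]) auto
      moreover have "jumps C (pt 0 (x, u) t) = {}"
        using jumps_stp_subset[OF xu t] by auto
      ultimately show "G (pt 0 (x, u) t) = a (x 0)"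
        using False c vertices(5)[OF xu t] by (simp add: G_def)
    qed
    have x0: "x 0 \<in> Obj C" "u 0 0 = Ident C (x 0)" using nerveD(1,3)[OF xu] by auto
    have "continuous_map (simplex_top 0) (Y (x 0)) (\<lambda>t. a (x 0))" using a_in x0 by auto
    then have "continuous_map (simplex_top 0) (Y (x 0)) (gmap tr G 0 (x, u))"
      by (rule continuous_map_eq) (use G c x0 a_in tr_id in \<open>simp add: gmap_def\<close>)
    then show ?thesis using G c x0 a_in by simp
  qed
qed

lemma barycentric_radial:
  assumes t: "t \<in> \<Delta> (Suc n)" "i \<le> Suc n" "t i = 0" and r: "0 \<le> r" "r \<le> 1"
  defines "q \<equiv> \<lambda>k. (1 - r) * t k + r * (if k \<le> Suc n then 1 / real (Suc (Suc n)) else 0)"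
  shows "q \<in> \<Delta> (Suc n)" "real (Suc (Suc n)) * Min (q ` {..Suc n}) = r"
    "r < 1 \<Longrightarrow> radial (Suc n) q = t" "0 < r \<Longrightarrow> k \<le> Suc n \<Longrightarrow> 0 < q k"
proof -
  note d = standard_simplexD[OF t(1)]
  have b: "(\<lambda>k. if k \<le> Suc n then 1 / real (Suc (Suc n)) else 0) \<in> \<Delta> (Suc n)"
    by (rule standard_simplexI) auto
  show "q \<in> \<Delta> (Suc n)"
    unfolding q_def by (rule convex_standard_simplex[OF t(1) b r])
  have m: "Min (q ` {..Suc n}) = r / real (Suc (Suc n))"
  proof (rule Min_eqI)
    show "r / real (Suc (Suc n)) \<in> q ` {..Suc n}"
      by (rule image_eqI[of _ _ i]) (use t in \<open>auto simp: q_def\<close>)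
    fix y assume "y \<in> q ` {..Suc n}"
    then obtain k where k: "k \<le> Suc n" "y = q k" by auto
    have "0 \<le> (1 - r) * t k" using r d(1) by simp
    then show "r / real (Suc (Suc n)) \<le> y" using k by (simp add: q_def)
  qed simp
  then show "real (Suc (Suc n)) * Min (q ` {..Suc n}) = r" by simp
  have N: "real (Suc (Suc n)) * (r / real (Suc (Suc n))) = r" by simp
  show "radial (Suc n) q = t" if "r < 1"
  proof
    show "radial (Suc n) q k = t k" for k
      unfolding radial_def m N using that d(3)[of k] by (simp add: q_def)
  qed
  show "0 < q k" if "0 < r" "k \<le> Suc n"
  proof -
    have "0 \<le> (1 - r) * t k" using r d(1) by simp
    moreover have "0 < r * (1 / real (Suc (Suc n)))" using that by simp
    ultimately show ?thesis using that by (simp add: q_def add_nonneg_pos)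
  qed
qed

lemma barycentric_exists:
  assumes q: "q \<in> \<Delta> (Suc n)"
  obtains t r i where "t \<in> \<Delta> (Suc n)" "i \<le> Suc n" "t i = 0" "0 \<le> r" "r \<le> 1"
    "q = (\<lambda>k. (1 - r) * t k + r * (if k \<le> Suc n then 1 / real (Suc (Suc n)) else 0))"
proof -
  note d = standard_simplexD[OF q]
  define m where "m = Min (q ` {..Suc n})"
  have mle: "m \<le> q k" if "k \<le> Suc n" for k
    unfolding m_def using that by (intro Min_le) auto
  have "m \<in> q ` {..Suc n}" unfolding m_def by (rule Min_in) auto
  then obtain i where i: "i \<le> Suc n" "q i = m" by auto
  have m0: "0 \<le> m" using i d(1) by metis
  define r where "r = real (Suc (Suc n)) * m"
  have "(\<Sum>k\<le>Suc n. m) \<le> sum q {..Suc n}" by (rule sum_mono) (use mle in auto)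
  then have r1: "r \<le> 1" using d(4) by (simp add: r_def)
  show thesis
  proof (cases "r = 1")
    case True
    have m: "m = 1 / real (Suc (Suc n))" using True by (simp add: r_def field_simps)
    have "q k = m" if "k \<le> Suc n" for k
    proof (rule ccontr)
      assume "q k \<noteq> m"
      then have "(\<Sum>k\<le>Suc n. m) < sum q {..Suc n}"
        by (intro sum_strict_mono_ex1) (use mle that in \<open>auto simp: le_less intro!: bexI[of _ k]\<close>)
      then show False using True d(4) by (simp add: r_def)
    qed
    then have eq: "q = (\<lambda>k. (1 - 1) * (if k = 0 then 1 else 0) + 1 * (if k \<le> Suc n then 1 / real (Suc (Suc n)) else 0))"
      using d(3) m by (auto simp: fun_eq_iff)
    show thesis by (rule that[of "\<lambda>k. if k = 0 then 1 else 0" 1 1]) (use eq in auto)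
  next
    case False
    then have lt: "r < 1" using r1 by simp
    define t where "t = (\<lambda>k. if k \<le> Suc n then (q k - m) / (1 - r) else 0)"
    have "t \<in> \<Delta> (Suc n)"
    proof (rule standard_simplexI)
      have "sum t {..Suc n} = (\<Sum>k\<le>Suc n. (q k - m)) / (1 - r)"
        unfolding sum_divide_distrib by (rule sum.cong) (auto simp: t_def)
      also have "(\<Sum>k\<le>Suc n. (q k - m)) = 1 - r"
        unfolding sum_subtractf d(4) by (simp add: r_def)
      finally show "sum t {..Suc n} = 1" using lt by simp
    qed (use mle lt in \<open>auto simp: t_def\<close>)
    moreover have "t i = 0" using i by (simp add: t_def)
    moreover have "q = (\<lambda>k. (1 - r) * t k + r * (if k \<le> Suc n then 1 / real (Suc (Suc n)) else 0))"
      using lt d(3) by (auto simp: fun_eq_iff t_def r_def)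
    moreover have "0 \<le> r" using m0 by (simp add: r_def)
    ultimately show thesis using that i(1) r1 by blast
  qed
qed

lemma good_nondeg:
  assumes good: "good n" and xu: "(x, u) \<in> splx C (Suc n)" and nd: "nondeg C (Suc n) (x, u)"
    and nP0: "\<not> P0 (x ` {..Suc n})"
  shows "t \<in> \<Delta> (Suc n) \<Longrightarrow> G (pt (Suc n) (x, u) t) \<in> topspace (Y (x (cidx t 0)))"
    and "continuous_map (simplex_top (Suc n)) (Y (x 0)) (gmap tr G (Suc n) (x, u))"
proof -
  let ?N = "Suc n" and ?I = "top_of_set {0..1::real}" and ?g = "gmap tr G (Suc n) (x, u)"
  note d = nerveD[OF xu]
  have x0: "x 0 \<in> Obj C" "u 0 0 = Ident C (x 0)" using d(1,3) by auto
  define F where "F i = {t \<in> \<Delta> ?N. t i = 0}" for i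
  define Bd where "Bd = (\<Union>i\<le>?N. F i)"
  let ?B = "subtopology (simplex_top ?N) Bd"
  have topB: "topspace ?B = Bd" by (auto simp: Bd_def F_def)
  have Gface: "G (pt (?N) (x, u) t) \<in> topspace (Y (x (cidx t 0)))" if "i \<le> ?N" "t \<in> F i" for t i
  proof -
    have t: "t \<in> \<Delta> (Suc n)" "t i = 0" using that by (auto simp: F_def)
    note p = push_face_op[OF t(1) that(1) t(2)]
    show ?thesis
      using good_Act(1)[OF good xu face_op_simplex_op[of i] p(1)] p(2) by simp
  qed
  have cont_face: "continuous_map (subtopology (simplex_top ?N) (F i)) (Y (x 0)) ?g" if i: "i \<le> ?N" for i
  proof -
    have "continuous_map (subtopology (simplex_top ?N) (F i)) (simplex_top n) (\<lambda>t. t \<circ> face_op i)"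
    proof (rule continuous_map_into_simplex)
      show "continuous_map (subtopology (simplex_top ?N) (F i)) euclideanreal (\<lambda>t. (t \<circ> face_op i) k)" for k
        unfolding o_def by (intro continuous_map_from_subtopology[OF continuous_map_simplex_coord])
    qed (use push_face_op(1) i in \<open>auto simp: F_def\<close>)
    from continuous_map_compose[OF this good_Act(3)[OF good xu face_op_simplex_op[of i]]]
    show ?thesis
      by (rule continuous_map_eq) (use push_face_op(2) i in \<open>auto simp: F_def\<close>)
  qed
  have closed_face: "closedin (simplex_top ?N) (F i)" for i
  proof -
    have "F i = {t \<in> topspace (simplex_top ?N). t i \<in> {0}}" by (auto simp: F_def)
    then show ?thesis
      using closedin_continuous_map_preimage[OF continuous_map_simplex_coord, of "{0}" ?N i] by simp
  qed
  have cont_B: "continuous_map ?B (Y (x 0)) ?g"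
  proof (rule pasting_lemma_closed[where I = "{..?N}" and T = F and f = "\<lambda>_. ?g"])
    fix i assume i: "i \<in> {..?N}"
    then have sub: "F i \<subseteq> Bd" by (auto simp: Bd_def)
    show "closedin ?B (F i)"
      using closed_face[of i] sub by (rule closedin_subset_topspace)
    show "continuous_map (subtopology ?B (F i)) (Y (x 0)) ?g"
    proof -
      have "Bd \<inter> F i = F i" using sub by blast
      then show ?thesis using cont_face[of i] i unfolding subtopology_subtopology[of "simplex_top ?N"] by simp
    qed
  qed (auto simp: topB, auto simp: Bd_def)
  have inB: "?g t \<in> topspace (Y (x 0))" if "t \<in> Bd" for t
    using continuous_map_in_topspace[OF cont_B] that topB by blast
  define q where "q = (\<lambda>(r, t) k. (1 - r) * t k + r * (if k \<le> ?N then 1 / real (Suc ?N) else 0))"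
  have main: "G (pt (?N) (x, u) (q (r, t))) = H (x 0) (r, ?g t)"
    and c0: "cidx (q (r, t)) 0 = 0" if t: "t \<in> Bd" and r: "0 < r" "r \<le> 1" for t r
  proof -
    obtain i where i: "i \<le> ?N" "t \<in> \<Delta> ?N" "t i = 0" using t by (auto simp: Bd_def F_def)
    have r': "0 \<le> r" using r by simp
    have qe: "q (r, t) = (\<lambda>k. (1 - r) * t k + r * (if k \<le> ?N then 1 / real (Suc ?N) else 0))"
      by (simp add: q_def)
    note bc = barycentric_radial[OF i(2,1,3) r' r(2), folded qe]
    have pos: "0 < q (r, t) k" if "k \<le> ?N" for k
      using bc(4)[OF r(1) that] by (simp add: qe)
    let ?p = "pt (?N) (x, u) (q (r, t))"
    show c0: "cidx (q (r, t)) 0 = 0"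
      using cidx_partial_sum(3)[OF bc(1) pos[OF le0]] by simp
    then have fp: "fst ?p 0 = x 0" using vertices(5)[OF xu bc(1)] by simp
    have "card (jumps C ?p) = ?N"
      using nondeg_rep_unique(1)[OF xu bc(1) nd pos xu bc(1) nd pos refl] by simp
    then have "G ?p = Gn ?N ?p" by (simp add: G_def)
    also have "\<dots> = (if r = 1 then a (x 0) else H (x 0) (r, gmap tr (Gn n) ?N (x, u) (radial ?N (q (r, t)))))"
      using nP0 objs_interior[OF bc(1) pos, of x u] canonical_rep_eq[OF xu bc(1) nd pos] \<open>card (jumps C ?p) = ?N\<close> fp bc(2)
      by (simp del: One_nat_def) (use fp in auto)
    also have "\<dots> = H (x 0) (r, ?g t)"
    proof (cases "r = 1")
      case True then show ?thesis using H1[OF x0(1) inB[OF t]] by simp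
    next
      case False
      note p = push_face_op[OF i(2,1,3)]
      have "pt (?N) (x, u) t = pt n (Act (nerve C) n ?N (face_op i) (x, u)) (t \<circ> face_op i)"
        using stp_Act[OF p(1) face_op_simplex_op] p(2) by metis
      moreover obtain x' u' where A: "Act (nerve C) n ?N (face_op i) (x, u) = (x', u')" by force
      moreover have "(x', u') \<in> splx C n"
        using Act_in_nerve[OF xu face_op_simplex_op] A by metis
      ultimately have "card (jumps C (pt (?N) (x, u) t)) \<le> n"
        using card_jumps_le p(1) by metis
      then have "gmap tr (Gn n) ?N (x, u) t = ?g t"
        by (simp add: gmap_def Gn_eq_G)
      then show ?thesis using False bc(3) r by simp
    qed
    finally show "G ?p = H (x 0) (r, ?g t)" .
  qed
  have Hin: "H (x 0) (r, ?g t) \<in> topspace (Y (x 0))" if "t \<in> Bd" "0 \<le> r" "r \<le> 1" for r t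
    by (rule continuous_map_in_topspace[OF H_cont[OF x0(1)]]) (use inB that in auto)
  show "t \<in> \<Delta> ?N \<Longrightarrow> G (pt (?N) (x, u) t) \<in> topspace (Y (x (cidx t 0)))"
  proof -
    assume t: "t \<in> \<Delta> ?N"
    obtain s r i where s: "s \<in> \<Delta> ?N" "i \<le> ?N" "s i = 0" "0 \<le> r" "r \<le> 1" "t = q (r, s)"
      by (rule barycentric_exists[OF t]) (simp add: q_def)
    then have B: "s \<in> Bd" by (auto simp: Bd_def F_def)
    show ?thesis
    proof (cases "r = 0")
      case True
      then have "t = s" using s by (simp add: q_def)
      then show ?thesis using Gface s by (auto simp: F_def)
    next
      case False
      then show ?thesis using main[OF B, of r] c0[OF B, of r] Hin[OF B, of r] s by simp
    qed
  qed
  let ?P = "prod_topology ?I ?B"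
  have gq: "?g (q z) = (H (x 0) \<circ> (\<lambda>z. (fst z, ?g (snd z)))) z" if "z \<in> topspace ?P" for z
  proof -
    obtain r t where z: "z = (r, t)" by force
    then have t: "t \<in> Bd" and r: "0 \<le> r" "r \<le> 1" using that topB by auto
    show ?thesis
    proof (cases "r = 0")
      case True
      then show ?thesis using H0[OF x0(1) inB[OF t]] by (simp add: z q_def)
    next
      case False
      then have "?g (q (r, t)) = tr (x 0) (x 0) (Ident C (x 0)) (H (x 0) (r, ?g t))"
        using main[OF t, of r] c0[OF t, of r] r x0(2) by (simp add: gmap_def)
      also have "\<dots> = H (x 0) (r, ?g t)" using tr_id[OF x0(1) Hin[OF t r]] .
      finally show ?thesis by (simp add: z)
    qed
  qed
  have "continuous_map ?P (Y (x 0)) (H (x 0) \<circ> (\<lambda>z. (fst z, ?g (snd z))))"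
  proof (rule continuous_map_compose[OF _ H_cont[OF x0(1)]])
    show "continuous_map ?P (prod_topology ?I (Y (x 0))) (\<lambda>z. (fst z, ?g (snd z)))"
      using continuous_map_compose[OF continuous_map_snd cont_B]
      by (intro continuous_map_pairedI continuous_map_fst) (simp add: o_def)
  qed
  then have gqc: "continuous_map ?P (Y (x 0)) (?g \<circ> q)"
    by (rule continuous_map_eq) (simp add: gq del: topspace_prod_topology)
  have Bsub: "continuous_map ?P euclideanreal (\<lambda>z. snd z k)" for k
    using continuous_map_compose[OF continuous_map_snd continuous_map_from_subtopology[OF continuous_map_simplex_coord]]
    by (fastforce simp: o_def)
  have cf: "continuous_map ?P euclideanreal fst"
    using continuous_map_fst continuous_map_into_fulltopology by blast
  have qc: "continuous_map ?P (simplex_top ?N) q"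
  proof (rule continuous_map_into_simplex)
    show "continuous_map ?P euclideanreal (\<lambda>z. q z k)" for k
      unfolding q_def prod.case_eq_if
      by (intro continuous_map_add continuous_map_real_mult continuous_map_diff Bsub cf) auto
    fix z assume z: "z \<in> topspace ?P"
    then obtain r t where "z = (r, t)" "t \<in> Bd" "0 \<le> r" "r \<le> 1" using topB by auto
    then show "q z \<in> \<Delta> ?N"
      using barycentric_radial(1) by (auto simp: q_def Bd_def F_def)
  qed
  have "quotient_map ?P (simplex_top ?N) q"
  proof (rule continuous_closed_imp_quotient_map[OF qc])
    show "closed_map ?P (simplex_top ?N) q"
    proof (rule continuous_imp_closed_map_gen[OF _ Hausdorff_imp_kc_space qc])
      have "closedin (simplex_top ?N) Bd"
        unfolding Bd_def by (rule closedin_Union) (use closed_face in auto)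
      then have "compact_space ?B"
        by (intro closedin_compact_space[THEN compact_space_subtopology] compact_space_subtopology compactin_standard_simplex) auto
      then show "compact_space ?P"
        by (simp add: compact_space_prod_topology compact_space_subtopology compactin_euclidean_iff)
      show "Hausdorff_space (simplex_top ?N)"
        by (intro Hausdorff_space_subtopology) (simp add: Hausdorff_space_product_topology)
    qed
    show "q ` topspace ?P = topspace (simplex_top ?N)"
    proof
      show "q ` topspace ?P \<subseteq> topspace (simplex_top ?N)"
        using continuous_map_in_topspace[OF qc] by blast
      show "topspace (simplex_top ?N) \<subseteq> q ` topspace ?P"
      proof
        fix t assume "t \<in> topspace (simplex_top ?N)"
        then have t: "t \<in> \<Delta> ?N" by simp
        obtain s r i where s: "s \<in> \<Delta> ?N" "i \<le> ?N" "s i = 0" "0 \<le> r" "r \<le> 1" "t = q (r, s)"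
          by (rule barycentric_exists[OF t]) (simp add: q_def)
        then have "(r, s) \<in> topspace ?P" unfolding topspace_prod_topology topB by (auto simp: Bd_def F_def)
        then show "t \<in> q ` topspace ?P" using s(6) by blast
      qed
    qed
  qed
  then show "continuous_map (simplex_top ?N) (Y (x 0)) ?g"
    using gqc continuous_compose_quotient_map_eq by blast
qed

lemma good: "good n"
proof (induction n)
  case (Suc n)
  show ?case
    unfolding good_def
  proof (intro allI impI)
    fix x u assume xu: "(x, u) \<in> splx C (Suc n)"
    show "(\<forall>t\<in>\<Delta> (Suc n). G (pt (Suc n) (x, u) t) \<in> topspace (Y (x (cidx t 0)))) \<and>
       continuous_map (simplex_top (Suc n)) (Y (x 0)) (gmap tr G (Suc n) (x, u))"
      using good_P0[OF xu] good_degenerate[OF Suc xu] good_nondeg[OF Suc xu]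
      by (cases "P0 (x ` {..Suc n})"; cases "nondeg C (Suc n) (x, u)") blast+
  qed
qed (rule good_0)

lemma carrier_extension:
  assumes "(x, u) \<in> splx C n"
  shows "t \<in> \<Delta> n \<Longrightarrow> G (pt n (x, u) t) \<in> topspace (Y (x (cidx t 0)))"
    "continuous_map (simplex_top n) (Y (x 0)) (gmap tr G n (x, u))"
  using good assms unfolding good_def by blast+

end

definition coslice :: "('o, 'm) cat \<Rightarrow> 'o \<Rightarrow> 'o set \<Rightarrow> ('o \<times> 'm, 'm) cat" where
  "coslice C b A = \<lparr>Obj = {(X, g). X \<in> Obj C \<inter> A \<and> g \<in> Hom C b X},
     Hom = (\<lambda>X Y. {u \<in> Hom C (fst X) (fst Y). Comp C b (fst X) (fst Y) u (snd X) = snd Y}),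
     Comp = (\<lambda>X Y Z. Comp C (fst X) (fst Y) (fst Z)),
     Ident = (\<lambda>X. Ident C (fst X))\<rparr>"

lemma coslice_simps [simp]:
  "Obj (coslice C b A) = {(X, g). X \<in> Obj C \<inter> A \<and> g \<in> Hom C b X}"
  "Hom (coslice C b A) X Y = {u \<in> Hom C (fst X) (fst Y). Comp C b (fst X) (fst Y) u (snd X) = snd Y}"
  "Comp (coslice C b A) X Y Z = Comp C (fst X) (fst Y) (fst Z)"
  "Ident (coslice C b A) X = Ident C (fst X)"
  by (simp_all add: coslice_def)

lemma full_subcategory_simps [simp]:
  "Obj (full C A) = Obj C \<inter> A" "Hom (full C A) = Hom C"
  "Comp (full C A) = Comp C" "Ident (full C A) = Ident C"
  by (simp_all add: full_subcategory_def)

lemma category_full_subcategory: "category C \<Longrightarrow> category (full C A)"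
  unfolding category_def by auto

lemma category_coslice:
  assumes "category C" "b \<in> Obj C" shows "category (coslice C b A)"
proof -
  interpret category C by fact
  show ?thesis
  proof
    fix X assume "X \<in> Obj (coslice C b A)"
    then show "Ident (coslice C b A) X \<in> Hom (coslice C b A) X X"
      using assms(2) by (auto simp: Ident_in Comp_Ident_left)
  next
    fix X Y Z f g
    assume a: "X \<in> Obj (coslice C b A)" "Y \<in> Obj (coslice C b A)" "Z \<in> Obj (coslice C b A)"
      "f \<in> Hom (coslice C b A) X Y" "g \<in> Hom (coslice C b A) Y Z"
    have "Comp C b (fst X) (fst Z) (Comp C (fst X) (fst Y) (fst Z) g f) (snd X) =
       Comp C b (fst Y) (fst Z) g (Comp C b (fst X) (fst Y) f (snd X))"
      by (rule Comp_assoc) (use a assms(2) in auto)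
    then show "Comp (coslice C b A) X Y Z g f \<in> Hom (coslice C b A) X Z"
      using a by (auto intro!: Comp_in)
  qed (auto simp: Comp_Ident_left Comp_Ident_right Comp_assoc)
qed

lemma is_functor_fst_coslice:
  assumes "category C" "b \<in> Obj C"
  shows "is_functor (coslice C b A) (full C A) fst (\<lambda>X Y f. f)"
  using assms by (auto simp: is_functor_def category_coslice category_full_subcategory)

lemma is_functor_precomp:
  assumes C: "category C" and b: "b \<in> Obj C" and c: "c \<in> Obj C" and f: "f \<in> Hom C b c" and sub: "A \<inter> Obj C \<subseteq> A'"
  shows "is_functor (coslice C c A) (coslice C b A') (\<lambda>X. (fst X, Comp C b c (fst X) (snd X) f)) (\<lambda>X Y u. u)"
proof -
  interpret category C by fact
  show ?thesis
    unfolding is_functor_def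
  proof (intro conjI ballI)
    fix X assume X: "X \<in> Obj (coslice C c A)"
    then show "(fst X, Comp C b c (fst X) (snd X) f) \<in> Obj (coslice C b A')"
      using sub by (auto intro!: Comp_in b c f)
    fix Y u assume "Y \<in> Obj (coslice C c A)" and u: "u \<in> Hom (coslice C c A) X Y"
    then show "u \<in> Hom (coslice C b A') (fst X, Comp C b c (fst X) (snd X) f) (fst Y, Comp C b c (fst Y) (snd Y) f)"
      using X Comp_assoc[OF b c, of "fst X" "fst Y" f "snd X" u] f by auto
  qed (use C b c in \<open>auto simp: category_coslice\<close>)
qed

lemma fstep_comp_const: "fstep F (\<lambda>X Y u. u) (fstep G (\<lambda>X Y u. u) p) = fstep (\<lambda>X. F (G X)) (\<lambda>X Y u. u) p"
  by (auto simp: fstep_def prod.case_eq_if fun_eq_iff)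

lemma fstep_cong:
  assumes "p \<in> pts C" "\<And>X. X \<in> Obj C \<Longrightarrow> F X = G X"
    "\<And>X Y u. X \<in> Obj C \<Longrightarrow> Y \<in> Obj C \<Longrightarrow> u \<in> Hom C X Y \<Longrightarrow> F' X Y u = G' X Y u"
  shows "fstep F F' p = fstep G G' p"
  using pull_stepsD(1,3)[OF assms(1)] assms(2,3) by (auto simp: fstep_def prod.case_eq_if fun_eq_iff)

lemma fstep_id:
  assumes "p \<in> pts C"
  shows "fstep (\<lambda>X. X) (\<lambda>X Y u. u) p = p"
  using pull_stepsD(2,4)[OF assms] by (auto simp: fstep_def prod.case_eq_if fun_eq_iff intro!: prod_eqI)

lemma coslice_simplex:
  assumes C: "category C" and l: "l \<le> n"
    and "\<And>i. i \<le> n \<Longrightarrow> x i \<in> Obj C" "\<And>i. l \<le> i \<Longrightarrow> i \<le> n \<Longrightarrow> x i \<in> A"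
    and "\<And>i j. i \<le> j \<Longrightarrow> j \<le> n \<Longrightarrow> u i j \<in> Hom C (x i) (x j)"
    and "\<And>i. i \<le> n \<Longrightarrow> u i i = Ident C (x i)"
    and "\<And>i j k. i \<le> j \<Longrightarrow> j \<le> k \<Longrightarrow> k \<le> n \<Longrightarrow> u i k = Comp C (x i) (x j) (x k) (u j k) (u i j)"
  shows "trunc n (\<lambda>i. (x (max l i), u l (max l i)), \<lambda>i k. u (max l i) (max l k)) \<in> splx (coslice C (x l) A) n"
proof (rule trunc_in_nerve)
  show "u (max l i) (max l k) \<in> Hom (coslice C (x l) A) (x (max l i), u l (max l i)) (x (max l k), u l (max l k))"
    if "i \<le> k" "k \<le> n" for i k
    using that l assms(5)[of "max l i" "max l k"] assms(7)[of l "max l i" "max l k"] by auto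
  show "u (max l i) (max l k) = Comp (coslice C (x l) A) (x (max l i), u l (max l i)) (x (max l j), u l (max l j))
     (x (max l k), u l (max l k)) (u (max l j) (max l k)) (u (max l i) (max l j))"
    if "i \<le> j" "j \<le> k" "k \<le> n" for i j k
    using that l assms(7)[of "max l i" "max l j" "max l k"] by simp
qed (use assms(3-6) l in auto)

definition contr :: "('o, 'm) cat \<Rightarrow> bool" where
  "contr C \<longleftrightarrow> contractible_space (steps C) \<and> pts C \<noteq> {}"

lemma topspace_steps_nonempty:
  assumes C: "category C" and X: "X \<in> Obj C" shows "pts C \<noteq> {}"
proof -
  interpret category C by fact
  have "trunc 0 (\<lambda>i. X, \<lambda>i j. Ident C X) \<in> splx C 0"
    by (rule trunc_in_nerve) (use X Ident_in Comp_Ident_left in auto)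
  then show ?thesis
    using stp_in_steps nonempty_standard_simplex by (metis empty_iff ex_in_conv)
qed

lemma is_functor_id: "category C \<Longrightarrow> is_functor C C (\<lambda>X. X) (\<lambda>X Y u. u)"
  by (auto simp: is_functor_def)

lemma is_functor_const:
  assumes "category C" "category D" "b \<in> Obj D"
  shows "is_functor C D (\<lambda>X. b) (\<lambda>X Y u. Ident D b)"
proof -
  interpret D: category D by fact
  show ?thesis using assms by (auto simp: is_functor_def D.Ident_in D.Comp_Ident_left)
qed

lemma contr_if_null_homotopic:
  assumes C: "category C" and b: "b \<in> Obj C"
    and h: "homotopic C C (fstep (\<lambda>X. X) (\<lambda>X Y u. u)) (fstep (\<lambda>X. b) (\<lambda>X Y u. Ident C b))"
  shows "contr C"
proof -
  have "homotopic C C id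
      (\<lambda>p. (\<lambda>s. if 0 \<le> s \<and> s < 1 then b else undefined, \<lambda>r s. if 0 \<le> r \<and> r \<le> s \<and> s < 1 then Ident C b else undefined))"
    by (rule homotopic_with_eq[OF h]) (auto simp: fstep_id, auto simp: fstep_def prod.case_eq_if)
  then show ?thesis
    unfolding contr_def contractible_space_def using topspace_steps_nonempty[OF C b] by blast
qed

lemma contr_initial:
  assumes C: "category C" and b: "b \<in> Obj C"
    and e: "\<And>X. X \<in> Obj C \<Longrightarrow> e X \<in> Hom C b X"
    and en: "\<And>X Y f. X \<in> Obj C \<Longrightarrow> Y \<in> Obj C \<Longrightarrow> f \<in> Hom C X Y \<Longrightarrow> Comp C b X Y f (e X) = e Y"
  shows "contr C"
proof -
  interpret category C by fact
  have "natural C C (\<lambda>X. b) (\<lambda>X Y u. Ident C b) (\<lambda>X. X) (\<lambda>X Y u. u) e"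
    unfolding natural_def using C b e en by (auto simp: is_functor_id is_functor_const Comp_Ident_right)
  from homotopic_with_symD[OF homotopic_natural[OF this]] show ?thesis
    by (rule contr_if_null_homotopic[OF C b])
qed

lemma contr_coslice_self:
  assumes C: "category C" and b: "b \<in> Obj C" "b \<in> A"
  shows "contr (coslice C b A)"
proof -
  interpret category C by fact
  show ?thesis
    by (rule contr_initial[where b = "(b, Ident C b)" and e = snd])
      (use b in \<open>auto simp: category_coslice[OF C] Ident_in Comp_Ident_right\<close>)
qed

lemma contrE:
  assumes "contr C"
  obtains H a where "continuous_map (prod_topology (top_of_set {0..1::real}) (steps C)) (steps C) H"
    "\<And>y. H (0, y) = y" "\<And>y. H (1, y) = a" "a \<in> pts C"
proof -
  have "steps C \<noteq> trivial_topology" using assms by (auto simp: contr_def)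
  then obtain a where a: "a \<in> pts C" "homotopic C C id (\<lambda>x. a)"
    using assms by (auto simp: contr_def contractible_space)
  then obtain H where "continuous_map (prod_topology (top_of_set {0..1::real}) (steps C)) (steps C) H"
    "\<And>y. H (0, y) = y" "\<And>y. H (1, y) = a"
    unfolding homotopic_with_def by auto
  then show thesis using that a by blast
qed

theorem quillen_A:
  assumes C: "category C" and A: "A \<subseteq> Obj C" and contr: "\<And>b. b \<in> Obj C \<Longrightarrow> contr (coslice C b A)"
  obtains r where "continuous_map (steps C) (steps (full C A)) r"
    "\<And>p. p \<in> pts (full C A) \<Longrightarrow> r p = p"
    "homotopic C C r id"
proof -
  interpret category C by fact
  let ?U = "\<lambda>X. coslice C (fst X) (if snd X then A else Obj C)"
  let ?A = "full C A"
  define Y where "Y X = steps (?U X)" for X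
  define tr :: "'a \<times> bool \<Rightarrow> 'a \<times> bool \<Rightarrow> 'b \<Rightarrow> ('a \<times> 'b, 'b) step \<Rightarrow> ('a \<times> 'b, 'b) step"
    where "tr X Z f = fstep (\<lambda>W. (fst W, Comp C (fst X) (fst Z) (fst W) (snd W) f)) (\<lambda>X Y u. u)"
    for X Z f
  have cU: "contr (?U X)" if "X \<in> Obj (cyl C)" for X
    using that contr[of "fst X"] contr_coslice_self[OF C, of "fst X" "Obj C"] by (cases "snd X") auto
  have "\<forall>X. \<exists>Ha. X \<in> Obj (cyl C) \<longrightarrow> continuous_map (prod_topology (top_of_set {0..1::real}) (Y X)) (Y X) (fst Ha) \<and>
      (\<forall>y. fst Ha (0, y) = y) \<and> (\<forall>y. fst Ha (1, y) = snd Ha) \<and> snd Ha \<in> topspace (Y X)"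
    unfolding Y_def by (metis cU contrE fst_conv snd_conv)
  then obtain Ha where Ha: "\<And>X. X \<in> Obj (cyl C) \<Longrightarrow> continuous_map (prod_topology (top_of_set {0..1::real}) (Y X)) (Y X) (fst (Ha X)) \<and>
      (\<forall>y. fst (Ha X) (0, y) = y) \<and> (\<forall>y. fst (Ha X) (1, y) = snd (Ha X)) \<and> snd (Ha X) \<in> topspace (Y X)"
    by metis
  define P0 where "P0 U \<longleftrightarrow> U \<subseteq> Obj C \<times> {False} \<or> U \<subseteq> A \<times> {True}" for U :: "('a \<times> bool) set"
  define G0 :: "('a \<times> bool, 'b) step \<Rightarrow> ('a \<times> 'b, 'b) step"
    where "G0 = (\<lambda>(x, u). (\<lambda>s. if 0 \<le> s \<and> s < 1 then (fst (x s), u 0 s) else undefined, u))"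
  define \<tau> where "\<tau> n l = (\<lambda>(x :: nat \<Rightarrow> 'a \<times> bool, u :: nat \<Rightarrow> nat \<Rightarrow> 'b). trunc n (\<lambda>i. (fst (x (max l i)), u l (max l i)), \<lambda>i k. u (max l i) (max l k)))"
    for n l
  have snd_in: "snd (x i) = snd (x l) \<and> fst (x i) \<in> (if snd (x l) then A else Obj C)"
    if "P0 (x ` {..n})" "i \<le> n" "l \<le> n" for x :: "nat \<Rightarrow> 'a \<times> bool" and n i l
  proof -
    have "x i \<in> x ` {..n}" "x l \<in> x ` {..n}" using that by auto
    then have "x i \<in> Obj C \<times> {False} \<and> x l \<in> Obj C \<times> {False} \<or> x i \<in> A \<times> {True} \<and> x l \<in> A \<times> {True}"
      using that(1) unfolding P0_def by blast
    then show ?thesis by (auto simp: mem_Times_iff)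
  qed
  have \<tau>_in: "\<tau> n l (x, u) \<in> Simp (nerve (?U (x l))) n"
    if xu: "(x, u) \<in> splx (cyl C) n" and P: "P0 (x ` {..n})" and l: "l \<le> n" for n l x u
    unfolding \<tau>_def prod.case
  proof (rule coslice_simplex[OF C l, where x = "\<lambda>i. fst (x i)"])
    note d = nerveD[OF xu]
    show "fst (x i) \<in> Obj C" if "i \<le> n" for i using d(1)[OF that] by auto
    show "fst (x i) \<in> (if snd (x l) then A else Obj C)" if "i \<le> n" for i
      using snd_in[OF P that l] by blast
    show "u i j \<in> Hom C (fst (x i)) (fst (x j))" if "i \<le> j" "j \<le> n" for i j
      using d(2)[OF that] by (auto split: if_splits)
    show "u i i = Ident C (fst (x i))" if "i \<le> n" for i using d(3)[OF that] by simp
    show "u i k = Comp C (fst (x i)) (fst (x j)) (fst (x k)) (u j k) (u i j)"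
      if "i \<le> j" "j \<le> k" "k \<le> n" for i j k using d(4)[OF that] by simp
  qed
  have stp_\<tau>: "pt n (\<tau> n l (x, u)) t = (\<lambda>s. if 0 \<le> s \<and> s < 1 then (fst (x (cidx t s)), u l (cidx t s)) else undefined,
      snd (pt n (x, u) t))"
    if t: "t \<in> \<Delta> n" and l: "l \<le> cidx t 0" for n l x u t
  proof -
    have "max l (cidx t s) = cidx t s" if "0 \<le> s" "s < 1" for s
      using cidx_mono[OF t, of 0 s] that l by simp
    then show ?thesis
      unfolding stp_def \<tau>_def prod.case pull_trunc[OF t]
      by (intro prod_eqI ext) (auto simp: pull_def)
  qed
  have G0_eq: "G0 (pt n (x, u) t) = pt n (\<tau> n (cidx t 0) (x, u)) t"
    if t: "t \<in> \<Delta> n" for n x u t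
    unfolding stp_\<tau>[OF t order_refl] by (auto simp: G0_def stp_def pull_def fun_eq_iff)
  have tr_G0: "gmap tr G0 n (x, u) t = pt n (\<tau> n 0 (x, u)) t"
    if xu: "(x, u) \<in> splx (cyl C) n" and t: "t \<in> \<Delta> n" for n x u t
  proof -
    note d = nerveD(4)[OF xu]
    have "Comp C (fst (x 0)) (fst (x (cidx t 0))) (fst (x (cidx t s))) (u (cidx t 0) (cidx t s)) (u 0 (cidx t 0)) = u 0 (cidx t s)"
      if "0 \<le> s" "s < 1" for s
      using d[of 0 "cidx t 0" "cidx t s"] that cidx_mono[OF t, of 0 s] cidx_bounds(1)[OF t, of s] by simp
    then show ?thesis
      unfolding gmap_def prod.case G0_eq[OF t] stp_\<tau>[OF t order_refl] stp_\<tau>[OF t le0]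
      by (intro prod_eqI ext) (auto simp: tr_def fstep_def stp_def pull_def)
  qed
  interpret K: carrier_system "cyl C" Y tr "\<lambda>X. fst (Ha X)" "\<lambda>X. snd (Ha X)" P0 G0
  proof (rule carrier_system.intro)
    show "category (cyl C)" by (rule category_cyl[OF C])
    show "continuous_map (Y Z) (Y X) (tr X Z f)"
      if X: "X \<in> Obj (cyl C)" and Z: "Z \<in> Obj (cyl C)" and f: "f \<in> Hom (cyl C) X Z" for X Z f
      unfolding Y_def tr_def
      by (rule continuous_map_fstep, rule is_functor_precomp[OF C]) (use X Z f A in \<open>auto split: if_splits\<close>)
    show "tr X X (Ident (cyl C) X) y = y" if X: "X \<in> Obj (cyl C)" and y: "y \<in> topspace (Y X)" for X y
    proof -
      have "tr X X (Ident (cyl C) X) y = fstep (\<lambda>W. W) (\<lambda>X Y u. u) y"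
        unfolding tr_def by (rule fstep_cong[OF y[unfolded Y_def]]) (use X in \<open>auto simp: Comp_Ident_right\<close>)
      then show ?thesis using fstep_id[OF y[unfolded Y_def]] by simp
    qed
    show "tr X Z (Comp (cyl C) X W Z g f) y = tr X W f (tr W Z g y)"
      if X: "X \<in> Obj (cyl C)" and W: "W \<in> Obj (cyl C)" and Z: "Z \<in> Obj (cyl C)"
        and f: "f \<in> Hom (cyl C) X W" and g: "g \<in> Hom (cyl C) W Z" and y: "y \<in> topspace (Y Z)" for X W Z f g y
      unfolding tr_def fstep_comp_const
    proof (rule fstep_cong[OF y[unfolded Y_def]])
      fix V assume "V \<in> Obj (?U Z)"
      then show "(fst V, Comp C (fst X) (fst Z) (fst V) (snd V) (Comp (cyl C) X W Z g f)) =
         (fst (fst V, Comp C (fst W) (fst Z) (fst V) (snd V) g),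
          Comp C (fst X) (fst W) (fst (fst V, Comp C (fst W) (fst Z) (fst V) (snd V) g))
           (snd (fst V, Comp C (fst W) (fst Z) (fst V) (snd V) g)) f)"
        using X W Z f g Comp_assoc[of "fst X" "fst W" "fst Z" "fst V" f g "snd V"]
        by (auto split: if_splits)
    qed simp
    show "G0 (pt n (x, u) t) \<in> topspace (Y (x (cidx t 0)))"
      if "(x, u) \<in> splx (cyl C) n" "P0 (x ` {..n})" and t: "t \<in> \<Delta> n" for n x u t
      unfolding G0_eq[OF t] Y_def using \<tau>_in[OF that(1,2)] cidx_bounds(1)[OF t, of 0] t by (intro stp_in_steps) auto
    show "continuous_map (simplex_top n) (Y (x 0)) (gmap tr G0 n (x, u))"
      if xu: "(x, u) \<in> splx (cyl C) n" and P: "P0 (x ` {..n})" for n x u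
      unfolding Y_def
      by (rule continuous_map_eq[OF continuous_map_stp[OF \<tau>_in[OF xu P le0]]]) (simp add: tr_G0[OF xu])
    show "P0 U \<Longrightarrow> V \<subseteq> U \<Longrightarrow> P0 V" for U V by (auto simp: P0_def)
  qed (use Ha in auto)
  define pr :: "('a \<times> 'b, 'b) step \<Rightarrow> ('a, 'b) step" where "pr = fstep fst (\<lambda>X Y u. u)"
  have pr_cont: "continuous_map (Y X) (steps (full C (if snd X then A else Obj C))) pr"
    if "X \<in> Obj (cyl C)" for X
    unfolding Y_def pr_def by (rule continuous_map_fstep, rule is_functor_fst_coslice[OF C]) (use that in auto)
  have pr_tr: "pr (tr X Z f y) = pr y" for X Z f y
    by (auto simp: pr_def tr_def fstep_def prod.case_eq_if fun_eq_iff)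
  have PG: "continuous_map (simplex_top n) (steps (full C (if snd (x 0) then A else Obj C)))
      (\<lambda>t. pr (K.G (pt n (x, u) t)))" if xu: "(x, u) \<in> splx (cyl C) n" for n x u
  proof -
    have "continuous_map (simplex_top n) (steps (full C (if snd (x 0) then A else Obj C))) (pr \<circ> gmap tr K.G n (x, u))"
      by (rule continuous_map_compose[OF K.carrier_extension(2)[OF xu] pr_cont]) (use nerveD(1)[OF xu] in auto)
    then show ?thesis by (rule continuous_map_eq) (simp add: gmap_def pr_tr)
  qed
  have full: "full C (Obj C) = C" by (simp add: full_subcategory_def)
  have incl: "continuous_map (steps (full C B)) (steps C) id" for B
    unfolding continuous_map_steps
  proof (intro allI ballI)
    fix n \<sigma> assume "\<sigma> \<in> Simp (nerve (full C B)) n"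
    then have "\<sigma> \<in> splx C n" by (cases \<sigma>) (auto simp: nerve_simps)
    then show "continuous_map (simplex_top n) (steps C) (\<lambda>t. id (pt n \<sigma> t))"
      unfolding id_apply by (rule continuous_map_stp)
  qed
  have cont1: "continuous_map (steps (cyl C)) (steps C) (pr \<circ> K.G)"
    unfolding continuous_map_steps
  proof (intro allI ballI)
    fix n \<sigma> assume s: "\<sigma> \<in> splx (cyl C) n"
    obtain x u where xu: "\<sigma> = (x, u)" by force
    from continuous_map_compose[OF PG[OF s[unfolded xu]] incl]
    show "continuous_map (simplex_top n) (steps C) (\<lambda>t. (pr \<circ> K.G) (pt n \<sigma> t))"
      by (simp add: o_def xu)
  qed
  define r where "r = pr \<circ> K.G \<circ> at_level True"
  have r: "continuous_map (steps C) (steps ?A) r"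
    unfolding continuous_map_steps
  proof (intro allI ballI)
    fix n and \<sigma> :: "('a, 'b) nerve_simplex" assume s: "\<sigma> \<in> splx C n"
    obtain x u where xu: "\<sigma> = (x, u)" by force
    let ?s = "trunc n (\<lambda>i. (x i, True), u)"
    have at: "at_level True (pt n (x, u) t) = pt n (?s) t" "?s \<in> splx (cyl C) n"
      if "t \<in> \<Delta> n" for t
      using fstep_stp[OF is_functor_at_level[OF C] s[unfolded xu] that] unfolding at_level_def by auto
    obtain t0 where "t0 \<in> \<Delta> n" using nonempty_standard_simplex by blast
    then have s': "(\<lambda>i\<in>{..n}. (x i, True), \<lambda>i j. if i \<le> j \<and> j \<le> n then u i j else undefined) \<in> splx (cyl C) n"
      using at(2) by (simp add: trunc_def)
    have "continuous_map (simplex_top n) (steps ?A) (\<lambda>t. pr (K.G (pt n (?s) t)))"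
      using PG[OF s'] by (simp add: trunc_def)
    then show "continuous_map (simplex_top n) (steps ?A) (\<lambda>t. r (pt n \<sigma> t))"
      by (rule continuous_map_eq) (simp add: r_def xu at(1))
  qed
  have PG0: "pr (K.G (at_level b p)) = p" if p: "p \<in> pts C" and P: "P0 ((\<lambda>X. (X, b)) ` objs p)" for b p
  proof -
    have "objs (at_level b p) = (\<lambda>X. (X, b)) ` objs p"
      by (auto simp: objs_def at_level_def fstep_def prod.case_eq_if image_iff)
    then have "K.G (at_level b p) = G0 (at_level b p)" using K.G_P0 P by simp
    then show ?thesis
      using pull_stepsD(2,4)[OF p]
      by (auto simp: pr_def G0_def at_level_def fstep_def prod.case_eq_if fun_eq_iff intro!: prod_eqI)
  qed
  have objs_in: "objs p \<subseteq> Obj D" if "p \<in> pts D" for p and D :: "('a, 'b) cat"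
    using pull_stepsD(1)[OF that] by (auto simp: objs_def)
  have r_id: "r p = p" if p: "p \<in> topspace (steps ?A)" for p
  proof -
    have "p \<in> pts C" using continuous_map_in_topspace[OF incl p] by simp
    then show ?thesis
      unfolding r_def o_def using objs_in[OF p] by (intro PG0) (auto simp: P0_def)
  qed
  have "homotopic C C (pr \<circ> K.G \<circ> at_level False) r"
    unfolding r_def
    by (rule homotopic_with_compose_continuous_map_left[OF homotopic_at_level[OF C] cont1]) simp
  then have "homotopic C C id r"
  proof (rule homotopic_with_eq)
    fix p assume p: "p \<in> pts C"
    have "P0 ((\<lambda>X. (X, False)) ` objs p)" using objs_in[OF p] by (auto simp: P0_def)
    then show "id p = (pr \<circ> K.G \<circ> at_level False) p" using PG0[OF p] by simp
  qed auto
  then show thesis using that r r_id homotopic_with_symD by blast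
qed

lemma contr_full_subcategory:
  assumes C: "category C" and A: "A \<subseteq> Obj C" and contr: "\<And>b. b \<in> Obj C \<Longrightarrow> contr (coslice C b A)"
    and cC: "contr C"
  shows "contr (full C A)"
proof -
  obtain r where r: "continuous_map (steps C) (steps (full C A)) r"
    "\<And>p. p \<in> pts (full C A) \<Longrightarrow> r p = p"
    using quillen_A[OF C A contr] by blast
  have incl: "continuous_map (steps (full C A)) (steps C) id"
    unfolding continuous_map_steps
  proof (intro allI ballI)
    fix n \<sigma> assume "\<sigma> \<in> splx (full C A) n"
    then have "\<sigma> \<in> splx C n" by (cases \<sigma>) (auto simp: nerve_simps)
    then show "continuous_map (simplex_top n) (steps C) (\<lambda>t. id (pt n \<sigma> t))"
      unfolding id_apply by (rule continuous_map_stp)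
  qed
  have "retraction_map (steps C) (steps (full C A)) r"
    unfolding retraction_map_def retraction_maps_def using r incl by auto
  then have "contractible_space (steps (full C A))"
    using contractible_space_retraction_map_image cC unfolding contr_def by blast
  moreover have "pts (full C A) \<noteq> {}"
    using continuous_map_in_topspace[OF r(1)] cC unfolding contr_def by blast
  ultimately show ?thesis by (simp add: contr_def)
qed

lemma contr_retract:
  assumes F: "is_functor C D Fo Fm" and G: "is_functor D C Go Gm"
    and h: "homotopic C C (fstep Go Gm \<circ> fstep Fo Fm) id"
    and D: "contr D"
  shows "contr C"
proof -
  obtain c where c: "homotopic_with (\<lambda>h. True) (steps C) (steps C) (fstep Go Gm \<circ> fstep Fo Fm) (\<lambda>x. c)"
    using nullhomotopic_through_contractible_space[OF continuous_map_fstep[OF F] continuous_map_fstep[OF G]] D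
    unfolding contr_def by blast
  then have "contractible_space (steps C)"
    unfolding contractible_space_def using h homotopic_with_symD homotopic_with_trans by blast
  moreover have "pts C \<noteq> {}"
    using continuous_map_in_topspace[OF continuous_map_fstep[OF G]] D unfolding contr_def by blast
  ultimately show ?thesis by (simp add: contr_def)
qed

section \<open>Contractible posets\<close>

text \<open>A thin category is a preordered set; the morphisms of functors are then determined by the
  objects.\<close>

definition thin :: "('o, 'm) cat \<Rightarrow> bool" where
  "thin C \<longleftrightarrow> category C \<and> (\<forall>X\<in>Obj C. \<forall>Y\<in>Obj C. \<forall>f\<in>Hom C X Y. \<forall>g\<in>Hom C X Y. f = g)"

definition monotone_obj :: "('o, 'm) cat \<Rightarrow> ('p, 'n) cat \<Rightarrow> ('o \<Rightarrow> 'p) \<Rightarrow> bool" where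
  "monotone_obj C D F \<longleftrightarrow> (\<forall>X\<in>Obj C. F X \<in> Obj D) \<and>
     (\<forall>X\<in>Obj C. \<forall>Y\<in>Obj C. Hom C X Y \<noteq> {} \<longrightarrow> Hom D (F X) (F Y) \<noteq> {})"

definition thin_map :: "('p, 'n) cat \<Rightarrow> ('o \<Rightarrow> 'p) \<Rightarrow> 'o \<Rightarrow> 'o \<Rightarrow> 'm \<Rightarrow> 'n" where
  "thin_map D F X Y f = (SOME g. g \<in> Hom D (F X) (F Y))"

lemma is_functor_thin_map:
  assumes C: "category C" and D: "thin D" and F: "monotone_obj C D F"
  shows "is_functor C D F (thin_map D F)"
proof -
  interpret C: category C by fact
  interpret D: category D using D by (simp add: thin_def)
  have F1: "X \<in> Obj C \<Longrightarrow> F X \<in> Obj D" for X using F by (simp add: monotone_obj_def)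
  have uniq: "f = g" if "X \<in> Obj D" "Y \<in> Obj D" "f \<in> Hom D X Y" "g \<in> Hom D X Y" for X Y f g
    using D that by (simp add: thin_def)
  have hom: "thin_map D F X Y f \<in> Hom D (F X) (F Y)" if "X \<in> Obj C" "Y \<in> Obj C" "f \<in> Hom C X Y" for X Y f
    unfolding thin_map_def by (rule someI_ex) (use F that in \<open>unfold monotone_obj_def, blast\<close>)
  show ?thesis
    unfolding is_functor_def
  proof (intro conjI ballI)
    fix X assume X: "X \<in> Obj C"
    show "thin_map D F X X (Ident C X) = Ident D (F X)"
      by (rule uniq[OF _ _ hom]) (use X F1 C.Ident_in D.Ident_in in auto)
    fix Y Z f g assume "Y \<in> Obj C" "Z \<in> Obj C" "f \<in> Hom C X Y" "g \<in> Hom C Y Z"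
    then show "thin_map D F X Z (Comp C X Y Z g f) = Comp D (F X) (F Y) (F Z) (thin_map D F Y Z g) (thin_map D F X Y f)"
      using X by (intro uniq[OF F1 F1 hom] D.Comp_in F1 hom C.Comp_in)
  qed (use F1 hom C.category_axioms D.category_axioms in auto)
qed

lemma homotopic_thin:
  assumes D: "thin D" and F: "is_functor C D F Fm" and G: "is_functor C D G Gm"
    and le: "\<And>X. X \<in> Obj C \<Longrightarrow> Hom D (F X) (G X) \<noteq> {}"
  shows "homotopic C D (fstep F Fm) (fstep G Gm)"
proof -
  interpret D: category D using D by (simp add: thin_def)
  note f = is_functorD[OF F] and g = is_functorD[OF G]
  define \<eta> where "\<eta> X = (SOME h. h \<in> Hom D (F X) (G X))" for X
  have e: "\<eta> X \<in> Hom D (F X) (G X)" if "X \<in> Obj C" for X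
    unfolding \<eta>_def by (rule someI_ex) (use le[OF that] in auto)
  have "natural C D F Fm G Gm \<eta>"
    unfolding natural_def
  proof (intro conjI ballI)
    fix X Y h assume h: "X \<in> Obj C" "Y \<in> Obj C" "h \<in> Hom C X Y"
    have "Comp D (F X) (F Y) (G Y) (\<eta> Y) (Fm X Y h) \<in> Hom D (F X) (G Y)"
      "Comp D (F X) (G X) (G Y) (Gm X Y h) (\<eta> X) \<in> Hom D (F X) (G Y)"
      using h f(3,5) g(3,5) e by (auto intro!: D.Comp_in)
    then show "Comp D (F X) (F Y) (G Y) (\<eta> Y) (Fm X Y h) = Comp D (F X) (G X) (G Y) (Gm X Y h) (\<eta> X)"
      using D h(1,2) f(3) g(3) unfolding thin_def by blast
  qed (use F G e in auto)
  then show ?thesis by (rule homotopic_natural)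
qed

text \<open>The conical contraction \<open>X \<ge> n X \<le> e X \<ge> c\<close>.\<close>

lemma contr_thin:
  assumes C: "thin C" and n: "monotone_obj C C n" and e: "monotone_obj C C e" and c: "c \<in> Obj C"
    and "\<And>X. X \<in> Obj C \<Longrightarrow> Hom C (n X) X \<noteq> {}" "\<And>X. X \<in> Obj C \<Longrightarrow> Hom C (n X) (e X) \<noteq> {}"
    "\<And>X. X \<in> Obj C \<Longrightarrow> Hom C c (e X) \<noteq> {}"
  shows "contr C"
proof -
  have cat: "category C" using C by (simp add: thin_def)
  note f = is_functor_thin_map[OF cat C n] is_functor_thin_map[OF cat C e] is_functor_id[OF cat] is_functor_const[OF cat cat c]
  have "homotopic C C (fstep n (thin_map C n)) (fstep (\<lambda>X. X) (\<lambda>X Y u. u))"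
    by (rule homotopic_thin[OF C f(1,3)]) (use assms in auto)
  moreover have "homotopic C C (fstep n (thin_map C n)) (fstep e (thin_map C e))"
    by (rule homotopic_thin[OF C f(1,2)]) (use assms in auto)
  moreover have "homotopic C C (fstep (\<lambda>X. c) (\<lambda>X Y u. Ident C c)) (fstep e (thin_map C e))"
    by (rule homotopic_thin[OF C f(4,2)]) (use assms in auto)
  ultimately have "homotopic C C (fstep (\<lambda>X. X) (\<lambda>X Y u. u)) (fstep (\<lambda>X. c) (\<lambda>X Y u. Ident C c))"
    by (meson homotopic_with_symD homotopic_with_trans)
  then show ?thesis by (rule contr_if_null_homotopic[OF cat c])
qed

lemma contr_thin_retract:
  assumes C: "thin C" and D: "thin D" and F: "monotone_obj C D F" and G: "monotone_obj D C G"
    and le: "\<And>X. X \<in> Obj C \<Longrightarrow> Hom C X (G (F X)) \<noteq> {}" and cD: "contr D"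
  shows "contr C"
proof -
  have cat: "category C" "category D" using C D by (simp_all add: thin_def)
  note f = is_functor_thin_map[OF cat(1) D F] and g = is_functor_thin_map[OF cat(2) C G]
  have GF: "monotone_obj C C (\<lambda>X. G (F X))" using F G by (simp add: monotone_obj_def)
  have eq: "fstep G (thin_map C G) (fstep F (thin_map D F) p) = fstep (\<lambda>X. G (F X)) (thin_map C (\<lambda>X. G (F X))) p" for p
    by (auto simp: fstep_def prod.case_eq_if fun_eq_iff thin_map_def)
  have "homotopic C C (fstep (\<lambda>X. X) (\<lambda>X Y u. u)) (fstep (\<lambda>X. G (F X)) (thin_map C (\<lambda>X. G (F X))))"
    by (rule homotopic_thin[OF C is_functor_id[OF cat(1)] is_functor_thin_map[OF cat(1) C GF]]) (use le in auto)
  then have "homotopic C C (fstep G (thin_map C G) \<circ> fstep F (thin_map D F)) id"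
    by (rule homotopic_with_eq[OF homotopic_with_symD]) (auto simp: eq fstep_id)
  then show ?thesis by (rule contr_retract[OF f g _ cD])
qed

lemma contr_coslice_coslice:
  assumes C: "category C" and P: "P \<in> Obj C" and X: "X \<in> Obj (coslice C P A)"
    and sub: "\<And>Z. Z \<in> B \<Longrightarrow> fst Z \<in> A'"
    and in_B: "\<And>R u. R \<in> Obj C \<inter> A' \<Longrightarrow> u \<in> Hom C (fst X) R \<Longrightarrow>
      (R, Comp C P (fst X) R u (snd X)) \<in> Obj (coslice C P A) \<inter> B"
    and contr: "contr (coslice C (fst X) A')"
  shows "contr (coslice (coslice C P A) X B)"
proof -
  let ?K = "coslice C P A"
  have X': "fst X \<in> Obj C" using X by auto
  note cat = category_coslice[OF C P, of A] category_coslice[OF C X', of A']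
  note catK = category_coslice[OF cat(1) X, of B]
  have F: "is_functor (coslice ?K X B) (coslice C (fst X) A') (\<lambda>Z. (fst (fst Z), snd Z)) (\<lambda>X Y u. u)"
    using cat(2) catK sub by (auto simp: is_functor_def)
  have G: "is_functor (coslice C (fst X) A') (coslice ?K X B) (\<lambda>Z. ((fst Z, Comp C P (fst X) (fst Z) (snd Z) (snd X)), snd Z)) (\<lambda>X Y u. u)"
    unfolding is_functor_def
  proof (intro conjI ballI)
    interpret category C by fact
    fix Z assume Z: "Z \<in> Obj (coslice C (fst X) A')"
    then show "((fst Z, Comp C P (fst X) (fst Z) (snd Z) (snd X)), snd Z) \<in> Obj (coslice ?K X B)"
      using in_B[of "fst Z" "snd Z"] by auto
    fix W u assume "W \<in> Obj (coslice C (fst X) A')" "u \<in> Hom (coslice C (fst X) A') Z W"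
    then show "u \<in> Hom (coslice ?K X B) ((fst Z, Comp C P (fst X) (fst Z) (snd Z) (snd X)), snd Z)
        ((fst W, Comp C P (fst X) (fst W) (snd W) (snd X)), snd W)"
      using Z X P Comp_assoc[of P "fst X" "fst Z" "fst W" "snd X" "snd Z" u] by auto
  qed (use cat(2) catK in auto)
  have "fstep (\<lambda>Z. ((fst Z, Comp C P (fst X) (fst Z) (snd Z) (snd X)), snd Z)) (\<lambda>X Y u. u)
      (fstep (\<lambda>Z. (fst (fst Z), snd Z)) (\<lambda>X Y u. u) p) = p" if p: "p \<in> topspace (steps (coslice ?K X B))" for p
    unfolding fstep_comp_const
    by (subst fstep_id[OF p, symmetric], rule fstep_cong[OF p]) auto
  then have "homotopic (coslice ?K X B) (coslice ?K X B)
      (fstep (\<lambda>Z. ((fst Z, Comp C P (fst X) (fst Z) (snd Z) (snd X)), snd Z)) (\<lambda>X Y u. u) \<circ>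
       fstep (\<lambda>Z. (fst (fst Z), snd Z)) (\<lambda>X Y u. u)) id"
    by (rule homotopic_with_id2)
  then show ?thesis by (rule contr_retract[OF F G _ contr])
qed

section \<open>Groups of \<open>p\<close>-power torsion\<close>

abbreviation (in group) grp where "grp X \<equiv> G\<lparr>carrier := X\<rparr>"

lemma (in group) coprime_pow_eq_one:
  assumes "x \<in> carrier G" "x [^] (m::nat) = \<one>" "x [^] (n::nat) = \<one>" "coprime m n"
  shows "x = \<one>"
proof -
  have "ord x dvd m" "ord x dvd n" using assms pow_eq_id by auto
  then have "ord x dvd 1" using assms(4) coprime_common_divisor by blast
  then show ?thesis using pow_eq_id[OF assms(1), of 1] assms(1) by simp
qed

lemma p_group_order:
  fixes G (structure)
  assumes p: "prime (p::nat)" and G: "group G" "finite (carrier G)"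
    and tor: "\<And>x. x \<in> carrier G \<Longrightarrow> \<exists>n. x [^]\<^bsub>G\<^esub> (p ^ n :: nat) = \<one>\<^bsub>G\<^esub>"
  shows "\<exists>a. order G = p ^ a"
proof -
  interpret group G by fact
  have pos: "order G \<noteq> 0" using G by (auto simp: order_def)
  obtain m where m: "order G = p ^ multiplicity p (order G) * m" "\<not> p dvd m"
    using multiplicity_decompose'[of "order G" p] pos prime_gt_1_nat[OF p] by auto
  have "m = 1"
  proof (rule ccontr)
    assume "m \<noteq> 1"
    then obtain q where q: "prime q" "q dvd m" using prime_factor_nat by blast
    then have qp: "q \<noteq> p" using m(2) by blast
    obtain m' where "order G = q ^ 1 * m'" using m q by (metis dvd_def dvd_mult power_one_right)
    then obtain H where H: "subgroup H G" "card H = q ^ 1"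
      using sylow_thm[OF q(1) G(1) _ G(2)] by blast
    then have "card H > 1" using q(1) prime_gt_1_nat by simp
    then have "\<not> H \<subseteq> {\<one>}" using card_mono[of "{\<one>}" H] by force
    then obtain h where h: "h \<in> H" "h \<noteq> \<one>" by blast
    interpret H: group "G\<lparr>carrier := H\<rparr>" using H(1) subgroup_imp_group by blast
    have "finite H" using H(1) G(2) finite_subset subgroup.subset by blast
    then have "h [^] q = \<one>"
      using H.pow_order_eq_1[of h] h(1) H(2) by (simp add: order_def flip: nat_pow_consistent)
    moreover obtain n where "h [^] (p ^ n) = \<one>"
      using tor h(1) H(1) subgroup.subset by blast
    moreover have "coprime q (p ^ n)"
      using primes_coprime[OF q(1) p qp] by simp
    ultimately show False
      using coprime_pow_eq_one[of h q "p ^ n"] h H(1) subgroup.subset by blast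
  qed
  then show ?thesis using m(1) by auto
qed

locale p_action = group G for G (structure) +
  fixes p :: nat and act :: "'a \<Rightarrow> 'x \<Rightarrow> 'x" and X :: "'x set"
  assumes prime: "prime p" and fin: "finite X"
    and torsion: "g \<in> carrier G \<Longrightarrow> \<exists>n. g [^] (p ^ n :: nat) = \<one>"
    and act_closed: "g \<in> carrier G \<Longrightarrow> x \<in> X \<Longrightarrow> act g x \<in> X"
    and act_one: "x \<in> X \<Longrightarrow> act \<one> x = x"
    and act_mult: "g \<in> carrier G \<Longrightarrow> h \<in> carrier G \<Longrightarrow> x \<in> X \<Longrightarrow> act (g \<otimes> h) x = act g (act h x)"
begin

lemma hom_Bij: "group_hom G (BijGroup X) (\<lambda>g. restrict (act g) X)"
proof -
  have bij: "restrict (act g) X \<in> Bij X" if g: "g \<in> carrier G" for g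
  proof -
    have "bij_betw (act g) X X"
    proof (rule bij_betw_byWitness[where f' = "act (inv g)"])
      show "\<forall>x\<in>X. act (inv g) (act g x) = x" "\<forall>x\<in>X. act g (act (inv g) x) = x"
        using g act_one by (auto simp flip: act_mult)
    qed (use g act_closed in auto)
    then show ?thesis by (auto simp: Bij_def cong: bij_betw_cong)
  qed
  have "(\<lambda>g. restrict (act g) X) \<in> hom G (BijGroup X)"
    using bij by (auto simp: hom_def BijGroup_def compose_def act_mult act_closed fun_eq_iff)
  then show ?thesis
    by (simp add: group_hom_def group_hom_axioms_def group_BijGroup is_group)
qed

definition "J = (\<lambda>g. restrict (act g) X) ` carrier G"

abbreviation "BJ \<equiv> BijGroup X\<lparr>carrier := J\<rparr>"

lemma J_group: "subgroup J (BijGroup X)" "group BJ" "finite J"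
    "\<exists>a. order BJ = p ^ a"
proof -
  interpret B: group_hom G "BijGroup X" "\<lambda>g. restrict (act g) X" by (rule hom_Bij)
  show J: "subgroup J (BijGroup X)" unfolding J_def using B.subgroup_img_is_subgroup[OF subgroup_self] .
  then show grp: "group BJ"
    by (rule B.H.subgroup_imp_group)
  have "J \<subseteq> X \<rightarrow>\<^sub>E X"
    unfolding J_def using act_closed by auto
  then show finJ: "finite J" using fin finite_PiE[of X "\<lambda>_. X"] finite_subset by blast
  show "\<exists>a. order BJ = p ^ a"
  proof (rule p_group_order[OF prime grp])
    fix f assume "f \<in> carrier BJ"
    then obtain g where g: "g \<in> carrier G" "f = restrict (act g) X" by (auto simp: J_def)
    then obtain n where "g [^] (p ^ n) = \<one>" using torsion by blast
    then have "f [^]\<^bsub>BijGroup X\<^esub> (p ^ n) = \<one>\<^bsub>BijGroup X\<^esub>"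
      using B.hom_nat_pow[OF g(1), of "p ^ n"] g(2) by simp
    then show "\<exists>n. f [^]\<^bsub>BJ\<^esub> (p ^ n) = \<one>\<^bsub>BJ\<^esub>"
      by (auto simp flip: B.H.nat_pow_consistent)
  qed (use finJ in auto)
qed

lemma J_action: "group_action BJ X (\<lambda>f. f)"
proof -
  interpret B: group "BijGroup X" by (rule group_BijGroup)
  have "(\<lambda>f. f) \<in> hom BJ (BijGroup X)"
    using subgroup.subset[OF J_group(1)] by (auto simp: hom_def)
  then show ?thesis
    by (simp add: group_action_def group_hom_def group_hom_axioms_def B.is_group J_group)
qed

lemma orbit_J: "x \<in> X \<Longrightarrow> orbit BJ (\<lambda>f. f) x = {act g x | g. g \<in> carrier G}"
proof -
  have "{f x |f. f \<in> (\<lambda>g. restrict (act g) X) ` carrier G} = {restrict (act g) X x |g. g \<in> carrier G}" by blast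
  then show "x \<in> X \<Longrightarrow> ?thesis" by (simp add: orbit_def J_def)
qed

lemma card_orbit:
  assumes "x \<in> X" shows "\<exists>a. card {act g x | g. g \<in> carrier G} = p ^ a"
proof -
  interpret A: group_action "BJ" X "\<lambda>f. f" by (rule J_action)
  obtain a where "order BJ = p ^ a" using J_group(4) by blast
  then have "card {act g x | g. g \<in> carrier G} dvd p ^ a"
    using dvdI[OF A.orbit_stabilizer_theorem[OF assms, symmetric]] unfolding orbit_J[OF assms] by simp
  then show ?thesis using divides_primepow_nat[OF prime] by auto
qed

lemma card_transitive:
  assumes "x \<in> X" "\<And>y. y \<in> X \<Longrightarrow> \<exists>g\<in>carrier G. y = act g x"
  shows "\<exists>a. card X = p ^ a"
proof -
  have "X = {act g x | g. g \<in> carrier G}" using assms act_closed by blast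
  then show ?thesis using card_orbit[OF assms(1)] by metis
qed

lemma fixed_points: "p dvd card X - card {x \<in> X. \<forall>g\<in>carrier G. act g x = x}"
  "card {x \<in> X. \<forall>g\<in>carrier G. act g x = x} \<le> card X"
proof -
  let ?Fix = "{x \<in> X. \<forall>g\<in>carrier G. act g x = x}" and ?G = "BJ"
  interpret A: group_action ?G X "\<lambda>f. f" by (rule J_action)
  show "card ?Fix \<le> card X" using fin by (intro card_mono) auto
  let ?O = "orbits ?G X (\<lambda>f. f)"
  have finO: "finite ?O" and finS: "\<And>orb. orb \<in> ?O \<Longrightarrow> finite orb"
    using A.orbits_coverture fin by (metis finite_UnionD, metis Union_upper finite_subset)
  have cX: "card X = (\<Sum>orb\<in>?O. card orb)"
    using A.disjoint_sum[OF fin, of "\<lambda>_. 1::nat"] by simp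
  let ?S = "(\<lambda>x. {x}) ` ?Fix"
  have one: "act \<one> x = x" if "x \<in> X" for x using act_one that .
  have S: "?S \<subseteq> ?O"
  proof
    fix orb assume "orb \<in> ?S"
    then obtain x where x: "x \<in> ?Fix" "orb = {x}" by blast
    then have "orbit ?G (\<lambda>f. f) x = {x}"
      using x one_closed by (auto simp: orbit_J intro!: exI[of _ \<one>])
    then show "orb \<in> ?O" using x by (auto simp: orbits_def)
  qed
  have "p dvd card orb" if orb: "orb \<in> ?O - ?S" for orb
  proof -
    obtain x where x: "x \<in> X" "orb = {act g x | g. g \<in> carrier G}"
      using orb orbit_J by (auto simp: orbits_def)
    then obtain a where a: "card orb = p ^ a" using card_orbit by blast
    have "a \<noteq> 0"
    proof
      assume "a = 0"
      then obtain y where y: "orb = {y}" using a by (metis card_1_singletonE power_0)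
      moreover have "x \<in> orb" using x one one_closed by force
      ultimately have "orb = {x}" by auto
      then have "x \<in> ?Fix" using x by auto
      then show False using orb \<open>orb = {x}\<close> by blast
    qed
    then show ?thesis using a by (simp add: dvd_power)
  qed
  then have d: "p dvd (\<Sum>orb\<in>?O - ?S. card orb)" by (rule dvd_sum)
  have "card X = (\<Sum>orb\<in>?O - ?S. card orb) + (\<Sum>orb\<in>?S. card orb)"
    unfolding cX by (rule sum.subset_diff[OF S finO])
  moreover have "(\<Sum>orb\<in>?S. card orb) = card ?Fix"
    by (subst sum.reindex) auto
  ultimately show "p dvd card X - card ?Fix" using d by simp
qed

end

abbreviation (in group) lcos (infixl "\<star>" 60) where "x \<star> U \<equiv> x <#\<^bsub>G\<^esub> U"

lemma (in group) coset_action: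
  assumes p: "prime (p::nat)" and E: "subgroup E G" and Q: "subgroup Q G" and H: "subgroup H G" and HQ: "H \<subseteq> Q" and EQ: "E \<subseteq> Q"
    and tor: "\<And>x. x \<in> E \<Longrightarrow> \<exists>n. x [^] (p ^ n :: nat) = \<one>"
    and fin: "finite ((\<lambda>x. x \<star> H) ` Q)"
  shows "p_action (grp E) p (\<lambda>g U. g \<star> U) ((\<lambda>x. x \<star> H) ` Q)"
proof -
  have Hs: "H \<subseteq> carrier G" and Qs: "Q \<subseteq> carrier G" and Es: "E \<subseteq> carrier G" using E Q H by (auto dest: subgroup.subset)
  interpret E: group "grp E" using E subgroup_imp_group by blast
  show ?thesis
  proof
    show "\<exists>n. g [^]\<^bsub>grp E\<^esub> (p ^ n) = \<one>\<^bsub>grp E\<^esub>" if "g \<in> carrier (grp E)" for g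
      using that tor EQ by (auto simp flip: nat_pow_consistent)
    fix g U assume g: "g \<in> carrier (grp E)" and U: "U \<in> (\<lambda>x. x \<star> H) ` Q"
    then obtain x where x: "x \<in> Q" "U = x \<star> H" by blast
    have "g \<star> U = (g \<otimes> x) \<star> H" using g x Hs Qs Es by (auto simp: lcos_m_assoc subset_iff)
    moreover have "g \<otimes> x \<in> Q" using g x EQ subgroup.m_closed[OF Q] by auto
    ultimately show "g \<star> U \<in> (\<lambda>x. x \<star> H) ` Q" by blast
  next
    fix U assume "U \<in> (\<lambda>x. x \<star> H) ` Q"
    then obtain x where x: "x \<in> Q" "U = x \<star> H" by blast
    then have "U \<subseteq> carrier G" using Hs Qs l_coset_subset_G by blast
    then show "\<one>\<^bsub>grp E\<^esub> \<star> U = U" by (simp add: lcos_mult_one)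
    fix g h assume "g \<in> carrier (grp E)" "h \<in> carrier (grp E)"
    then show "(g \<otimes>\<^bsub>grp E\<^esub> h) \<star> U = g \<star> (h \<star> U)"
      using \<open>U \<subseteq> carrier G\<close> Es by (auto simp: lcos_m_assoc subset_iff)
  qed (use p fin in auto)
qed

lemma (in group) lcoset_fixed:
  assumes H: "subgroup H G" and x: "x \<in> carrier G" and e: "e \<in> carrier G" and fx: "e \<star> (x \<star> H) = x \<star> H"
  shows "inv x \<otimes> e \<otimes> x \<in> H"
proof -
  have Hs: "H \<subseteq> carrier G" using H by (auto dest: subgroup.subset)
  have "(e \<otimes> x) \<star> H = x \<star> H" using fx Hs x e by (simp add: lcos_m_assoc)
  moreover have "e \<otimes> x \<in> (e \<otimes> x) \<star> H" using subgroup.one_closed[OF H] x e by (force simp: l_coset_def)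
  ultimately obtain h where h: "h \<in> H" "e \<otimes> x = x \<otimes> h" by (auto simp: l_coset_def)
  then have "inv x \<otimes> (e \<otimes> x) = h" using x e Hs by (simp add: inv_solve_left' subset_iff)
  then show ?thesis using h x e by (simp add: m_assoc)
qed

text \<open>\<open>H\<close> acts on the set of its cosets in \<open>Q\<close>, whose number is divisible by \<open>p\<close>.\<close>

lemma (in group) normalizer_grows_finite_index:
  assumes p: "prime (p::nat)" and Q: "subgroup Q G" and H: "subgroup H G" and HQ: "H \<subset> Q"
    and tor: "\<And>x. x \<in> Q \<Longrightarrow> \<exists>n. x [^] (p ^ n :: nat) = \<one>"
    and fin: "finite ((\<lambda>x. x \<star> H) ` Q)"
  obtains x where "x \<in> Q" "x \<notin> H" "\<And>h. h \<in> H \<Longrightarrow> x \<otimes> h \<otimes> inv x \<in> H"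
proof -
  let ?X = "(\<lambda>x. x \<star> H) ` Q"
  have Hs: "H \<subseteq> carrier G" and Qs: "Q \<subseteq> carrier G" using Q H by (auto dest: subgroup.subset)
  have self: "x \<in> x \<star> H" if "x \<in> carrier G" for x
    using subgroup.one_closed[OF H] that by (force simp: l_coset_def)
  have HX: "\<one> \<star> H = H" using Hs lcos_mult_one by blast
  interpret A: p_action "grp Q" p "\<lambda>g U. g \<star> U" ?X
    by (rule coset_action) (use p Q H HQ tor fin in auto)
  interpret B: p_action "grp H" p "\<lambda>g U. g \<star> U" ?X
    by (rule coset_action) (use p Q H HQ tor fin in auto)
  have oneQ: "\<one> \<in> Q" using Q subgroup.one_closed by blast
  have HinX: "H \<in> ?X" using oneQ HX by force
  obtain y where y: "y \<in> Q" "y \<notin> H" using HQ by blast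
  have "\<exists>a. card ?X = p ^ a"
    by (rule A.card_transitive[OF HinX]) auto
  then obtain a where a: "card ?X = p ^ a" by blast
  have "y \<star> H \<in> ?X" "y \<star> H \<noteq> H" using y self[of y] Qs by auto
  then have "card ?X \<noteq> 1" using HinX by (metis card_1_singletonE singletonD)
  then have "p dvd card ?X" using a by (cases a) auto
  let ?F = "{U \<in> ?X. \<forall>g\<in>carrier (grp H). g \<star> U = U}"
  have "p dvd card ?F"
    using dvd_diff_nat[OF \<open>p dvd card ?X\<close> B.fixed_points(1)] B.fixed_points(2) by simp
  moreover have HF: "H \<in> ?F"
    using HinX by (auto simp: coset_join3 H subsetD[OF Hs])
  have "finite ?F" using fin by auto
  moreover have "card ?F > 0" using HF \<open>finite ?F\<close> by (subst card_gt_0_iff) blast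
  ultimately have "card ?F \<ge> p" by (intro dvd_imp_le)
  then have "card ?F > 1" using prime_gt_1_nat[OF p] by linarith
  then have "\<not> ?F \<subseteq> {H}"
    using card_mono[of "{H}" ?F] by force
  then obtain U where U: "U \<in> ?F" "U \<noteq> H" by blast
  then obtain z where z: "z \<in> Q" "U = z \<star> H" by blast
  have zc: "z \<in> carrier G" using z Qs by blast
  have "z \<notin> H" using U(2) z(2) coset_join3[OF zc H] by auto
  have conj: "inv z \<otimes> h \<otimes> z \<in> H" if h: "h \<in> H" for h
    using lcoset_fixed[OF H zc _ _] U(1) z(2) h Hs by auto
  have "inv z \<in> Q" using subgroup.m_inv_closed[OF Q z(1)] .
  moreover have "inv z \<notin> H"
    using \<open>z \<notin> H\<close> subgroup.m_inv_closed[OF H, of "inv z"] inv_inv[OF zc] by auto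
  ultimately show thesis using that[of "inv z"] conj zc by simp
qed

lemma (in group) sylow_contains_conjugate:
  assumes p: "prime p" and fin: "finite (carrier G)" and Q: "sylow_subgroup p Q G"
    and Y: "subgroup Y G" and tor: "\<And>y. y \<in> Y \<Longrightarrow> \<exists>n. y [^] (p ^ n :: nat) = \<one>"
  obtains x where "x \<in> carrier G" "\<And>y. y \<in> Y \<Longrightarrow> x \<otimes> y \<otimes> inv x \<in> Q"
proof -
  let ?X = "(\<lambda>x. x \<star> Q) ` carrier G"
  have Qs: "subgroup Q G" "card Q = p ^ multiplicity p (order G)" using Q by (auto simp: sylow_subgroup_def)
  have Ys: "Y \<subseteq> carrier G" using Y by (auto dest: subgroup.subset)
  interpret B: p_action "grp Y" p "\<lambda>g U. g \<star> U" ?X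
    by (rule coset_action) (use p Y Qs(1) subgroup_self subgroup.subset[OF Qs(1)] Ys tor fin in auto)
  have "card ?X * card Q = order G"
    using l_lagrange[OF fin Qs(1)] by (simp add: LCOSETS_def UNION_singleton_eq_range)
  moreover have "order G \<noteq> 0" using fin by (auto simp: order_def)
  ultimately have ndvd: "\<not> p dvd card ?X"
    using multiplicity_decompose'[of "order G" p] prime_gt_1_nat[OF p] Qs(2)
    by (metis less_irrefl mult.commute mult_cancel_left nat_dvd_1_iff_1 power_not_zero mult_is_0)
  let ?F = "{U \<in> ?X. \<forall>g\<in>carrier (grp Y). g \<star> U = U}"
  have "?F \<noteq> {}"
  proof
    assume "?F = {}"
    then have "card ?F = 0" by (simp only: card.empty)
    then show False using B.fixed_points(1) ndvd by (simp only: diff_zero)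
  qed
  then obtain U where "U \<in> ?X" "\<forall>g\<in>carrier (grp Y). g \<star> U = U" by blast
  then obtain z where z: "z \<in> carrier G" "\<And>g. g \<in> Y \<Longrightarrow> g \<star> (z \<star> Q) = z \<star> Q" by auto
  have "inv z \<otimes> y \<otimes> z \<in> Q" if "y \<in> Y" for y
    using lcoset_fixed[OF Qs(1) z(1) _ z(2)[OF that]] that Ys by blast
  then show thesis using that[of "inv z"] z(1) by simp
qed

definition p_fractions :: "nat \<Rightarrow> rat monoid" where
  "p_fractions p = \<lparr>carrier = {of_int a / of_nat (p ^ n) | a n. True}, monoid.mult = (+), one = 0\<rparr>"

lemma prufer_group_eq: "prufer_group p = p_fractions p Mod \<int>"
  by (simp add: prufer_group_def p_fractions_def)

lemma p_fractions_simps [simp]: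
  "carrier (p_fractions p) = {of_int a / of_nat (p ^ n) | a n. True}"
  "monoid.mult (p_fractions p) = (+)" "one (p_fractions p) = 0"
  by (simp_all add: p_fractions_def)

context
  fixes p :: nat assumes p: "prime p"
begin

abbreviation Zp where "Zp \<equiv> prufer_group p"

lemma p_pos: "0 < p" using p prime_gt_0_nat by blast

lemma p_fraction_sum:
  "of_int a / of_nat (p ^ n) + of_int b / of_nat (p ^ m) =
     (of_int (a * p ^ m + b * p ^ n) / of_nat (p ^ (n + m)) :: rat)"
  using p_pos by (simp add: field_simps power_add)

lemma comm_group_p_fractions: "comm_group (p_fractions p)"
proof (rule comm_groupI)
  fix x y assume "x \<in> carrier (p_fractions p)" "y \<in> carrier (p_fractions p)"
  then obtain a n b m where xy: "x = of_int a / of_nat (p ^ n)" "y = of_int b / of_nat (p ^ m)" by auto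
  show "x \<otimes>\<^bsub>p_fractions p\<^esub> y \<in> carrier (p_fractions p)"
    unfolding xy p_fractions_simps p_fraction_sum by blast
next
  show "\<one>\<^bsub>p_fractions p\<^esub> \<in> carrier (p_fractions p)"
    by (auto intro!: exI[of _ 0])
  fix x assume "x \<in> carrier (p_fractions p)"
  then obtain a n where x: "x = of_int a / of_nat (p ^ n)" by auto
  then have "- x = of_int (- a) / of_nat (p ^ n)" by simp
  then have "- x \<in> carrier (p_fractions p)" unfolding p_fractions_simps by blast
  then show "\<exists>y\<in>carrier (p_fractions p). y \<otimes>\<^bsub>p_fractions p\<^esub> x = \<one>\<^bsub>p_fractions p\<^esub>"
    by (rule bexI[rotated]) simp
qed auto

lemma normal_Ints: "\<int> \<lhd> p_fractions p"
proof -
  interpret comm_group "p_fractions p" by (rule comm_group_p_fractions)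
  have sub: "\<int> \<subseteq> carrier (p_fractions p)"
  proof
    fix z :: rat assume "z \<in> \<int>"
    then obtain a where "z = of_int a / of_nat (p ^ 0)" by (auto elim: Ints_cases)
    then show "z \<in> carrier (p_fractions p)" unfolding p_fractions_simps by blast
  qed
  have inv: "inv\<^bsub>p_fractions p\<^esub> z = - z" if "z \<in> \<int>" for z
    using subsetD[OF sub that] subsetD[OF sub Ints_minus[OF that]] by (intro inv_equality) simp_all
  have "subgroup \<int> (p_fractions p)"
    by (rule subgroup.intro) (use sub inv in auto)
  then show ?thesis by (rule subgroup_imp_normal)
qed

definition pfrac :: "int \<Rightarrow> nat \<Rightarrow> rat set" where
  "pfrac a n = \<int> #>\<^bsub>p_fractions p\<^esub> (of_int a / of_nat (p ^ n))"

lemma frac_eq_iff: "pfrac a n = pfrac b m \<longleftrightarrow> (of_int a / of_nat (p ^ n) - of_int b / of_nat (p ^ m) :: rat) \<in> \<int>"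
proof -
  have eq: "pfrac a n = {z. z - of_int a / of_nat (p ^ n) \<in> \<int>}" for a n
    by (auto simp: pfrac_def r_coset_def)
  show ?thesis
  proof
    assume "pfrac a n = pfrac b m"
    moreover have "of_int a / of_nat (p ^ n) \<in> pfrac a n" by (simp add: eq)
    ultimately show "of_int a / of_nat (p ^ n) - of_int b / of_nat (p ^ m) \<in> (\<int> :: rat set)" by (simp add: eq)
  next
    assume d: "of_int a / of_nat (p ^ n) - of_int b / of_nat (p ^ m) \<in> (\<int> :: rat set)"
    show "pfrac a n = pfrac b m"
      unfolding eq
    proof (intro Collect_cong iffI)
      fix z :: rat
      show "z - of_int b / of_nat (p ^ m) \<in> \<int>" if "z - of_int a / of_nat (p ^ n) \<in> \<int>"
        using Ints_add[OF that d] by simp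
      show "z - of_int a / of_nat (p ^ n) \<in> \<int>" if "z - of_int b / of_nat (p ^ m) \<in> \<int>"
        using Ints_diff[OF that d] by simp
    qed
  qed
qed

lemma carrier_prufer: "carrier (Zp) = {pfrac a n | a n. True}"
  by (auto simp: prufer_group_eq carrier_FactGroup pfrac_def)

lemma one_prufer: "\<one>\<^bsub>Zp\<^esub> = pfrac 0 0"
  by (auto simp: prufer_group_eq pfrac_def r_coset_def)

lemma frac_eq_one: "pfrac a n = \<one>\<^bsub>Zp\<^esub> \<longleftrightarrow> int (p ^ n) dvd a"
proof -
  have "pfrac a n = \<one>\<^bsub>Zp\<^esub> \<longleftrightarrow> (of_int a / of_nat (p ^ n) :: rat) \<in> \<int>"
    by (simp add: one_prufer frac_eq_iff)
  also have "\<dots> \<longleftrightarrow> int (p ^ n) dvd a"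
  proof
    assume "(of_int a / of_nat (p ^ n) :: rat) \<in> \<int>"
    then obtain b where "of_int a / of_nat (p ^ n) = (of_int b :: rat)" by (auto elim: Ints_cases)
    then have "(of_int a :: rat) = of_int (b * int (p ^ n))" using p_pos by (simp add: field_simps)
    then show "int (p ^ n) dvd a" unfolding of_int_eq_iff by simp
  next
    assume "int (p ^ n) dvd a"
    then obtain b where "a = int (p ^ n) * b" by auto
    then have "(of_int a / of_nat (p ^ n) :: rat) = of_int b" using p_pos by simp
    then show "(of_int a / of_nat (p ^ n) :: rat) \<in> \<int>" by simp
  qed
  finally show ?thesis .
qed

lemma comm_group_prufer: "comm_group (Zp)"
  unfolding prufer_group_eq
  using comm_group.abelian_FactGroup[OF comm_group_p_fractions] normal_Ints by (simp add: normal_def)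

lemma p_fractions_pow: "x [^]\<^bsub>p_fractions p\<^esub> (k::nat) = of_nat k * x"
  by (induction k) (auto simp: algebra_simps)

lemma frac_pow: "pfrac a n [^]\<^bsub>Zp\<^esub> (k::nat) = pfrac (int k * a) n"
proof -
  have "of_int a / of_nat (p ^ n) \<in> carrier (p_fractions p)" by auto
  then show ?thesis
    using normal.FactGroup_pow[OF normal_Ints, of "of_int a / of_nat (p ^ n)" k]
    by (simp add: pfrac_def prufer_group_eq p_fractions_pow)
qed

lemma frac_Suc: "pfrac (int p * a) (Suc n) = pfrac a n"
  using p_pos by (simp add: frac_eq_iff)

lemma prufer_torsion: "x \<in> carrier (Zp) \<Longrightarrow> \<exists>n. x [^]\<^bsub>Zp\<^esub> (p ^ n :: nat) = \<one>\<^bsub>Zp\<^esub>"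
  unfolding carrier_prufer
proof safe
  fix a n show "\<exists>m. pfrac a n [^]\<^bsub>Zp\<^esub> (p ^ m :: nat) = \<one>\<^bsub>Zp\<^esub>"
    by (rule exI[of _ n]) (simp add: frac_pow frac_eq_one)
qed

lemma prufer_divisible: "x \<in> carrier (Zp) \<Longrightarrow> \<exists>y\<in>carrier (Zp). y [^]\<^bsub>Zp\<^esub> p = x"
  unfolding carrier_prufer using frac_Suc frac_pow by blast

lemma prufer_socle: "{x \<in> carrier (Zp). x [^]\<^bsub>Zp\<^esub> p = \<one>\<^bsub>Zp\<^esub>} = (\<lambda>j. pfrac (int j) 1) ` {..<p}"
proof (intro equalityI subsetI)
  fix x assume "x \<in> {x \<in> carrier (Zp). x [^]\<^bsub>Zp\<^esub> p = \<one>\<^bsub>Zp\<^esub>}"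
  then obtain a n where x: "x = pfrac a n" "int (p ^ n) dvd int p * a"
    by (auto simp: carrier_prufer frac_pow frac_eq_one)
  then obtain b where b: "int p * a = int (p ^ n) * b" by auto
  have "x = pfrac b 1"
  proof -
    have "(of_int p :: rat) * of_int a = of_nat (p ^ n) * of_int b"
      using arg_cong[OF b, of "of_int :: int \<Rightarrow> rat"] by simp
    then have "(of_int a / of_nat (p ^ n) :: rat) - of_int b / of_nat (p ^ 1) = 0"
      using p_pos by (simp add: field_simps)
    then show ?thesis unfolding x frac_eq_iff by simp
  qed
  also have "\<dots> = pfrac (int (nat (b mod int p))) 1"
  proof -
    have "b = int p * (b div int p) + b mod int p" by simp
    then have "(of_int b :: rat) = of_int p * of_int (b div int p) + of_int (b mod int p)"
      by (metis of_int_add of_int_mult)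
    moreover have "int (nat (b mod int p)) = b mod int p" using p_pos by simp
    ultimately have "(of_int b / of_nat (p ^ 1) :: rat) - of_int (int (nat (b mod int p))) / of_nat (p ^ 1) = of_int (b div int p)"
      using p_pos by (simp add: field_simps)
    then show ?thesis unfolding frac_eq_iff by simp
  qed
  finally show "x \<in> (\<lambda>j. pfrac (int j) 1) ` {..<p}"
    using p_pos by (intro image_eqI[of _ _ "nat (b mod int p)"]) (auto simp: nat_less_iff)
next
  fix x assume "x \<in> (\<lambda>j. pfrac (int j) 1) ` {..<p}"
  then obtain j where "x = pfrac (int j) 1" by blast
  then show "x \<in> {x \<in> carrier (Zp). x [^]\<^bsub>Zp\<^esub> p = \<one>\<^bsub>Zp\<^esub>}"
    using frac_eq_one[of "int p * int j" 1] by (auto simp: carrier_prufer frac_pow)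
qed

lemma card_prufer_socle: "card {x \<in> carrier (Zp). x [^]\<^bsub>Zp\<^esub> p = \<one>\<^bsub>Zp\<^esub>} = p"
proof -
  have "inj_on (\<lambda>j. pfrac (int j) 1) {..<p}"
  proof (rule inj_onI)
    fix i j assume ij: "i \<in> {..<p}" "j \<in> {..<p}" "pfrac (int i) 1 = pfrac (int j) 1"
    then have "(of_int (int i) / of_nat (p ^ 1) - of_int (int j) / of_nat (p ^ 1) :: rat) \<in> \<int>"
      by (simp only: frac_eq_iff)
    then have "(of_int (int i - int j) / of_nat (p ^ 1) - of_int 0 / of_nat (p ^ 0) :: rat) \<in> \<int>"
      by (simp add: diff_divide_distrib)
    then have "pfrac (int i - int j) 1 = pfrac 0 0" by (simp only: frac_eq_iff)
    then have "int p dvd int i - int j" using frac_eq_one[of "int i - int j" 1] by (simp add: one_prufer)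
    then show "i = j" using ij(1,2) zdvd_not_zless[of "int i - int j" "int p"] zdvd_not_zless[of "int j - int i" "int p"]
      by (cases i j rule: linorder_cases) (auto simp: dvd_diff_commute)
  qed
  then show ?thesis unfolding prufer_socle by (simp add: card_image)
qed

lemma prufer_hom:
  fixes G (structure)
  assumes G: "comm_group G" and y: "\<And>n. y n \<in> carrier G" "y 0 = \<one>" "\<And>n. y (Suc n) [^] p = y n"
  obtains f where "f \<in> hom (Zp) G" "\<And>a n. f (pfrac a n) = y n [^] a"
    "y 1 \<noteq> \<one> \<Longrightarrow> inj_on f (carrier (Zp))"
proof -
  interpret G: comm_group G by fact
  interpret P: comm_group "Zp" by (rule comm_group_prufer)
  have up: "y (n + m) [^] (int (p ^ m) * a) = y n [^] a" for n m a
  proof (induction m arbitrary: a)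
    case (Suc m)
    have "y (n + Suc m) [^] (int (p ^ Suc m) * a) = (y (Suc (n + m)) [^] int p) [^] (int (p ^ m) * a)"
      using y(1) by (simp add: G.int_pow_pow mult.assoc)
    also have "y (Suc (n + m)) [^] int p = y (n + m)"
      using y(3) by (simp add: int_pow_int)
    finally show ?case using Suc by simp
  qed simp
  have wd: "y n [^] a = y m [^] b" if "of_int a / of_nat (p ^ n) = (of_int b / of_nat (p ^ m) :: rat)" for a b n m
  proof -
    have "(of_int (int (p ^ m) * a) :: rat) = of_int (int (p ^ n) * b)"
      using that p_pos by (simp add: field_simps)
    then have "int (p ^ m) * a = int (p ^ n) * b" unfolding of_int_eq_iff .
    then show ?thesis using up[of n m a] up[of m n b] by (simp add: add.commute)
  qed
  define F where "F q = (SOME z. \<exists>a n. q = of_int a / of_nat (p ^ n) \<and> z = y n [^] a)" for q :: rat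
  have F: "F (of_int a / of_nat (p ^ n)) = y n [^] a" for a n
    unfolding F_def
  proof (rule some_equality)
    fix z assume "\<exists>b m. of_int a / of_nat (p ^ n) = (of_int b / of_nat (p ^ m) :: rat) \<and> z = y m [^] b"
    then obtain b m where b: "of_int a / of_nat (p ^ n) = (of_int b / of_nat (p ^ m) :: rat)" "z = y m [^] b" by blast
    show "z = y n [^] a" unfolding b(2) by (rule wd[OF b(1), symmetric])
  qed blast
  have hom: "F \<in> hom (p_fractions p) G"
  proof (rule homI)
    fix q r assume "q \<in> carrier (p_fractions p)" "r \<in> carrier (p_fractions p)"
    then obtain a n b m where qr: "q = of_int a / of_nat (p ^ n)" "r = of_int b / of_nat (p ^ m)" by auto
    have "F (q + r) = y (n + m) [^] (int (p ^ m) * a + int (p ^ n) * b)"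
      unfolding qr p_fraction_sum F by (simp add: mult.commute)
    also have "\<dots> = y n [^] a \<otimes> y m [^] b"
      using up[of n m a] up[of m n b] y(1) by (simp add: G.int_pow_mult add.commute)
    finally show "F (q \<otimes>\<^bsub>p_fractions p\<^esub> r) = F q \<otimes> F r" by (simp only: qr F p_fractions_simps)
  qed (use F y(1) in auto)
  have eq: "F q = F r" if q: "q \<in> carrier (p_fractions p)" "r \<in> carrier (p_fractions p)"
    and qr': "\<int> #>\<^bsub>p_fractions p\<^esub> q = \<int> #>\<^bsub>p_fractions p\<^esub> r" for q r
  proof -
    obtain a n b m where qr: "q = of_int a / of_nat (p ^ n)" "r = of_int b / of_nat (p ^ m)" using q by auto
    then have "q - r \<in> \<int>" using qr' frac_eq_iff[of a n b m] by (simp add: pfrac_def)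
    then obtain c where c: "q - r = of_int c / of_nat (p ^ 0)" by (auto elim: Ints_cases)
    have "q = r + of_int c / of_nat (p ^ 0)" using c by simp
    then have "F q = F ((of_int b / of_nat (p ^ m)) \<otimes>\<^bsub>p_fractions p\<^esub> (of_int c / of_nat (p ^ 0)))" by (simp add: qr)
    also have "\<dots> = F (of_int b / of_nat (p ^ m)) \<otimes> F (of_int c / of_nat (p ^ 0))"
      by (rule hom_mult[OF hom]; unfold p_fractions_simps; blast)
    also have "\<dots> = F r" unfolding F qr using y(1,2) by simp
    finally show ?thesis .
  qed
  obtain f where f: "f \<in> hom (p_fractions p Mod \<int>) G" "\<And>q. q \<in> carrier (p_fractions p) \<Longrightarrow> f (\<int> #>\<^bsub>p_fractions p\<^esub> q) = F q"
  proof (rule FactGroup_universal[OF hom normal_Ints eq])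
    fix g assume "g \<in> hom (p_fractions p Mod \<int>) G"
      "\<And>x. x \<in> carrier (p_fractions p) \<Longrightarrow> g (\<int> #>\<^bsub>p_fractions p\<^esub> x) = F x"
    then show thesis by (rule that)
  qed
  have f': "f (pfrac a n) = y n [^] a" for a n
    unfolding pfrac_def F[symmetric] by (rule f(2); unfold p_fractions_simps; blast)
  have inj: "inj_on f (carrier (Zp))" if y1: "y 1 \<noteq> \<one>"
  proof -
    have dvd: "y n [^] a = \<one> \<Longrightarrow> int (p ^ n) dvd a" for n a
    proof (induction n arbitrary: a)
      case (Suc n)
      have "y (Suc n) [^] (p ^ Suc n) = \<one>"
        using up[of 0 "Suc n" 1] y(2) by (simp flip: int_pow_int)
      then have "G.ord (y (Suc n)) dvd p ^ Suc n" using G.pow_eq_id y(1) by blast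
      then obtain i where i: "G.ord (y (Suc n)) = p ^ i" using divides_primepow_nat[OF p] by blast
      have "i \<noteq> 0"
      proof
        assume "i = 0"
        then have "y (Suc n) = \<one>" using G.pow_eq_id[OF y(1), of "Suc n" 1] i y(1) by simp
        then show False using up[of 1 n 1] y1 y(1) by simp
      qed
      then have "int p dvd int (G.ord (y (Suc n)))" using i by (simp add: dvd_power)
      moreover have "int (G.ord (y (Suc n))) dvd a" using G.int_pow_eq_id[OF y(1)] Suc.prems by blast
      ultimately have "int p dvd a" by (rule dvd_trans)
      then obtain b where b: "a = int p * b" by auto
      have "y n [^] b = \<one>" using up[of n 1 b] Suc.prems b by simp
      then have "int (p ^ n) dvd b" by (rule Suc.IH)
      then show ?case using b by simp
    qed simp
    interpret h: group_hom "Zp" G f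
      using f(1)[folded prufer_group_eq] by (simp add: group_hom_def group_hom_axioms_def P.is_group G.is_group)
    show ?thesis
    proof (rule h.trivial_ker_imp_inj)
      show "kernel (Zp) G f = {\<one>\<^bsub>Zp\<^esub>}"
      proof (intro equalityI subsetI)
        fix x assume x: "x \<in> kernel (Zp) G f"
        then obtain a n where "x = pfrac a n" by (auto simp: kernel_def carrier_prufer)
        then have "x = \<one>\<^bsub>Zp\<^esub>" using x dvd f' frac_eq_one by (auto simp only: kernel_def mem_Collect_eq)
        then show "x \<in> {\<one>\<^bsub>Zp\<^esub>}" by blast
      qed (simp add: kernel_def)
    qed
  qed
  show thesis by (rule that[OF _ f' inj]) (use f(1) prufer_group_eq in simp)
qed

definition toral :: "nat \<Rightarrow> ('a, 'b) monoid_scheme \<Rightarrow> bool" where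
  "toral k G \<longleftrightarrow> comm_group G \<and> (\<forall>x\<in>carrier G. \<exists>n. x [^]\<^bsub>G\<^esub> (p ^ n :: nat) = \<one>\<^bsub>G\<^esub>) \<and>
     (\<forall>x\<in>carrier G. \<exists>y\<in>carrier G. y [^]\<^bsub>G\<^esub> p = x) \<and> card {x \<in> carrier G. x [^]\<^bsub>G\<^esub> p = \<one>\<^bsub>G\<^esub>} = p ^ k"

abbreviation Zpow :: "nat \<Rightarrow> (nat \<Rightarrow> rat set) monoid" where
  "Zpow k \<equiv> product_group {..<k} (\<lambda>_. Zp)"

lemma prufer_power_pow:
  "x \<in> carrier (Zpow k) \<Longrightarrow> x [^]\<^bsub>Zpow k\<^esub> (n::nat) = (\<lambda>i\<in>{..<k}. x i [^]\<^bsub>Zp\<^esub> n)"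
  by (induction n) (auto simp: restrict_def fun_eq_iff)

lemma group_prufer_power: "comm_group (Zpow k)"
proof -
  interpret P: comm_group "Zp" by (rule comm_group_prufer)
  interpret group "Zpow k" by (rule product_group) (rule P.is_group)
  show ?thesis
    by (rule group.group_comm_groupI[OF is_group]) (auto simp: PiE_def Pi_def intro!: restrict_ext P.m_comm)
qed

lemma toral_prufer_power: "toral k (Zpow k)"
  unfolding toral_def
proof (intro conjI ballI)
  interpret P: comm_group "Zp" by (rule comm_group_prufer)
  show "comm_group (Zpow k)" by (rule group_prufer_power)
  fix x assume x: "x \<in> carrier (Zpow k)"
  have xi: "x i \<in> carrier (Zp)" if "i < k" for i using x that by (auto simp: PiE_def Pi_def)
  then have "\<forall>i. \<exists>m. i < k \<longrightarrow> x i [^]\<^bsub>Zp\<^esub> (p ^ m :: nat) = \<one>\<^bsub>Zp\<^esub>"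
    using prufer_torsion by blast
  from choice[OF this] obtain m where m: "\<And>i. i < k \<Longrightarrow> x i [^]\<^bsub>Zp\<^esub> (p ^ m i) = \<one>\<^bsub>Zp\<^esub>" by blast
  define n where "n = sum m {..<k}"
  have "x i [^]\<^bsub>Zp\<^esub> (p ^ n) = \<one>\<^bsub>Zp\<^esub>" if "i < k" for i
  proof -
    have "n = m i + (n - m i)" using member_le_sum[of i "{..<k}" m] that by (simp add: n_def)
    then have "x i [^]\<^bsub>Zp\<^esub> (p ^ n) = (x i [^]\<^bsub>Zp\<^esub> (p ^ m i)) [^]\<^bsub>Zp\<^esub> (p ^ (n - m i))"
      using xi[OF that] by (metis P.nat_pow_pow power_add)
    then show ?thesis using m[OF that] by simp
  qed
  then have "x [^]\<^bsub>Zpow k\<^esub> (p ^ n) = \<one>\<^bsub>Zpow k\<^esub>"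
    unfolding prufer_power_pow[OF x] by (auto intro!: restrict_ext)
  then show "\<exists>n. x [^]\<^bsub>Zpow k\<^esub> (p ^ n) = \<one>\<^bsub>Zpow k\<^esub>" by blast
  have "\<forall>i. \<exists>z. i < k \<longrightarrow> z \<in> carrier (Zp) \<and> z [^]\<^bsub>Zp\<^esub> p = x i"
    using x prufer_divisible by (metis PiE_mem carrier_product_group lessThan_iff)
  then obtain z where z: "\<And>i. i < k \<Longrightarrow> z i \<in> carrier (Zp) \<and> z i [^]\<^bsub>Zp\<^esub> p = x i" by metis
  have zc: "restrict z {..<k} \<in> carrier (Zpow k)" using z by auto
  have "restrict z {..<k} [^]\<^bsub>Zpow k\<^esub> p = x"
    unfolding prufer_power_pow[OF zc] using z x by (auto simp: fun_eq_iff PiE_def extensional_def)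
  then show "\<exists>y\<in>carrier (Zpow k). y [^]\<^bsub>Zpow k\<^esub> p = x" using zc by blast
next
  have "{x \<in> carrier (Zpow k). x [^]\<^bsub>Zpow k\<^esub> p = \<one>\<^bsub>Zpow k\<^esub>} =
      (\<Pi>\<^sub>E i\<in>{..<k}. {x \<in> carrier (Zp). x [^]\<^bsub>Zp\<^esub> p = \<one>\<^bsub>Zp\<^esub>})" (is "?A = ?B")
  proof (intro equalityI subsetI)
    fix x assume x: "x \<in> ?A"
    then have "(\<lambda>i\<in>{..<k}. x i [^]\<^bsub>Zp\<^esub> p) = (\<lambda>i\<in>{..<k}. \<one>\<^bsub>Zp\<^esub>)"
      using prufer_power_pow[of x k p] by simp
    then have "x i [^]\<^bsub>Zp\<^esub> p = \<one>\<^bsub>Zp\<^esub>" if "i < k" for i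
      using that by (metis lessThan_iff restrict_apply')
    then show "x \<in> ?B" using x by (auto simp: PiE_def Pi_def)
  next
    fix x assume x: "x \<in> ?B"
    then have "x \<in> carrier (Zpow k)" by (auto simp: PiE_def Pi_def)
    then show "x \<in> ?A" using x prufer_power_pow[of x k p] by (auto simp: PiE_def Pi_def intro!: restrict_ext)
  qed
  then show "card {x \<in> carrier (Zpow k). x [^]\<^bsub>Zpow k\<^esub> p = \<one>\<^bsub>Zpow k\<^esub>} = p ^ k"
    by (simp add: card_PiE card_prufer_socle)
qed

lemma toral_iso:
  fixes G (structure)
  assumes "group G" "group H" "f \<in> iso G H" "toral k H"
  shows "toral k G"
proof -
  interpret f: group_hom G H f using assms by (simp add: group_hom_def group_hom_axioms_def iso_def)
  have H: "comm_group H" "\<And>x. x \<in> carrier H \<Longrightarrow> \<exists>n. x [^]\<^bsub>H\<^esub> (p ^ n :: nat) = \<one>\<^bsub>H\<^esub>"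
    "\<And>x. x \<in> carrier H \<Longrightarrow> \<exists>y\<in>carrier H. y [^]\<^bsub>H\<^esub> p = x" "card {x \<in> carrier H. x [^]\<^bsub>H\<^esub> p = \<one>\<^bsub>H\<^esub>} = p ^ k"
    using assms(4) unfolding toral_def by blast+
  interpret H: comm_group H by (rule H)
  have bij: "bij_betw f (carrier G) (carrier H)" using assms(3) by (simp add: iso_def)
  then have inj: "inj_on f (carrier G)" and surj: "f ` carrier G = carrier H" by (auto simp: bij_betw_def)
  have eq: "x = y \<longleftrightarrow> f x = f y" if "x \<in> carrier G" "y \<in> carrier G" for x y using inj that by (auto simp: inj_on_def)
  have "comm_group G"
    by (rule group.group_comm_groupI[OF assms(1)]) (simp add: eq H.m_comm)
  moreover have "\<exists>n. x [^] (p ^ n :: nat) = \<one>" if x: "x \<in> carrier G" for x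
    using H(2)[of "f x"] x by (simp add: eq f.hom_nat_pow)
  moreover have "\<exists>y\<in>carrier G. y [^] p = x" if x: "x \<in> carrier G" for x
  proof -
    obtain z where z: "z \<in> carrier H" "z [^]\<^bsub>H\<^esub> p = f x" using H(3)[of "f x"] x by auto
    then obtain y where "y \<in> carrier G" "z = f y" using surj by blast
    then show ?thesis using z x by (auto simp: eq f.hom_nat_pow)
  qed
  moreover have "card {x \<in> carrier G. x [^] p = \<one>} = p ^ k"
  proof -
    have "f ` {x \<in> carrier G. x [^] p = \<one>} = {x \<in> carrier H. x [^]\<^bsub>H\<^esub> p = \<one>\<^bsub>H\<^esub>}"
    proof (intro equalityI subsetI)
      fix z assume z: "z \<in> {x \<in> carrier H. x [^]\<^bsub>H\<^esub> p = \<one>\<^bsub>H\<^esub>}"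
      then obtain x where x: "x \<in> carrier G" "z = f x" using surj by blast
      then have "f (x [^] p) = f \<one>" using z by (simp add: f.hom_nat_pow)
      then have "x [^] p = \<one>" using inj_onD[OF inj] x by simp
      then show "z \<in> f ` {x \<in> carrier G. x [^] p = \<one>}" using x by blast
    next
      fix z assume "z \<in> f ` {x \<in> carrier G. x [^] p = \<one>}"
      then obtain x where x: "x \<in> carrier G" "z = f x" "x [^] p = \<one>" by blast
      then show "z \<in> {x \<in> carrier H. x [^]\<^bsub>H\<^esub> p = \<one>\<^bsub>H\<^esub>}" using f.hom_nat_pow[OF x(1), of p] by simp
    qed
    then show ?thesis
      using card_image[OF inj_on_subset[OF inj, of "{x \<in> carrier G. x [^] p = \<one>}"]] H(4) by auto
  qed
  ultimately show ?thesis unfolding toral_def by blast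
qed

lemma divisible_power:
  fixes G (structure)
  assumes G: "group G" and div: "\<And>x. x \<in> E \<Longrightarrow> \<exists>y\<in>E. y [^] p = x" and E: "E \<subseteq> carrier G" and x: "x \<in> E"
  shows "\<exists>y\<in>E. y [^] (p ^ n :: nat) = x"
proof -
  interpret group G by fact
  show ?thesis using x
  proof (induction n arbitrary: x)
  case 0
  then show ?case using E by (intro bexI[of _ x]) auto
next
  case (Suc n)
  then obtain y where y: "y \<in> E" "y [^] (p ^ n) = x" by blast
  then obtain z where "z \<in> E" "z [^] p = y" using div by blast
  then show ?case using y E by (auto simp: nat_pow_pow intro!: bexI[of _ z])
  qed
qed

lemma divisible_subgroup_eq:
  fixes G (structure)
  assumes G: "comm_group G" and tor: "\<And>x. x \<in> carrier G \<Longrightarrow> \<exists>n. x [^] (p ^ n :: nat) = \<one>"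
    and E: "subgroup E G" and div: "\<And>x. x \<in> E \<Longrightarrow> \<exists>y\<in>E. y [^] p = x"
    and soc: "{x \<in> carrier G. x [^] p = \<one>} \<subseteq> E"
  shows "E = carrier G"
proof -
  interpret G: comm_group G by fact
  have Es: "E \<subseteq> carrier G" using E by (rule subgroup.subset)
  have "x [^] (p ^ n :: nat) = \<one> \<Longrightarrow> x \<in> E" if "x \<in> carrier G" for x n
    using that
  proof (induction n arbitrary: x)
    case 0
    then show ?case using subgroup.one_closed[OF E] by simp
  next
    case (Suc n)
    let ?z = "x [^] (p ^ n)"
    have "?z [^] p = \<one>" using Suc.prems by (simp add: G.nat_pow_pow mult.commute)
    then have "?z \<in> E" using soc Suc.prems(2) by blast
    then obtain y where y: "y \<in> E" "y [^] (p ^ n) = ?z" using divisible_power[OF G.is_group div Es] by blast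
    have yc: "y \<in> carrier G" using y Es by blast
    have "(x \<otimes> inv y) [^] (p ^ n) = ?z \<otimes> inv (y [^] (p ^ n))"
      using Suc.prems(2) yc by (simp add: G.nat_pow_distrib G.nat_pow_inv)
    then have "(x \<otimes> inv y) [^] (p ^ n) = \<one>" using y(2) Suc.prems(2) by simp
    then have "x \<otimes> inv y \<in> E" using Suc.IH Suc.prems(2) yc by blast
    then have "(x \<otimes> inv y) \<otimes> y \<in> E" using subgroup.m_closed[OF E] y(1) by blast
    then show ?case using Suc.prems(2) yc by (simp add: G.m_assoc)
  qed
  then show ?thesis using tor Es by blast
qed

lemma toral_classification_extend:
  fixes G (structure)
  assumes G: "comm_group G" and tor: "\<And>x. x \<in> carrier G \<Longrightarrow> \<exists>n. x [^] (p ^ n :: nat) = \<one>"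
    and div: "\<And>x. x \<in> carrier G \<Longrightarrow> \<exists>y\<in>carrier G. y [^] p = x"
    and h: "h \<in> hom (Zpow j) G" "inj_on h (carrier (Zpow j))"
    and ne: "h ` carrier (Zpow j) \<noteq> carrier G"
  shows "\<exists>h'. h' \<in> hom (Zpow (Suc j)) G \<and> inj_on h' (carrier (Zpow (Suc j)))"
proof -
  interpret G: comm_group G by fact
  interpret P: comm_group "Zp" by (rule comm_group_prufer)
  interpret PP: comm_group "Zpow j" by (rule group_prufer_power)
  interpret PS: comm_group "Zpow (Suc j)" by (rule group_prufer_power)
  interpret h: group_hom "Zpow j" G h
    using h(1) by (simp add: group_hom_def group_hom_axioms_def PP.is_group G.is_group)
  let ?E = "h ` carrier (Zpow j)"
  have E: "subgroup ?E G" by (rule h.img_is_subgroup)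
  have "\<exists>y\<in>?E. y [^] p = x" if x: "x \<in> ?E" for x
  proof -
    obtain c where c: "c \<in> carrier (Zpow j)" "x = h c" using x by blast
    obtain d where d: "d \<in> carrier (Zpow j)" "d [^]\<^bsub>Zpow j\<^esub> p = c"
      using toral_prufer_power[of j] c(1) unfolding toral_def by blast
    show ?thesis using h.hom_nat_pow[OF d(1), of p] d c(2) by (metis imageI)
  qed
  then obtain x where x: "x \<in> carrier G" "x [^] p = \<one>" "x \<notin> ?E"
    using divisible_subgroup_eq[OF G tor E] ne by blast
  define rt where "rt z = (SOME y. y \<in> carrier G \<and> y [^] p = z)" for z
  have rt: "rt z \<in> carrier G \<and> rt z [^] p = z" if "z \<in> carrier G" for z
    unfolding rt_def by (rule someI_ex) (use div[OF that] in blast)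
  define y where "y n = (if n = 0 then \<one> else (rt ^^ (n - 1)) x)" for n
  have yc: "y n \<in> carrier G" for n
  proof -
    have "(rt ^^ m) x \<in> carrier G" for m by (induction m) (use rt x in auto)
    then show ?thesis by (simp add: y_def)
  qed
  have ys: "y (Suc n) [^] p = y n" for n
  proof (cases n)
    case (Suc m)
    then show ?thesis using rt[OF yc[of n]] by (simp add: y_def)
  qed (use x in \<open>simp add: y_def\<close>)
  have y0: "y 0 = \<one>" and y1: "y 1 = x" by (simp_all add: y_def)
  have "y 1 \<noteq> \<one>" using x(3) subgroup.one_closed[OF E] y1 by auto
  then obtain f where f: "f \<in> hom (Zp) G" "\<And>a n. f (pfrac a n) = y n [^] a"
    "inj_on f (carrier (Zp))"
    using prufer_hom[OF G yc y0 ys] by metis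
  interpret f: group_hom "Zp" G f
    using f(1) by (simp add: group_hom_def group_hom_axioms_def P.is_group G.is_group)
  define h' where "h' c = h (restrict c {..<j}) \<otimes> f (c j)" for c
  have res: "restrict c {..<j} \<in> carrier (Zpow j)" "c j \<in> carrier (Zp)" if "c \<in> carrier (Zpow (Suc j))" for c
    using that by (auto simp: PiE_def Pi_def)
  have hom: "h' \<in> hom (Zpow (Suc j)) G"
  proof (rule homI)
    fix c d assume c: "c \<in> carrier (Zpow (Suc j))" and d: "d \<in> carrier (Zpow (Suc j))"
    have "restrict (c \<otimes>\<^bsub>Zpow (Suc j)\<^esub> d) {..<j} = restrict c {..<j} \<otimes>\<^bsub>Zpow j\<^esub> restrict d {..<j}"
      by (auto simp: fun_eq_iff)
    then show "h' (c \<otimes>\<^bsub>Zpow (Suc j)\<^esub> d) = h' c \<otimes> h' d"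
      using res[OF c] res[OF d] h.hom_mult[OF res(1)[OF c] res(1)[OF d]] h.hom_closed
      by (simp add: h'_def G.m_ac del: carrier_product_group mult_product_group) (simp add: G.m_ac)
  qed (use res h.hom_closed f.hom_closed in \<open>simp add: h'_def del: carrier_product_group\<close>)
  interpret h': group_hom "Zpow (Suc j)" G h'
    using hom by (simp add: group_hom_def group_hom_axioms_def PS.is_group G.is_group)
  have "inj_on h' (carrier (Zpow (Suc j)))"
  proof (rule h'.trivial_ker_imp_inj)
    have "c = \<one>\<^bsub>Zpow (Suc j)\<^esub>" if c: "c \<in> carrier (Zpow (Suc j))" and k: "h' c = \<one>" for c
    proof -
      note r = res[OF c]
      have "f (c j) = inv (h (restrict c {..<j}))"
        using k G.inv_unique'[of "h (restrict c {..<j})" "f (c j)"] h.hom_closed[OF r(1)] f.hom_closed[OF r(2)]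
        by (simp add: h'_def G.m_comm)
      then have fE: "f (c j) \<in> ?E" using subgroup.m_inv_closed[OF E imageI[OF r(1)]] by (simp only:)
      obtain a n where an: "c j = pfrac a n" using r(2) by (auto simp: carrier_prufer)
      have cj: "c j = \<one>\<^bsub>Zp\<^esub>"
      proof (rule ccontr)
        assume ne: "c j \<noteq> \<one>\<^bsub>Zp\<^esub>"
        define m where "m = (LEAST m. c j [^]\<^bsub>Zp\<^esub> (p ^ m) = \<one>\<^bsub>Zp\<^esub>)"
        have m: "c j [^]\<^bsub>Zp\<^esub> (p ^ m) = \<one>\<^bsub>Zp\<^esub>"
          unfolding m_def by (rule LeastI_ex) (rule prufer_torsion[OF r(2)])
        have "m \<noteq> 0" using m ne r(2) by (metis P.nat_pow_eone power_0)
        then obtain m' where m': "m = Suc m'" by (cases m) auto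
        define d where "d = c j [^]\<^bsub>Zp\<^esub> (p ^ m')"
        have d1: "d \<noteq> \<one>\<^bsub>Zp\<^esub>"
          unfolding d_def using not_less_Least[of m' "\<lambda>m. c j [^]\<^bsub>Zp\<^esub> (p ^ m) = \<one>\<^bsub>Zp\<^esub>"] m' m_def by auto
        have dc: "d \<in> carrier (Zp)" unfolding d_def using r(2) by simp
        have "d [^]\<^bsub>Zp\<^esub> p = \<one>\<^bsub>Zp\<^esub>"
          using m m' r(2) by (simp add: d_def P.nat_pow_pow mult.commute)
        then obtain i where i: "i < p" "d = pfrac (int i) 1" using dc prufer_socle by blast
        have "\<not> int p dvd int i" using d1 i frac_eq_one[of "int i" 1] by simp
        then have "coprime (int p) (int i)" using p prime_imp_coprime by (metis int_dvd_int_iff coprime_int_iff)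
        then obtain u v where uv: "u * int p + v * int i = 1" using bezout_int by (metis coprime_iff_gcd_eq_1)
        have "f d = f (c j) [^] (p ^ m')" unfolding d_def using f.hom_nat_pow[OF r(2)] by blast
        then have "f d \<in> ?E" using G.subgroup_int_pow_closed[OF E fE, of "int (p ^ m')"] by (simp only: int_pow_int)
        moreover have "f d = x [^] int i" using f(2) i y1 by simp
        ultimately have "(x [^] int i) [^] v \<in> ?E" using G.subgroup_int_pow_closed[OF E] by metis
        moreover have "x = (x [^] int p) [^] u \<otimes> (x [^] int i) [^] v"
          using uv x(1) by (simp add: G.int_pow_pow mult.commute flip: G.int_pow_mult)
        then have "x = (x [^] int i) [^] v"
          using x by (simp add: int_pow_int)
        ultimately show False using x(3) by simp
      qed
      then have "h (restrict c {..<j}) = \<one>"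
        using k h.hom_closed[OF r(1)] by (simp add: h'_def)
      then have "restrict c {..<j} = \<one>\<^bsub>Zpow j\<^esub>"
        using h(2) r(1) PP.one_closed h.hom_one by (metis inj_onD)
      then have "c i = \<one>\<^bsub>Zp\<^esub>" if "i < Suc j" for i
        using that cj by (metis less_SucE lessThan_iff one_product_group restrict_apply')
      then show ?thesis using c by (auto simp: fun_eq_iff PiE_def extensional_def)
    qed
    then show "kernel (Zpow (Suc j)) G h' = {\<one>\<^bsub>Zpow (Suc j)\<^esub>}"
      by (auto simp: kernel_def simp del: carrier_product_group one_product_group)
  qed
  then show ?thesis using hom by blast
qed

lemma toral_classification:
  fixes G (structure)
  assumes "toral k G" shows "G \<cong> Zpow k"
proof -
  have G: "comm_group G" "\<And>x. x \<in> carrier G \<Longrightarrow> \<exists>n. x [^] (p ^ n :: nat) = \<one>"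
    "\<And>x. x \<in> carrier G \<Longrightarrow> \<exists>y\<in>carrier G. y [^] p = x" and cd: "card {x \<in> carrier G. x [^] p = \<one>} = p ^ k"
    using assms unfolding toral_def by blast+
  interpret G: comm_group G by (rule G)
  let ?soc = "{x \<in> carrier G. x [^] p = \<one>}"
  have fin: "finite ?soc" using cd p_pos by (metis card.infinite power_eq_0_iff not_less0)
  let ?P = "\<lambda>j. \<exists>h. h \<in> hom (Zpow j) G \<and> inj_on h (carrier (Zpow j))"
  have bound: "j \<le> k" if "?P j" for j
  proof -
    obtain h where h: "h \<in> hom (Zpow j) G" "inj_on h (carrier (Zpow j))" using \<open>?P j\<close> by blast
    interpret PP: comm_group "Zpow j" by (rule group_prufer_power)
    interpret h: group_hom "Zpow j" G h
      using h(1) by (simp add: group_hom_def group_hom_axioms_def PP.is_group G.is_group)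
    let ?s = "{x \<in> carrier (Zpow j). x [^]\<^bsub>Zpow j\<^esub> p = \<one>\<^bsub>Zpow j\<^esub>}"
    have "h ` ?s \<subseteq> ?soc"
    proof
      fix z assume "z \<in> h ` ?s"
      then obtain c where c: "c \<in> carrier (Zpow j)" "c [^]\<^bsub>Zpow j\<^esub> p = \<one>\<^bsub>Zpow j\<^esub>" "z = h c" by blast
      then show "z \<in> ?soc" using h.hom_nat_pow[OF c(1), of p] h.hom_closed[OF c(1)] by (simp del: carrier_product_group one_product_group)
    qed
    then have "card ?s \<le> card ?soc" using h(2) fin by (intro card_inj_on_le[of h]) (auto intro: inj_on_subset)
    then have "p ^ j \<le> p ^ k" using toral_prufer_power[of j] cd unfolding toral_def by simp
    then show ?thesis using prime_gt_1_nat[OF p] by (simp add: power_increasing_iff)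
  qed
  have "?P 0"
  proof (intro exI conjI)
    show "(\<lambda>_. \<one>) \<in> hom (Zpow 0) G" by (auto simp: hom_def)
  qed (auto simp: inj_on_def)
  define Q where "Q j \<longleftrightarrow> ?P j" for j
  have "\<exists>j. Q j \<and> \<not> Q (Suc j)"
  proof (rule ccontr)
    assume *: "\<nexists>j. Q j \<and> \<not> Q (Suc j)"
    have "Q j" for j
      by (induction j) (use * \<open>?P 0\<close> in \<open>auto simp: Q_def\<close>)
    then show False using bound[of "Suc k"] by (simp add: Q_def)
  qed
  then obtain j where "Q j" "\<not> Q (Suc j)" by blast
  then obtain h where h: "h \<in> hom (Zpow j) G" "inj_on h (carrier (Zpow j))"
    unfolding Q_def by blast
  have "\<not> ?P (Suc j)" using \<open>\<not> Q (Suc j)\<close> unfolding Q_def .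
  then have "h ` carrier (Zpow j) = carrier G"
    using toral_classification_extend[OF G h] by blast
  then have iso: "h \<in> iso (Zpow j) G" using h by (simp add: iso_def bij_betw_def)
  then have iso': "inv_into (carrier (Zpow j)) h \<in> iso G (Zpow j)"
    using comm_group.axioms(2)[OF group_prufer_power] group.iso_set_sym by blast
  have "toral j G"
    using toral_iso[OF G.is_group comm_group.axioms(2)[OF group_prufer_power] iso' toral_prufer_power] .
  then have "p ^ j = p ^ k" using cd unfolding toral_def by simp
  then have "j = k" using prime_gt_1_nat[OF p] power_inject_exp by blast
  then show ?thesis using iso' by (auto simp: is_iso_def)
qed

lemma toral_iff:
  assumes "group G" shows "G \<cong> Zpow k \<longleftrightarrow> toral k G"
proof
  assume "G \<cong> Zpow k"
  then obtain f where "f \<in> iso G (Zpow k)" by (auto simp: is_iso_def)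
  then show "toral k G"
    by (rule toral_iso[OF assms comm_group.axioms(2)[OF group_prufer_power] _ toral_prufer_power])
qed (rule toral_classification)

end

definition dv :: "('a, 'b) monoid_scheme \<Rightarrow> nat \<Rightarrow> 'a set \<Rightarrow> 'a set" where
  "dv S p X = {x \<in> X. \<forall>n. \<exists>y\<in>X. y [^]\<^bsub>S\<^esub> (p ^ n :: nat) = x}"

lemma dv_mono: "X \<subseteq> Y \<Longrightarrow> dv S p X \<subseteq> dv S p Y"
  unfolding dv_def by blast

lemma dv_subset: "dv S p X \<subseteq> X"
  by (auto simp: dv_def)

lemma (in normal) rcos_eq_iff: "x \<in> carrier G \<Longrightarrow> H #> x = H \<longleftrightarrow> x \<in> H"
  using coset_join1[OF _ _ is_subgroup] coset_join2[OF _ is_subgroup] by blast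

lemma (in group) conj_map_closed: "g \<in> carrier G \<Longrightarrow> x \<in> carrier G \<Longrightarrow> conj_map G g x \<in> carrier G"
  by (simp add: conj_map_def)

lemma (in group) conj_map_mult:
  "g \<in> carrier G \<Longrightarrow> x \<in> carrier G \<Longrightarrow> y \<in> carrier G \<Longrightarrow> conj_map G g (x \<otimes> y) = conj_map G g x \<otimes> conj_map G g y"
  by (simp add: conj_map_def m_assoc inv_solve_left)

lemma (in group) conj_map_comp:
  "g \<in> carrier G \<Longrightarrow> h \<in> carrier G \<Longrightarrow> x \<in> carrier G \<Longrightarrow> conj_map G (g \<otimes> h) x = conj_map G g (conj_map G h x)"
  by (simp add: conj_map_def m_assoc inv_mult_group)

lemma (in group) conj_map_one [simp]: "x \<in> carrier G \<Longrightarrow> conj_map G \<one> x = x"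
  by (simp add: conj_map_def)

lemma (in group) conj_map_inv:
  "g \<in> carrier G \<Longrightarrow> x \<in> carrier G \<Longrightarrow> conj_map G (inv g) (conj_map G g x) = x"
  "g \<in> carrier G \<Longrightarrow> x \<in> carrier G \<Longrightarrow> conj_map G g (conj_map G (inv g) x) = x"
  by (simp_all flip: conj_map_comp)

lemma (in group) conj_map_commute:
  "g \<in> carrier G \<Longrightarrow> x \<in> carrier G \<Longrightarrow> g \<otimes> x = x \<otimes> g \<longleftrightarrow> conj_map G g x = x"
  by (metis conj_map_def inv_closed inv_solve_right m_closed)

lemma toral_extensionD:
  fixes G (structure)
  assumes p: "prime p" and G: "group G" and ext: "toral_extension p G k T"
  shows "T \<lhd> G" "toral p k (G\<lparr>carrier := T\<rparr>)" "finite (carrier (G Mod T))"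
    "\<exists>e. \<forall>x\<in>carrier G. x [^] (p ^ e :: nat) \<in> T" "T = dv G p (carrier G)"
proof -
  interpret group G by fact
  show N: "T \<lhd> G" and fin: "finite (carrier (G Mod T))" using ext by (auto simp: toral_extension_def)
  interpret T: normal T G by fact
  have gT: "group (G\<lparr>carrier := T\<rparr>)" using subgroup_imp_group[OF T.is_subgroup] .
  show tor: "toral p k (G\<lparr>carrier := T\<rparr>)"
    using ext toral_iff[OF p gT] by (simp add: toral_extension_def)
  have gQ: "group (G Mod T)" by (rule T.factorgroup_is_group)
  obtain e where e: "order (G Mod T) = p ^ e"
    using p_group_order[OF p gQ fin] ext unfolding toral_extension_def p_group_def by blast
  have pow: "x [^] (p ^ e :: nat) \<in> T" if x: "x \<in> carrier G" for x
  proof -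
    have "(T #> x) [^]\<^bsub>G Mod T\<^esub> (p ^ e) = \<one>\<^bsub>G Mod T\<^esub>"
      using group.pow_order_eq_1[OF gQ, of "T #> x"] x e by (auto simp: carrier_FactGroup)
    then show ?thesis using T.FactGroup_pow[OF x] T.rcos_eq_iff[of "x [^] (p ^ e)"] x by simp
  qed
  then show "\<exists>e. \<forall>x\<in>carrier G. x [^] (p ^ e :: nat) \<in> T" by blast
  have "\<exists>y\<in>T. y [^] p = x" if "x \<in> T" for x
    using tor that unfolding toral_def[OF p] by (auto simp flip: nat_pow_consistent)
  from divisible_power[OF p G this T.subset] have div: "\<exists>y\<in>T. y [^] (p ^ n :: nat) = x" if "x \<in> T" for x n
    using that by blast
  show "T = dv G p (carrier G)"
  proof
    show "T \<subseteq> dv G p (carrier G)" using div T.subset unfolding dv_def by blast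
    show "dv G p (carrier G) \<subseteq> T"
    proof
      fix x assume "x \<in> dv G p (carrier G)"
      then obtain y where "y \<in> carrier G" "y [^] (p ^ e) = x" unfolding dv_def by blast
      then show "x \<in> T" using pow by blast
    qed
  qed
qed

section \<open>Discrete \<open>p\<close>-toral groups\<close>

locale p_toral_group = group S for S (structure) +
  fixes p :: nat
  assumes p: "prime p" and discrete_p_toral: "discrete_p_toral p S"
begin

notation lcos (infixl "\<star>" 60)

abbreviation D where "D \<equiv> dv S p"

abbreviation cj where "cj \<equiv> conj_map S"

definition T where "T = D (carrier S)"

lemma p_gt_0: "0 < p" and p_gt_1: "1 < p"
  using prime_gt_0_nat[OF p] prime_gt_1_nat[OF p] by auto

lemma T_normal: "T \<lhd> S" and finite_quotient: "finite (carrier (S Mod T))"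
  and T_exp: "\<exists>e. \<forall>x\<in>carrier S. x [^] (p ^ e :: nat) \<in> T" and T_toral: "\<exists>k. toral p k (grp T)"
  and T_ext: "\<exists>k. toral_extension p S k T"
proof -
  obtain k T0 where ext: "toral_extension p S k T0" using discrete_p_toral by (auto simp: discrete_p_toral_def)
  note d = toral_extensionD[OF p is_group ext]
  have "T0 = T" using d(5) unfolding T_def .
  then show "T \<lhd> S" "finite (carrier (S Mod T))" "\<exists>e. \<forall>x\<in>carrier S. x [^] (p ^ e :: nat) \<in> T"
    "\<exists>k. toral p k (grp T)" "\<exists>k. toral_extension p S k T" using d(1-4) ext by blast+
qed

sublocale T: normal T S by (rule T_normal)

lemma T_comm: "x \<in> T \<Longrightarrow> y \<in> T \<Longrightarrow> x \<otimes> y = y \<otimes> x"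
  using T_toral unfolding toral_def[OF p] by (auto dest: comm_groupE(4))

lemma T_torsion: "x \<in> T \<Longrightarrow> \<exists>n. x [^] (p ^ n :: nat) = \<one>"
  using T_toral unfolding toral_def[OF p] by (auto simp flip: nat_pow_consistent)

lemma finite_T_socle: "finite {x \<in> T. x [^] p = \<one>}"
proof -
  obtain k where "card {x \<in> T. x [^] p = \<one>} = p ^ k"
    using T_toral unfolding toral_def[OF p] by (auto simp flip: nat_pow_consistent)
  then show ?thesis using p_gt_0 by (metis card.infinite power_eq_0_iff less_irrefl)
qed

lemma torsion: assumes "x \<in> carrier S" shows "\<exists>n. x [^] (p ^ n :: nat) = \<one>"
proof -
  obtain e where "x [^] (p ^ e :: nat) \<in> T" using T_exp assms by blast
  then obtain n where "(x [^] (p ^ e)) [^] (p ^ n) = \<one>" using T_torsion by blast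
  then have "x [^] (p ^ (e + n)) = \<one>" using assms by (simp add: nat_pow_pow power_add)
  then show ?thesis by blast
qed

lemma comm_T: "comm_group (grp T)"
  using T_toral unfolding toral_def[OF p] by blast

lemma T_pow_distrib: "x \<in> T \<Longrightarrow> y \<in> T \<Longrightarrow> (x \<otimes> y) [^] (n::nat) = x [^] n \<otimes> y [^] n"
  using comm_monoid.nat_pow_distrib[OF comm_group.axioms(1)[OF comm_T], of x y n] by (simp flip: nat_pow_consistent)

lemma subgroup_pow_closed: "subgroup X S \<Longrightarrow> x \<in> X \<Longrightarrow> x [^] (n::nat) \<in> X"
  by (induction n) (auto simp: subgroup.one_closed subgroup.m_closed)

lemma subgroupD:
  assumes "subgroup X S"
  shows "x \<in> X \<Longrightarrow> x \<in> carrier S" "\<one> \<in> X" "x \<in> X \<Longrightarrow> y \<in> X \<Longrightarrow> x \<otimes> y \<in> X" "x \<in> X \<Longrightarrow> inv x \<in> X"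
  using assms by (auto simp: subgroup_def)

lemma torsion_subgroupI:
  assumes X: "X \<subseteq> carrier S" "\<one> \<in> X" "\<And>a b. a \<in> X \<Longrightarrow> b \<in> X \<Longrightarrow> a \<otimes> b \<in> X" shows "subgroup X S"
proof (rule subgroupI)
  fix a assume a: "a \<in> X"
  then obtain n where n: "a [^] (p ^ n :: nat) = \<one>" using torsion X(1) by blast
  have "a [^] m \<in> X" for m :: nat by (induction m) (use a X(2,3) in auto)
  moreover have "a [^] (p ^ n - 1) \<otimes> a = \<one>" using n p_gt_0 nat_pow_Suc[of a "p ^ n - 1"] by simp
  then have "inv a = a [^] (p ^ n - 1)" using inv_equality a X(1) by blast
  ultimately show "inv a \<in> X" by simp
qed (use X in auto)

lemmas T_closed = subgroupD[OF T.is_subgroup]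

lemma finite_T_torsion: "finite {x \<in> T. x [^] (p ^ n :: nat) = \<one>}"
proof (induction n)
  case 0
  have "{x \<in> T. x [^] (p ^ 0 :: nat) = \<one>} \<subseteq> {\<one>}" using T_closed(1) by auto
  then show ?case using finite_subset by blast
next
  case (Suc n)
  let ?A = "{x \<in> T. x [^] (p ^ Suc n :: nat) = \<one>}" and ?B = "{x \<in> T. x [^] p = \<one>}"
  have im: "(\<lambda>x. x [^] (p ^ n)) ` ?A \<subseteq> ?B"
    using subgroup_pow_closed[OF T.is_subgroup] T_closed(1) by (auto simp: nat_pow_pow mult.commute)
  have "finite (?A \<inter> (\<lambda>x. x [^] (p ^ n)) -` {b})" for b
  proof (cases "?A \<inter> (\<lambda>x. x [^] (p ^ n)) -` {b} = {}")
    case False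
    then obtain a where a: "a \<in> T" "a [^] (p ^ n) = b" by blast
    have "?A \<inter> (\<lambda>x. x [^] (p ^ n)) -` {b} \<subseteq> (\<lambda>z. z \<otimes> a) ` {x \<in> T. x [^] (p ^ n :: nat) = \<one>}"
    proof
      fix x assume x: "x \<in> ?A \<inter> (\<lambda>x. x [^] (p ^ n)) -` {b}"
      have "b \<in> carrier S" using a T_closed(1) by auto
      then have "(x \<otimes> inv a) [^] (p ^ n) = \<one>"
        using x a T_closed by (simp add: T_pow_distrib nat_pow_inv)
      moreover have "x = (x \<otimes> inv a) \<otimes> a" using x a T_closed(1) by (simp add: m_assoc)
      ultimately show "x \<in> (\<lambda>z. z \<otimes> a) ` {x \<in> T. x [^] (p ^ n :: nat) = \<one>}" using x a T_closed by blast
    qed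
    then show ?thesis using Suc finite_subset by blast
  qed simp
  then show ?case
    using finite_finite_vimage_IntI[OF finite_subset[OF im finite_T_socle], of "\<lambda>x. x [^] (p ^ n)" ?A]
      finite_subset[of ?A "\<Union>b\<in>?B. ?A \<inter> (\<lambda>x. x [^] (p ^ n)) -` {b}"] im finite_T_socle by blast
qed

text \<open>The identity component of \<open>X\<close> is \<open>p\<^sup>n (X \<inter> T)\<close> for large \<open>n\<close>; it is found where the socles
  of the descending chain of these groups become stationary.\<close>

lemma D_structure:
  assumes X: "subgroup X S"
  obtains n where "D X = (\<lambda>b. b [^] (p ^ n :: nat)) ` (X \<inter> T)" "\<And>x. x \<in> D X \<Longrightarrow> \<exists>y\<in>D X. y [^] p = x"
    "\<And>b. b \<in> X \<inter> T \<Longrightarrow> \<exists>d\<in>D X. \<exists>t\<in>X \<inter> T. t [^] (p ^ n :: nat) = \<one> \<and> b = d \<otimes> t"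
proof -
  let ?B = "X \<inter> T"
  have B: "subgroup ?B S" using X T.is_subgroup by (rule subgroups_Inter_pair)
  note Bc = subgroupD[OF B]
  have Bd: "(x \<otimes> y) [^] (n::nat) = x [^] n \<otimes> y [^] n" if "x \<in> ?B" "y \<in> ?B" for x y n
    using that T_pow_distrib by blast
  define C where "C n = (\<lambda>b. b [^] (p ^ n :: nat)) ` ?B" for n
  define soc where "soc n = {x \<in> C n. x [^] p = \<one>}" for n
  have Csub: "C n \<subseteq> ?B" for n using subgroup_pow_closed[OF B] by (auto simp: C_def)
  have Cstep: "C (n + m) = (\<lambda>x. x [^] (p ^ m :: nat)) ` C n" for n m
    using Bc(1) by (force simp: C_def image_image nat_pow_pow power_add)
  have Cdec: "C (n + m) \<subseteq> C n" for n m
  proof -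
    have "C (n + m) = (\<lambda>b. (b [^] (p ^ m)) [^] (p ^ n)) ` ?B"
      using Bc(1) by (auto simp: C_def nat_pow_pow power_add mult.commute)
    then show ?thesis using subgroup_pow_closed[OF B] by (auto simp: C_def)
  qed
  have finsoc: "finite (soc n)" for n
    by (rule finite_subset[OF _ finite_T_socle]) (use Csub in \<open>auto simp: soc_def\<close>)
  define n where "n = (ARG_MIN (\<lambda>n. card (soc n)) n. True)"
  have stat: "soc (n + m) = soc n" for m
  proof (rule card_subset_eq[OF finsoc])
    show "soc (n + m) \<subseteq> soc n" using Cdec by (auto simp: soc_def)
    then have "card (soc (n + m)) \<le> card (soc n)" using finsoc card_mono by blast
    moreover have "card (soc n) \<le> card (soc (n + m))" unfolding n_def by (rule arg_min_nat_le) simp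
    ultimately show "card (soc (n + m)) = card (soc n)" by simp
  qed
  have Csg: "x \<otimes> inv y \<in> C n" if xy: "x \<in> C n" "y \<in> C n" for x y
  proof -
    obtain a b where ab: "a \<in> ?B" "b \<in> ?B" "x = a [^] (p ^ n)" "y = b [^] (p ^ n)" using xy unfolding C_def by blast
    have "x \<otimes> inv y = (a \<otimes> inv b) [^] (p ^ n)" using ab Bc by (simp add: Bd nat_pow_inv)
    then show ?thesis using ab Bc unfolding C_def by blast
  qed
  have div: "x [^] (p ^ s :: nat) = \<one> \<Longrightarrow> x \<in> C n \<Longrightarrow> x \<in> C (Suc n)" for x s
  proof (induction s arbitrary: x)
    case 0
    then have "x \<in> carrier S" using Csub Bc(1) by blast
    then have "x = \<one> [^] (p ^ Suc n)" using "0.prems" by simp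
    then show ?case using Bc(2) unfolding C_def by blast
  next
    case (Suc s)
    have xB: "x \<in> ?B" using Suc.prems(2) Csub by blast
    let ?z = "x [^] (p ^ s)"
    have "?z [^] p = \<one>" using Suc.prems(1) xB Bc(1) by (simp add: nat_pow_pow mult.commute)
    moreover have "?z \<in> C (n + s)" using Suc.prems(2) Cstep by blast
    ultimately have "?z \<in> soc (n + s)" by (simp add: soc_def)
    then have "?z \<in> soc (n + Suc s)" using stat[of s] stat[of "Suc s"] by simp
    then obtain y where y: "y \<in> ?B" "?z = y [^] (p ^ (n + Suc s))" by (auto simp: soc_def C_def)
    let ?w = "y [^] (p ^ Suc n)"
    have wS: "?w \<in> C (Suc n)" using y unfolding C_def by blast
    then have wC: "?w \<in> C n" using Cdec[of n 1] by auto
    have wB: "?w \<in> ?B" using wC Csub by blast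
    have "?w [^] (p ^ s) = ?z" using y Bc(1) by (simp add: nat_pow_pow power_add mult.commute mult.left_commute)
    then have "(x \<otimes> inv ?w) [^] (p ^ s) = \<one>" using xB wB Bc by (simp add: Bd nat_pow_inv)
    then have "x \<otimes> inv ?w \<in> C (Suc n)" using Suc.IH Csg[OF Suc.prems(2) wC] by blast
    then obtain a where a: "a \<in> ?B" "x \<otimes> inv ?w = a [^] (p ^ Suc n)" unfolding C_def by blast
    have "x = (x \<otimes> inv ?w) \<otimes> ?w" using xB wB Bc(1) by (simp add: m_assoc)
    also have "\<dots> = (a \<otimes> y) [^] (p ^ Suc n)" using a y by (simp add: Bd)
    finally show ?case using a y Bc unfolding C_def by blast
  qed
  have CC: "C (Suc n) = C n"
  proof
    show "C (Suc n) \<subseteq> C n" using Cdec[of n 1] by simp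
    show "C n \<subseteq> C (Suc n)"
    proof
      fix x assume x: "x \<in> C n"
      then have "x \<in> carrier S" using Csub Bc(1) by blast
      then obtain s where "x [^] (p ^ s :: nat) = \<one>" using torsion by blast
      then show "x \<in> C (Suc n)" using div x by blast
    qed
  qed
  have CCm: "C (n + m) = C n" for m
  proof (induction m)
    case (Suc m)
    have "C (n + Suc m) = (\<lambda>x. x [^] (p ^ m :: nat)) ` C (Suc n)" using Cstep[of "Suc n" m] by simp
    then show ?case using CC Cstep[of n m] Suc by simp
  qed simp
  have DC: "D X = C n"
  proof
    show "C n \<subseteq> D X"
    proof
      fix x assume x: "x \<in> C n"
      have "\<exists>y\<in>X. y [^] (p ^ m) = x" for m
      proof -
        have "x \<in> C (m + n)" using x CCm[of m] by (simp add: add.commute)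
        then obtain b where b: "b \<in> ?B" "x = b [^] (p ^ (m + n))" unfolding C_def by blast
        then have "x = (b [^] (p ^ n)) [^] (p ^ m)" using Bc(1) by (simp add: nat_pow_pow power_add mult.commute)
        then show ?thesis using b subgroup_pow_closed[OF B b(1)] by blast
      qed
      then show "x \<in> D X" using x Csub unfolding dv_def by blast
    qed
    obtain e where e: "\<And>x. x \<in> carrier S \<Longrightarrow> x [^] (p ^ e :: nat) \<in> T" using T_exp by blast
    show "D X \<subseteq> C n"
    proof
      fix x assume "x \<in> D X"
      then obtain y where y: "y \<in> X" "y [^] (p ^ (e + n)) = x" unfolding dv_def by blast
      then have "x = (y [^] (p ^ e)) [^] (p ^ n)" using subgroupD(1)[OF X] by (simp add: nat_pow_pow power_add)
      moreover have "y [^] (p ^ e) \<in> ?B" using y e subgroup_pow_closed[OF X] subgroupD(1)[OF X] by blast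
      ultimately show "x \<in> C n" unfolding C_def by blast
    qed
  qed
  show thesis
  proof (rule that)
    show "D X = (\<lambda>b. b [^] (p ^ n :: nat)) ` (X \<inter> T)" using DC C_def by simp
    show "\<exists>y\<in>D X. y [^] p = x" if x: "x \<in> D X" for x
    proof -
      have "C n = (\<lambda>y. y [^] p) ` C n" using CC Cstep[of n 1] by simp
      from subsetD[OF equalityD1[OF this]] show ?thesis using x unfolding DC by blast
    qed
    show "\<exists>d\<in>D X. \<exists>t\<in>X \<inter> T. t [^] (p ^ n :: nat) = \<one> \<and> b = d \<otimes> t" if b: "b \<in> X \<inter> T" for b
    proof -
      have "b [^] (p ^ n) \<in> C n" using b unfolding C_def by blast
      then have "b [^] (p ^ n) \<in> C (n + n)" using CCm by simp
      then obtain d where d: "d \<in> C n" "b [^] (p ^ n) = d [^] (p ^ n)" using Cstep[of n n] by auto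
      have dB: "d \<in> ?B" using d Csub by blast
      have "(inv d \<otimes> b) [^] (p ^ n) = \<one>" using d(2) dB b Bc by (simp add: Bd nat_pow_inv)
      moreover have "b = d \<otimes> (inv d \<otimes> b)" using dB b Bc(1) by (simp flip: m_assoc)
      ultimately show ?thesis using d(1) dB b Bc unfolding DC by blast
    qed
  qed
qed

lemma D_divisible: "subgroup X S \<Longrightarrow> x \<in> D X \<Longrightarrow> \<exists>y\<in>D X. y [^] p = x"
  using D_structure by metis

lemma D_subset_T: "subgroup X S \<Longrightarrow> D X \<subseteq> T"
  unfolding T_def by (intro dv_mono subgroup.subset)

lemma D_subgroup: assumes X: "subgroup X S" shows "subgroup (D X) S"
proof -
  obtain n where n: "D X = (\<lambda>b. b [^] (p ^ n :: nat)) ` (X \<inter> T)" using D_structure[OF X] by metis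
  have B: "subgroup (X \<inter> T) S" using X T.is_subgroup by (rule subgroups_Inter_pair)
  note Bc = subgroupD[OF B]
  show ?thesis
  proof (rule torsion_subgroupI)
    show "D X \<subseteq> carrier S" by (rule subset_trans[OF dv_subset subgroup.subset[OF X]])
    have "\<one> = \<one> [^] (p ^ n)" by simp
    then show "\<one> \<in> D X" unfolding n using Bc(2) by blast
    show "a \<otimes> a' \<in> D X" if a: "a \<in> D X" "a' \<in> D X" for a a'
    proof -
      obtain b b' where b: "b \<in> X \<inter> T" "a = b [^] (p ^ n)" "b' \<in> X \<inter> T" "a' = b' [^] (p ^ n)" using a unfolding n by blast
      then have "a \<otimes> a' = (b \<otimes> b') [^] (p ^ n)" using T_pow_distrib by simp
      then show ?thesis using b(1,3) Bc(3) unfolding n by blast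
    qed
  qed
qed

lemma conj_pow:
  "g \<in> carrier S \<Longrightarrow> x \<in> carrier S \<Longrightarrow> (g \<otimes> x \<otimes> inv g) [^] (n::nat) = g \<otimes> x [^] n \<otimes> inv g"
proof (induction n)
  case (Suc n)
  then show ?case by (simp add: m_assoc inv_solve_left) (simp add: m_assoc[symmetric])
qed simp

lemma D_conj:
  assumes X: "subgroup X S" and x: "x \<in> X" and d: "d \<in> D X" shows "x \<otimes> d \<otimes> inv x \<in> D X"
proof -
  note Xc = subgroupD[OF X]
  have "\<exists>y\<in>X. y [^] (p ^ n) = x \<otimes> d \<otimes> inv x" for n
  proof -
    obtain y where "y \<in> X" "y [^] (p ^ n) = d" using d unfolding dv_def by blast
    then have "(x \<otimes> y \<otimes> inv x) [^] (p ^ n) = x \<otimes> d \<otimes> inv x" using conj_pow[OF Xc(1)[OF x] Xc(1)] by simp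
    moreover have "x \<otimes> y \<otimes> inv x \<in> X" by (intro Xc(3,4) x \<open>y \<in> X\<close>)
    ultimately show ?thesis by blast
  qed
  moreover have "d \<in> X" using subsetD[OF dv_subset d] .
  then have "x \<otimes> d \<otimes> inv x \<in> X" by (intro Xc(3,4) x)
  ultimately show ?thesis by (simp add: dv_def)
qed

definition rk where "rk X = multiplicity p (card {x \<in> D X. x [^] p = \<one>})"

definition idx where "idx X = card ((\<lambda>a. D X #> a) ` X)"

lemma card_socle: assumes X: "subgroup X S" shows "card {x \<in> D X. x [^] p = \<one>} = p ^ rk X"
proof -
  let ?K = "{x \<in> D X. x [^] p = \<one>}"
  note Dc = subgroupD[OF D_subgroup[OF X]]
  have KT: "?K \<subseteq> {x \<in> T. x [^] p = \<one>}" using D_subset_T[OF X] by auto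
  then have fin: "finite ?K" using finite_T_socle finite_subset by blast
  have K: "subgroup ?K S"
  proof (rule subgroupI)
    show "a \<otimes> b \<in> ?K" if "a \<in> ?K" "b \<in> ?K" for a b
      using that Dc(3) subsetD[OF D_subset_T[OF X]] T_pow_distrib[of a b p] by auto
    show "inv a \<in> ?K" if "a \<in> ?K" for a
      using that Dc by (auto simp: nat_pow_inv)
  qed (use Dc in auto)
  interpret K: group "grp ?K" using subgroup_imp_group[OF K] .
  have "\<exists>a. order (grp ?K) = p ^ a"
  proof (rule p_group_order[OF p K.is_group])
    fix x assume "x \<in> carrier (grp ?K)"
    then have "x [^]\<^bsub>grp ?K\<^esub> (p ^ 1) = \<one>\<^bsub>grp ?K\<^esub>" by (simp flip: nat_pow_consistent)
    then show "\<exists>n. x [^]\<^bsub>grp ?K\<^esub> (p ^ n) = \<one>\<^bsub>grp ?K\<^esub>" by blast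
  qed (use fin in simp)
  then obtain a where "card ?K = p ^ a" by (auto simp: order_def)
  then show ?thesis using p by (simp add: rk_def multiplicity_same_power not_prime_unit)
qed

lemma toral_D: assumes X: "subgroup X S" shows "toral p (rk X) (grp (D X))"
proof -
  have sub: "D X \<subseteq> T" using D_subset_T[OF X] .
  have g: "group (grp (D X))" using D_subgroup[OF X] subgroup_imp_group by blast
  have "comm_group (grp (D X))"
    by (rule group.group_comm_groupI[OF g]) (use sub T_comm in auto)
  then show ?thesis
    unfolding toral_def[OF p]
    using card_socle[OF X] D_divisible[OF X] T_torsion sub by (auto simp flip: nat_pow_consistent)
qed

lemma T_rcosets_finite: "finite ((\<lambda>a. T #> a) ` carrier S)"
  using finite_quotient by (simp add: carrier_FactGroup)

definition nT where "nT = card ((\<lambda>a. T #> a) ` carrier S)"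

lemma rcos_T_eq: "a \<in> carrier S \<Longrightarrow> b \<in> carrier S \<Longrightarrow> T #> a = T #> b \<Longrightarrow> a \<otimes> inv b \<in> T"
proof -
  assume ab: "a \<in> carrier S" "b \<in> carrier S" "T #> a = T #> b"
  have "a \<in> T #> b" using rcos_self[OF ab(1) T.is_subgroup] ab(3) by simp
  then obtain t where "t \<in> T" "a = t \<otimes> b" by (auto simp: r_coset_def)
  then show ?thesis using ab T_closed(1) by (simp add: m_assoc)
qed

lemma coset_count:
  assumes X: "subgroup X S" and E: "subgroup E S" "E \<subseteq> X" and K: "finite K" "K \<subseteq> carrier S"
    and dec: "\<And>t. t \<in> X \<inter> T \<Longrightarrow> \<exists>d\<in>E. \<exists>b\<in>K. t = d \<otimes> b"
  shows "finite ((\<lambda>a. E #> a) ` X)" "card ((\<lambda>a. E #> a) ` X) \<le> card K * nT"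
proof -
  note Xc = subgroupD[OF X]
  define r where "r U = (SOME a. a \<in> X \<and> T #> a = U)" for U
  have r: "r (T #> x) \<in> X \<and> T #> r (T #> x) = T #> x" if "x \<in> X" for x
    unfolding r_def by (rule someI_ex) (use that in blast)
  let ?C = "(\<lambda>a. T #> a) ` carrier S"
  have sub: "(\<lambda>a. E #> a) ` X \<subseteq> (\<lambda>(b, U). E #> (b \<otimes> r U)) ` (K \<times> ?C)"
  proof
    fix V assume "V \<in> (\<lambda>a. E #> a) ` X"
    then obtain x where x: "x \<in> X" "V = E #> x" by blast
    let ?y = "r (T #> x)"
    have y: "?y \<in> X" "T #> x = T #> ?y" using r[OF x(1)] by auto
    have "x \<otimes> inv ?y \<in> X \<inter> T"
      by (intro IntI rcos_T_eq[OF Xc(1)[OF x(1)] Xc(1)[OF y(1)] y(2)] Xc(3,4) x(1) y(1))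
    then obtain d b where db: "d \<in> E" "b \<in> K" "x \<otimes> inv ?y = d \<otimes> b" using dec by blast
    have cc: "d \<in> carrier S" "b \<in> carrier S" "x \<in> carrier S" "?y \<in> carrier S"
      using db K(2) E subgroup.subset Xc(1) x(1) y(1) by blast+
    have "x = d \<otimes> (b \<otimes> ?y)" using db(3) cc by (metis inv_solve_right' m_assoc m_closed inv_closed)
    then have "V = E #> (b \<otimes> ?y)"
      using x(2) cc coset_mult_assoc[of E d "b \<otimes> ?y"] coset_join2[OF cc(1) E(1) db(1)] E Xc(1) by (metis m_closed subgroup.subset)
    then show "V \<in> (\<lambda>(b, U). E #> (b \<otimes> r U)) ` (K \<times> ?C)" using db(2) cc(3) by auto
  qed
  have fin: "finite (K \<times> ?C)" using K(1) T_rcosets_finite by blast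
  show "finite ((\<lambda>a. E #> a) ` X)" using sub fin finite_surj by blast
  have "card ((\<lambda>a. E #> a) ` X) \<le> card ((\<lambda>(b, U). E #> (b \<otimes> r U)) ` (K \<times> ?C))"
    by (rule card_mono[OF _ sub]) (use fin in blast)
  also have "\<dots> \<le> card (K \<times> ?C)" by (rule card_image_le[OF fin])
  finally show "card ((\<lambda>a. E #> a) ` X) \<le> card K * nT" by (simp add: card_cartesian_product nT_def)
qed

lemma D_rcosets_finite: assumes X: "subgroup X S" shows "finite ((\<lambda>a. D X #> a) ` X)"
proof -
  obtain n where n: "\<And>b. b \<in> X \<inter> T \<Longrightarrow> \<exists>d\<in>D X. \<exists>t\<in>X \<inter> T. t [^] (p ^ n :: nat) = \<one> \<and> b = d \<otimes> t"
    using D_structure[OF X] by metis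
  show ?thesis
  proof (rule coset_count(1)[OF X D_subgroup[OF X] dv_subset])
    show "finite {t \<in> T. t [^] (p ^ n :: nat) = \<one>}" by (rule finite_T_torsion)
  qed (use n T_closed(1) in blast)+
qed

lemma toral_extension_D: assumes X: "subgroup X S" shows "toral_extension p (grp X) (rk X) (D X)"
proof -
  interpret X: group "grp X" using subgroup_imp_group[OF X] .
  note Xc = subgroupD[OF X] and Dc = subgroupD[OF D_subgroup[OF X]]
  have sub: "subgroup (D X) (grp X)"
    using subgroup_incl[OF D_subgroup[OF X] X dv_subset] .
  have N: "D X \<lhd> grp X"
    unfolding X.normal_inv_iff using sub D_conj[OF X] X by (auto simp: m_inv_consistent)
  interpret N: normal "D X" "grp X" by fact
  have rc: "D X #>\<^bsub>grp X\<^esub> a = D X #> a" for a by (simp add: r_coset_def)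
  have car: "carrier (grp X Mod D X) = (\<lambda>a. D X #> a) ` X" by (simp add: carrier_FactGroup rc)
  have "p_group p (grp X Mod D X)"
    unfolding p_group_def
  proof (intro conjI ballI N.factorgroup_is_group)
    fix U assume "U \<in> carrier (grp X Mod D X)"
    then obtain a where a: "a \<in> X" "U = D X #>\<^bsub>grp X\<^esub> a" by (auto simp: car rc)
    obtain n where n: "a [^] (p ^ n :: nat) = \<one>" using torsion Xc(1)[OF a(1)] by blast
    have "U [^]\<^bsub>grp X Mod D X\<^esub> (p ^ n) = D X #>\<^bsub>grp X\<^esub> (a [^] (p ^ n))"
      unfolding a(2) using N.FactGroup_pow[of a "p ^ n"] a(1) by (simp flip: nat_pow_consistent)
    then show "\<exists>n. U [^]\<^bsub>grp X Mod D X\<^esub> (p ^ n) = \<one>\<^bsub>grp X Mod D X\<^esub>"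
      using n Dc(1) by (auto simp: rc r_coset_def intro!: exI[of _ n])
  qed
  moreover have "grp (D X) \<cong> Zpow p (rk X)"
    by (rule toral_classification[OF p toral_D[OF X]])
  ultimately show ?thesis
    using N D_rcosets_finite[OF X] by (simp add: toral_extension_def car)
qed

lemma toral_extension_unique:
  assumes X: "subgroup X S" and ext: "toral_extension p (grp X) k Z"
  shows "Z = D X" "k = rk X"
proof -
  have g: "group (grp X)" using subgroup_imp_group[OF X] .
  note e = toral_extensionD[OF p g ext]
  show "Z = D X" using e(5) by (simp add: dv_def flip: nat_pow_consistent)
  then have "p ^ k = p ^ rk X"
    using e(2) card_socle[OF X] unfolding toral_def[OF p] by (simp flip: nat_pow_consistent)
  then show "k = rk X" using p_gt_1 power_inject_exp by blast
qed

lemma identity_component_eq: assumes X: "subgroup X S" shows "identity_component p (grp X) = D X"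
  unfolding identity_component_def
  by (rule the_equality) (use toral_extension_D[OF X] toral_extension_unique[OF X] in blast)+

lemma toral_size_eq: assumes X: "subgroup X S" shows "toral_size p (grp X) = (rk X, idx X)"
proof -
  have "toral_rank p (grp X) = rk X"
    unfolding toral_rank_def
    by (rule the_equality) (use toral_extension_D[OF X] toral_extension_unique[OF X] in blast)+
  moreover have "carrier (grp X Mod D X) = (\<lambda>a. D X #> a) ` X"
    by (simp add: carrier_FactGroup r_coset_def)
  ultimately show ?thesis
    by (simp add: toral_size_def identity_component_eq[OF X] order_def idx_def)
qed

lemma identity_component_S: "identity_component p S = T"
  using identity_component_eq[OF subgroup_self] by (simp add: T_def)

lemma rk_mono: assumes "subgroup X S" "subgroup Y S" "X \<subseteq> Y" shows "rk X \<le> rk Y"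
proof -
  have "{x \<in> D X. x [^] p = \<one>} \<subseteq> {x \<in> D Y. x [^] p = \<one>}" using dv_mono[OF assms(3)] by blast
  moreover have "finite {x \<in> D Y. x [^] p = \<one>}"
    by (rule finite_subset[OF _ finite_T_socle]) (use D_subset_T[OF assms(2)] in blast)
  ultimately have "p ^ rk X \<le> p ^ rk Y" unfolding card_socle[OF assms(1), symmetric] card_socle[OF assms(2), symmetric]
    by (rule card_mono[rotated])
  then show ?thesis using p_gt_1 by (simp add: power_increasing_iff)
qed

lemma D_eq_if_rk_eq:
  assumes X: "subgroup X S" and Y: "subgroup Y S" and sub: "D X \<subseteq> D Y" and rk: "rk Y \<le> rk X"
  shows "D X = D Y"
proof -
  have t: "toral p (rk Y) (grp (D Y))" by (rule toral_D[OF Y])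
  have "D X = carrier (grp (D Y))"
  proof (rule divisible_subgroup_eq[OF p])
    show "comm_group (grp (D Y))"
      "\<And>x. x \<in> carrier (grp (D Y)) \<Longrightarrow> \<exists>n. x [^]\<^bsub>grp (D Y)\<^esub> (p ^ n :: nat) = \<one>\<^bsub>grp (D Y)\<^esub>"
      using t unfolding toral_def[OF p] by blast+
    show "subgroup (D X) (grp (D Y))" using subgroup_incl[OF D_subgroup[OF X] D_subgroup[OF Y] sub] .
    show "\<exists>y\<in>D X. y [^]\<^bsub>grp (D Y)\<^esub> p = x" if "x \<in> D X" for x
      using D_divisible[OF X that] by (simp flip: nat_pow_consistent)
    have "{x \<in> D X. x [^] p = \<one>} = {x \<in> D Y. x [^] p = \<one>}"
    proof (rule card_seteq)
      show "finite {x \<in> D Y. x [^] p = \<one>}"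
        by (rule finite_subset[OF _ finite_T_socle]) (use D_subset_T[OF Y] in blast)
      show "card {x \<in> D Y. x [^] p = \<one>} \<le> card {x \<in> D X. x [^] p = \<one>}"
        unfolding card_socle[OF X] card_socle[OF Y] using rk p_gt_0 by (simp add: power_increasing)
    qed (use sub in blast)
    then show "{x \<in> carrier (grp (D Y)). x [^]\<^bsub>grp (D Y)\<^esub> p = \<one>\<^bsub>grp (D Y)\<^esub>} \<subseteq> D X"
      by (auto simp flip: nat_pow_consistent)
  qed
  then show ?thesis by simp
qed

lemma size_strict_mono:
  assumes X: "subgroup X S" and Y: "subgroup Y S" and sub: "X \<subset> Y"
  shows "rk X < rk Y \<or> (rk X = rk Y \<and> idx X < idx Y)"
proof (cases "rk X < rk Y")
  case False
  then have rk: "rk X = rk Y" using rk_mono[OF X Y] sub by auto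
  then have eq: "D X = D Y" using D_eq_if_rk_eq[OF X Y dv_mono] sub by auto
  have "(\<lambda>a. D X #> a) ` X \<subset> (\<lambda>a. D Y #> a) ` Y"
  proof
    show "(\<lambda>a. D X #> a) ` X \<subseteq> (\<lambda>a. D Y #> a) ` Y" unfolding eq using sub by blast
    obtain y where y: "y \<in> Y" "y \<notin> X" using sub by blast
    have "D Y #> y \<notin> (\<lambda>a. D X #> a) ` X"
    proof
      assume "D Y #> y \<in> (\<lambda>a. D X #> a) ` X"
      then obtain x where x: "x \<in> X" "D X #> y = D X #> x" using eq by auto
      have "y \<in> D X #> y" by (rule rcos_self[OF _ D_subgroup[OF X]]) (use y subgroupD(1)[OF Y] in blast)
      then obtain d where "d \<in> D X" "y = d \<otimes> x" using x(2) by (auto simp: r_coset_def)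
      then show False using y x(1) subgroupD(3)[OF X] dv_subset[of S p X] by blast
    qed
    then show "(\<lambda>a. D X #> a) ` X \<noteq> (\<lambda>a. D Y #> a) ` Y" using y(1) by blast
  qed
  then have "idx X < idx Y" unfolding idx_def by (rule psubset_card_mono[OF D_rcosets_finite[OF Y]])
  then show ?thesis using rk by blast
qed simp

lemma iso_invariants:
  assumes X: "subgroup X S" and Y: "subgroup Y S" and f: "f \<in> hom (grp X) (grp Y)"
    and bij: "bij_betw f X Y"
  shows "f ` D X = D Y" "rk X = rk Y" "idx X = idx Y"
proof -
  note Xc = subgroupD[OF X]
  interpret f: group_hom "grp X" "grp Y" f
    using f X Y by (simp add: group_hom_def group_hom_axioms_def subgroup_imp_group)
  have pow: "f (x [^] (n::nat)) = f x [^] n" if "x \<in> X" for x n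
    using f.hom_nat_pow[of x n] that by (simp flip: nat_pow_consistent)
  have mult: "f (x \<otimes> y) = f x \<otimes> f y" if "x \<in> X" "y \<in> X" for x y using f.hom_mult that by simp
  have inj: "inj_on f X" and surj: "f ` X = Y" using bij by (auto simp: bij_betw_def)
  show D: "f ` D X = D Y"
  proof (intro equalityI subsetI)
    fix z assume "z \<in> f ` D X"
    then obtain x where x: "x \<in> D X" "z = f x" by blast
    have "\<exists>y\<in>Y. y [^] (p ^ n) = z" for n
    proof -
      obtain y where y: "y \<in> X" "y [^] (p ^ n) = x" using x(1) unfolding dv_def by blast
      then show ?thesis using x(2) pow surj by (metis imageI)
    qed
    then show "z \<in> D Y" using x surj unfolding dv_def by blast
  next
    fix z assume z: "z \<in> D Y"
    then obtain x where x: "x \<in> X" "z = f x" using surj unfolding dv_def by blast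
    have "\<exists>y\<in>X. y [^] (p ^ n) = x" for n
    proof -
      obtain y' where "y' \<in> Y" "y' [^] (p ^ n) = z" using z unfolding dv_def by blast
      then obtain y where y: "y \<in> X" "f y [^] (p ^ n) = z" using surj by blast
      then have "f (y [^] (p ^ n)) = f x" using pow x by simp
      then have "y [^] (p ^ n) = x" using inj_onD[OF inj] subgroup_pow_closed[OF X y(1)] x(1) by blast
      then show ?thesis using y(1) by blast
    qed
    then show "z \<in> f ` D X" using x unfolding dv_def by blast
  qed
  have DX: "D X \<subseteq> X" by (rule dv_subset)
  have "f ` {x \<in> D X. x [^] p = \<one>} = {x \<in> D Y. x [^] p = \<one>}"
  proof -
    have "f x [^] p = \<one> \<longleftrightarrow> x [^] p = \<one>" if "x \<in> X" for x
    proof -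
      have "f x [^] p = \<one> \<longleftrightarrow> f (x [^] p) = f \<one>" using pow[OF that] f.hom_one by simp
      also have "\<dots> \<longleftrightarrow> x [^] p = \<one>" using inj_on_eq_iff[OF inj subgroup_pow_closed[OF X that] Xc(2)] .
      finally show ?thesis .
    qed
    then show ?thesis unfolding D[symmetric] using subsetD[OF DX] by auto
  qed
  then have "card {x \<in> D Y. x [^] p = \<one>} = card {x \<in> D X. x [^] p = \<one>}"
    using card_image[OF inj_on_subset[OF inj, of "{x \<in> D X. x [^] p = \<one>}"]] DX by auto
  then show "rk X = rk Y" by (simp add: rk_def)
  have coset: "f ` (D X #> a) = D Y #> f a" if "a \<in> X" for a
  proof -
    have "f ` (D X #> a) = (\<lambda>d. f (d \<otimes> a)) ` D X" by (auto simp: r_coset_def)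
    also have "\<dots> = (\<lambda>d. f d \<otimes> f a) ` D X"
      by (rule image_cong[OF refl]) (use that subsetD[OF DX] mult in blast)
    also have "\<dots> = D Y #> f a" unfolding D[symmetric] by (auto simp: r_coset_def)
    finally show ?thesis .
  qed
  have "(\<lambda>U. f ` U) ` ((\<lambda>a. D X #> a) ` X) = (\<lambda>a. D Y #> a) ` Y"
    using coset surj by (force simp: image_image)
  moreover have "inj_on (\<lambda>U. f ` U) ((\<lambda>a. D X #> a) ` X)"
  proof (rule inj_onI)
    fix U V assume UV: "U \<in> (\<lambda>a. D X #> a) ` X" "V \<in> (\<lambda>a. D X #> a) ` X" "f ` U = f ` V"
    have sub: "W \<subseteq> X" if "W \<in> (\<lambda>a. D X #> a) ` X" for W
      using that DX Xc(3) by (auto simp: r_coset_def)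
    show "U = V" using inj_on_image_eq_iff[OF inj sub[OF UV(1)] sub[OF UV(2)]] UV(3) by blast
  qed
  ultimately show "idx X = idx Y" unfolding idx_def by (metis card_image)
qed

lemma subgroup_mult_normal:
  assumes P: "subgroup P S" and M: "subgroup M S" and c: "\<And>x d. x \<in> P \<Longrightarrow> d \<in> M \<Longrightarrow> cj x d \<in> M"
  shows "subgroup {x \<otimes> d | x d. x \<in> P \<and> d \<in> M} S" "P \<subseteq> {x \<otimes> d | x d. x \<in> P \<and> d \<in> M}" "M \<subseteq> {x \<otimes> d | x d. x \<in> P \<and> d \<in> M}"
proof -
  note Pc = subgroupD[OF P] and Mc = subgroupD[OF M]
  show "P \<subseteq> {x \<otimes> d | x d. x \<in> P \<and> d \<in> M}" using Pc(1) Mc(2) by (force intro: r_one[symmetric])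
  show "M \<subseteq> {x \<otimes> d | x d. x \<in> P \<and> d \<in> M}" using Mc(1) Pc(2) by (force intro: l_one[symmetric])
  show "subgroup {x \<otimes> d | x d. x \<in> P \<and> d \<in> M} S"
  proof (rule torsion_subgroupI)
    show "{x \<otimes> d | x d. x \<in> P \<and> d \<in> M} \<subseteq> carrier S" using Pc(1) Mc(1) by blast
    show "\<one> \<in> {x \<otimes> d | x d. x \<in> P \<and> d \<in> M}" using Pc(2) Mc(2) by force
  next
    fix a b assume "a \<in> {x \<otimes> d | x d. x \<in> P \<and> d \<in> M}" "b \<in> {x \<otimes> d | x d. x \<in> P \<and> d \<in> M}"
    then obtain x d y e where a: "x \<in> P" "d \<in> M" "a = x \<otimes> d" and b: "y \<in> P" "e \<in> M" "b = y \<otimes> e" by blast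
    have c': "x \<in> carrier S" "d \<in> carrier S" "y \<in> carrier S" "e \<in> carrier S" using Pc(1) Mc(1) a b by blast+
    have "a \<otimes> b = (x \<otimes> y) \<otimes> (cj (inv y) d \<otimes> e)" using c' a(3) b(3)
      by (simp add: conj_map_def m_assoc flip: m_assoc[of y "inv y"])
    moreover have "cj (inv y) d \<otimes> e \<in> M" by (intro c Mc(3) a(2) b(2) Pc(4) b(1))
    ultimately show "a \<otimes> b \<in> {x \<otimes> d | x d. x \<in> P \<and> d \<in> M}" using Pc(3)[OF a(1) b(1)] by blast
  qed
qed

lemma subgroup_T_torsion: assumes X: "subgroup X S" shows "subgroup {x \<in> X \<inter> T. x [^] (n :: nat) = \<one>} S"
  by (rule torsion_subgroupI) (use subgroupD[OF X] T_closed T_pow_distrib in auto)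

lemma normalizer_grows:
  assumes H: "subgroup H S" and Q: "subgroup Q S" and sub: "H \<subset> Q"
  obtains x where "x \<in> Q" "x \<notin> H" "\<And>h. h \<in> H \<Longrightarrow> x \<otimes> h \<otimes> inv x \<in> H"
proof -
  note Hc = subgroupD[OF H] and Qc = subgroupD[OF Q]
  text \<open>It suffices to find a group between \<open>H\<close> and \<open>Q\<close> in which \<open>H\<close> is proper of finite index.\<close>
  have "\<exists>Q'. subgroup Q' S \<and> H \<subset> Q' \<and> Q' \<subseteq> Q \<and> finite ((\<lambda>x. x \<star> H) ` Q')"
  proof (cases "Q \<inter> T \<subseteq> H")
    case True
    have "finite ((\<lambda>x. x \<star> H) ` Q)"
    proof -
      define r where "r U = (SOME a. a \<in> Q \<and> T #> a = U)" for U
      have r: "r (T #> x) \<in> Q \<and> T #> r (T #> x) = T #> x" if "x \<in> Q" for x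
        unfolding r_def by (rule someI_ex) (use that in blast)
      have "(\<lambda>x. x \<star> H) ` Q \<subseteq> (\<lambda>U. r U \<star> H) ` ((\<lambda>a. T #> a) ` carrier S)"
      proof
        fix V assume "V \<in> (\<lambda>x. x \<star> H) ` Q"
        then obtain x where x: "x \<in> Q" "V = x \<star> H" by blast
        let ?y = "r (T #> x)"
        have y: "?y \<in> Q" "T #> x = T #> ?y" using r[OF x(1)] by auto
        have c: "x \<in> carrier S" "?y \<in> carrier S" using x(1) y(1) Qc(1) by auto
        have t: "x \<otimes> inv ?y \<in> T" by (rule rcos_T_eq[OF c y(2)])
        have "inv ?y \<otimes> (x \<otimes> inv ?y) \<otimes> ?y \<in> T" using T.inv_op_closed1[OF c(2) t] .
        then have "inv ?y \<otimes> x \<in> T" using c by (simp add: m_assoc)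
        moreover have "inv ?y \<otimes> x \<in> Q" by (intro Qc(3,4) x(1) y(1))
        ultimately have h: "inv ?y \<otimes> x \<in> H" using True by blast
        have "x \<star> H = (?y \<otimes> (inv ?y \<otimes> x)) \<star> H" using c by (simp flip: m_assoc)
        also have "\<dots> = ?y \<star> ((inv ?y \<otimes> x) \<star> H)"
          using c subgroup.subset[OF H] by (simp add: lcos_m_assoc)
        also have "(inv ?y \<otimes> x) \<star> H = H" using coset_join3[OF _ H h] c by simp
        finally show "V \<in> (\<lambda>U. r U \<star> H) ` ((\<lambda>a. T #> a) ` carrier S)" using x(2) c(1) by blast
      qed
      then show ?thesis using T_rcosets_finite finite_subset by blast
    qed
    then show ?thesis using Q sub by blast
  next
    case False
    then obtain t where t: "t \<in> Q" "t \<in> T" "t \<notin> H" by blast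
    obtain n where n: "t [^] (p ^ n :: nat) = \<one>" using T_torsion t by blast
    define M where "M = {x \<in> Q \<inter> T. x [^] (p ^ n :: nat) = \<one>}"
    have finM: "finite M" unfolding M_def by (rule finite_subset[OF _ finite_T_torsion[of n]]) auto
    have M: "subgroup M S" unfolding M_def by (rule subgroup_T_torsion[OF Q])
    note Mc = subgroupD[OF M]
    have norm: "cj h m \<in> M" if "h \<in> Q" "m \<in> M" for h m
      using that Qc T.inv_op_closed2 T_closed(1) by (auto simp: M_def conj_pow conj_map_def)
    define Q' where "Q' = {h \<otimes> m | h m. h \<in> H \<and> m \<in> M}"
    have "cj h m \<in> M" if "h \<in> H" "m \<in> M" for h m using norm that sub by blast
    note Q' = subgroup_mult_normal[OF H M this, folded Q'_def]
    have "t \<in> M" using t n by (simp add: M_def)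
    then have strict: "H \<subset> Q'" using Q'(2,3) t(3) by blast
    have Q'Q: "Q' \<subseteq> Q" using sub Qc(3) by (auto simp: Q'_def M_def)
    have "(\<lambda>x. x \<star> H) ` Q' \<subseteq> (\<lambda>m. m \<star> H) ` M"
    proof
      fix V assume "V \<in> (\<lambda>x. x \<star> H) ` Q'"
      then obtain h m where hm: "h \<in> H" "m \<in> M" "V = (h \<otimes> m) \<star> H" by (auto simp: Q'_def)
      have c: "h \<in> carrier S" "m \<in> carrier S" using hm Hc(1) Mc(1) by auto
      have "h \<otimes> m = (h \<otimes> m \<otimes> inv h) \<otimes> h" using c by (simp add: m_assoc)
      then have "V = (h \<otimes> m \<otimes> inv h) \<star> (h \<star> H)"
        using hm(3) c subgroup.subset[OF H] by (simp add: lcos_m_assoc)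
      then have "V = (h \<otimes> m \<otimes> inv h) \<star> H" using coset_join3[OF c(1) H hm(1)] by simp
      then show "V \<in> (\<lambda>m. m \<star> H) ` M" using norm[of h m] hm sub unfolding conj_map_def by blast
    qed
    then have "finite ((\<lambda>x. x \<star> H) ` Q')" using finM finite_subset by blast
    then show ?thesis using Q'(1) strict Q'Q by blast
  qed
  then obtain Q' where Q': "subgroup Q' S" "H \<subset> Q'" "Q' \<subseteq> Q" "finite ((\<lambda>x. x \<star> H) ` Q')" by blast
  obtain x where "x \<in> Q'" "x \<notin> H" "\<And>h. h \<in> H \<Longrightarrow> x \<otimes> h \<otimes> inv x \<in> H"
    by (rule normalizer_grows_finite_index[OF p Q'(1) H Q'(2) _ Q'(4)]) (use torsion subgroupD(1)[OF Q'(1)] in blast)+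
  then show thesis using that Q'(3) by blast
qed

end

lemma (in group) normalizer_iff:
  assumes "P \<subseteq> carrier G"
  shows "g \<in> normalizer G P \<longleftrightarrow> g \<in> carrier G \<and> conj_map G g ` P = P"
proof -
  have "g \<star> P #> inv g = conj_map G g ` P" if "g \<in> carrier G"
    using that assms by (auto simp: l_coset_def r_coset_def conj_map_def)
  then show ?thesis using assms by (auto simp: normalizer_def stabilizer_def)
qed

lemma (in group) centralizer_subgroup:
  assumes "P \<subseteq> carrier G" shows "subgroup (centralizer G P) G"
proof (rule subgroupI)
  have *: "g \<in> centralizer G P \<longleftrightarrow> g \<in> carrier G \<and> (\<forall>x\<in>P. conj_map G g x = x)" for g
    using assms conj_map_commute by (auto simp: centralizer_def subset_iff)
  have "\<one> \<in> centralizer G P" using assms by (auto simp: centralizer_def)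
  then show "centralizer G P \<noteq> {}" by blast
  show "inv a \<in> centralizer G P" if "a \<in> centralizer G P" for a
    using that assms conj_map_inv(1)[of a] by (auto simp: * subset_iff) metis
  show "a \<otimes> b \<in> centralizer G P" if "a \<in> centralizer G P" "b \<in> centralizer G P" for a b
    using that assms by (auto simp: * conj_map_comp subset_iff)
qed (auto simp: centralizer_def)

section \<open>Saturated fusion systems\<close>

locale fusion = p_toral_group S p for S (structure) and p +
  fixes F :: "('a set, 'a \<Rightarrow> 'a) cat"
  assumes saturated: "saturated_fusion_system p S F"
begin

lemma fs: "fusion_system S F" using saturated by (simp add: saturated_fusion_system_def)

lemma Obj_F [simp]: "Obj F = {P. subgroup P S}" using fs by (simp add: fusion_system_def)

lemma F_sub: "subcategory F (subgroup_category S)" using fs by (simp add: fusion_system_def)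

lemma category_F: "category F" using F_sub by (simp add: subcategory_def)

lemma Ident_F: "subgroup P S \<Longrightarrow> Ident F P = (\<lambda>x\<in>P. x)"
  using F_sub by (simp add: subcategory_def subgroup_category_def)

lemma Comp_F:
  "\<lbrakk>subgroup P S; subgroup Q S; subgroup R S; f \<in> Hom F P Q; g \<in> Hom F Q R\<rbrakk> \<Longrightarrow> Comp F P Q R g f = compose P g f"
  using F_sub unfolding subcategory_def subgroup_category_def by simp

lemma Hom_FD:
  assumes "subgroup P S" "subgroup Q S" "f \<in> Hom F P Q"
  shows "f \<in> hom (grp P) (grp Q)" "f \<in> extensional P" "inj_on f P" "f ` P \<subseteq> Q"
    "x \<in> P \<Longrightarrow> y \<in> P \<Longrightarrow> f (x \<otimes> y) = f x \<otimes> f y"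
proof -
  have "f \<in> hom (grp P) (grp Q) \<inter> extensional P"
  proof -
    have "Hom F P Q \<subseteq> Hom (subgroup_category S) P Q" using F_sub assms(1,2) unfolding subcategory_def by simp
    then show ?thesis using assms(3) by (auto simp: subgroup_category_def)
  qed
  then show *: "f \<in> hom (grp P) (grp Q)" "f \<in> extensional P" by auto
  show "inj_on f P" using fs assms by (auto simp: fusion_system_def)
  show "f ` P \<subseteq> Q" "x \<in> P \<Longrightarrow> y \<in> P \<Longrightarrow> f (x \<otimes> y) = f x \<otimes> f y" using * by (auto simp: hom_def)
qed

definition FM :: "'a set \<Rightarrow> ('a \<Rightarrow> 'a) \<Rightarrow> bool" where
  "FM P f \<longleftrightarrow> subgroup P S \<and> restrict f P \<in> Hom F P (carrier S)"

lemma Comp_F_in: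
  "\<lbrakk>subgroup P S; subgroup Q S; subgroup R S; f \<in> Hom F P Q; g \<in> Hom F Q R\<rbrakk> \<Longrightarrow> compose P g f \<in> Hom F P R"
  using category.Comp_in[OF category_F, of P Q R f g] Comp_F by simp

lemma conj_in_F:
  assumes "subgroup P S" "subgroup Q S" "g \<in> carrier S" "cj g ` P \<subseteq> Q"
  shows "restrict (cj g) P \<in> Hom F P Q"
proof -
  have "conj_hom S (carrier S) P Q \<subseteq> Hom F P Q" using fs assms(1,2) by (simp add: fusion_system_def)
  then show ?thesis using assms unfolding conj_hom_def by blast
qed

lemma incl_in_F:
  assumes "subgroup P S" "subgroup Q S" "P \<subseteq> Q"
  shows "(\<lambda>x\<in>P. x) \<in> Hom F P Q"
proof -
  have c: "cj \<one> x = x" if "x \<in> P" for x using that subgroupD(1)[OF assms(1)] by simp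
  have "restrict (cj \<one>) P \<in> Hom F P Q" by (rule conj_in_F) (use c assms in auto)
  moreover have "restrict (cj \<one>) P = (\<lambda>x\<in>P. x)" using c by (intro restrict_ext) auto
  ultimately show ?thesis by simp
qed

lemma Hom_F_iso:
  assumes P: "subgroup P S" and Q: "subgroup Q S" and f: "f \<in> Hom F P Q"
  shows "subgroup (f ` P) S" "f \<in> isos F P (f ` P)"
proof -
  obtain R g where R: "subgroup R S" "R \<subseteq> Q" "g \<in> isos F P R" "f = Comp F P R Q (\<lambda>x\<in>R. x) g"
  proof -
    have "\<forall>P\<in>Obj F. \<forall>Q\<in>Obj F. \<forall>\<phi>\<in>Hom F P Q. \<exists>R\<in>Obj F. R \<subseteq> Q \<and> (\<exists>\<psi>\<in>isos F P R. \<phi> = Comp F P R Q (\<lambda>x\<in>R. x) \<psi>)"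
      using fs unfolding fusion_system_def by blast
    then show thesis using P Q f that by (metis Obj_F mem_Collect_eq)
  qed
  obtain h where h: "g \<in> Hom F P R" "h \<in> Hom F R P" "Comp F P R P h g = Ident F P" "Comp F R P R g h = Ident F R"
    using R(3) by (auto simp: isos_def)
  have "f = compose P (\<lambda>x\<in>R. x) g"
    using R(4) Comp_F[OF P R(1) Q h(1) incl_in_F[OF R(1) Q R(2)]] by simp
  also have "\<dots> = g"
    using Hom_FD(2,4)[OF P R(1) h(1)] by (auto simp: compose_def fun_eq_iff extensional_def)
  finally have fg: "f = g" .
  have "g ` P = R"
  proof
    show "R \<subseteq> g ` P"
    proof
      fix r assume r: "r \<in> R"
      have "compose R g h r = r" using h(4) Comp_F[OF R(1) P R(1) h(2,1)] Ident_F[OF R(1)] r by simp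
      then have "g (h r) = r" using r by (simp add: compose_def)
      moreover have "h r \<in> P" using Hom_FD(4)[OF R(1) P h(2)] r by blast
      ultimately show "r \<in> g ` P" by force
    qed
  qed (use Hom_FD(4)[OF P R(1) h(1)] in blast)
  then show "subgroup (f ` P) S" "f \<in> isos F P (f ` P)" using R fg by auto
qed

lemma Hom_F_iff:
  assumes P: "subgroup P S" and Q: "subgroup Q S"
  shows "f \<in> Hom F P Q \<longleftrightarrow> f \<in> extensional P \<and> FM P f \<and> f ` P \<subseteq> Q"
proof
  assume f: "f \<in> Hom F P Q"
  note d = Hom_FD[OF P Q f]
  have "compose P (\<lambda>x\<in>Q. x) f \<in> Hom F P (carrier S)"
    by (rule Comp_F_in[OF P Q subgroup_self f incl_in_F[OF Q subgroup_self subgroup.subset[OF Q]]])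
  moreover have "compose P (\<lambda>x\<in>Q. x) f = restrict f P" using d(4) by (auto simp: compose_def fun_eq_iff)
  ultimately have "restrict f P \<in> Hom F P (carrier S)" by simp
  then show "f \<in> extensional P \<and> FM P f \<and> f ` P \<subseteq> Q" using P d(2,4) unfolding FM_def by blast
next
  assume a: "f \<in> extensional P \<and> FM P f \<and> f ` P \<subseteq> Q"
  then have "restrict f P = f" "restrict f P \<in> Hom F P (carrier S)" unfolding FM_def by (blast intro: extensional_restrict)+
  then have f: "f \<in> Hom F P (carrier S)" by simp
  note i = Hom_F_iso[OF P subgroup_self f]
  have "compose P (\<lambda>x\<in>f ` P. x) f \<in> Hom F P Q"
    by (rule Comp_F_in[OF P i(1) Q _ incl_in_F[OF i(1) Q]]) (use i(2) a in \<open>auto simp: isos_def\<close>)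
  moreover have "compose P (\<lambda>x\<in>f ` P. x) f = f" using a by (auto simp: compose_def fun_eq_iff extensional_def)
  ultimately show "f \<in> Hom F P Q" by simp
qed

lemma FM_Hom: "FM P f \<Longrightarrow> subgroup Q S \<Longrightarrow> f ` P \<subseteq> Q \<Longrightarrow> restrict f P \<in> Hom F P Q"
  by (subst Hom_F_iff) (auto simp: FM_def)

lemma FMD:
  assumes "FM P f"
  shows "subgroup P S" "inj_on f P" "f ` P \<subseteq> carrier S" "subgroup (f ` P) S"
    "x \<in> P \<Longrightarrow> y \<in> P \<Longrightarrow> f (x \<otimes> y) = f x \<otimes> f y" "x \<in> P \<Longrightarrow> f x \<in> carrier S"
proof -
  show P: "subgroup P S" using assms by (simp add: FM_def)
  have h: "restrict f P \<in> Hom F P (carrier S)" using assms by (simp add: FM_def)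
  note d = Hom_FD[OF P subgroup_self h]
  show "inj_on f P" using d(3) by (simp add: inj_on_def)
  show "f ` P \<subseteq> carrier S" "x \<in> P \<Longrightarrow> f x \<in> carrier S" using d(4) by auto
  show "x \<in> P \<Longrightarrow> y \<in> P \<Longrightarrow> f (x \<otimes> y) = f x \<otimes> f y" using d(5)[of x y] subgroupD(3)[OF P] by simp
  show "subgroup (f ` P) S" using Hom_F_iso(1)[OF P subgroup_self h] by simp
qed

lemma FM_hom:
  assumes "FM P f" "subgroup Q S" "f ` P \<subseteq> Q"
  shows "f \<in> hom (grp P) (grp Q)"
  using FMD[OF assms(1)] assms(3) by (auto simp: hom_def)

lemma FM_group_hom: "FM P f \<Longrightarrow> group_hom (grp P) S f"
  using FM_hom[OF _ subgroup_self] FMD(1,3)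
  by (simp add: group_hom_def group_hom_axioms_def subgroup_imp_group is_group)

lemma FM_pow: "FM P f \<Longrightarrow> x \<in> P \<Longrightarrow> f (x [^] (n::nat)) = f x [^] n"
  using group_hom.hom_nat_pow[OF FM_group_hom, of P f x n] by (simp flip: nat_pow_consistent)

lemma FM_inv: assumes "FM P f" "x \<in> P" shows "f (inv x) = inv (f x)"
  using group_hom.hom_inv[OF FM_group_hom[OF assms(1)], of x] assms(2)
  unfolding m_inv_consistent[OF FMD(1)[OF assms(1)] assms(2)] by simp

lemma FM_one: assumes "FM P f" shows "f \<one> = \<one>"
  using FM_pow[OF assms subgroupD(2)[OF FMD(1)[OF assms]], of 0] by simp

lemma FM_cong: "FM P f \<Longrightarrow> (\<And>x. x \<in> P \<Longrightarrow> f x = g x) \<Longrightarrow> FM P g"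
  unfolding FM_def by (metis (no_types, lifting) restrict_ext)

lemma FM_id: "subgroup P S \<Longrightarrow> FM P (\<lambda>x. x)"
  using incl_in_F[OF _ subgroup_self] by (simp add: FM_def subgroup.subset)

lemma FM_conj: "subgroup P S \<Longrightarrow> g \<in> carrier S \<Longrightarrow> FM P (cj g)"
  using conj_in_F[OF _ subgroup_self] subgroup.subset by (fastforce simp: FM_def conj_map_closed)

lemma FM_comp:
  assumes f: "FM P f" and g: "FM Q g" and sub: "f ` P \<subseteq> Q"
  shows "FM P (\<lambda>x. g (f x))"
proof -
  have "compose P (restrict g Q) (restrict f P) \<in> Hom F P (carrier S)"
    by (rule Comp_F_in[OF FMD(1)[OF f] FMD(1)[OF g] subgroup_self FM_Hom[OF f FMD(1)[OF g] sub]]) (use g in \<open>simp add: FM_def\<close>)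
  moreover have "compose P (restrict g Q) (restrict f P) = restrict (\<lambda>x. g (f x)) P"
    using sub by (auto simp: compose_def fun_eq_iff)
  ultimately show ?thesis using FMD(1)[OF f] by (simp add: FM_def)
qed

lemma FM_restrict: assumes "FM P f" "subgroup Q S" "Q \<subseteq> P" shows "FM Q f"
  using FM_comp[OF FM_id[OF assms(2)] assms(1)] assms(3) by simp

lemma FM_inverse: assumes f: "FM P f" shows "FM (f ` P) (inv_into P f)"
proof -
  note d = FMD[OF f]
  let ?g = "restrict f P"
  have h: "?g \<in> Hom F P (carrier S)" using f by (simp add: FM_def)
  have im: "?g ` P = f ` P" by simp
  have "?g \<in> isos F P (f ` P)" using Hom_F_iso(2)[OF d(1) subgroup_self h] by simp
  then obtain k where k: "?g \<in> Hom F P (f ` P)" "k \<in> Hom F (f ` P) P" "Comp F P (f ` P) P k ?g = Ident F P"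
    by (auto simp: isos_def)
  have "compose P k ?g = (\<lambda>x\<in>P. x)" using k Comp_F[OF d(1,4,1) k(1,2)] Ident_F[OF d(1)] by simp
  then have kf: "k (f x) = x" if "x \<in> P" for x using that by (metis (no_types, lifting) compose_eq restrict_apply')
  have "FM (f ` P) k" using Hom_F_iff[OF d(4,1)] k(2) by blast
  then show ?thesis by (rule FM_cong) (use kf inv_into_f_f[OF d(2)] in auto)
qed

lemma isomorphic_F: "isomorphic_in F P Q \<longleftrightarrow> (\<exists>f. FM P f \<and> f ` P = Q)"
proof
  assume "isomorphic_in F P Q"
  then obtain f g where PQ: "subgroup P S" "subgroup Q S" and fg: "f \<in> Hom F P Q" "g \<in> Hom F Q P" "Comp F Q P Q f g = Ident F Q"
    by (auto simp: isomorphic_in_def isos_def)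
  have "compose Q f g = (\<lambda>x\<in>Q. x)" using fg Comp_F[OF PQ(2,1,2) fg(2,1)] Ident_F[OF PQ(2)] by simp
  then have "f (g x) = x" if "x \<in> Q" for x using that by (metis (no_types, lifting) compose_eq restrict_apply')
  then have "Q \<subseteq> f ` P" using Hom_FD(4)[OF PQ(2,1) fg(2)] by force
  then show "\<exists>f. FM P f \<and> f ` P = Q" using Hom_F_iff[OF PQ] fg(1) by blast
next
  assume "\<exists>f. FM P f \<and> f ` P = Q"
  then obtain f where f: "FM P f" "f ` P = Q" by blast
  note d = FMD[OF f(1)]
  have "restrict f P \<in> isos F P (restrict f P ` P)"
    by (rule Hom_F_iso(2)[OF d(1) subgroup_self]) (use f in \<open>simp add: FM_def\<close>)
  then have "restrict f P \<in> isos F P Q" using f(2) by simp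
  then have "isos F P Q \<noteq> {}" by blast
  moreover have "subgroup Q S" using d(4) f(2) by blast
  ultimately show "isomorphic_in F P Q" using d(1) by (simp add: isomorphic_in_def)
qed

lemma isomorphic_refl: "subgroup P S \<Longrightarrow> isomorphic_in F P P"
  unfolding isomorphic_F by (intro exI[of _ "\<lambda>x. x"]) (simp add: FM_id)

lemma isomorphic_image: assumes "isomorphic_in F P Q" "FM Q f" shows "isomorphic_in F P (f ` Q)"
proof -
  obtain g where g: "FM P g" "g ` P = Q" using assms(1) unfolding isomorphic_F by blast
  then have "FM P (\<lambda>x. f (g x))" using FM_comp[OF g(1) assms(2)] by blast
  moreover have "(\<lambda>x. f (g x)) ` P = f ` Q" using g(2) by (simp flip: image_image)
  ultimately show ?thesis unfolding isomorphic_F by blast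
qed

lemma isomorphic_trans: "isomorphic_in F P Q \<Longrightarrow> isomorphic_in F Q R \<Longrightarrow> isomorphic_in F P R"
  using isomorphic_image unfolding isomorphic_F[of Q R] by blast

lemma isomorphic_sym: assumes "isomorphic_in F P Q" shows "isomorphic_in F Q P"
proof -
  obtain g where g: "FM P g" "g ` P = Q" using assms(1) unfolding isomorphic_F by blast
  have "inv_into P g ` g ` P = P" using inv_into_image_cancel[OF FMD(2)[OF g(1)] order_refl] .
  then show ?thesis unfolding isomorphic_F using FM_inverse[OF g(1)] g(2) by blast
qed

lemma FM_invariants:
  assumes "FM P f" shows "f ` D P = D (f ` P)" "rk (f ` P) = rk P" "idx (f ` P) = idx P"
  using iso_invariants[OF FMD(1)[OF assms] FMD(4)[OF assms] FM_hom[OF assms FMD(4)[OF assms] order_refl]]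
    FMD(2)[OF assms] by (auto simp: bij_betw_def)

lemma extension:
  assumes f: "FM P f" and fc: "fully_centralized p S F (f ` P)" and X: "subgroup X S" "P \<subseteq> X"
    and ext: "\<And>g. g \<in> X \<Longrightarrow> cj g ` P = P \<and> (\<exists>h\<in>carrier S. \<forall>x\<in>P. f (cj g x) = cj h (f x))"
  shows "\<exists>k. FM X k \<and> (\<forall>x\<in>P. k x = f x)"
proof -
  note d = FMD[OF f]
  have Ps: "P \<subseteq> carrier S" using d(1) by (rule subgroup.subset)
  let ?f = "restrict f P"
  let ?N = "N_phi S P ?f"
  let ?good = "\<lambda>g. g \<in> carrier S \<and> cj g ` P = P \<and> (\<exists>h\<in>carrier S. \<forall>x\<in>P. f (cj g x) = cj h (f x))"
  have N: "g \<in> ?N \<longleftrightarrow> ?good g" for g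
  proof
    assume "g \<in> ?N"
    then have g: "g \<in> carrier S" "cj g ` P = P"
      and m: "(\<lambda>x\<in>?f ` P. ?f (cj g (inv_into P ?f x))) \<in> conj_hom S (carrier S) (?f ` P) (?f ` P)"
      using normalizer_iff[OF Ps] by (auto simp: N_phi_def)
    obtain h where h: "h \<in> carrier S" "(\<lambda>x\<in>?f ` P. ?f (cj g (inv_into P ?f x))) = restrict (cj h) (?f ` P)"
      using m unfolding conj_hom_def by auto
    have inj: "inj_on ?f P" using d(2) by (simp add: inj_on_def)
    have "f (cj g x) = cj h (f x)" if x: "x \<in> P" for x
    proof -
      have "(\<lambda>x\<in>?f ` P. ?f (cj g (inv_into P ?f x))) (?f x) = restrict (cj h) (?f ` P) (?f x)"
        by (simp only: h(2))
      then have "?f (cj g (inv_into P ?f (?f x))) = cj h (?f x)" using x by simp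
      moreover have "inv_into P ?f (?f x) = x" by (rule inv_into_f_f[OF inj x])
      moreover have "cj g x \<in> P" using g(2) x by blast
      ultimately show ?thesis using x by simp
    qed
    then show "?good g" using g h(1) by blast
  next
    assume g: "?good g"
    then obtain h where h: "h \<in> carrier S" "\<And>x. x \<in> P \<Longrightarrow> f (cj g x) = cj h (f x)" by blast
    have inj: "inj_on ?f P" using d(2) by (simp add: inj_on_def)
    have gP: "cj g x \<in> P" if "x \<in> P" for x using g that by blast
    have "(\<lambda>x\<in>?f ` P. ?f (cj g (inv_into P ?f x))) = restrict (cj h) (?f ` P)"
    proof (rule restrict_ext)
      fix y assume "y \<in> ?f ` P"
      then obtain x where x: "x \<in> P" "y = ?f x" by blast
      then show "?f (cj g (inv_into P ?f y)) = cj h y"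
        using inv_into_f_f[OF inj x(1)] h(2)[OF x(1)] gP[OF x(1)] by simp
    qed
    moreover have "cj h ` (?f ` P) \<subseteq> ?f ` P"
      using h(2) gP by (auto simp flip: h(2))
    ultimately have "(\<lambda>x\<in>?f ` P. ?f (cj g (inv_into P ?f x))) \<in> conj_hom S (carrier S) (?f ` P) (?f ` P)"
      unfolding conj_hom_def using h(1) by blast
    then show "g \<in> ?N" using g normalizer_iff[OF Ps] unfolding N_phi_def by blast
  qed
  have NS: "subgroup ?N S"
  proof (rule torsion_subgroupI)
    show "?N \<subseteq> carrier S" using iffD1[OF N] by blast
    have "?good \<one>"
    proof (intro conjI bexI[of _ \<one>] ballI)
      show "cj \<one> ` P = P" using conj_map_one[OF subsetD[OF Ps]] by simp
      show "f (cj \<one> x) = cj \<one> (f x)" if "x \<in> P" for x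
        using conj_map_one[OF subsetD[OF Ps that]] conj_map_one[OF d(6)[OF that]] by simp
    qed auto
    then show "\<one> \<in> ?N" by (rule iffD2[OF N])
  next
    fix a b assume "a \<in> ?N" "b \<in> ?N"
    obtain h where a: "a \<in> carrier S" "cj a ` P = P" and h: "h \<in> carrier S" "\<And>x. x \<in> P \<Longrightarrow> f (cj a x) = cj h (f x)"
      using iffD1[OF N \<open>a \<in> ?N\<close>] by blast
    obtain k where b: "b \<in> carrier S" "cj b ` P = P" and k: "k \<in> carrier S" "\<And>x. x \<in> P \<Longrightarrow> f (cj b x) = cj k (f x)"
      using iffD1[OF N \<open>b \<in> ?N\<close>] by blast
    have im: "cj (a \<otimes> b) ` P = P"
    proof -
      have "cj (a \<otimes> b) ` P = cj a ` cj b ` P"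
        unfolding image_image by (rule image_cong[OF refl]) (use Ps a b conj_map_comp in auto)
      then show ?thesis using a b by simp
    qed
    have "f (cj (a \<otimes> b) x) = cj (h \<otimes> k) (f x)" if x: "x \<in> P" for x
    proof -
      have bx: "cj b x \<in> P" using b x by blast
      show ?thesis using conj_map_comp[OF a(1) b(1), of x] conj_map_comp[OF h(1) k(1) d(6)[OF x]] h(2)[OF bx] k(2)[OF x] x Ps by auto
    qed
    then have "?good (a \<otimes> b)" using m_closed[OF a(1) b(1)] im m_closed[OF h(1) k(1)] by blast
    then show "a \<otimes> b \<in> ?N" by (rule iffD2[OF N])
  qed
  have "?f \<in> Hom F P (carrier S)" using f by (simp add: FM_def)
  moreover have "fully_centralized p S F (?f ` P)" using fc by simp
  moreover have "\<forall>P\<in>Obj F. \<forall>\<phi>\<in>Hom F P (carrier S). fully_centralized p S F (\<phi> ` P) \<longrightarrow>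
        (\<exists>\<psi>\<in>Hom F (N_phi S P \<phi>) (carrier S). restrict \<psi> P = \<phi>)"
    using saturated unfolding saturated_fusion_system_def by blast
  moreover have "P \<in> Obj F" using d(1) by simp
  ultimately have "\<exists>k\<in>Hom F ?N (carrier S). restrict k P = ?f" by blast
  then obtain k where k: "k \<in> Hom F ?N (carrier S)" "restrict k P = ?f" by blast
  have XN: "X \<subseteq> ?N"
  proof
    fix g assume g: "g \<in> X"
    then have "?good g" using ext[OF g] subgroupD(1)[OF X(1) g] by blast
    then show "g \<in> ?N" by (rule iffD2[OF N])
  qed
  have "FM ?N k" using Hom_F_iff[OF NS subgroup_self] k(1) by blast
  then have "FM X k" by (rule FM_restrict[OF _ X(1) XN])
  moreover have "k x = f x" if "x \<in> P" for x using k(2) that by (metis restrict_apply')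
  ultimately show ?thesis by blast
qed

lemma extension_centralizer:
  assumes f: "FM E f" and fc: "fully_centralized p S F (f ` E)" and ab: "\<And>x y. x \<in> E \<Longrightarrow> y \<in> E \<Longrightarrow> x \<otimes> y = y \<otimes> x"
  shows "\<exists>k. FM (centralizer S E) k \<and> (\<forall>x\<in>E. k x = f x)"
proof (rule extension[OF f fc])
  note d = FMD[OF f]
  have Es: "E \<subseteq> carrier S" using d(1) by (rule subgroup.subset)
  show "subgroup (centralizer S E) S" by (rule centralizer_subgroup[OF Es])
  show "E \<subseteq> centralizer S E" using ab Es by (auto simp: centralizer_def)
  fix g assume g: "g \<in> centralizer S E"
  then have c: "cj g x = x" if "x \<in> E" for x
    using that Es conj_map_commute[of g x] by (auto simp: centralizer_def)
  have "cj \<one> (f x) = f x" if "x \<in> E" for x using d(6)[OF that] by simp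
  then show "cj g ` E = E \<and> (\<exists>h\<in>carrier S. \<forall>x\<in>E. f (cj g x) = cj h (f x))"
    using c by (auto intro!: bexI[of _ \<one>])
qed

lemma union_extension:
  assumes "\<And>n. FM (P n) f" "\<And>n::nat. P n \<subseteq> P (Suc n)"
  shows "FM (\<Union>n. P n) f"
proof -
  have inc: "P m \<subseteq> P n" if "m \<le> n" for m n using lift_Suc_mono_le[of P] assms(2) that by blast
  have common: "\<exists>n. x \<in> P n \<and> y \<in> P n" if "x \<in> (\<Union>n. P n)" "y \<in> (\<Union>n. P n)" for x y
    using that inc by (metis UN_E max.cobounded1 max.cobounded2 subsetD)
  note d = FMD[OF assms(1)]
  have U: "subgroup (\<Union>n. P n) S"
  proof (rule torsion_subgroupI)
    show "a \<otimes> b \<in> (\<Union>n. P n)" if "a \<in> (\<Union>n. P n)" "b \<in> (\<Union>n. P n)" for a b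
      using common[OF that] subgroupD(3)[OF d(1)] by blast
    show "(\<Union>n. P n) \<subseteq> carrier S" using subgroup.subset[OF d(1)] by blast
    show "\<one> \<in> (\<Union>n. P n)" using subgroupD(2)[OF d(1)] by blast
  qed
  let ?f = "restrict f (\<Union>n. P n)"
  have "?f \<in> hom (grp (\<Union>n. P n)) (grp (carrier S)) \<inter> extensional (\<Union>n. P n)"
  proof (intro IntI homI)
    fix x y assume xy: "x \<in> carrier (grp (\<Union>n. P n))" "y \<in> carrier (grp (\<Union>n. P n))"
    then obtain n where n: "x \<in> P n" "y \<in> P n" using common[of x y] by auto
    moreover have "x \<otimes> y \<in> P n" using subgroupD(3)[OF d(1)] n by blast
    ultimately show "?f (x \<otimes>\<^bsub>grp (\<Union>n. P n)\<^esub> y) = ?f x \<otimes>\<^bsub>grp (carrier S)\<^esub> ?f y"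
      using d(5)[OF n] xy by auto
  qed (use d(6) in auto)
  then have "?f \<in> Hom (subgroup_category S) (\<Union>n. P n) (carrier S)" by (simp add: subgroup_category_def)
  moreover have "P n \<in> Obj F \<and> P n \<subseteq> P (Suc n) \<and> restrict ?f (P n) \<in> Hom F (P n) (carrier S)" for n
  proof -
    have "restrict ?f (P n) = restrict f (P n)" by (auto simp: fun_eq_iff)
    then show ?thesis using assms by (simp add: FM_def)
  qed
  moreover have "\<forall>P :: nat \<Rightarrow> 'a set. \<forall>\<phi>\<in>Hom (subgroup_category S) (\<Union>n. P n) (carrier S).
        (\<forall>n. P n \<in> Obj F \<and> P n \<subseteq> P (Suc n) \<and> restrict \<phi> (P n) \<in> Hom F (P n) (carrier S)) \<longrightarrow>
        \<phi> \<in> Hom F (\<Union>n. P n) (carrier S)"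
    using saturated unfolding saturated_fusion_system_def by blast
  ultimately have "?f \<in> Hom F (\<Union>n. P n) (carrier S)" by blast
  then show ?thesis using U by (simp add: FM_def)
qed

lemma D_D: assumes "subgroup X S" shows "D (D X) = D X"
proof
  show "D X \<subseteq> D (D X)"
    using divisible_power[OF p is_group D_divisible[OF assms] subgroup.subset[OF D_subgroup[OF assms]]]
    by (auto simp: dv_def[of S p "D X"])
qed (rule dv_subset)

lemma idx_bound:
  assumes X: "subgroup X S" and Y: "subgroup Y S" and sub: "D Y \<subseteq> D X"
    and pow: "\<And>t. t \<in> X \<inter> T \<Longrightarrow> t [^] (p ^ N :: nat) \<in> D Y"
  shows "idx X \<le> card {t \<in> T. t [^] (p ^ N :: nat) = \<one>} * nT"
  unfolding idx_def
proof (rule coset_count(2)[OF X D_subgroup[OF X] dv_subset])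
  show "finite {t \<in> T. t [^] (p ^ N) = \<one>}" "{t \<in> T. t [^] (p ^ N) = \<one>} \<subseteq> carrier S"
    using finite_T_torsion[of N] T_closed(1) by auto
  fix t assume t: "t \<in> X \<inter> T"
  then have tT: "t \<in> T" by blast
  have "t [^] (p ^ N) \<in> D (D Y)" using pow[OF t] D_D[OF Y] by simp
  then obtain u where u: "u \<in> D Y" "u [^] (p ^ N) = t [^] (p ^ N)" unfolding dv_def[of S p "D Y"] by blast
  have uT: "u \<in> T" using D_subset_T[OF Y] u(1) by blast
  note uc = T_closed(1)[OF uT] and tc = T_closed(1)[OF tT]
  have "(inv u \<otimes> t) [^] (p ^ N) = \<one>"
    using T_pow_distrib[OF T_closed(4)[OF uT] tT] u(2) uc tc by (simp add: nat_pow_inv)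
  then have "inv u \<otimes> t \<in> {t \<in> T. t [^] (p ^ N) = \<one>}" using T_closed(3)[OF T_closed(4)[OF uT] tT] by simp
  moreover have "t = u \<otimes> (inv u \<otimes> t)" using uc tc by (simp flip: m_assoc)
  ultimately show "\<exists>d\<in>D X. \<exists>b\<in>{t \<in> T. t [^] (p ^ N) = \<one>}. t = d \<otimes> b" using sub u(1) by blast
qed

lemma D_T: "D T = T"
  using D_D[OF subgroup_self] by (simp add: T_def)

lemma FM_T_surj: assumes "FM T f" shows "f ` T = T"
proof -
  note d = FMD[OF assms] and i = FM_invariants[OF assms]
  have DfT: "D (f ` T) = f ` T" using i(1) D_T by simp
  then have sub: "f ` T \<subseteq> T" using D_subset_T[OF d(4)] by simp
  have "D (f ` T) = D T" by (rule D_eq_if_rk_eq[OF d(4) T.is_subgroup dv_mono[OF sub]]) (simp add: i(2))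
  then show ?thesis using DfT D_T by simp
qed

lemma rk_T: "D (centralizer S Q) = T \<and> idx (centralizer S Q) \<le> nT"
  if Q: "Q \<subseteq> carrier S" and rk: "rk (centralizer S Q) = rk (carrier S)"
proof -
  have C: "subgroup (centralizer S Q) S" by (rule centralizer_subgroup[OF Q])
  have "D (centralizer S Q) = D (carrier S)"
    by (rule D_eq_if_rk_eq[OF C subgroup_self dv_mono[OF subgroup.subset[OF C]]]) (simp add: rk)
  then have D: "D (centralizer S Q) = T" by (simp add: T_def)
  have "idx (centralizer S Q) \<le> nT"
    unfolding idx_def D nT_def by (rule card_mono[OF T_rcosets_finite]) (use subgroup.subset[OF C] in blast)
  then show ?thesis using D by blast
qed

lemma exists_fully_centralized:
  assumes E: "subgroup E S" "E \<subseteq> T"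
  shows "\<exists>f. FM E f \<and> fully_centralized p S F (f ` E)"
proof -
  have sub: "Q \<subseteq> carrier S" if "isomorphic_in F E Q" for Q
    using that FMD(3) unfolding isomorphic_F by blast
  note C = centralizer_subgroup[OF sub]
  let ?P = "\<lambda>Q. isomorphic_in F E Q \<and> rk (centralizer S Q) = rk (carrier S)"
  have "T \<subseteq> centralizer S E" using T_comm E(2) T_closed(1) by (auto simp: centralizer_def subset_iff)
  then have "rk T \<le> rk (centralizer S E)" using rk_mono[OF T.is_subgroup C] isomorphic_refl[OF E(1)] by blast
  moreover have "rk T = rk (carrier S)" using D_T by (simp add: rk_def T_def)
  moreover have "rk (centralizer S E) \<le> rk (carrier S)"
    using rk_mono[OF C subgroup_self] isomorphic_refl[OF E(1)] subgroup.subset[OF C] by blast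
  ultimately have "rk (centralizer S E) = rk (carrier S)" by linarith
  then have PE: "?P E" using isomorphic_refl[OF E(1)] by blast
  have bound: "idx (centralizer S Q) \<le> nT" if "?P Q" for Q using rk_T[OF sub] that by blast
  define Q where "Q = arg_max (\<lambda>Q. idx (centralizer S Q)) ?P"
  have Q: "?P Q" "\<And>Q'. ?P Q' \<Longrightarrow> idx (centralizer S Q') \<le> idx (centralizer S Q)"
    using arg_max_nat_lemma[of ?P E "\<lambda>Q. idx (centralizer S Q)" "Suc nT"] PE bound unfolding Q_def by (auto simp: less_Suc_eq_le)
  have "fully_centralized p S F Q"
    unfolding fully_centralized_def
  proof (intro conjI allI impI)
    show "Q \<in> Obj F" using Q(1) FMD(4) unfolding isomorphic_F by auto
    fix Q' assume "isomorphic_in F Q Q'"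
    then have EQ': "isomorphic_in F E Q'" using isomorphic_trans Q(1) by blast
    note C' = C[OF EQ'] and C0 = C[OF conjunct1[OF Q(1)]]
    have "rk (centralizer S Q') \<le> rk (carrier S)" using rk_mono[OF C' subgroup_self subgroup.subset[OF C']] .
    then show "size_le (toral_size p (grp (centralizer S Q'))) (toral_size p (grp (centralizer S Q)))"
      unfolding toral_size_eq[OF C'] toral_size_eq[OF C0] size_le_def using Q EQ' by (auto simp: le_less)
  qed
  then show ?thesis using Q(1) unfolding isomorphic_F by blast
qed

lemma extends_to_T:
  assumes B: "B \<subseteq> T" and f: "FM B f" and fB: "f ` B \<subseteq> T"
  shows "\<exists>w. FM T w \<and> (\<forall>x\<in>B. w x = f x)"
proof -
  note d = FMD[OF f]
  have ab: "x \<otimes> y = y \<otimes> x" if "x \<in> A" "y \<in> A" "A \<subseteq> T" for x y A using that T_comm by blast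
  have TC: "T \<subseteq> centralizer S A" if "A \<subseteq> T" for A
    using that T_comm T_closed(1) by (auto simp: centralizer_def subset_iff)
  obtain g where g: "FM (f ` B) g" "fully_centralized p S F (g ` f ` B)"
    using exists_fully_centralized[OF d(4) fB] by blast
  obtain k2 where k2: "FM (centralizer S (f ` B)) k2" "\<And>x. x \<in> f ` B \<Longrightarrow> k2 x = g x"
    using extension_centralizer[OF g ab[OF _ _ fB]] by blast
  have gf: "FM B (\<lambda>x. g (f x))" by (rule FM_comp[OF f g(1) order_refl])
  obtain k1 where k1: "FM (centralizer S B) k1" "\<And>x. x \<in> B \<Longrightarrow> k1 x = g (f x)"
    using extension_centralizer[OF gf _ ab[OF _ _ B]] g(2) unfolding image_image by blast
  have v1: "FM T k1" by (rule FM_restrict[OF k1(1) T.is_subgroup TC[OF B]])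
  have v2: "FM T k2" by (rule FM_restrict[OF k2(1) T.is_subgroup TC[OF fB]])
  have i2: "FM T (inv_into T k2)" using FM_inverse[OF v2] FM_T_surj[OF v2] by simp
  have "FM T (\<lambda>x. inv_into T k2 (k1 x))" by (rule FM_comp[OF v1 i2]) (use FM_T_surj[OF v1] in simp)
  moreover have "inv_into T k2 (k1 x) = f x" if x: "x \<in> B" for x
  proof -
    have "k1 x = k2 (f x)" using k1(2) k2(2) x by simp
    then show ?thesis using inv_into_f_f[OF FMD(2)[OF v2], of "f x"] fB x by auto
  qed
  ultimately show ?thesis by blast
qed

lemma FM_endo_surj: assumes f: "FM R f" and sub: "f ` R \<subseteq> R" shows "f ` R = R"
proof (rule ccontr)
  assume "f ` R \<noteq> R"
  then have "f ` R \<subset> R" using sub by blast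
  from size_strict_mono[OF FMD(4)[OF f] FMD(1)[OF f] this] show False
    unfolding FM_invariants(2,3)[OF f] by auto
qed

lemma FM_centralizer:
  assumes f: "FM P f" and x: "x \<in> P" "\<And>y. y \<in> X \<Longrightarrow> x \<otimes> y = y \<otimes> x" and X: "X \<subseteq> P"
  shows "f x \<in> centralizer S (f ` X)"
proof -
  have "f x \<otimes> f y = f y \<otimes> f x" if y: "y \<in> X" for y
    using FMD(5)[OF f x(1), of y] FMD(5)[OF f _ x(1), of y] x(2)[OF y] subsetD[OF X y] by simp
  then show ?thesis using FMD(6)[OF f x(1)] by (auto simp: centralizer_def)
qed

lemma FM_inv_into: "FM P f \<Longrightarrow> x \<in> P \<Longrightarrow> inv_into P f (f x) = x"
  using FMD(2) by (rule inv_into_f_f)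

lemma centralizer_image:
  assumes f: "FM P f" and C: "centralizer S (f ` P) \<subseteq> f ` P" "centralizer S P \<subseteq> P"
  shows "centralizer S (f ` P) = f ` centralizer S P"
proof
  have c: "x \<in> centralizer S Q \<Longrightarrow> y \<in> Q \<Longrightarrow> x \<otimes> y = y \<otimes> x" for x y Q by (auto simp: centralizer_def)
  show "f ` centralizer S P \<subseteq> centralizer S (f ` P)"
    by (rule image_subsetI, rule FM_centralizer[OF f subsetD[OF C(2)] c order_refl])
  show "centralizer S (f ` P) \<subseteq> f ` centralizer S P"
  proof
    fix z assume z: "z \<in> centralizer S (f ` P)"
    have "inv_into P f z \<in> centralizer S (inv_into P f ` f ` P)"
      by (rule FM_centralizer[OF FM_inverse[OF f] subsetD[OF C(1) z] c[OF z] order_refl])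
    then have "inv_into P f z \<in> centralizer S P" by (simp add: inv_into_image_cancel[OF FMD(2)[OF f]])
    from imageI[OF this, of f] show "z \<in> f ` centralizer S P"
      unfolding f_inv_into_f[OF subsetD[OF C(1) z]] .
  qed
qed

abbreviation centric where "centric \<equiv> F_centric S F"

lemma centricD:
  assumes "centric P"
  shows "subgroup P S" "FM P f \<Longrightarrow> centralizer S (f ` P) \<subseteq> f ` P" "centralizer S P \<subseteq> P"
proof -
  show P: "subgroup P S" using assms by (simp add: F_centric_def)
  show "FM P f \<Longrightarrow> centralizer S (f ` P) \<subseteq> f ` P"
    using assms isomorphic_F[of P "f ` P"] unfolding F_centric_def by blast
  show "centralizer S P \<subseteq> P" using assms isomorphic_refl[OF P] unfolding F_centric_def by blast
qed

lemma centricI: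
  assumes "subgroup P S" "\<And>f. FM P f \<Longrightarrow> centralizer S (f ` P) \<subseteq> f ` P" shows "centric P"
  using assms unfolding F_centric_def isomorphic_F by auto

lemma centric_image: assumes P: "centric P" and f: "FM P f" shows "centric (f ` P)"
proof (rule centricI[OF FMD(4)[OF f]])
  fix g assume "FM (f ` P) g"
  from centricD(2)[OF P FM_comp[OF f this order_refl]] show "centralizer S (g ` f ` P) \<subseteq> g ` f ` P"
    by (simp add: image_image)
qed

lemma centric_overgroup:
  assumes P: "centric P" and Q: "subgroup Q S" "P \<subseteq> Q" shows "centric Q"
proof (rule centricI[OF Q(1)])
  fix f assume f: "FM Q f"
  have "FM P f" by (rule FM_restrict[OF f centricD(1)[OF P] Q(2)])
  from centricD(2)[OF P this] have "centralizer S (f ` P) \<subseteq> f ` P" .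
  moreover have "centralizer S (f ` Q) \<subseteq> centralizer S (f ` P)" using Q(2) by (auto simp: centralizer_def)
  ultimately show "centralizer S (f ` Q) \<subseteq> f ` Q" using Q(2) by blast
qed

lemma centric_fully_centralized:
  assumes P: "centric P" shows "fully_centralized p S F P"
  unfolding fully_centralized_def
proof (intro conjI allI impI)
  show "P \<in> Obj F" using centricD(1)[OF P] by simp
  fix Q assume "isomorphic_in F P Q"
  then obtain f where f: "FM P f" "Q = f ` P" unfolding isomorphic_F by blast
  have C: "subgroup (centralizer S P) S" "subgroup (centralizer S Q) S"
    using centralizer_subgroup subgroup.subset FMD(1,4)[OF f(1)] f(2) by auto
  have eq: "centralizer S Q = f ` centralizer S P"
    unfolding f(2) by (rule centralizer_image[OF f(1) centricD(2)[OF P f(1)] centricD(3)[OF P]])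
  have "FM (centralizer S P) f" by (rule FM_restrict[OF f(1) C(1) centricD(3)[OF P]])
  from FM_invariants(2,3)[OF this]
  show "size_le (toral_size p (grp (centralizer S Q))) (toral_size p (grp (centralizer S P)))"
    unfolding toral_size_eq[OF C(1)] toral_size_eq[OF C(2)] unfolding eq size_le_def by simp
qed

lemma isos_F: assumes P: "subgroup P S" shows "isos F P P = {f \<in> extensional P. FM P f \<and> f ` P = P}"
proof (intro equalityI subsetI)
  fix f assume f: "f \<in> isos F P P"
  then have h: "f \<in> Hom F P P" by (simp add: isos_def)
  then have "f \<in> extensional P" "FM P f" "f ` P \<subseteq> P" using Hom_F_iff[OF P P] by auto
  then show "f \<in> {f \<in> extensional P. FM P f \<and> f ` P = P}" using FM_endo_surj by blast
next
  fix f assume f: "f \<in> {f \<in> extensional P. FM P f \<and> f ` P = P}"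
  then have "restrict f P = f" by (blast intro: extensional_restrict)
  then have "f \<in> Hom F P (carrier S)" using f unfolding FM_def by auto
  from Hom_F_iso(2)[OF P subgroup_self this] show "f \<in> isos F P P" using f by simp
qed

lemma group_aut_F: assumes P: "subgroup P S" shows "group (aut_group F P)"
proof (rule groupI)
  interpret category F by (rule category_F)
  have PO: "P \<in> Obj F" using P by simp
  note a = isos_F[OF P]
  have mult: "x \<otimes>\<^bsub>aut_group F P\<^esub> y = compose P x y" if "x \<in> isos F P P" "y \<in> isos F P P" for x y
    using that Comp_F[OF P P P] by (simp add: aut_group_def isos_def)
  show "\<one>\<^bsub>aut_group F P\<^esub> \<in> carrier (aut_group F P)"
    using Ident_in[OF PO] Comp_Ident_left[OF PO PO] by (auto simp: aut_group_def isos_def)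
  fix x assume x: "x \<in> carrier (aut_group F P)"
  then obtain y where y: "y \<in> Hom F P P" "Comp F P P P y x = Ident F P" "Comp F P P P x y = Ident F P" "x \<in> Hom F P P"
    by (auto simp: aut_group_def isos_def)
  then show "\<exists>y\<in>carrier (aut_group F P). y \<otimes>\<^bsub>aut_group F P\<^esub> x = \<one>\<^bsub>aut_group F P\<^esub>"
    by (auto simp: aut_group_def isos_def)
  show "\<one>\<^bsub>aut_group F P\<^esub> \<otimes>\<^bsub>aut_group F P\<^esub> x = x" using y Comp_Ident_left[OF PO PO] by (simp add: aut_group_def)
  fix z assume z: "z \<in> carrier (aut_group F P)"
  show "x \<otimes>\<^bsub>aut_group F P\<^esub> z \<in> carrier (aut_group F P)"
  proof -
    have x': "x \<in> extensional P" "FM P x" "x ` P = P" and z': "z \<in> extensional P" "FM P z" "z ` P = P"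
      using x z a by (auto simp: aut_group_def)
    have "FM P (compose P x z)" by (rule FM_cong[OF FM_comp[OF z'(2) x'(2)]]) (use z' in \<open>auto simp: compose_def\<close>)
    moreover have "compose P x z ` P = x ` z ` P" unfolding image_image by (simp add: compose_def)
    then have "compose P x z ` P = P" using x'(3) z'(3) by simp
    ultimately show ?thesis using mult[of x z] x z unfolding a by (simp add: aut_group_def a)
  qed
  fix w assume w: "w \<in> carrier (aut_group F P)"
  show "(x \<otimes>\<^bsub>aut_group F P\<^esub> z) \<otimes>\<^bsub>aut_group F P\<^esub> w = x \<otimes>\<^bsub>aut_group F P\<^esub> (z \<otimes>\<^bsub>aut_group F P\<^esub> w)"
    using Comp_assoc[OF PO PO PO PO] x z w by (simp add: aut_group_def isos_def)
qed

lemma aut_F_simps: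
  assumes P: "subgroup P S"
  shows "carrier (aut_group F P) = {f \<in> extensional P. FM P f \<and> f ` P = P}"
    "\<one>\<^bsub>aut_group F P\<^esub> = (\<lambda>x\<in>P. x)"
    "x \<in> carrier (aut_group F P) \<Longrightarrow> y \<in> carrier (aut_group F P) \<Longrightarrow> x \<otimes>\<^bsub>aut_group F P\<^esub> y = compose P x y"
  using isos_F[OF P] Ident_F[OF P] Comp_F[OF P P P] by (simp_all add: aut_group_def isos_def)

text \<open>\<open>W = Aut\<^sub>F(T)\<close> is finite because \<open>T\<close> is fully normalized with trivial inner automorphisms.\<close>

lemma finite_W: "finite {w \<in> extensional T. FM T w}"
proof -
  note T = T.is_subgroup
  have W: "carrier (aut_group F T) = {w \<in> extensional T. FM T w}" using FM_T_surj unfolding aut_F_simps(1)[OF T] by blast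
  have "isomorphic_in F T Q \<Longrightarrow> Q = T" for Q using FM_T_surj unfolding isomorphic_F by blast
  then have "fully_normalized p S F T" using T unfolding fully_normalized_def size_le_def by auto
  then have fin: "finite (carrier (out_group S F T))"
    using saturated T unfolding saturated_fusion_system_def by auto
  have inn: "conj_hom S T T T = {\<lambda>x\<in>T. x}"
  proof -
    have c: "restrict (cj g) T = (\<lambda>x\<in>T. x)" if g: "g \<in> T" for g
    proof (rule restrict_ext)
      show "cj g x = x" if "x \<in> T" for x
        using T_comm[OF g that] conj_map_commute T_closed(1) g that by auto
    qed
    have "cj \<one> ` T \<subseteq> T" using T_closed(1) by auto
    then have "(\<lambda>x\<in>T. x) \<in> conj_hom S T T T"
      unfolding conj_hom_def using c[OF T_closed(2)] T_closed(2) by (intro CollectI exI[of _ \<one>]) simp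
    moreover have "f = (\<lambda>x\<in>T. x)" if "f \<in> conj_hom S T T T" for f
      using that c unfolding conj_hom_def by (elim CollectE exE conjE) simp
    ultimately show ?thesis by blast
  qed
  interpret A: group "aut_group F T" by (rule group_aut_F[OF T])
  have "\<one>\<^bsub>aut_group F T\<^esub> = (\<lambda>x\<in>T. x)" by (rule aut_F_simps(2)[OF T])
  then have cos: "conj_hom S T T T #>\<^bsub>aut_group F T\<^esub> a = {a}" if "a \<in> carrier (aut_group F T)" for a
    using that A.l_one unfolding inn by (auto simp: r_coset_def)
  have "(\<lambda>a. {a}) ` carrier (aut_group F T) = carrier (out_group S F T)"
    unfolding out_group_def carrier_FactGroup using cos by (intro image_cong) auto
  then have "finite ((\<lambda>a. {a}) ` carrier (aut_group F T))" using fin by simp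
  then show ?thesis unfolding W[symmetric] by (rule finite_imageD) auto
qed

abbreviation ex where "ex \<equiv> group_exponent (S Mod identity_component p S)"
abbreviation pw where "pw \<equiv> power_subgroup p S"
abbreviation fx where "fx \<equiv> bullet_I p S F"
abbreviation bul where "bul \<equiv> bullet p S F"

lemma exponent:
  shows "0 < ex" "x \<in> carrier S \<Longrightarrow> x [^] ex \<in> T" "\<exists>n. ex dvd p ^ n"
proof -
  let ?Q = "\<lambda>n. 0 < n \<and> (\<forall>x\<in>carrier S. x [^] n \<in> T)"
  have eq: "0 < n \<and> (\<forall>x\<in>carrier (S Mod T). x [^]\<^bsub>S Mod T\<^esub> n = \<one>\<^bsub>S Mod T\<^esub>) \<longleftrightarrow> ?Q n" for n :: nat
    unfolding carrier_FactGroup by (simp add: T.FactGroup_pow T.rcos_eq_iff cong: conj_cong)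
  have e: "ex = (LEAST n. ?Q n)" unfolding group_exponent_def identity_component_S eq ..
  obtain n where n: "\<And>x. x \<in> carrier S \<Longrightarrow> x [^] (p ^ n :: nat) \<in> T" using T_exp by blast
  then have "?Q (p ^ n)" using p_gt_0 by simp
  then have Q: "?Q ex" unfolding e by (rule LeastI)
  then show "0 < ex" "x \<in> carrier S \<Longrightarrow> x [^] ex \<in> T" by blast+
  have "p ^ n mod ex = 0"
  proof (rule ccontr)
    assume r: "p ^ n mod ex \<noteq> 0"
    have "x [^] (p ^ n mod ex) \<in> T" if x: "x \<in> carrier S" for x
    proof -
      have a: "(x [^] ex) [^] (p ^ n div ex) \<in> T" using subgroup_pow_closed[OF T.is_subgroup] Q x by blast
      have "x [^] (p ^ n) = (x [^] ex) [^] (p ^ n div ex) \<otimes> x [^] (p ^ n mod ex)"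
        using x by (simp add: nat_pow_pow nat_pow_mult)
      then have "x [^] (p ^ n mod ex) = inv ((x [^] ex) [^] (p ^ n div ex)) \<otimes> x [^] (p ^ n)"
        using x by (simp add: inv_solve_left)
      then show ?thesis using T_closed(3)[OF T_closed(4)[OF a] n[OF x]] by simp
    qed
    then have "ex \<le> p ^ n mod ex" unfolding e using r by (intro Least_le) (simp add: e)
    then show False using mod_less_divisor[of ex "p ^ n"] Q by linarith
  qed
  then show "\<exists>n. ex dvd p ^ n" by auto
qed

lemma fx_iff: "t \<in> fx A \<longleftrightarrow> t \<in> T \<and> (\<forall>w. FM T w \<longrightarrow> (\<forall>a\<in>A. w a = a) \<longrightarrow> w t = t)" if A: "A \<subseteq> T"
proof -
  have c: "carrier (aut_group F T) = {w \<in> extensional T. FM T w}"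
    using FM_T_surj unfolding aut_F_simps(1)[OF T.is_subgroup] by blast
  have r: "FM T (restrict w T)" if "FM T w" for w by (rule FM_cong[OF that]) simp
  show ?thesis
    unfolding bullet_I_def identity_component_S c
  proof (intro iffI; elim CollectE conjE; intro CollectI conjI allI impI ballI)
    fix w assume t: "t \<in> T" and h: "\<forall>w\<in>{w \<in> extensional T. FM T w}. (\<forall>a\<in>A. w a = a) \<longrightarrow> w t = t"
      and w: "FM T w" "\<forall>a\<in>A. w a = a"
    have "\<forall>a\<in>A. restrict w T a = a" using w(2) A by auto
    then have "restrict w T t = t" using bspec[OF h, of "restrict w T"] r[OF w(1)] by simp
    then show "w t = t" using t by simp
  qed auto
qed

lemma fx_fixed: "t \<in> fx A \<Longrightarrow> A \<subseteq> T \<Longrightarrow> FM T w \<Longrightarrow> (\<And>a. a \<in> A \<Longrightarrow> w a = a) \<Longrightarrow> w t = t"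
  by (simp add: fx_iff)

lemma fx_subset: "fx A \<subseteq> T"
  by (auto simp: bullet_I_def identity_component_S)

lemma FM_inv_T: "FM T w \<Longrightarrow> FM T (inv_into T w)"
  using FM_inverse[of T w] FM_T_surj by simp

lemma fx_agree:
  assumes A: "A \<subseteq> T" and u: "FM T u" and v: "FM T v" and eq: "\<And>a. a \<in> A \<Longrightarrow> u a = v a" and t: "t \<in> fx A"
  shows "u t = v t"
proof -
  have uT: "u x \<in> T" "v x \<in> T" if "x \<in> T" for x using FM_T_surj[OF u] FM_T_surj[OF v] that by auto
  have "FM T (\<lambda>x. inv_into T u (v x))" by (rule FM_comp[OF v FM_inv_T[OF u]]) (use FM_T_surj[OF v] in simp)
  moreover have "inv_into T u (v a) = a" if a: "a \<in> A" for a
    using FM_inv_into[OF u, of a] eq[OF a] a A by auto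
  ultimately have i: "inv_into T u (v t) = t" by (rule fx_fixed[OF t A])
  have "v t \<in> u ` T" using uT(2)[OF subsetD[OF fx_subset t]] FM_T_surj[OF u] by simp
  then show ?thesis using f_inv_into_f[of "v t" u T] i by simp
qed

lemma fx_subgroup: assumes A: "A \<subseteq> T" shows "subgroup (fx A) S"
proof (rule torsion_subgroupI)
  have "w \<one> = \<one>" if "FM T w" for w using FM_one[OF that] .
  then show "\<one> \<in> fx A" unfolding fx_iff[OF A] using T_closed(2) by blast
  show "fx A \<subseteq> carrier S" using fx_subset T_closed(1) by blast
  show "a \<otimes> b \<in> fx A" if "a \<in> fx A" "b \<in> fx A" for a b
  proof -
    have aT: "a \<in> T" "b \<in> T" using that fx_subset by blast+
    have "w (a \<otimes> b) = a \<otimes> b" if w: "FM T w" "\<forall>a\<in>A. w a = a" for w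
      using FMD(5)[OF w(1) aT] fx_fixed[OF \<open>a \<in> fx A\<close> A w(1)] fx_fixed[OF \<open>b \<in> fx A\<close> A w(1)] w(2) by simp
    then show ?thesis unfolding fx_iff[OF A] using T_closed(3)[OF aT] by blast
  qed
qed

lemma subset_fx: "A \<subseteq> T \<Longrightarrow> A \<subseteq> fx A"
  using fx_iff by blast

lemma fx_image:
  assumes A: "A \<subseteq> T" and B: "B \<subseteq> T" and w: "FM T w" and AB: "w ` A \<subseteq> B" and t: "t \<in> fx A"
  shows "w t \<in> fx B"
  unfolding fx_iff[OF B]
proof (intro conjI allI impI)
  show "w t \<in> T" using FM_T_surj[OF w] fx_subset t by blast
  fix u assume u: "FM T u" "\<forall>b\<in>B. u b = b"
  have uw: "FM T (\<lambda>x. u (w x))" by (rule FM_comp[OF w u(1)]) (use FM_T_surj[OF w] in simp)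
  show "u (w t) = w t" by (rule fx_agree[OF A uw w _ t]) (use u(2) AB in blast)
qed

lemma agree_on_D:
  assumes k: "FM R k" and w: "FM T w" and A: "A \<subseteq> R" "A \<subseteq> T" and eq: "\<And>a. a \<in> A \<Longrightarrow> k a = w a"
    and x: "x \<in> R" "x \<in> D (fx A)"
  shows "k x = w x"
proof -
  define E where "E = R \<inter> T"
  have E: "subgroup E S" "E \<subseteq> T" "E \<subseteq> R" unfolding E_def
    using subgroups_Inter_pair[OF FMD(1)[OF k] T.is_subgroup] by auto
  have kE: "FM E k" by (rule FM_restrict[OF k E(1,3)])
  have Ecomm: "x \<otimes> y = y \<otimes> x" if "x \<in> E" "y \<in> E" for x y using T_comm E(2) that by blast
  have kEcomm: "x \<otimes> y = y \<otimes> x" if xy: "x \<in> k ` E" "y \<in> k ` E" for x y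
  proof -
    obtain a b where ab: "a \<in> E" "b \<in> E" "x = k a" "y = k b" using xy by blast
    show ?thesis unfolding ab(3,4) FMD(5)[OF kE ab(1,2), symmetric] FMD(5)[OF kE ab(2,1), symmetric] Ecomm[OF ab(1,2)] ..
  qed
  obtain f where f: "FM E f" "fully_centralized p S F (f ` E)" using exists_fully_centralized[OF E(1,2)] by blast
  define g where "g z = f (inv_into E k z)" for z
  have gk: "g (k a) = f a" if "a \<in> E" for a unfolding g_def FM_inv_into[OF kE that] ..
  have g: "FM (k ` E) g" unfolding g_def
    by (rule FM_comp[OF FM_inverse[OF kE] f(1)]) (simp add: inv_into_image_cancel[OF FMD(2)[OF kE]])
  have "g ` k ` E = f ` E" unfolding image_image using gk by simp
  then have gfc: "fully_centralized p S F (g ` k ` E)" using f(2) by simp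
  obtain k1 where k1: "FM (centralizer S E) k1" "\<And>a. a \<in> E \<Longrightarrow> k1 a = f a"
    using extension_centralizer[OF f Ecomm] by blast
  obtain k2 where k2: "FM (centralizer S (k ` E)) k2" "\<And>a. a \<in> k ` E \<Longrightarrow> k2 a = g a"
    using extension_centralizer[OF g gfc kEcomm] by blast
  let ?C = "centralizer S (k ` E)"
  have TCE: "T \<subseteq> centralizer S E" using T_comm E(2) T_closed(1) unfolding centralizer_def by blast
  have v1: "FM T k1" by (rule FM_restrict[OF k1(1) T.is_subgroup TCE])
  have C: "subgroup ?C S" by (rule FMD(1)[OF k2(1)])
  have kEC: "k ` E \<subseteq> ?C" using kEcomm FMD(3)[OF kE] unfolding centralizer_def by blast
  have AE: "A \<subseteq> E" using A E_def by blast
  have fxS: "subgroup (fx A) S" by (rule fx_subgroup[OF A(2)])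
  have wC: "w t \<in> ?C" if t: "t \<in> fx A" for t
  proof -
    have wt: "w t \<in> carrier S" using FMD(6)[OF w] fx_subset t by blast
    have "w t \<otimes> k y = k y \<otimes> w t" if y: "y \<in> E" for y
    proof -
      have kyc: "k y \<in> carrier S" by (rule FMD(6)[OF kE y])
      have c: "FM T (cj (k y))" by (rule FM_conj[OF T.is_subgroup kyc])
      have cw: "FM T (\<lambda>x. cj (k y) (w x))" by (rule FM_comp[OF w c]) (simp add: FM_T_surj[OF w])
      have "cj (k y) (w t) = w t"
      proof (rule fx_agree[OF A(2) cw w _ t])
        fix a assume a: "a \<in> A"
        have ka: "k a \<in> carrier S" using FMD(6)[OF kE] AE a by blast
        have "k y \<otimes> k a = k a \<otimes> k y" by (rule kEcomm) (use y AE a in auto)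
        then show "cj (k y) (w a) = w a" using conj_map_commute[OF kyc ka] eq[OF a] by simp
      qed
      then show ?thesis using conj_map_commute[OF kyc wt] by simp
    qed
    then show ?thesis using wt unfolding centralizer_def by blast
  qed
  define Z where "Z = {z \<in> T \<inter> ?C. k2 z \<in> T}"
  have TC: "subgroup (T \<inter> ?C) S" by (rule subgroups_Inter_pair[OF T.is_subgroup C])
  have Z: "subgroup Z S"
  proof (rule torsion_subgroupI)
    show "Z \<subseteq> carrier S" using T_closed(1) by (auto simp: Z_def)
    show "\<one> \<in> Z" using subgroupD(2)[OF TC] FM_one[OF k2(1)] T_closed(2) by (simp add: Z_def)
    show "a \<otimes> b \<in> Z" if "a \<in> Z" "b \<in> Z" for a b
      using that subgroupD(3)[OF TC] FMD(5)[OF k2(1)] T_closed(3) by (simp add: Z_def)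
  qed
  have "FM Z k2" by (rule FM_restrict[OF k2(1) Z]) (auto simp: Z_def)
  then obtain w2 where w2: "FM T w2" "\<And>z. z \<in> Z \<Longrightarrow> w2 z = k2 z"
    using extends_to_T[of Z k2] unfolding Z_def by blast
  have w2w: "FM T (\<lambda>x. w2 (w x))" by (rule FM_comp[OF w w2(1)]) (simp add: FM_T_surj[OF w])
  have agree: "k1 t = w2 (w t)" if t: "t \<in> fx A" for t
  proof (rule fx_agree[OF A(2) v1 w2w _ t])
    fix a assume a: "a \<in> A"
    have aE: "a \<in> E" using a AE by blast
    have k2a: "k2 (k a) = k1 a" using k2(2)[of "k a"] gk[OF aE] k1(2)[OF aE] aE by simp
    have "k1 a \<in> T" using FM_T_surj[OF v1] aE E(2) by blast
    moreover have "k a \<in> T" using FM_T_surj[OF w] eq[OF a] a A(2) by auto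
    moreover have "k a \<in> ?C" using kEC aE by blast
    ultimately have "k a \<in> Z" using k2a by (simp add: Z_def)
    then show "k1 a = w2 (w a)" using w2(2) k2a eq[OF a] by simp
  qed
  have Dsub: "subgroup (D (fx A)) S" "D (fx A) \<subseteq> fx A" by (rule D_subgroup[OF fxS], rule dv_subset)
  have wDC: "w ` D (fx A) \<subseteq> ?C" using wC Dsub(2) by blast
  have wD: "FM (D (fx A)) w" by (rule FM_restrict[OF w Dsub(1)]) (use Dsub(2) fx_subset in blast)
  have wxZ: "w x \<in> Z"
  proof -
    have "FM (D (fx A)) (\<lambda>x. k2 (w x))" by (rule FM_comp[OF wD k2(1) wDC])
    then have "D ((\<lambda>x. k2 (w x)) ` D (fx A)) = (\<lambda>x. k2 (w x)) ` D (fx A)"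
      "subgroup ((\<lambda>x. k2 (w x)) ` D (fx A)) S"
      using FM_invariants(1) D_D[OF fxS] FMD(4) by metis+
    then have "k2 (w x) \<in> T" using D_subset_T x(2) by blast
    moreover have "w x \<in> T" using FM_T_surj[OF w] fx_subset Dsub(2) x(2) by blast
    ultimately show ?thesis using wDC x(2) by (auto simp: Z_def)
  qed
  have xE: "x \<in> E" using x fx_subset Dsub(2) by (auto simp: E_def)
  have "k2 (w x) = k1 x" using agree x(2) Dsub(2) w2(2)[OF wxZ] by auto
  also have "\<dots> = k2 (k x)" using k2(2)[of "k x"] gk[OF xE] k1(2)[OF xE] xE by simp
  finally show "k x = w x" using inj_onD[OF FMD(2)[OF k2(1)], of "w x" "k x"] kEC xE wxZ by (auto simp: Z_def)
qed

lemma pw_subset: assumes P: "subgroup P S" shows "pw P \<subseteq> P" "pw P \<subseteq> T" "x \<in> P \<Longrightarrow> x [^] ex \<in> pw P"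
proof -
  have G: "{g [^] ex | g. g \<in> P} \<subseteq> P" using subgroup_pow_closed[OF P] by blast
  have GT: "{g [^] ex | g. g \<in> P} \<subseteq> T" using exponent(2) subgroupD(1)[OF P] by blast
  show "pw P \<subseteq> P" unfolding power_subgroup_def by (rule generate_subgroup_incl[OF G P])
  show "pw P \<subseteq> T" unfolding power_subgroup_def by (rule generate_subgroup_incl[OF GT T.is_subgroup])
  show "x \<in> P \<Longrightarrow> x [^] ex \<in> pw P" unfolding power_subgroup_def by (blast intro: generate.incl)
qed

lemma FM_pw: assumes f: "FM P f" and Q: "f ` P \<subseteq> Q" and a: "a \<in> pw P" shows "f a \<in> pw Q"
proof -
  note P = FMD(1)[OF f]
  have G: "{g [^] ex | g. g \<in> P} \<subseteq> P" using subgroup_pow_closed[OF P] by blast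
  have g: "f h \<in> {g [^] ex | g. g \<in> Q}" if "h \<in> {g [^] ex | g. g \<in> P}" for h
    using that Q FM_pow[OF f] by blast
  have "a \<in> P \<and> f a \<in> generate S {g [^] ex | g. g \<in> Q}"
    using a unfolding power_subgroup_def
  proof (induction rule: generate.induct)
    case one then show ?case using subgroupD(2)[OF P] FM_one[OF f] generate.one[of S] by simp
  next
    case (incl h) then show ?case using g G generate.incl by (metis (no_types, lifting) subsetD)
  next
    case (inv h)
    then have "h \<in> P" using G by blast
    then show ?case using subgroupD(4)[OF P] FM_inv[OF f] generate.inv[OF g[OF inv]] by simp
  next
    case (eng h k)
    then have hk: "h \<in> P" "k \<in> P" by blast+
    from eng.IH(1,2) generate.eng[of "f h" S _ "f k"] show ?case
      unfolding FMD(5)[OF f hk] using subgroupD(3)[OF P hk] by blast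
  qed
  then show ?thesis unfolding power_subgroup_def by blast
qed

abbreviation DI where "DI P \<equiv> D (fx (pw P))"

lemma FM_DI:
  assumes A: "A \<subseteq> T" and B: "B \<subseteq> T" and w: "FM T w" and AB: "w ` A \<subseteq> B" and d: "d \<in> D (fx A)"
  shows "w d \<in> D (fx B)"
proof -
  have "\<exists>y\<in>fx B. y [^] (p ^ n :: nat) = w d" for n
  proof -
    obtain y where y: "y \<in> fx A" "y [^] (p ^ n) = d" using d unfolding dv_def by blast
    have "w y [^] (p ^ n) = w d" using FM_pow[OF w subsetD[OF fx_subset y(1)]] y(2) by metis
    then show ?thesis using fx_image[OF A B w AB y(1)] by blast
  qed
  moreover have "w d \<in> fx B" using fx_image[OF A B w AB] d by (simp add: dv_def)
  ultimately show ?thesis unfolding dv_def by blast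
qed

lemma DI_facts:
  assumes P: "subgroup P S"
  shows "subgroup (DI P) S" "DI P \<subseteq> T" "x \<in> P \<Longrightarrow> d \<in> DI P \<Longrightarrow> cj x d \<in> DI P"
    "bul P = {x \<otimes> d | x d. x \<in> P \<and> d \<in> DI P}"
proof -
  note f = fx_subgroup[OF pw_subset(2)[OF P]]
  show "subgroup (DI P) S" by (rule D_subgroup[OF f])
  show "DI P \<subseteq> T" by (rule D_subset_T[OF f])
  show "cj x d \<in> DI P" if x: "x \<in> P" and d: "d \<in> DI P"
  proof (rule FM_DI[OF pw_subset(2)[OF P] pw_subset(2)[OF P] _ _ d])
    have xc: "x \<in> carrier S" using subgroupD(1)[OF P x] .
    show "FM T (cj x)" by (rule FM_conj[OF T.is_subgroup xc])
    have "cj x ` P \<subseteq> P" unfolding conj_map_def using x subgroupD(3,4)[OF P] by blast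
    then show "cj x ` pw P \<subseteq> pw P" using FM_pw[OF FM_conj[OF P xc]] by blast
  qed
  show "bul P = {x \<otimes> d | x d. x \<in> P \<and> d \<in> DI P}"
    unfolding bullet_def identity_component_eq[OF f] set_mult_def by blast
qed

lemma bullet_subgroup:
  assumes P: "subgroup P S" shows "subgroup (bul P) S" "P \<subseteq> bul P" "DI P \<subseteq> bul P"
  using subgroup_mult_normal[OF P DI_facts(1)[OF P] DI_facts(3)[OF P]] unfolding DI_facts(4)[OF P] by blast+

lemma idx_bullet_bounded: "\<exists>B. \<forall>P. subgroup P S \<longrightarrow> idx (bul P) \<le> B"
proof -
  have fin: "finite {fx A | A. A \<subseteq> T}"
  proof (rule finite_subset)
    let ?W = "{w \<in> extensional T. FM T w}"
    show "{fx A | A. A \<subseteq> T} \<subseteq> (\<lambda>V. {t \<in> T. \<forall>w\<in>V. w t = t}) ` Pow ?W"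
    proof
      fix I assume "I \<in> {fx A | A. A \<subseteq> T}"
      then obtain A where A: "A \<subseteq> T" "I = fx A" by blast
      have "carrier (aut_group F T) = ?W" using FM_T_surj unfolding aut_F_simps(1)[OF T.is_subgroup] by blast
      then have "I = {t \<in> T. \<forall>w\<in>{w \<in> ?W. \<forall>a\<in>A. w a = a}. w t = t}"
        unfolding A(2) bullet_I_def identity_component_S by auto
      then show "I \<in> (\<lambda>V. {t \<in> T. \<forall>w\<in>V. w t = t}) ` Pow ?W" by blast
    qed
  qed (use finite_W in simp)
  obtain n0 where n0: "ex dvd p ^ n0" using exponent(3) by blast
  define Q where "Q I n \<longleftrightarrow> (\<forall>b\<in>I. \<exists>d\<in>D I. \<exists>t\<in>I. t [^] (p ^ n :: nat) = \<one> \<and> b = d \<otimes> t)" for I n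
  have Q: "\<exists>n. Q I n" if I: "I \<in> {fx A | A. A \<subseteq> T}" for I
  proof -
    obtain A where A: "A \<subseteq> T" "I = fx A" using I by blast
    have sub: "I \<inter> T = I" unfolding A(2) using fx_subset by blast
    obtain n where n: "\<And>b. b \<in> I \<inter> T \<Longrightarrow> \<exists>d\<in>D I. \<exists>t\<in>I \<inter> T. t [^] (p ^ n :: nat) = \<one> \<and> b = d \<otimes> t"
      by (rule D_structure[OF fx_subgroup[OF A(1)], folded A(2)]) (rule that)
    have "Q I n" unfolding Q_def by (rule ballI, rule n[unfolded sub])
    then show ?thesis ..
  qed
  define nn where "nn I = (SOME n. Q I n)" for I
  have nn: "Q I (nn I)" if "I \<in> {fx A | A. A \<subseteq> T}" for I unfolding nn_def by (rule someI_ex[OF Q[OF that]])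
  define N where "N = n0 + Max (nn ` {fx A | A. A \<subseteq> T})"
  have "idx (bul P) \<le> card {x \<in> T. x [^] (p ^ N) = \<one>} * nT" if P: "subgroup P S" for P
  proof (rule idx_bound[OF bullet_subgroup(1)[OF P] DI_facts(1)[OF P]])
    show "D (DI P) \<subseteq> D (bul P)" by (rule dv_mono[OF bullet_subgroup(3)[OF P]])
    let ?I = "fx (pw P)"
    have I: "subgroup ?I S" "?I \<in> {fx A | A. A \<subseteq> T}" using fx_subgroup pw_subset[OF P] by blast+
    note Ic = subgroupD[OF I(1)] and Dc = subgroupD[OF DI_facts(1)[OF P]]
    fix t assume t: "t \<in> bul P \<inter> T"
    then obtain x d where xd: "x \<in> P" "d \<in> DI P" "t = x \<otimes> d" unfolding DI_facts(4)[OF P] by blast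
    have c: "x \<in> carrier S" "d \<in> carrier S" using subgroupD(1)[OF P xd(1)] Dc(1)[OF xd(2)] by auto
    have "x = t \<otimes> inv d" using c xd(3) by (simp add: m_assoc)
    then have xT: "x \<in> T" using t xd(2) T_closed(3,4) DI_facts(2)[OF P] by blast
    have dT: "d \<in> T" using xd(2) DI_facts(2)[OF P] by blast
    obtain q where q: "p ^ n0 = ex * q" using n0 by blast
    have "t [^] (p ^ n0) = (x [^] ex) [^] q \<otimes> d [^] (p ^ n0)"
      using T_pow_distrib[OF xT dT] c by (simp add: xd(3) nat_pow_pow q)
    moreover have "(x [^] ex) [^] q \<in> ?I"
      by (rule subgroup_pow_closed[OF I(1)]) (use pw_subset(3)[OF P xd(1)] subset_fx[OF pw_subset(2)[OF P]] in blast)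
    moreover have "d [^] (p ^ n0) \<in> ?I" using subgroup_pow_closed[OF I(1)] xd(2) by (simp add: dv_def)
    ultimately have "t [^] (p ^ n0) \<in> ?I" using Ic(3) by simp
    then obtain d' b where db: "d' \<in> DI P" "b \<in> ?I" "b [^] (p ^ nn ?I) = \<one>" "t [^] (p ^ n0) = d' \<otimes> b"
      using nn[OF I(2)] unfolding Q_def by blast
    have le: "n0 + nn ?I \<le> N" using fin I(2) unfolding N_def by (intro add_left_mono Max_ge) auto
    have d'T: "d' \<in> T" and bT: "b \<in> T" and tT: "t \<in> T" using db(1,2) DI_facts(2)[OF P] fx_subset t by blast+
    have "t [^] (p ^ N) = ((t [^] (p ^ n0)) [^] (p ^ nn ?I)) [^] (p ^ (N - (n0 + nn ?I)))"
      using T_closed(1)[OF tT] le by (simp add: nat_pow_pow flip: power_add)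
    also have "\<dots> = (d' [^] (p ^ nn ?I)) [^] (p ^ (N - (n0 + nn ?I)))"
      using T_pow_distrib[OF d'T bT] db(3,4) T_closed(1)[OF d'T] by simp
    finally show "t [^] (p ^ N) \<in> D (DI P)"
      using subgroup_pow_closed[OF DI_facts(1)[OF P]] db(1) D_D[OF I(1)] by simp
  qed
  then show ?thesis by blast
qed

lemma conj_stabilizer:
  assumes R: "subgroup R S" and Q: "subgroup Q S" "R \<subseteq> Q"
  shows "subgroup {g \<in> Q. cj g ` R = R} S" "R \<subseteq> {g \<in> Q. cj g ` R = R}"
proof -
  note Rs = subgroup.subset[OF R] and Qc = subgroupD[OF Q(1)]
  have iff: "g \<in> {g \<in> Q. cj g ` R = R} \<longleftrightarrow> g \<in> Q \<inter> normalizer S R" for g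
    using normalizer_iff[OF Rs] Qc(1) by auto
  then have eq: "{g \<in> Q. cj g ` R = R} = Q \<inter> normalizer S R" by blast
  show "subgroup {g \<in> Q. cj g ` R = R} S"
    unfolding eq by (rule subgroups_Inter_pair[OF Q(1) normalizer_imp_subgroup[OF Rs]])
  have "cj g ` R = R" if g: "g \<in> R" for g
    by (rule FM_endo_surj[OF FM_conj[OF R subgroupD(1)[OF R g]]])
      (use g subgroupD(3,4)[OF R] in \<open>auto simp: conj_map_def\<close>)
  then show "R \<subseteq> {g \<in> Q. cj g ` R = R}" using Q(2) by blast
qed

lemma FM_conj_map: assumes f: "FM R f" and x: "x \<in> R" "y \<in> R" shows "f (cj x y) = cj (f x) (f y)"
  unfolding conj_map_def
  using FMD(5)[OF f subgroupD(3)[OF FMD(1)[OF f] x] subgroupD(4)[OF FMD(1)[OF f] x(1)]] FMD(5)[OF f x] FM_inv[OF f x(1)] by simp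

text \<open>The extension of \<open>f\<close> to \<open>P\<^sup>\<bullet>\<close> is \<open>x d \<mapsto> f(x) w(d)\<close>, where \<open>w \<in> W\<close> agrees with \<open>f\<close> on the
  power subgroup.\<close>

lemma bullet_extension:
  assumes P: "centric P" and f: "FM P f"
  obtains g where "FM (bul P) g" "\<And>x. x \<in> P \<Longrightarrow> g x = f x" "\<And>Q. subgroup Q S \<Longrightarrow> f ` P \<subseteq> Q \<Longrightarrow> g ` bul P \<subseteq> bul Q"
    "\<And>k y. FM (bul P) k \<Longrightarrow> (\<And>x. x \<in> P \<Longrightarrow> k x = f x) \<Longrightarrow> y \<in> bul P \<Longrightarrow> k y = g y"
proof -
  note PS = centricD(1)[OF P]
  note Pc = subgroupD[OF PS] and pw = pw_subset[OF PS] and DI = DI_facts[OF PS] and bul = bullet_subgroup[OF PS]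
  note Dc = subgroupD[OF DI(1)]
  have fpw: "FM (pw P) f"
  proof (rule FM_restrict[OF f _ pw(1)])
    show "subgroup (pw P) S" unfolding power_subgroup_def
      by (rule generate_is_subgroup) (use subgroup_pow_closed[OF PS] Pc(1) in blast)
  qed
  have fpwT: "f ` pw P \<subseteq> T"
    using FM_pw[OF f order_refl] pw_subset(2)[OF FMD(4)[OF f]] by blast
  obtain w where w: "FM T w" "\<And>a. a \<in> pw P \<Longrightarrow> w a = f a"
    using extends_to_T[OF pw(2) fpw fpwT] by blast
  have DT: "d \<in> T" "d \<in> carrier S" "w d \<in> carrier S" if "d \<in> DI P" for d
    using that DI(2) Dc(1) FMD(6)[OF w(1)] by blast+
  have Dfx: "DI P \<subseteq> fx (pw P)" by (rule dv_subset)
  have agree: "k x = w x" if "FM R k" "P \<subseteq> R" "\<And>x. x \<in> P \<Longrightarrow> k x = f x" "x \<in> R" "x \<in> DI P" for R k x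
  proof (rule agree_on_D[OF that(1) w(1) _ pw(2) _ that(4,5)])
    show "pw P \<subseteq> R" using pw(1) that(2) by blast
    show "k a = w a" if "a \<in> pw P" for a using that w(2) pw(1) \<open>\<And>x. x \<in> P \<Longrightarrow> k x = f x\<close> by auto
  qed
  have wconj: "w (cj x d) = cj (f x) (w d)" if x: "x \<in> P" and d: "d \<in> DI P" for x d
  proof -
    have c: "FM T (cj x)" "FM T (cj (f x))" using FM_conj[OF T.is_subgroup] Pc(1)[OF x] FMD(6)[OF f x] by auto
    have 1: "FM T (\<lambda>y. w (cj x y))" by (rule FM_comp[OF c(1) w(1)]) (simp add: FM_T_surj[OF c(1)])
    have 2: "FM T (\<lambda>y. cj (f x) (w y))" by (rule FM_comp[OF w(1) c(2)]) (simp add: FM_T_surj[OF w(1)])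
    show ?thesis
    proof (rule fx_agree[OF pw(2) 1 2 _ subsetD[OF Dfx d]])
      fix a assume a: "a \<in> pw P"
      have "cj x ` P \<subseteq> P" unfolding conj_map_def using x Pc(3,4) by blast
      then have "cj x a \<in> pw P" using FM_pw[OF FM_conj[OF PS Pc(1)[OF x]] _ a] by blast
      then show "w (cj x a) = cj (f x) (w a)"
        using w(2) a FM_conj_map[OF f x subsetD[OF pw(1) a]] by simp
    qed
  qed
  define g where "g y = (let x = SOME x. x \<in> P \<and> inv x \<otimes> y \<in> DI P in f x \<otimes> w (inv x \<otimes> y))" for y
  have g: "g (x \<otimes> d) = f x \<otimes> w d" if x: "x \<in> P" and d: "d \<in> DI P" for x d
  proof -
    define x' where "x' = (SOME x'. x' \<in> P \<and> inv x' \<otimes> (x \<otimes> d) \<in> DI P)"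
    have "x' \<in> P \<and> inv x' \<otimes> (x \<otimes> d) \<in> DI P"
      unfolding x'_def by (rule someI[of _ x]) (use x d Pc(1) Dc(1) in \<open>simp flip: m_assoc\<close>)
    then have x': "x' \<in> P" "inv x' \<otimes> (x \<otimes> d) \<in> DI P" by auto
    let ?d = "inv x' \<otimes> (x \<otimes> d)" and ?e = "inv x' \<otimes> x"
    note c = Pc(1)[OF x] Pc(1)[OF x'(1)] Dc(1)[OF d]
    have eP: "?e \<in> P" by (intro Pc(3,4) x x'(1))
    have "?e = ?d \<otimes> inv d" using c by (simp add: m_assoc)
    then have eD: "?e \<in> DI P" using Dc(3,4) d x'(2) by simp
    have we: "w ?e = f ?e" using agree[OF f order_refl refl eP eD] by simp
    have "?d = ?e \<otimes> d" using c by (simp add: m_assoc)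
    then have "w ?d = f ?e \<otimes> w d" using FMD(5)[OF w(1) DT(1)[OF eD] DT(1)[OF d]] we by simp
    then have "f x' \<otimes> w ?d = f x' \<otimes> f ?e \<otimes> w d" using FMD(6)[OF f] x'(1) eP DT(3)[OF d] by (simp add: m_assoc)
    also have "f x' \<otimes> f ?e = f x" using FMD(5)[OF f x'(1) eP, symmetric] c by (simp flip: m_assoc)
    finally show ?thesis unfolding g_def Let_def x'_def[symmetric] .
  qed
  have gP: "g x = f x" if x: "x \<in> P" for x
    using g[OF x Dc(2)] FM_one[OF w(1)] Pc(1)[OF x] FMD(6)[OF f x] by simp
  have gC: "g y \<in> carrier S" if y: "y \<in> bul P" for y
  proof -
    obtain x d where "x \<in> P" "d \<in> DI P" "y = x \<otimes> d" using y unfolding DI(4) by blast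
    then show ?thesis using g FMD(6)[OF f] DT(3) by simp
  qed
  have ghom: "g (a \<otimes> b) = g a \<otimes> g b" if a: "a \<in> bul P" and b: "b \<in> bul P" for a b
  proof -
    obtain x d y e where a': "x \<in> P" "d \<in> DI P" "a = x \<otimes> d" and b': "y \<in> P" "e \<in> DI P" "b = y \<otimes> e"
      using a b unfolding DI(4) by blast
    note c = Pc(1)[OF a'(1)] Dc(1)[OF a'(2)] Pc(1)[OF b'(1)] Dc(1)[OF b'(2)]
    note fc = FMD(6)[OF f a'(1)] FMD(6)[OF f b'(1)] DT(3)[OF a'(2)] DT(3)[OF b'(2)]
    note yi = Pc(4)[OF b'(1)]
    have cD: "cj (inv y) d \<in> DI P" by (rule DI(3)[OF yi a'(2)])
    have "a \<otimes> b = (x \<otimes> y) \<otimes> (cj (inv y) d \<otimes> e)" using c a'(3) b'(3)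
      by (simp add: conj_map_def m_assoc flip: m_assoc[of y "inv y"])
    then have "g (a \<otimes> b) = f (x \<otimes> y) \<otimes> w (cj (inv y) d \<otimes> e)"
      using g[OF Pc(3)[OF a'(1) b'(1)] Dc(3)[OF cD b'(2)]] by simp
    also have "\<dots> = f x \<otimes> f y \<otimes> (cj (inv (f y)) (w d) \<otimes> w e)"
      using FMD(5)[OF f a'(1) b'(1)] FMD(5)[OF w(1) DT(1)[OF cD] DT(1)[OF b'(2)]] wconj[OF yi a'(2)] FM_inv[OF f b'(1)] by simp
    also have "\<dots> = (f x \<otimes> w d) \<otimes> (f y \<otimes> w e)" using fc by (simp add: conj_map_def m_assoc flip: m_assoc[of "f y" "inv (f y)"])
    finally show ?thesis using g a' b' by simp
  qed
  have uniq: "k y = g y" if k: "FM R k" "P \<subseteq> R" "\<And>x. x \<in> P \<Longrightarrow> k x = f x" and R: "R \<subseteq> bul P" and y: "y \<in> R" for R k y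
  proof -
    obtain x d where xd: "x \<in> P" "d \<in> DI P" "y = x \<otimes> d" using y R unfolding DI(4) by blast
    note RS = FMD(1)[OF k(1)]
    have "d = inv x \<otimes> y" using xd Pc(1) Dc(1) by (simp flip: m_assoc)
    then have dR: "d \<in> R" using subgroupD(3,4)[OF RS] xd(1) k(2) y by blast
    have "k y = k x \<otimes> k d" using FMD(5)[OF k(1) subsetD[OF k(2) xd(1)] dR] xd(3) by simp
    then show ?thesis using agree[OF k dR xd(2)] k(3)[OF xd(1)] g[OF xd(1,2)] xd(3) by simp
  qed
  define M where "M n = {d \<in> DI P. d [^] (p ^ n :: nat) = \<one>}" for n
  have Mfin: "finite (M n)" for n
    by (rule finite_subset[OF _ finite_T_torsion[of n]]) (use DI(2) in \<open>auto simp: M_def\<close>)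
  have M: "subgroup (M n) S" for n using subgroup_T_torsion[OF DI(1)] DI(2) by (simp add: M_def Int_absorb2)
  have Mconj: "cj x d \<in> M n" if "x \<in> P" "d \<in> M n" for x d n
    using that DI(3) conj_pow[of x d "p ^ n"] Pc(1) Dc(1) by (simp add: M_def conj_map_def)
  define PM where "PM n = {x \<otimes> d | x d. x \<in> P \<and> d \<in> M n}" for n
  note PMs = subgroup_mult_normal[OF PS M Mconj, folded PM_def]
  have PMb: "PM n \<subseteq> bul P" for n unfolding PM_def DI(4) M_def by blast
  have FMn: "FM (PM n) g" for n
  proof -
    let ?ok = "\<lambda>R. P \<subseteq> R \<and> R \<subseteq> PM n \<and> FM R g"
    define R where "R = arg_max (\<lambda>R. card (R \<inter> M n)) ?ok"
    have "?ok P" using PMs(2) FM_cong[OF f] gP by auto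
    then have R: "?ok R" "\<And>R'. ?ok R' \<Longrightarrow> card (R' \<inter> M n) \<le> card (R \<inter> M n)"
      using arg_max_nat_lemma[of ?ok P "\<lambda>R. card (R \<inter> M n)" "Suc (card (M n))"] card_mono[OF Mfin]
      unfolding R_def by (auto simp: less_Suc_eq_le)
    then have R': "P \<subseteq> R" "R \<subseteq> PM n" "FM R g" by auto
    note RS = FMD(1)[OF R'(3)]
    have "R = PM n"
    proof (rule ccontr)
      assume "R \<noteq> PM n"
      then have "R \<subset> PM n" using R'(2) by blast
      from normalizer_grows[OF RS PMs(1) this] obtain x where x: "x \<in> PM n" "x \<notin> R" "\<And>h. h \<in> R \<Longrightarrow> x \<otimes> h \<otimes> inv x \<in> R"
        by metis
      define X where "X = {y \<in> PM n. cj y ` R = R}"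
      have xX: "x \<in> X" unfolding X_def using x(1,3) FM_endo_surj[OF FM_conj[OF RS subgroupD(1)[OF PMs(1) x(1)]]]
        by (auto simp: conj_map_def)
      have X: "subgroup X S" "R \<subseteq> X" using conj_stabilizer[OF RS PMs(1)[of n] R'(2), folded X_def] by blast+
      have XPM: "X \<subseteq> PM n" by (auto simp: X_def)
      have "fully_centralized p S F (g ` R)"
        by (rule centric_fully_centralized[OF centric_image[OF centric_overgroup[OF P RS R'(1)] R'(3)]])
      then have "\<exists>k. FM X k \<and> (\<forall>x\<in>R. k x = g x)"
      proof (rule extension[OF R'(3) _ X])
        fix y assume y: "y \<in> X"
        then have yb: "y \<in> bul P" using XPM PMb by blast
        have yi: "inv y \<in> bul P" using subgroupD(4)[OF bul(1) yb] .
        have gyi: "g (inv y) = inv (g y)"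
        proof -
          have "g y \<otimes> g (inv y) = \<one>" using ghom[OF yb yi, symmetric] subgroupD(1)[OF bul(1) yb] gP[OF Pc(2)] FM_one[OF f] by simp
          then show ?thesis using inv_equality[of "g (inv y)" "g y"] gC[OF yb] gC[OF yi] by (metis inv_comm)
        qed
        have "g (cj y r) = cj (g y) (g r)" if r: "r \<in> R" for r
        proof -
          have rb: "r \<in> bul P" using r R'(2) PMb by blast
          show ?thesis unfolding conj_map_def
            using ghom[OF subgroupD(3)[OF bul(1) yb rb] yi] ghom[OF yb rb] gyi by simp
        qed
        then show "cj y ` R = R \<and> (\<exists>h\<in>carrier S. \<forall>x\<in>R. g (cj y x) = cj h (g x))"
          using y gC[OF yb] unfolding X_def by blast
      qed
      then obtain k where k: "FM X k" "\<And>x. x \<in> R \<Longrightarrow> k x = g x" by blast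
      have PX: "P \<subseteq> X" using R'(1) X(2) by blast
      have kf: "k x = f x" if "x \<in> P" for x using k(2)[OF subsetD[OF R'(1) that]] gP[OF that] by simp
      have "FM X g" by (rule FM_cong[OF k(1)], rule uniq[OF k(1) PX kf]) (use XPM PMb in auto)
      then have le: "card (X \<inter> M n) \<le> card (R \<inter> M n)" using R(2) PX XPM by blast
      have fin: "finite (X \<inter> M n)" using Mfin by simp
      have "R \<inter> M n = X \<inter> M n" by (rule card_seteq[OF fin _ le]) (use X(2) in blast)
      moreover obtain a m where am: "a \<in> P" "m \<in> M n" "x = a \<otimes> m" using x(1) unfolding PM_def by blast
      have "m = inv a \<otimes> x" using am Pc(1) subgroupD(1)[OF M] by (simp flip: m_assoc)
      then have "m \<in> X" using subgroupD(3,4)[OF X(1)] xX am(1) PX by blast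
      ultimately have "m \<in> R" using am(2) by blast
      then show False using x(2) am(3) subgroupD(3)[OF RS] am(1) R'(1) by blast
    qed
    then show ?thesis using R'(3) by simp
  qed
  have inc: "PM n \<subseteq> PM (Suc n)" for n
  proof -
    have "M n \<subseteq> M (Suc n)"
    proof
      fix d assume d: "d \<in> M n"
      then have "d \<in> carrier S" using Dc(1) by (simp add: M_def)
      then have "d [^] (p ^ Suc n) = (d [^] (p ^ n)) [^] p" by (simp add: nat_pow_pow mult.commute)
      then show "d \<in> M (Suc n)" using d by (simp add: M_def del: power_Suc)
    qed
    then show ?thesis unfolding PM_def by blast
  qed
  have un: "(\<Union>n. PM n) = bul P"
  proof
    show "bul P \<subseteq> (\<Union>n. PM n)"
    proof
      fix y assume "y \<in> bul P"
      then obtain x d where xd: "x \<in> P" "d \<in> DI P" "y = x \<otimes> d" unfolding DI(4) by blast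
      obtain n where "d [^] (p ^ n :: nat) = \<one>" using torsion[OF DT(2)[OF xd(2)]] by blast
      then have "y \<in> PM n" unfolding PM_def M_def using xd by blast
      then show "y \<in> (\<Union>n. PM n)" by blast
    qed
  qed (use PMb in blast)
  have "FM (bul P) g" using union_extension[of PM g, OF FMn inc] unfolding un .
  moreover have "g ` bul P \<subseteq> bul Q" if Q: "subgroup Q S" "f ` P \<subseteq> Q" for Q
  proof
    fix z assume "z \<in> g ` bul P"
    then obtain x d where xd: "x \<in> P" "d \<in> DI P" "z = g (x \<otimes> d)" unfolding DI(4) by blast
    have "w d \<in> DI Q"
      by (rule FM_DI[OF pw(2) pw_subset(2)[OF Q(1)] w(1) _ xd(2)]) (use FM_pw[OF f Q(2)] w(2) in auto)
    then show "z \<in> bul Q" unfolding xd(3) g[OF xd(1,2)] DI_facts(4)[OF Q(1)] using Q(2) xd(1) by blast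
  qed
  moreover have "k y = g y" if "FM (bul P) k" "\<And>x. x \<in> P \<Longrightarrow> k x = f x" "y \<in> bul P" for k y
    by (rule uniq[OF that(1) bul(2) that(2) order_refl that(3)])
  ultimately show thesis using that[of g] gP by blast
qed

text \<open>The norm of \<open>t\<close>, the product of its conjugates under \<open>Q\<close>, commutes with \<open>Q\<close> and differs from a
  power of \<open>t\<close> by commutators \<open>[t, q] \<in> Q\<close>.\<close>

lemma norm_mem:
  assumes Q: "subgroup Q S" and C: "centralizer S Q \<subseteq> Q" and t: "t \<in> T" "cj t ` Q = Q"
  shows "\<exists>n. 0 < n \<and> n \<le> nT \<and> t [^] n \<in> Q"
proof -
  note Qc = subgroupD[OF Q]
  have tc: "t \<in> carrier S" using t T_closed by blast
  define G where "G = grp T"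
  interpret G: comm_group G unfolding G_def by (rule comm_T)
  have Gs [simp]: "carrier G = T" "(\<otimes>\<^bsub>G\<^esub>) = (\<otimes>)" "\<one>\<^bsub>G\<^esub> = \<one>" by (simp_all add: G_def)
  have Gpow: "x [^]\<^bsub>G\<^esub> n = x [^] n" for x and n :: nat unfolding G_def by (simp flip: nat_pow_consistent)
  have Tconj: "cj g x \<in> T" if "g \<in> carrier S" "x \<in> T" for g x
    using T.inv_op_closed2 that by (simp add: conj_map_def)
  define X where "X = (\<lambda>q. T #> q) ` Q"
  have X: "finite X" "card X \<le> nT" "X \<noteq> {}"
    using finite_subset[OF _ T_rcosets_finite, of X] card_mono[OF T_rcosets_finite, of X] Qc(1,2)
    unfolding X_def nT_def by blast+
  define rep where "rep U = (SOME q. q \<in> Q \<and> T #> q = U)" for U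
  have rep: "rep U \<in> Q" "T #> rep U = U" if U: "U \<in> X" for U
    using someI_ex[of "\<lambda>q. q \<in> Q \<and> T #> q = U"] U unfolding X_def rep_def by blast+
  define f where "f U = cj (rep U) t" for U
  have f: "f (T #> q) = cj q t" if q: "q \<in> Q" for q
  proof -
    let ?r = "rep (T #> q)"
    have UX: "T #> q \<in> X" using q unfolding X_def by blast
    note r = rep[OF UX]
    have c: "q \<in> carrier S" "?r \<in> carrier S" using Qc(1) q r(1) by auto
    define s where "s = ?r \<otimes> inv q"
    have s: "s \<in> T" unfolding s_def by (rule rcos_T_eq[OF c(2,1) r(2)])
    have sc: "s \<in> carrier S" using T_closed(1)[OF s] .
    have "?r = s \<otimes> q" using c by (simp add: s_def m_assoc)
    then have "f (T #> q) = cj s (cj q t)" using conj_map_comp[OF sc c(1) tc] by (simp add: f_def)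
    also have "\<dots> = cj q t"
      using conj_map_commute[OF sc, of "cj q t"] T_comm[OF s Tconj[OF c(1) t(1)]] Tconj[OF c(1) t(1)] T_closed(1) by blast
    finally show ?thesis .
  qed
  have fT: "f U \<in> T" if "U \<in> X" for U unfolding f_def using Tconj Qc(1) rep(1)[OF that] t(1) by blast
  define N where "N = finprod G f X"
  have NT: "N \<in> T" using G.finprod_closed[of f X] fT by (auto simp: N_def)
  have conj_prod: "cj r (finprod G g A) = finprod G (\<lambda>U. cj r (g U)) A"
    if "r \<in> carrier S" "finite A" "g \<in> A \<rightarrow> T" for r g A
    using that(2,3)
  proof (induction A rule: finite_induct)
    case empty then show ?case using that(1) by (simp add: conj_map_def)
  next
    case (insert a A)
    have gA: "g \<in> A \<rightarrow> T" "g a \<in> T" using insert.prems by auto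
    have pT: "finprod G g A \<in> T" using G.finprod_closed[of g A] gA by simp
    have "(\<lambda>U. cj r (g U)) \<in> A \<rightarrow> T" "cj r (g a) \<in> T" using gA Tconj[OF that(1)] by auto
    then show ?case using insert gA pT conj_map_mult[OF that(1) T_closed(1)[OF gA(2)] T_closed(1)[OF pT]] by simp
  qed
  have Nfix: "cj r N = N" if r: "r \<in> Q" for r
  proof -
    have rc: "r \<in> carrier S" using Qc(1)[OF r] .
    define h where "h U = T #> (r \<otimes> rep U)" for U
    have hX: "h U \<in> X" if "U \<in> X" for U unfolding X_def h_def by (rule imageI) (intro Qc(3) r rep(1) that)
    have "inj_on h X"
    proof (rule inj_onI)
      fix U V assume UV: "U \<in> X" "V \<in> X" "h U = h V"
      note c = Qc(1)[OF rep(1)[OF UV(1)]] Qc(1)[OF rep(1)[OF UV(2)]]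
      have "(r \<otimes> rep U) \<otimes> inv (r \<otimes> rep V) \<in> T" using UV(3) c rc unfolding h_def by (intro rcos_T_eq) auto
      then have "cj r (rep U \<otimes> inv rep V) \<in> T" using c rc by (simp add: conj_map_def inv_mult_group m_assoc)
      from Tconj[OF inv_closed[OF rc] this] have "rep U \<otimes> inv rep V \<in> T" using conj_map_inv(1)[OF rc] c by simp
      then have "rep U \<in> T #> rep V" using c by (force simp: r_coset_def m_assoc)
      then show "U = V" using repr_independence[OF _ _ T.is_subgroup] rep(2)[OF UV(1)] rep(2)[OF UV(2)] c by metis
    qed
    moreover have "h ` X = X" by (rule card_subset_eq[OF X(1)]) (use hX card_image[OF calculation] in auto)
    ultimately have "N = finprod G (\<lambda>U. f (h U)) X"
      using G.finprod_reindex[of f h X] fT unfolding N_def by simp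
    also have "\<dots> = finprod G (\<lambda>U. cj r (f U)) X"
    proof (rule G.finprod_cong'[OF refl])
      show "(\<lambda>U. cj r (f U)) \<in> X \<rightarrow> carrier G" using Tconj[OF rc] fT by simp
      show "f (h U) = cj r (f U)" if "U \<in> X" for U
        unfolding h_def f[OF Qc(3)[OF r rep(1)[OF that]]] using conj_map_comp[OF rc Qc(1)[OF rep(1)[OF that]] tc] by (simp add: f_def)
    qed
    also have "\<dots> = cj r N" unfolding N_def using conj_prod[OF rc X(1), of f] fT by simp
    finally show ?thesis by simp
  qed
  have "N \<otimes> x = x \<otimes> N" if "x \<in> Q" for x using conj_map_commute[OF Qc(1)[OF that] T_closed(1)[OF NT]] Nfix[OF that] by simp
  then have NQ: "N \<in> Q" using C T_closed(1)[OF NT] unfolding centralizer_def by blast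
  have QT: "subgroup (Q \<inter> T) S" by (rule subgroups_Inter_pair[OF Q T.is_subgroup])
  have prod_mem: "finprod G g A \<in> Q \<inter> T" if "finite A" "g \<in> A \<rightarrow> Q \<inter> T" for g A
    using that
  proof (induction A rule: finite_induct)
    case empty then show ?case using subgroupD(2)[OF QT] by simp
  next
    case (insert a A)
    then have "g \<in> A \<rightarrow> T" "g a \<in> T" "g \<in> A \<rightarrow> Q \<inter> T" "g a \<in> Q \<inter> T" by auto
    then show ?case using insert subgroupD(3)[OF QT] by simp
  qed
  have d: "inv t \<otimes> f U \<in> Q \<inter> T" if U: "U \<in> X" for U
  proof -
    note q = rep(1)[OF U]
    note qc = Qc(1)[OF q]
    have "cj t (inv (rep U)) \<in> Q" using t(2) Qc(4)[OF q] by blast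
    then have "rep U \<otimes> cj t (inv (rep U)) \<in> Q" using Qc(3) q by blast
    moreover have "rep U \<otimes> cj t (inv (rep U)) = f U \<otimes> inv t" using qc tc by (simp add: f_def conj_map_def m_assoc)
    moreover have "f U \<otimes> inv t = inv t \<otimes> f U" by (rule T_comm[OF fT[OF U] T_closed(4)[OF t(1)]])
    ultimately show ?thesis using T_closed(3)[OF T_closed(4)[OF t(1)] fT[OF U]] by simp
  qed
  define A where "A = finprod G (\<lambda>U. inv t \<otimes> f U) X"
  have A: "A \<in> Q \<inter> T" unfolding A_def by (rule prod_mem[OF X(1)]) (use d in simp)
  have "N = finprod G (\<lambda>U. t \<otimes>\<^bsub>G\<^esub> (inv t \<otimes> f U)) X"
    unfolding N_def by (rule G.finprod_cong'[OF refl]) (use d t fT tc T_closed in \<open>auto simp flip: m_assoc\<close>)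
  also have "\<dots> = t [^] card X \<otimes> A"
    using G.finprod_multf[of "\<lambda>_. t" X "\<lambda>U. inv t \<otimes> f U"] d t(1) G.finprod_const[of t X] unfolding A_def Gpow by simp
  finally have "t [^] card X = N \<otimes> inv A" using tc Qc(1) A by (simp add: m_assoc)
  then have "t [^] card X \<in> Q" using Qc(3)[OF NQ Qc(4)] A by auto
  moreover have "0 < card X" using X by (simp add: card_gt_0_iff)
  ultimately show ?thesis using X(2) by blast
qed

lemma pow_mem:
  assumes H: "subgroup H S" and x: "x \<in> carrier S" "x [^] (m::nat) \<in> H" and m: "0 < m"
  shows "x [^] (p ^ multiplicity p m) \<in> H"
proof -
  obtain s where s: "x [^] (p ^ s :: nat) = \<one>" using torsion[OF x(1)] by blast
  obtain u v where uv: "m * u = p ^ s * v + gcd m (p ^ s)" using bezout_nat[of m "p ^ s"] m by auto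
  have "(x [^] m) [^] u = (x [^] (p ^ s)) [^] v \<otimes> x [^] gcd m (p ^ s)"
    using x(1) uv by (simp add: nat_pow_pow nat_pow_mult)
  then have g: "x [^] gcd m (p ^ s) \<in> H" using subgroup_pow_closed[OF H x(2), of u] s x(1) by simp
  obtain i where i: "gcd m (p ^ s) = p ^ i" using divides_primepow_nat[OF p, of "gcd m (p ^ s)" s] by auto
  have "p ^ i dvd m" using i by (metis gcd_dvd1)
  then have "i \<le> multiplicity p m" using m p_gt_1 by (intro multiplicity_geI) auto
  then have "x [^] (p ^ multiplicity p m) = (x [^] (p ^ i)) [^] (p ^ (multiplicity p m - i))"
    using x(1) by (simp add: nat_pow_pow flip: power_add)
  then show ?thesis using g i subgroup_pow_closed[OF H] by simp
qed

lemma normalizer_exponent: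
  "\<exists>K. \<forall>Q x. centric Q \<longrightarrow> x \<in> normalizer S Q \<longrightarrow> x [^] (p ^ K :: nat) \<in> Q"
proof (intro exI allI impI)
  fix Q x assume Q: "centric Q" and x: "x \<in> normalizer S Q"
  note QS = centricD(1)[OF Q]
  have N: "subgroup (normalizer S Q) S" by (rule normalizer_imp_subgroup[OF subgroup.subset[OF QS]])
  have xc: "x \<in> carrier S" using subgroupD(1)[OF N x] .
  have "x [^] ex \<in> normalizer S Q" by (rule subgroup_pow_closed[OF N x])
  then have "cj (x [^] ex) ` Q = Q" using normalizer_iff[OF subgroup.subset[OF QS]] by blast
  then obtain n where n: "0 < n" "n \<le> nT" "(x [^] ex) [^] n \<in> Q"
    using norm_mem[OF QS centricD(3)[OF Q] exponent(2)[OF xc]] by blast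
  obtain k where k: "fact nT = n * k" using dvd_fact[of n nT] n by auto
  have "x [^] (ex * fact nT) = ((x [^] ex) [^] n) [^] k" using xc k by (simp add: nat_pow_pow mult.assoc)
  then have "x [^] (ex * fact nT) \<in> Q" using subgroup_pow_closed[OF QS n(3)] by simp
  then show "x [^] (p ^ multiplicity p (ex * fact nT)) \<in> Q" by (rule pow_mem[OF QS xc]) (use exponent(1) in simp)
qed

lemma exists_fully_normalized:
  assumes P: "centric P" shows "\<exists>f. FM P f \<and> fully_normalized p S F (f ` P)"
proof -
  note PS = centricD(1)[OF P]
  let ?N = "normalizer S"
  have C: "centric Q" if "isomorphic_in F P Q" for Q
    using that centric_image[OF P] unfolding isomorphic_F by blast
  have N: "subgroup (?N Q) S" if "subgroup Q S" for Q by (rule normalizer_imp_subgroup[OF subgroup.subset[OF that]])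
  have N': "subgroup (?N Q) S" if "isomorphic_in F P Q" for Q using N[OF centricD(1)[OF C[OF that]]] .
  obtain K where K: "\<And>Q x. centric Q \<Longrightarrow> x \<in> ?N Q \<Longrightarrow> x [^] (p ^ K :: nat) \<in> Q"
    using normalizer_exponent by metis
  obtain n where n: "\<And>b. b \<in> P \<inter> T \<Longrightarrow> \<exists>d\<in>D P. \<exists>t\<in>P \<inter> T. t [^] (p ^ n :: nat) = \<one> \<and> b = d \<otimes> t"
    by (rule D_structure[OF PS]) (rule that)
  obtain e where e: "\<And>x. x \<in> carrier S \<Longrightarrow> x [^] (p ^ e :: nat) \<in> T" using T_exp by blast
  have powD: "x [^] (p ^ (e + n) :: nat) \<in> D P" if x: "x \<in> P" for x
  proof -
    have xc: "x \<in> carrier S" using subgroupD(1)[OF PS x] .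
    have "x [^] (p ^ e) \<in> P \<inter> T" using subgroup_pow_closed[OF PS x] e[OF xc] by blast
    then obtain d t where dt: "d \<in> D P" "t \<in> P \<inter> T" "t [^] (p ^ n) = \<one>" "x [^] (p ^ e) = d \<otimes> t" using n by blast
    note DP = D_subgroup[OF PS]
    have dT: "d \<in> T" using D_subset_T[OF PS] dt(1) by blast
    have "x [^] (p ^ (e + n)) = (x [^] (p ^ e)) [^] (p ^ n)" using xc by (simp add: nat_pow_pow power_add)
    also have "\<dots> = d [^] (p ^ n)" using T_pow_distrib[OF dT, of t "p ^ n"] dt T_closed(1)[OF dT] by simp
    finally show ?thesis using subgroup_pow_closed[OF DP dt(1)] by simp
  qed
  define M where "M = card {t \<in> T. t [^] (p ^ (K + (e + n)) :: nat) = \<one>} * nT"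
  have bound: "idx (?N Q) \<le> M" if Q: "isomorphic_in F P Q" for Q
    unfolding M_def
  proof (rule idx_bound[OF N'[OF Q] centricD(1)[OF C[OF Q]]])
    obtain f where f: "FM P f" "f ` P = Q" using Q unfolding isomorphic_F by blast
    fix t assume t: "t \<in> ?N Q \<inter> T"
    then have tc: "t \<in> carrier S" using T_closed by auto
    have "t [^] (p ^ K) \<in> Q" using K[OF C[OF Q]] t by blast
    then obtain x where x: "x \<in> P" "t [^] (p ^ K) = f x" using f(2) by blast
    have "(t [^] (p ^ K)) [^] (p ^ (e + n)) = f (x [^] (p ^ (e + n)))" unfolding x(2) using FM_pow[OF f(1) x(1)] by simp
    then show "t [^] (p ^ (K + (e + n))) \<in> D Q"
      using FM_invariants(1)[OF f(1)] powD[OF x(1)] f(2) tc by (auto simp: nat_pow_pow power_add)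
  next
    note QS = centricD(1)[OF C[OF Q]]
    have "Q \<subseteq> ?N Q" using conj_stabilizer(2)[OF QS subgroup_self subgroup.subset[OF QS]] normalizer_iff[OF subgroup.subset[OF QS]] by blast
    then show "D Q \<subseteq> D (?N Q)" by (rule dv_mono)
  qed
  have bound2: "rk (?N Q) \<le> rk (carrier S)" if Q: "isomorphic_in F P Q" for Q
    using rk_mono[OF N'[OF Q] subgroup_self subgroup.subset[OF N'[OF Q]]] .
  let ?iso = "isomorphic_in F P"
  define B where "B = Suc M"
  define m where "m Q = rk (?N Q) * B + idx (?N Q)" for Q
  have mB: "m Q < (Suc (rk (carrier S))) * B" if Q: "?iso Q" for Q
  proof -
    have "rk (?N Q) * B \<le> rk (carrier S) * B" using bound2[OF Q] by (rule mult_le_mono1)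
    then show ?thesis using bound[OF Q] by (simp add: m_def B_def)
  qed
  define Q where "Q = arg_max m ?iso"
  have Q: "?iso Q" "\<And>R. ?iso R \<Longrightarrow> m R \<le> m Q"
    using arg_max_nat_lemma[of ?iso P m "Suc (rk (carrier S)) * B"] isomorphic_refl[OF PS] mB unfolding Q_def by auto
  have "fully_normalized p S F Q"
    unfolding fully_normalized_def
  proof (intro conjI allI impI)
    show "Q \<in> Obj F" using centricD(1)[OF C[OF Q(1)]] by simp
    fix R assume "isomorphic_in F Q R"
    then have R: "?iso R" using isomorphic_trans Q(1) by blast
    have "m R \<le> m Q" by (rule Q(2)[OF R])
    then have "rk (?N R) * B + idx (?N R) \<le> rk (?N Q) * B + idx (?N Q)" by (simp add: m_def)
    moreover have "idx (?N Q) < B" using bound[OF Q(1)] by (simp add: B_def)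
    ultimately have "rk (?N R) * B < Suc (rk (?N Q)) * B" by simp
    then have "rk (?N R) \<le> rk (?N Q)" unfolding mult_less_cancel2 by simp
    moreover have "idx (?N R) \<le> idx (?N Q)" if "rk (?N R) = rk (?N Q)" using \<open>m R \<le> m Q\<close> that by (simp add: m_def)
    ultimately show "size_le (toral_size p (grp (?N R))) (toral_size p (grp (?N Q)))"
      unfolding toral_size_eq[OF N'[OF R]] toral_size_eq[OF N'[OF Q(1)]] size_le_def by auto
  qed
  then show ?thesis using Q(1) unfolding isomorphic_F by blast
qed

text \<open>For \<open>a(P) \<lhd> Q\<close>, \<open>pb P a q\<close> is the automorphism \<open>a\<^sup>-\<^sup>1 c\<^sub>q a\<close> of \<open>P\<close>.\<close>

definition nrm where
  "nrm P Q a \<longleftrightarrow> FM P a \<and> subgroup Q S \<and> a ` P \<subseteq> Q \<and> (\<forall>q\<in>Q. cj q ` a ` P = a ` P)"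

definition pb where "pb P a q = (\<lambda>x\<in>P. inv_into P a (cj q (a x)))"

abbreviation Aut where "Aut P \<equiv> aut_group F P"
abbreviation Inn where "Inn P \<equiv> conj_hom S P P P"

lemma nrmD: assumes "nrm P Q a"
  shows "FM P a" "subgroup Q S" "a ` P \<subseteq> Q" "q \<in> Q \<Longrightarrow> cj q ` a ` P = a ` P" "subgroup P S" "q \<in> Q \<Longrightarrow> q \<in> carrier S"
proof -
  show 1: "FM P a" "subgroup Q S" "a ` P \<subseteq> Q" "q \<in> Q \<Longrightarrow> cj q ` a ` P = a ` P"
    using assms unfolding nrm_def by simp_all
  show "subgroup P S" "q \<in> Q \<Longrightarrow> q \<in> carrier S" by (rule FMD(1)[OF 1(1)], rule subgroupD(1)[OF 1(2)])
qed

lemma nrmI: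
  assumes "FM P a" "subgroup Q S" "a ` P \<subseteq> Q" "\<And>q. q \<in> Q \<Longrightarrow> cj q ` a ` P \<subseteq> a ` P"
  shows "nrm P Q a"
proof -
  have "cj q ` a ` P = a ` P" if "q \<in> Q" for q
    by (rule FM_endo_surj[OF FM_conj[OF FMD(4)[OF assms(1)] subgroupD(1)[OF assms(2) that]] assms(4)[OF that]])
  then show ?thesis using assms(1-3) unfolding nrm_def by simp
qed

lemma pb_apply: assumes "nrm P Q a" "q \<in> Q" "x \<in> P" shows "a (pb P a q x) = cj q (a x)" "pb P a q x \<in> P"
proof -
  have "cj q (a x) \<in> a ` P" using nrmD(4)[OF assms(1,2)] assms(3) by blast
  then show "a (pb P a q x) = cj q (a x)" "pb P a q x \<in> P"
    using assms(3) by (auto simp: pb_def f_inv_into_f inv_into_into)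
qed

lemma pb_in: assumes n: "nrm P Q a" and q: "q \<in> Q" shows "pb P a q \<in> carrier (Aut P)"
proof -
  note d = nrmD[OF n]
  have c: "FM (a ` P) (cj q)" by (rule FM_conj[OF FMD(4)[OF d(1)] d(6)[OF q]])
  have "FM P (\<lambda>x. inv_into P a (cj q (a x)))"
    by (rule FM_comp[OF FM_comp[OF d(1) c order_refl] FM_inverse[OF d(1)]]) (use d(4)[OF q] in \<open>simp add: image_image\<close>)
  then have f: "FM P (pb P a q)" by (rule FM_cong) (simp add: pb_def)
  moreover have "pb P a q ` P = P" by (rule FM_endo_surj[OF f]) (use pb_apply(2)[OF n q] in blast)
  moreover have "pb P a q \<in> extensional P" by (simp add: pb_def)
  ultimately show ?thesis unfolding aut_F_simps(1)[OF d(5)] by blast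
qed

lemma Aut_D:
  assumes "subgroup P S" "y \<in> carrier (Aut P)"
  shows "y \<in> extensional P" "FM P y" "y ` P = P" "x \<in> P \<Longrightarrow> y x \<in> P"
  using assms(2) unfolding aut_F_simps(1)[OF assms(1)] by blast+

lemma Aut_mult:
  assumes "subgroup P S" "x \<in> carrier (Aut P)" "y \<in> carrier (Aut P)" "z \<in> P"
  shows "(x \<otimes>\<^bsub>Aut P\<^esub> y) z = x (y z)"
  using aut_F_simps(3)[OF assms(1-3)] assms(4) by (simp add: compose_def)

lemma pb_unique:
  assumes n: "nrm P Q a" and q: "q \<in> Q" and y: "y \<in> extensional P" "\<And>x. x \<in> P \<Longrightarrow> y x \<in> P"
    "\<And>x. x \<in> P \<Longrightarrow> a (y x) = cj q (a x)"
  shows "y = pb P a q"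
proof (rule extensionalityI[OF y(1), of _])
  show "pb P a q \<in> extensional P" by (simp add: pb_def)
  show "y x = pb P a q x" if x: "x \<in> P" for x
    using inj_onD[OF FMD(2)[OF nrmD(1)[OF n]] _ y(2)[OF x] pb_apply(2)[OF n q x]] y(3)[OF x] pb_apply(1)[OF n q x] by simp
qed

lemma pb_hom: assumes n: "nrm P Q a" shows "group_hom (grp Q) (Aut P) (pb P a)"
proof -
  note d = nrmD[OF n]
  have "pb P a (q \<otimes> r) = pb P a q \<otimes>\<^bsub>Aut P\<^esub> pb P a r" if qr: "q \<in> Q" "r \<in> Q" for q r
  proof (rule sym, rule pb_unique[OF n subgroupD(3)[OF d(2) qr]])
    interpret A: group "Aut P" by (rule group_aut_F[OF d(5)])
    have "pb P a q \<otimes>\<^bsub>Aut P\<^esub> pb P a r \<in> carrier (Aut P)" using A.m_closed pb_in[OF n] qr by blast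
    then show "pb P a q \<otimes>\<^bsub>Aut P\<^esub> pb P a r \<in> extensional P" by (rule Aut_D(1)[OF d(5)])
    fix x assume x: "x \<in> P"
    note m = Aut_mult[OF d(5) pb_in[OF n qr(1)] pb_in[OF n qr(2)] x]
    show "(pb P a q \<otimes>\<^bsub>Aut P\<^esub> pb P a r) x \<in> P" unfolding m by (intro pb_apply(2)[OF n] qr x)
    show "a ((pb P a q \<otimes>\<^bsub>Aut P\<^esub> pb P a r) x) = cj (q \<otimes> r) (a x)"
      unfolding m pb_apply(1)[OF n qr(1) pb_apply(2)[OF n qr(2) x]] pb_apply(1)[OF n qr(2) x]
      by (rule conj_map_comp[symmetric]) (use d(6) qr FMD(6)[OF d(1) x] in auto)
  qed
  then show ?thesis
    using pb_in[OF n] subgroup_imp_group[OF d(2)] group_aut_F[OF d(5)]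
    by (auto simp: group_hom_def group_hom_axioms_def hom_def)
qed

lemma pb_inner: assumes n: "nrm P Q a" and x: "x \<in> P" shows "pb P a (a x) = restrict (cj x) P"
proof (rule sym, rule pb_unique[OF n])
  note d = nrmD[OF n]
  have m: "cj x y \<in> P" if "y \<in> P" for y
    unfolding conj_map_def by (intro subgroupD(3,4)[OF d(5)] x that)
  show "a x \<in> Q" using d(3) x by blast
  fix y assume y: "y \<in> P"
  show "restrict (cj x) P y \<in> P" using m y by simp
  show "a (restrict (cj x) P y) = cj (a x) (a y)" using FM_conj_map[OF d(1) x y] y by simp
qed simp

lemma nrm_id: assumes "subgroup P S" "subgroup Q S" "P \<subseteq> Q" "Q \<subseteq> normalizer S P" shows "nrm P Q (\<lambda>x. x)"
proof (rule nrmI[OF FM_id[OF assms(1)] assms(2)])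
  show "cj q ` (\<lambda>x. x) ` P \<subseteq> (\<lambda>x. x) ` P" if "q \<in> Q" for q
    using subsetD[OF assms(4) that] unfolding normalizer_iff[OF subgroup.subset[OF assms(1)]] by simp
qed (use assms(3) in simp)

lemma pb_id: assumes "nrm P Q (\<lambda>x. x)" "q \<in> Q" shows "pb P (\<lambda>x. x) q = restrict (cj q) P"
proof (rule sym, rule pb_unique[OF assms])
  fix x assume x: "x \<in> P"
  show "restrict (cj q) P x \<in> P" using nrmD(4)[OF assms] x by auto
qed auto

lemma subgroup_normalizer: "subgroup P S \<Longrightarrow> P \<subseteq> normalizer S P"
proof
  fix x assume P: "subgroup P S" and x: "x \<in> P"
  show "x \<in> normalizer S P"
    using subsetD[OF conj_stabilizer(2)[OF P subgroup_self subgroup.subset[OF P]] x]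
    unfolding normalizer_iff[OF subgroup.subset[OF P]] by simp
qed

lemma Inn_eq: assumes P: "subgroup P S" shows "Inn P = pb P (\<lambda>x. x) ` P" "nrm P P (\<lambda>x. x)"
proof -
  show n: "nrm P P (\<lambda>x. x)" by (rule nrm_id[OF P P order_refl subgroup_normalizer[OF P]])
  have "cj g ` P \<subseteq> P" if "g \<in> P" for g using nrmD(4)[OF n that] by simp
  then show "Inn P = pb P (\<lambda>x. x) ` P" unfolding conj_hom_def using pb_id[OF n] by force
qed

lemma AutS_eq: assumes P: "subgroup P S"
  shows "conj_hom S (carrier S) P P = pb P (\<lambda>x. x) ` normalizer S P" "nrm P (normalizer S P) (\<lambda>x. x)"
proof -
  note N = normalizer_iff[OF subgroup.subset[OF P]]
  show n: "nrm P (normalizer S P) (\<lambda>x. x)"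
    by (rule nrm_id[OF P normalizer_imp_subgroup[OF subgroup.subset[OF P]] subgroup_normalizer[OF P] order_refl])
  have e: "g \<in> carrier S \<and> cj g ` P \<subseteq> P \<longleftrightarrow> g \<in> normalizer S P" for g
    using FM_endo_surj[OF FM_conj[OF P], of g] unfolding N by blast
  have "conj_hom S (carrier S) P P = (\<lambda>g. restrict (cj g) P) ` normalizer S P"
    unfolding conj_hom_def using e by blast
  then show "conj_hom S (carrier S) P P = pb P (\<lambda>x. x) ` normalizer S P" using pb_id[OF n] by simp
qed

lemma pb_image_subgroup: assumes n: "nrm P Q a" "subgroup R S" "R \<subseteq> Q" shows "subgroup (pb P a ` R) (Aut P)"
  by (rule group_hom.subgroup_img_is_subgroup[OF pb_hom[OF n(1)] subgroup_incl[OF n(2) nrmD(2)[OF n(1)] n(3)]])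

lemma Inn_normal: assumes P: "subgroup P S" shows "Inn P \<lhd> Aut P"
proof -
  interpret A: group "Aut P" by (rule group_aut_F[OF P])
  note n = Inn_eq(2)[OF P]
  have "y \<otimes>\<^bsub>Aut P\<^esub> h \<otimes>\<^bsub>Aut P\<^esub> inv\<^bsub>Aut P\<^esub> y \<in> Inn P" if y: "y \<in> carrier (Aut P)" and h: "h \<in> Inn P" for y h
  proof -
    obtain x where x: "x \<in> P" "h = pb P (\<lambda>x. x) x" using h unfolding Inn_eq(1)[OF P] by blast
    note yd = Aut_D[OF P y]
    note i = pb_in[OF n x(1)] pb_in[OF n yd(4)[OF x(1)]]
    have "y \<otimes>\<^bsub>Aut P\<^esub> h = pb P (\<lambda>x. x) (y x) \<otimes>\<^bsub>Aut P\<^esub> y"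
    proof (rule extensionalityI[of _ P])
      show "y \<otimes>\<^bsub>Aut P\<^esub> h \<in> extensional P" "pb P (\<lambda>x. x) (y x) \<otimes>\<^bsub>Aut P\<^esub> y \<in> extensional P"
        using Aut_D(1)[OF P A.m_closed] y i x(2) by auto
      fix z assume z: "z \<in> P"
      show "(y \<otimes>\<^bsub>Aut P\<^esub> h) z = (pb P (\<lambda>x. x) (y x) \<otimes>\<^bsub>Aut P\<^esub> y) z"
        unfolding x(2) Aut_mult[OF P y i(1) z] Aut_mult[OF P i(2) y z]
        unfolding pb_id[OF n x(1)] pb_id[OF n yd(4)[OF x(1)]] using FM_conj_map[OF yd(2) x(1) z] z yd(4)[OF z] by simp
    qed
    then have "y \<otimes>\<^bsub>Aut P\<^esub> h \<otimes>\<^bsub>Aut P\<^esub> inv\<^bsub>Aut P\<^esub> y = pb P (\<lambda>x. x) (y x)" using i(2) y by (simp add: A.m_assoc)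
    then show ?thesis unfolding Inn_eq(1)[OF P] using yd(4)[OF x(1)] by simp
  qed
  moreover have "subgroup (Inn P) (Aut P)" unfolding Inn_eq(1)[OF P] by (rule pb_image_subgroup[OF n P order_refl])
  ultimately show ?thesis unfolding A.normal_inv_iff by blast
qed

text \<open>Among the subgroups normalizing a copy of \<open>P\<close>, the ordering is detected by the
  automorphisms of \<open>P\<close> that they induce.\<close>

lemma factor_through:
  assumes P: "centric P" and a: "nrm P Q a" and b: "nrm P R b" and sub: "pb P a ` Q \<subseteq> pb P b ` R"
  shows "\<exists>k. FM Q k \<and> k ` Q \<subseteq> R \<and> (\<forall>x\<in>P. k (a x) = b x)"
proof -
  note da = nrmD[OF a] and db = nrmD[OF b]
  define g where "g z = b (inv_into P a z)" for z
  have ga: "g (a x) = b x" if "x \<in> P" for x unfolding g_def FM_inv_into[OF da(1) that] ..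
  have g: "FM (a ` P) g" unfolding g_def
    by (rule FM_comp[OF FM_inverse[OF da(1)] db(1)]) (simp add: inv_into_image_cancel[OF FMD(2)[OF da(1)]])
  have gP: "g ` a ` P = b ` P" unfolding image_image using ga by simp
  have fc: "fully_centralized p S F (g ` a ` P)" unfolding gP
    by (rule centric_fully_centralized[OF centric_image[OF P db(1)]])
  have ex: "\<exists>h\<in>R. \<forall>z\<in>a ` P. g (cj q z) = cj h (g z)" if q: "q \<in> Q" for q
  proof -
    obtain h where h: "h \<in> R" "pb P a q = pb P b h" using sub q by blast
    have "g (cj q (a x)) = cj h (g (a x))" if x: "x \<in> P" for x
      unfolding pb_apply(1)[OF a q x, symmetric] ga[OF pb_apply(2)[OF a q x]] ga[OF x]
      unfolding h(2) by (rule pb_apply(1)[OF b h(1) x])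
    then show ?thesis using h(1) by blast
  qed
  have "\<exists>k. FM Q k \<and> (\<forall>z\<in>a ` P. k z = g z)"
    by (rule extension[OF g fc da(2,3)]) (use da(4) ex db(6) in blast)
  then obtain k where k: "FM Q k" "\<And>z. z \<in> a ` P \<Longrightarrow> k z = g z" by blast
  have "k q \<in> R" if q: "q \<in> Q" for q
  proof -
    obtain h where h: "h \<in> R" "\<And>z. z \<in> a ` P \<Longrightarrow> g (cj q z) = cj h (g z)" using ex[OF q] by blast
    note c = FMD(6)[OF k(1) q] db(6)[OF h(1)]
    have "inv h \<otimes> k q \<in> centralizer S (b ` P)"
    proof -
      have "(inv h \<otimes> k q) \<otimes> y = y \<otimes> (inv h \<otimes> k q)" if y: "y \<in> b ` P" for y
      proof -
        obtain z where z: "z \<in> a ` P" "y = g z" using y gP by blast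
        have yc: "y \<in> carrier S" using y FMD(6)[OF db(1)] by blast
        have zQ: "z \<in> Q" using z(1) da(3) by blast
        have "cj q z \<in> a ` P" using da(4)[OF q] z(1) by blast
        then have "cj (k q) y = cj h y"
          using FM_conj_map[OF k(1) q zQ] k(2) z h(2)[OF z(1)] by simp
        then have "cj (inv h \<otimes> k q) y = y"
          using conj_map_comp[OF inv_closed[OF c(2)] c(1) yc] conj_map_inv(1)[OF c(2) yc] by simp
        then show ?thesis using conj_map_commute[of "inv h \<otimes> k q" y] c yc by simp
      qed
      then show ?thesis using c unfolding centralizer_def by blast
    qed
    then have "inv h \<otimes> k q \<in> R" using centricD(2)[OF P db(1)] db(3) by blast
    then have "h \<otimes> (inv h \<otimes> k q) \<in> R" by (rule subgroupD(3)[OF db(2) h(1)])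
    then show ?thesis using c by (simp flip: m_assoc)
  qed
  then have "k ` Q \<subseteq> R" by (rule image_subsetI)
  moreover have "k (a x) = b x" if "x \<in> P" for x using k(2)[OF imageI[OF that]] ga[OF that] by simp
  ultimately show ?thesis using k(1) by (intro exI[of _ k]) simp
qed

lemma out_hom:
  assumes P: "subgroup P S"
  shows "group_hom (Aut P) (out_group S F P) (\<lambda>u. Inn P #>\<^bsub>Aut P\<^esub> u)"
    "u \<in> carrier (Aut P) \<Longrightarrow> Inn P #>\<^bsub>Aut P\<^esub> u = \<one>\<^bsub>out_group S F P\<^esub> \<longleftrightarrow> u \<in> Inn P"
proof -
  interpret I: normal "Inn P" "Aut P" by (rule Inn_normal[OF P])
  show "group_hom (Aut P) (out_group S F P) (\<lambda>u. Inn P #>\<^bsub>Aut P\<^esub> u)"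
    using I.r_coset_hom_Mod I.factorgroup_is_group I.is_group
    unfolding out_group_def by (simp add: group_hom_def group_hom_axioms_def)
  show "u \<in> carrier (Aut P) \<Longrightarrow> Inn P #>\<^bsub>Aut P\<^esub> u = \<one>\<^bsub>out_group S F P\<^esub> \<longleftrightarrow> u \<in> Inn P"
    unfolding out_group_def FactGroup_def by (simp add: I.rcos_eq_iff)
qed

lemma (in group) subgroup_preimage:
  assumes h: "group_hom G H h" and Y: "subgroup Y H" shows "subgroup {x \<in> carrier G. h x \<in> Y} G"
proof -
  interpret h: group_hom G H h by (rule h)
  show ?thesis by (rule subgroupI) (use Y in \<open>auto simp: subgroup_def\<close>)
qed

lemma realize_automorphisms:
  assumes P: "centric P" and Y: "subgroup Y (Aut P)" "Inn P \<subseteq> Y"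
    and tor: "\<And>y. y \<in> Y \<Longrightarrow> \<exists>n. y [^]\<^bsub>Aut P\<^esub> (p ^ n :: nat) \<in> Inn P"
  shows "\<exists>R a. nrm P R a \<and> pb P a ` R = Y"
proof -
  note PS = centricD(1)[OF P]
  obtain f where f: "FM P f" and fn: "fully_normalized p S F (f ` P)" using exists_fully_normalized[OF P] by blast
  define P' where "P' = f ` P"
  have P': "subgroup P' S" unfolding P'_def by (rule FMD(4)[OF f])
  let ?O = "out_group S F P'" and ?N = "normalizer S P'"
  have fin: "finite (carrier ?O)" and syl: "sylow_subgroup p (out_S S F P') ?O"
    using saturated fn P' unfolding saturated_fusion_system_def P'_def by auto
  interpret A: group "Aut P" by (rule group_aut_F[OF PS])
  interpret A': group "Aut P'" by (rule group_aut_F[OF P'])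
  interpret I: normal "Inn P'" "Aut P'" by (rule Inn_normal[OF P'])
  define \<nu> where "\<nu> u = Inn P' #>\<^bsub>Aut P'\<^esub> u" for u
  interpret \<nu>: group_hom "Aut P'" ?O \<nu> unfolding \<nu>_def[abs_def] by (rule out_hom(1)[OF P'])
  let ?g = "inv_into P f"
  have g: "?g z \<in> P" "f (?g z) = z" if "z \<in> P'" for z using that unfolding P'_def by (auto intro: inv_into_into f_inv_into_f)
  have gf: "?g (f x) = x" if "x \<in> P" for x by (rule FM_inv_into[OF f that])
  define \<Phi> where "\<Phi> y = (\<lambda>z\<in>P'. f (y (?g z)))" for y
  have \<Phi>in: "\<Phi> y \<in> carrier (Aut P')" if y: "y \<in> carrier (Aut P)" for y
  proof -
    note yd = Aut_D[OF PS y]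
    have "FM P' (\<lambda>z. f (y (?g z)))" unfolding P'_def
      by (rule FM_comp[OF FM_comp[OF FM_inverse[OF f] yd(2)] f]) (use g yd(4) in \<open>auto simp: P'_def\<close>)
    then have F: "FM P' (\<Phi> y)" by (rule FM_cong) (simp add: \<Phi>_def)
    have "\<Phi> y ` P' = P'" by (rule FM_endo_surj[OF F]) (use g yd(4) in \<open>auto simp: \<Phi>_def P'_def\<close>)
    then show ?thesis unfolding aut_F_simps(1)[OF P'] using F by (auto simp: \<Phi>_def)
  qed
  have "group_hom (Aut P) (Aut P') \<Phi>"
  proof -
    have "\<Phi> (x \<otimes>\<^bsub>Aut P\<^esub> y) = \<Phi> x \<otimes>\<^bsub>Aut P'\<^esub> \<Phi> y" if xy: "x \<in> carrier (Aut P)" "y \<in> carrier (Aut P)" for x y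
    proof (rule extensionalityI[of _ P'])
      show "\<Phi> (x \<otimes>\<^bsub>Aut P\<^esub> y) \<in> extensional P'" "\<Phi> x \<otimes>\<^bsub>Aut P'\<^esub> \<Phi> y \<in> extensional P'"
        using Aut_D(1)[OF P' A'.m_closed] \<Phi>in xy by (auto simp: \<Phi>_def)
      fix z assume z: "z \<in> P'"
      have "y (?g z) \<in> P" using Aut_D(4)[OF PS xy(2)] g(1)[OF z] by blast
      then show "\<Phi> (x \<otimes>\<^bsub>Aut P\<^esub> y) z = (\<Phi> x \<otimes>\<^bsub>Aut P'\<^esub> \<Phi> y) z"
        using Aut_mult[OF P' \<Phi>in[OF xy(1)] \<Phi>in[OF xy(2)] z] Aut_mult[OF PS xy g(1)[OF z]] z gf
        by (simp add: \<Phi>_def P'_def)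
    qed
    then show ?thesis using \<Phi>in A.is_group A'.is_group by (auto simp: group_hom_def group_hom_axioms_def hom_def)
  qed
  then interpret \<Phi>: group_hom "Aut P" "Aut P'" \<Phi> .
  have \<Phi>Inn: "\<Phi> h \<in> Inn P'" if h: "h \<in> Inn P" for h
  proof -
    obtain x where x: "x \<in> P" "h = restrict (cj x) P" using h unfolding conj_hom_def by blast
    have "\<Phi> h = restrict (cj (f x)) P'"
      unfolding \<Phi>_def x(2) by (rule restrict_ext) (use g FM_conj_map[OF f x(1)] in auto)
    moreover have "f x \<in> P'" using x(1) by (simp add: P'_def)
    moreover have "cj (f x) ` P' \<subseteq> P'" using nrmD(4)[OF Inn_eq(2)[OF P'] calculation(2)] by simp
    ultimately show ?thesis unfolding conj_hom_def by blast
  qed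
  have Yc: "y \<in> carrier (Aut P)" if "y \<in> Y" for y using subgroup.subset[OF Y(1)] that by blast
  let ?Y = "\<nu> ` \<Phi> ` Y"
  have sY: "subgroup ?Y ?O" by (rule \<nu>.subgroup_img_is_subgroup[OF \<Phi>.subgroup_img_is_subgroup[OF Y(1)]])
  have torY: "\<exists>n. y [^]\<^bsub>?O\<^esub> (p ^ n :: nat) = \<one>\<^bsub>?O\<^esub>" if yY: "y \<in> ?Y" for y
  proof -
    obtain u where u: "u \<in> Y" "y = \<nu> (\<Phi> u)" using yY by blast
    obtain n where n: "u [^]\<^bsub>Aut P\<^esub> (p ^ n :: nat) \<in> Inn P" using tor[OF u(1)] by blast
    have "y [^]\<^bsub>?O\<^esub> (p ^ n) = \<nu> (\<Phi> (u [^]\<^bsub>Aut P\<^esub> (p ^ n)))"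
      unfolding u(2) using \<Phi>.hom_nat_pow[OF Yc[OF u(1)]] \<nu>.hom_nat_pow[OF \<Phi>in[OF Yc[OF u(1)]]] by simp
    also have "\<dots> = \<one>\<^bsub>?O\<^esub>" unfolding \<nu>_def using out_hom(2)[OF P'] \<Phi>Inn[OF n] I.subset by blast
    finally show ?thesis by blast
  qed
  obtain x where x: "x \<in> carrier ?O" "\<And>y. y \<in> ?Y \<Longrightarrow> x \<otimes>\<^bsub>?O\<^esub> y \<otimes>\<^bsub>?O\<^esub> inv\<^bsub>?O\<^esub> x \<in> out_S S F P'"
    using \<nu>.H.sylow_contains_conjugate[OF p fin syl sY torY] by blast
  obtain \<alpha> where \<alpha>: "\<alpha> \<in> carrier (Aut P')" "x = \<nu> \<alpha>" using x(1) unfolding out_group_def carrier_FactGroup \<nu>_def by blast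
  note \<alpha>d = Aut_D[OF P' \<alpha>(1)]
  define a where "a x = \<alpha> (f x)" for x
  have FMa: "FM P a" unfolding a_def by (rule FM_comp[OF f \<alpha>d(2)]) (simp add: P'_def)
  have aP: "a ` P = P'" using \<alpha>d(3) unfolding a_def P'_def by (simp flip: image_image)
  have nN: "nrm P ?N a" unfolding nrm_def aP
    using FMa nrmD(2,4)[OF AutS_eq(2)[OF P']] subgroup_normalizer[OF P'] by auto
  note n' = AutS_eq(2)[OF P']
  have real: "\<exists>r\<in>?N. y = pb P a r" if y: "y \<in> Y" for y
  proof -
    note yc = Yc[OF y]
    let ?c = "\<alpha> \<otimes>\<^bsub>Aut P'\<^esub> \<Phi> y \<otimes>\<^bsub>Aut P'\<^esub> inv\<^bsub>Aut P'\<^esub> \<alpha>"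
    have cc: "?c \<in> carrier (Aut P')" using \<alpha>(1) \<Phi>in[OF yc] by simp
    have "\<nu> ?c \<in> out_S S F P'" using x(2)[of "\<nu> (\<Phi> y)"] y \<alpha> \<Phi>in[OF yc] by simp
    then obtain s where s: "s \<in> conj_hom S (carrier S) P' P'" "\<nu> ?c = \<nu> s"
      unfolding out_S_def carrier_FactGroup \<nu>_def by (auto simp: r_coset_def)
    obtain q where q: "q \<in> ?N" "s = pb P' (\<lambda>x. x) q" using s(1) unfolding AutS_eq(1)[OF P'] by blast
    have "?c \<in> Inn P' #>\<^bsub>Aut P'\<^esub> s" using A'.rcos_self[OF cc I.is_subgroup] s(2) unfolding \<nu>_def by simp
    then obtain i where i: "i \<in> Inn P'" "?c = i \<otimes>\<^bsub>Aut P'\<^esub> s" by (auto simp: r_coset_def)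
    obtain q' where q': "q' \<in> ?N" "i = pb P' (\<lambda>x. x) q'"
      using i(1) subgroup_normalizer[OF P'] unfolding Inn_eq(1)[OF P'] by blast
    define r where "r = q' \<otimes> q"
    have r: "r \<in> ?N" unfolding r_def by (rule subgroupD(3)[OF nrmD(2)[OF n'] q'(1) q(1)])
    have "?c = pb P' (\<lambda>x. x) r"
      unfolding i(2) q(2) q'(2) r_def using group_hom.hom_mult[OF pb_hom[OF n'], of q' q] q(1) q'(1) by simp
    then have "\<alpha> \<otimes>\<^bsub>Aut P'\<^esub> \<Phi> y = pb P' (\<lambda>x. x) r \<otimes>\<^bsub>Aut P'\<^esub> \<alpha>"
      using \<alpha>(1) \<Phi>in[OF yc] pb_in[OF n' r] by (metis A'.inv_solve_right' A'.m_closed)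
    then have eq: "\<alpha> (\<Phi> y z) = cj r (\<alpha> z)" if z: "z \<in> P'" for z
      using Aut_mult[OF P' \<alpha>(1) \<Phi>in[OF yc] z] Aut_mult[OF P' pb_in[OF n' r] \<alpha>(1) z] pb_id[OF n' r] \<alpha>d(4)[OF z] by simp
    have "y = pb P a r"
    proof (rule pb_unique[OF nN r Aut_D(1)[OF PS yc] Aut_D(4)[OF PS yc]])
      fix x assume x: "x \<in> P"
      then have "f x \<in> P'" by (simp add: P'_def)
      from eq[OF this] show "a (y x) = cj r (a x)" using \<open>f x \<in> P'\<close> gf[OF x] by (simp add: a_def \<Phi>_def)
    qed
    then show ?thesis using r by blast
  qed
  define R where "R = {r \<in> ?N. pb P a r \<in> Y}"
  have "subgroup {r \<in> carrier (grp ?N). pb P a r \<in> Y} (grp ?N)"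
    by (rule group.subgroup_preimage[OF subgroup_imp_group[OF nrmD(2)[OF nN]] pb_hom[OF nN] Y(1)])
  then have R: "subgroup R S" using incl_subgroup[OF nrmD(2)[OF nN]] by (simp add: R_def)
  have "a x \<in> R" if x: "x \<in> P" for x
  proof -
    have "pb P a (a x) \<in> Inn P" unfolding pb_inner[OF nN x] conj_hom_def using x nrmD(4)[OF Inn_eq(2)[OF PS] x] by auto
    then show ?thesis using Y(2) nrmD(3)[OF nN] x unfolding R_def by blast
  qed
  then have "nrm P R a" unfolding nrm_def using FMa R nrmD(4)[OF nN] by (auto simp: R_def)
  moreover have "pb P a ` R = Y" using real unfolding R_def by blast
  ultimately show ?thesis by blast
qed

lemma not_radical:
  assumes P: "subgroup P S" and nr: "\<not> F_radical p S F P"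
  shows "\<exists>Y. Y \<lhd> Aut P \<and> Inn P \<subset> Y \<and> (\<forall>y\<in>Y. \<exists>n. y [^]\<^bsub>Aut P\<^esub> (p ^ n :: nat) \<in> Inn P)"
proof -
  let ?O = "out_group S F P"
  interpret A: group "Aut P" by (rule group_aut_F[OF P])
  interpret I: normal "Inn P" "Aut P" by (rule Inn_normal[OF P])
  define \<nu> where "\<nu> u = Inn P #>\<^bsub>Aut P\<^esub> u" for u
  have \<nu>: "group_hom (Aut P) ?O \<nu>" unfolding \<nu>_def[abs_def] by (rule out_hom(1)[OF P])
  interpret \<nu>: group_hom "Aut P" ?O \<nu> by (rule \<nu>)
  note \<nu>1 = out_hom(2)[OF P, folded \<nu>_def]
  obtain N where N: "N \<lhd> ?O" "p_group p (?O\<lparr>carrier := N\<rparr>)" "N \<noteq> {\<one>\<^bsub>?O\<^esub>}"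
    using nr P unfolding F_radical_def by auto
  interpret N: normal N ?O by (rule N(1))
  define Y where "Y = {u \<in> carrier (Aut P). \<nu> u \<in> N}"
  have "subgroup Y (Aut P)" unfolding Y_def by (rule A.subgroup_preimage[OF \<nu> N.is_subgroup])
  moreover have "x \<otimes>\<^bsub>Aut P\<^esub> h \<otimes>\<^bsub>Aut P\<^esub> inv\<^bsub>Aut P\<^esub> x \<in> Y" if "x \<in> carrier (Aut P)" "h \<in> Y" for x h
    using that N.inv_op_closed2[of "\<nu> x" "\<nu> h"] by (simp add: Y_def)
  ultimately have "Y \<lhd> Aut P" unfolding A.normal_inv_iff by blast
  moreover have "Inn P \<subset> Y"
  proof
    show "Inn P \<subseteq> Y"
    proof
      fix u assume u: "u \<in> Inn P"
      then have uc: "u \<in> carrier (Aut P)" using I.subset by blast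
      then show "u \<in> Y" using \<nu>1[OF uc] u N.one_closed by (simp add: Y_def)
    qed
    obtain y where y: "y \<in> N" "y \<noteq> \<one>\<^bsub>?O\<^esub>" using N(3) N.one_closed by blast
    then have "y \<in> carrier ?O" using N.subset by blast
    then obtain u where u: "u \<in> carrier (Aut P)" "y = \<nu> u" unfolding out_group_def carrier_FactGroup \<nu>_def by blast
    then have "u \<in> Y" "u \<notin> Inn P" using y \<nu>1[OF u(1)] by (auto simp: Y_def)
    then show "Inn P \<noteq> Y" by blast
  qed
  moreover have "\<exists>n. y [^]\<^bsub>Aut P\<^esub> (p ^ n :: nat) \<in> Inn P" if y: "y \<in> Y" for y
  proof -
    have yc: "y \<in> carrier (Aut P)" and yN: "\<nu> y \<in> N" using y by (auto simp: Y_def)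
    obtain n where "\<nu> y [^]\<^bsub>?O\<lparr>carrier := N\<rparr>\<^esub> (p ^ n :: nat) = \<one>\<^bsub>?O\<lparr>carrier := N\<rparr>\<^esub>"
      using N(2) yN unfolding p_group_def by auto
    then have "\<nu> y [^]\<^bsub>?O\<^esub> (p ^ n) = \<one>\<^bsub>?O\<^esub>" by (simp flip: \<nu>.H.nat_pow_consistent)
    then have "\<nu> (y [^]\<^bsub>Aut P\<^esub> (p ^ n)) = \<one>\<^bsub>?O\<^esub>" using \<nu>.hom_nat_pow[OF yc] by simp
    then show ?thesis using \<nu>1[OF A.nat_pow_closed[OF yc]] by blast
  qed
  ultimately show ?thesis by blast
qed

end

section \<open>Linking systems\<close>

lemma coslice_full_subcategory: "coslice (full C U) b A = coslice C b (U \<inter> A)"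
  by (auto simp: coslice_def fun_eq_iff)

locale linking = fusion S p F for S (structure) and p and F :: "('a set, 'a \<Rightarrow> 'a) cat" +
  fixes L :: "('a set, 'm) cat" and \<pi> :: "'a set \<Rightarrow> 'a set \<Rightarrow> 'm \<Rightarrow> 'a \<Rightarrow> 'a" and \<delta> :: "'a set \<Rightarrow> 'a \<Rightarrow> 'm"
  assumes linking: "centric_linking_system S F L \<pi> \<delta>"
begin

abbreviation Z where "Z P \<equiv> P \<inter> centralizer S P"

lemma category_L: "category L" and Obj_L [simp]: "Obj L = {P. centric P}" and functor_L: "is_functor L F (\<lambda>P. P) \<pi>"
  using linking by (simp_all add: centric_linking_system_def)

sublocale category L by (rule category_L)

lemma L_Comp: "\<lbrakk>centric P; centric Q; centric R; f \<in> Hom L P Q; g \<in> Hom L Q R\<rbrakk> \<Longrightarrow> Comp L P Q R g f \<in> Hom L P R"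
  using Comp_in by simp

lemma L_assoc: "\<lbrakk>centric O'; centric P; centric Q; centric R; f \<in> Hom L O' P; g \<in> Hom L P Q; h \<in> Hom L Q R\<rbrakk>
    \<Longrightarrow> Comp L O' P R (Comp L P Q R h g) f = Comp L O' Q R h (Comp L O' P Q g f)"
  using Comp_assoc by simp

lemma \<pi>_in: assumes "centric P" "centric Q" "f \<in> Hom L P Q"
  shows "\<pi> P Q f \<in> Hom F P Q" "\<pi> P Q f \<in> extensional P" "FM P (\<pi> P Q f)" "\<pi> P Q f ` P \<subseteq> Q" "x \<in> P \<Longrightarrow> \<pi> P Q f x \<in> Q"
proof -
  show h: "\<pi> P Q f \<in> Hom F P Q" using functor_L assms unfolding is_functor_def by simp
  then show "\<pi> P Q f \<in> extensional P" "FM P (\<pi> P Q f)" "\<pi> P Q f ` P \<subseteq> Q"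
    unfolding Hom_F_iff[OF centricD(1)[OF assms(1)] centricD(1)[OF assms(2)]] by simp_all
  then show "x \<in> P \<Longrightarrow> \<pi> P Q f x \<in> Q" by blast
qed

lemma \<pi>_comp:
  assumes "centric P" "centric Q" "centric R" "f \<in> Hom L P Q" "g \<in> Hom L Q R" "x \<in> P"
  shows "\<pi> P R (Comp L P Q R g f) x = \<pi> Q R g (\<pi> P Q f x)"
proof -
  have "\<pi> P R (Comp L P Q R g f) = Comp F P Q R (\<pi> Q R g) (\<pi> P Q f)"
    using functor_L assms(1-5) unfolding is_functor_def by simp
  also have "\<dots> = compose P (\<pi> Q R g) (\<pi> P Q f)"
    by (rule Comp_F) (use assms centricD(1) \<pi>_in(1) in auto)
  finally show ?thesis using assms(6) by (simp add: compose_def)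
qed

lemma \<delta>_in: assumes P: "centric P" and g: "g \<in> P"
  shows "\<delta> P g \<in> Hom L P P" "\<pi> P P (\<delta> P g) = restrict (cj g) P" "\<delta> P g \<in> isos L P P"
    "h \<in> P \<Longrightarrow> \<delta> P (g \<otimes> h) = Comp L P P P (\<delta> P g) (\<delta> P h)"
proof -
  have h: "\<delta> P \<in> hom (grp P) (aut_group L P)" using linking P unfolding centric_linking_system_def by simp
  then show i: "\<delta> P g \<in> isos L P P" using g by (auto simp: hom_def aut_group_def)
  then show "\<delta> P g \<in> Hom L P P" by (simp add: isos_def)
  show "\<pi> P P (\<delta> P g) = restrict (cj g) P" using linking P g unfolding centric_linking_system_def by simp
  show "h \<in> P \<Longrightarrow> \<delta> P (g \<otimes> h) = Comp L P P P (\<delta> P g) (\<delta> P h)" using h g by (auto simp: hom_def aut_group_def)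
qed

lemma \<delta>_one: assumes P: "centric P" shows "\<delta> P \<one> = Ident L P"
proof -
  have o: "\<one> \<in> P" using subgroupD(2)[OF centricD(1)[OF P]] .
  note d = \<delta>_in[OF P o]
  have PO: "P \<in> Obj L" using P by simp
  obtain g where g: "g \<in> Hom L P P" "Comp L P P P g (\<delta> P \<one>) = Ident L P" using d(3) by (auto simp: isos_def)
  have "Comp L P P P (\<delta> P \<one>) (\<delta> P \<one>) = \<delta> P \<one>" using d(4)[OF o] by simp
  then have "Comp L P P P (Comp L P P P g (\<delta> P \<one>)) (\<delta> P \<one>) = Comp L P P P g (\<delta> P \<one>)"
    using L_assoc[OF P P P P d(1) d(1) g(1)] by simp
  then show ?thesis unfolding g(2) using Comp_Ident_left[OF PO PO d(1)] by simp
qed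

lemma \<delta>_commute:
  assumes "centric P" "centric Q" "f \<in> Hom L P Q" "g \<in> P"
  shows "Comp L P P Q f (\<delta> P g) = Comp L P Q Q (\<delta> Q (\<pi> P Q f g)) f"
  using linking assms unfolding centric_linking_system_def by simp

lemma \<delta>_free:
  assumes "centric P" "centric Q" "f \<in> Hom L P Q" "z \<in> Z P" "Comp L P P Q f (\<delta> P z) = f"
  shows "z = \<one>"
  using linking assms unfolding centric_linking_system_def by simp

lemma lift:
  assumes P: "centric P" and Q: "centric Q" and k: "FM P k" "k ` P \<subseteq> Q"
  obtains f where "f \<in> Hom L P Q" "\<And>x. x \<in> P \<Longrightarrow> \<pi> P Q f x = k x"
proof -
  have PQ: "P \<in> Obj L" "Q \<in> Obj L" using P Q by simp_all
  obtain h where h: "bij_betw h (center_orbit S L \<delta> P Q ` Hom L P Q) (Hom F P Q)"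
      "\<forall>f\<in>Hom L P Q. h (center_orbit S L \<delta> P Q f) = \<pi> P Q f"
    using linking PQ unfolding centric_linking_system_def by metis
  have "restrict k P \<in> Hom F P Q" by (rule FM_Hom[OF k(1) centricD(1)[OF Q] k(2)])
  then have "restrict k P \<in> h ` center_orbit S L \<delta> P Q ` Hom L P Q" using bij_betw_imp_surj_on[OF h(1)] by simp
  then obtain f where f: "f \<in> Hom L P Q" "restrict k P = h (center_orbit S L \<delta> P Q f)" by blast
  then have "\<pi> P Q f = restrict k P" using h(2) by simp
  then show thesis using that[OF f(1)] by simp
qed

lemma \<pi>_eq:
  assumes P: "centric P" and Q: "centric Q" and f: "f \<in> Hom L P Q" and g: "g \<in> Hom L P Q"
    and eq: "\<And>x. x \<in> P \<Longrightarrow> \<pi> P Q f x = \<pi> P Q g x"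
  obtains z where "z \<in> Z P" "g = Comp L P P Q f (\<delta> P z)"
proof -
  have PQ: "P \<in> Obj L" "Q \<in> Obj L" using P Q by simp_all
  obtain h where h: "bij_betw h (center_orbit S L \<delta> P Q ` Hom L P Q) (Hom F P Q)"
      "\<forall>f\<in>Hom L P Q. h (center_orbit S L \<delta> P Q f) = \<pi> P Q f"
    using linking PQ unfolding centric_linking_system_def by metis
  have "\<pi> P Q f = \<pi> P Q g" using extensionalityI[OF \<pi>_in(2)[OF P Q f] \<pi>_in(2)[OF P Q g] eq] .
  then have "h (center_orbit S L \<delta> P Q f) = h (center_orbit S L \<delta> P Q g)" using h(2) f g by simp
  then have orb: "center_orbit S L \<delta> P Q f = center_orbit S L \<delta> P Q g"
    using inj_onD[OF bij_betw_imp_inj_on[OF h(1)]] f g by blast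
  have "\<one> \<in> Z P" using subgroupD(2)[OF centricD(1)[OF P]] subgroupD(1)[OF centricD(1)[OF P]] by (simp add: centralizer_def)
  moreover have "g = Comp L P P Q g (\<delta> P \<one>)" using \<delta>_one[OF P] Comp_Ident_right[OF PQ g] by simp
  ultimately have "g \<in> center_orbit S L \<delta> P Q f" unfolding orb unfolding center_orbit_def by blast
  then show thesis unfolding center_orbit_def using that by blast
qed

lemma factor_iff:
  assumes P: "centric P" and Q: "centric Q" and R: "centric R"
    and f: "f \<in> Hom L P Q" and h: "h \<in> Hom L P R"
  shows "(\<exists>u\<in>Hom L Q R. Comp L P Q R u f = h) \<longleftrightarrow> (\<exists>k. FM Q k \<and> k ` Q \<subseteq> R \<and> (\<forall>x\<in>P. k (\<pi> P Q f x) = \<pi> P R h x))"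
proof
  assume "\<exists>u\<in>Hom L Q R. Comp L P Q R u f = h"
  then obtain u where u: "u \<in> Hom L Q R" "Comp L P Q R u f = h" by blast
  show "\<exists>k. FM Q k \<and> k ` Q \<subseteq> R \<and> (\<forall>x\<in>P. k (\<pi> P Q f x) = \<pi> P R h x)"
    using \<pi>_in(3,4)[OF Q R u(1)] \<pi>_comp[OF P Q R f u(1)] u(2) by (intro exI[of _ "\<pi> Q R u"]) simp
next
  assume "\<exists>k. FM Q k \<and> k ` Q \<subseteq> R \<and> (\<forall>x\<in>P. k (\<pi> P Q f x) = \<pi> P R h x)"
  then obtain k where k: "FM Q k" "k ` Q \<subseteq> R" "\<And>x. x \<in> P \<Longrightarrow> k (\<pi> P Q f x) = \<pi> P R h x" by blast
  obtain u where u: "u \<in> Hom L Q R" "\<And>x. x \<in> Q \<Longrightarrow> \<pi> Q R u x = k x" by (rule lift[OF Q R k(1,2)]) (rule that)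
  have uf: "Comp L P Q R u f \<in> Hom L P R" by (rule L_Comp[OF P Q R f u(1)])
  obtain z where z: "z \<in> Z P" "h = Comp L P P R (Comp L P Q R u f) (\<delta> P z)"
    by (rule \<pi>_eq[OF P R uf h]) (use \<pi>_comp[OF P Q R f u(1)] u(2) \<pi>_in(5)[OF P Q f] k(3) in auto)
  have zP: "z \<in> P" using z(1) by blast
  have fz: "\<pi> P Q f z \<in> Q" by (rule \<pi>_in(5)[OF P Q f zP])
  have "h = Comp L P Q R u (Comp L P P Q f (\<delta> P z))"
    using z(2) L_assoc[OF P P Q R \<delta>_in(1)[OF P zP] f u(1)] by simp
  also have "\<dots> = Comp L P Q R (Comp L Q Q R u (\<delta> Q (\<pi> P Q f z))) f"
    unfolding \<delta>_commute[OF P Q f zP] by (rule L_assoc[OF P Q Q R f \<delta>_in(1)[OF Q fz] u(1), symmetric])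
  finally show "\<exists>u\<in>Hom L Q R. Comp L P Q R u f = h"
    using L_Comp[OF Q Q R \<delta>_in(1)[OF Q fz] u(1)] by blast
qed

lemma \<delta>_left_free:
  assumes P: "centric P" and R: "centric R" and g: "g \<in> Hom L P R" and y: "y \<in> R"
    and c: "\<And>x. x \<in> P \<Longrightarrow> y \<otimes> \<pi> P R g x = \<pi> P R g x \<otimes> y" and eq: "Comp L P R R (\<delta> R y) g = g"
  shows "y = \<one>"
proof -
  note d = \<pi>_in(3)[OF P R g]
  have yc: "y \<in> carrier S" by (rule subgroupD(1)[OF centricD(1)[OF R] y])
  have "y \<in> centralizer S (\<pi> P R g ` P)" using c yc by (auto simp: centralizer_def)
  then have "y \<in> \<pi> P R g ` P" using centricD(2)[OF P d] by blast
  then obtain z where z: "z \<in> P" "y = \<pi> P R g z" by blast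
  have "z \<otimes> x = x \<otimes> z" if x: "x \<in> P" for x
  proof (rule inj_onD[OF FMD(2)[OF d]])
    show "\<pi> P R g (z \<otimes> x) = \<pi> P R g (x \<otimes> z)"
      using c[OF x] FMD(5)[OF d z(1) x] FMD(5)[OF d x z(1)] z(2) by simp
  qed (use subgroupD(3)[OF centricD(1)[OF P]] z(1) x in auto)
  then have zZ: "z \<in> Z P" using z(1) subgroupD(1)[OF centricD(1)[OF P] z(1)] by (simp add: centralizer_def)
  have "Comp L P P R g (\<delta> P z) = g" unfolding \<delta>_commute[OF P R g z(1)] z(2)[symmetric] by (rule eq)
  then have "z = \<one>" by (rule \<delta>_free[OF P R g zZ])
  then show ?thesis using z(2) FM_one[OF d] by simp
qed

lemma epi_if_\<pi>_eq:
  assumes P: "centric P" and Q: "centric Q" and R: "centric R"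
    and f: "f \<in> Hom L P Q" and u: "u \<in> Hom L Q R" and v: "v \<in> Hom L Q R"
    and eq: "Comp L P Q R u f = Comp L P Q R v f" and \<pi>: "\<And>x. x \<in> Q \<Longrightarrow> \<pi> Q R u x = \<pi> Q R v x"
  shows "u = v"
proof -
  obtain z where z: "z \<in> Z Q" "v = Comp L Q Q R u (\<delta> Q z)" by (rule \<pi>_eq[OF Q R u v]) (rule \<pi>, assumption, rule that)
  have zQ: "z \<in> Q" using z(1) by blast
  note uz = \<pi>_in(5)[OF Q R u zQ] and d = \<pi>_in(3)[OF Q R u] and uf = L_Comp[OF P Q R f u]
  have "\<pi> Q R u z = \<one>"
  proof (rule \<delta>_left_free[OF P R uf uz])
    fix x assume x: "x \<in> P"
    have fx: "\<pi> P Q f x \<in> Q" by (rule \<pi>_in(5)[OF P Q f x])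
    have "z \<otimes> \<pi> P Q f x = \<pi> P Q f x \<otimes> z" using z(1) fx by (simp add: centralizer_def)
    then show "\<pi> Q R u z \<otimes> \<pi> P R (Comp L P Q R u f) x = \<pi> P R (Comp L P Q R u f) x \<otimes> \<pi> Q R u z"
      unfolding \<pi>_comp[OF P Q R f u x] using FMD(5)[OF d zQ fx] FMD(5)[OF d fx zQ] by simp
  next
    have "Comp L P R R (\<delta> R (\<pi> Q R u z)) (Comp L P Q R u f) = Comp L P Q R (Comp L Q R R (\<delta> R (\<pi> Q R u z)) u) f"
      by (rule L_assoc[OF P Q R R f u \<delta>_in(1)[OF R uz], symmetric])
    also have "\<dots> = Comp L P Q R v f" unfolding z(2) \<delta>_commute[OF Q R u zQ] ..
    finally show "Comp L P R R (\<delta> R (\<pi> Q R u z)) (Comp L P Q R u f) = Comp L P Q R u f" using eq by simp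
  qed
  then have "\<pi> Q R u z = \<pi> Q R u \<one>" using FM_one[OF d] by simp
  then have "z = \<one>" using inj_onD[OF FMD(2)[OF d]] zQ subgroupD(2)[OF centricD(1)[OF Q]] by blast
  then show ?thesis using z(2) \<delta>_one[OF Q] Comp_Ident_right[of Q R u] Q R u by simp
qed

lemma epi_normalizer:
  assumes P: "centric P" and Q: "centric Q" and R: "centric R"
    and f: "f \<in> Hom L P Q" and u: "u \<in> Hom L Q R" and v: "v \<in> Hom L Q R"
    and eq: "Comp L P Q R u f = Comp L P Q R v f" and x: "x \<in> Q" "cj x ` \<pi> P Q f ` P \<subseteq> \<pi> P Q f ` P"
  shows "\<pi> Q R u x = \<pi> Q R v x"
proof -
  let ?f = "\<pi> P Q f"
  note df = \<pi>_in(3)[OF P Q f] and du = \<pi>_in(3)[OF Q R u] and dv = \<pi>_in(3)[OF Q R v] and QS = centricD(1)[OF Q] and RS = centricD(1)[OF R]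
  have xc: "x \<in> carrier S" by (rule subgroupD(1)[OF QS x(1)])
  note dx = \<delta>_in(1,2)[OF Q x(1)]
  have xf: "Comp L P Q Q (\<delta> Q x) f \<in> Hom L P Q" by (rule L_Comp[OF P Q Q f dx(1)])
  define k where "k y = inv_into P ?f (cj x (?f y))" for y
  have fk: "?f (k y) = cj x (?f y)" if y: "y \<in> P" for y
    unfolding k_def by (rule f_inv_into_f) (use x(2) y in blast)
  have "FM P (\<lambda>y. inv_into P ?f (cj x (?f y)))"
    by (rule FM_comp[OF FM_comp[OF df FM_conj[OF FMD(4)[OF df] xc] order_refl] FM_inverse[OF df]]) (use x(2) in blast)
  then have k: "FM P k" unfolding k_def[abs_def] .
  have kP: "k ` P \<subseteq> P" unfolding k_def using x(2) by (auto intro!: inv_into_into)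
  have "\<exists>a\<in>Hom L P P. Comp L P P Q f a = Comp L P Q Q (\<delta> Q x) f"
  proof -
    obtain a where a: "a \<in> Hom L P P" "\<And>y. y \<in> P \<Longrightarrow> \<pi> P P a y = k y" by (rule lift[OF P P k kP]) (rule that)
    obtain z where z: "z \<in> Z P" "Comp L P Q Q (\<delta> Q x) f = Comp L P P Q (Comp L P P Q f a) (\<delta> P z)"
    proof (rule \<pi>_eq[OF P Q L_Comp[OF P P Q a(1) f] xf])
      fix y assume y: "y \<in> P"
      show "\<pi> P Q (Comp L P P Q f a) y = \<pi> P Q (Comp L P Q Q (\<delta> Q x) f) y"
        unfolding \<pi>_comp[OF P P Q a(1) f y] \<pi>_comp[OF P Q Q f dx(1) y] a(2)[OF y] fk[OF y] dx(2)
        using \<pi>_in(5)[OF P Q f y] by simp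
    qed (rule that)
    have zP: "z \<in> P" using z(1) by blast
    have "Comp L P Q Q (\<delta> Q x) f = Comp L P P Q f (Comp L P P P a (\<delta> P z))"
      unfolding z(2) by (rule L_assoc[OF P P P Q \<delta>_in(1)[OF P zP] a(1) f])
    then show ?thesis using L_Comp[OF P P P \<delta>_in(1)[OF P zP] a(1)] by metis
  qed
  then obtain a where a: "a \<in> Hom L P P" "Comp L P P Q f a = Comp L P Q Q (\<delta> Q x) f" by blast
  have step: "Comp L P R R (\<delta> R (\<pi> Q R w x)) (Comp L P Q R w f) = Comp L P P R (Comp L P Q R w f) a" if w: "w \<in> Hom L Q R" for w
  proof -
    have "Comp L P R R (\<delta> R (\<pi> Q R w x)) (Comp L P Q R w f) = Comp L P Q R (Comp L Q R R (\<delta> R (\<pi> Q R w x)) w) f"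
      by (rule L_assoc[OF P Q R R f w \<delta>_in(1)[OF R \<pi>_in(5)[OF Q R w x(1)]], symmetric])
    also have "\<dots> = Comp L P Q R w (Comp L P P Q f a)"
      unfolding \<delta>_commute[OF Q R w x(1), symmetric] a(2) by (rule L_assoc[OF P Q Q R f dx(1) w])
    also have "\<dots> = Comp L P P R (Comp L P Q R w f) a" by (rule L_assoc[OF P P Q R a(1) f w, symmetric])
    finally show ?thesis .
  qed
  let ?g = "Comp L P Q R u f"
  have g: "?g \<in> Hom L P R" by (rule L_Comp[OF P Q R f u])
  define s where "s = \<pi> Q R u x"
  define t where "t = \<pi> Q R v x"
  have st: "s \<in> R" "t \<in> R" unfolding s_def t_def by (rule \<pi>_in(5)[OF Q R u x(1)], rule \<pi>_in(5)[OF Q R v x(1)])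
  have stc: "s \<in> carrier S" "t \<in> carrier S" using subgroupD(1)[OF RS] st by auto
  have ti: "inv t \<in> R" by (rule subgroupD(4)[OF RS st(2)])
  have e: "Comp L P R R (\<delta> R s) ?g = Comp L P R R (\<delta> R t) ?g"
    unfolding s_def t_def step[OF u] using step[OF v] eq by simp
  have "inv t \<otimes> s = \<one>"
  proof (rule \<delta>_left_free[OF P R g subgroupD(3)[OF RS ti st(1)]])
    have "Comp L P R R (\<delta> R (inv t \<otimes> s)) ?g = Comp L P R R (\<delta> R (inv t)) (Comp L P R R (\<delta> R s) ?g)"
      unfolding \<delta>_in(4)[OF R ti st(1)] by (rule L_assoc[OF P R R R g \<delta>_in(1)[OF R st(1)] \<delta>_in(1)[OF R ti]])
    also have "\<dots> = Comp L P R R (\<delta> R (inv t \<otimes> t)) ?g"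
      unfolding e \<delta>_in(4)[OF R ti st(2)] by (rule L_assoc[OF P R R R g \<delta>_in(1)[OF R st(2)] \<delta>_in(1)[OF R ti], symmetric])
    also have "\<dots> = ?g" using stc \<delta>_one[OF R] Comp_Ident_left[of P R ?g] P R g by simp
    finally show "Comp L P R R (\<delta> R (inv t \<otimes> s)) ?g = ?g" .
  next
    fix y assume y: "y \<in> P"
    let ?y = "\<pi> P R ?g y"
    have yc: "?y \<in> carrier S" by (rule FMD(6)[OF \<pi>_in(3)[OF P R g] y])
    note fy = \<pi>_in(5)[OF P Q f y]
    note ky = subsetD[OF kP imageI[OF y]]
    have cu: "cj s ?y = \<pi> P R ?g (k y)"
      unfolding s_def \<pi>_comp[OF P Q R f u y] \<pi>_comp[OF P Q R f u ky] fk[OF y] by (rule FM_conj_map[OF du x(1) fy, symmetric])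
    have cv: "cj t ?y = \<pi> P R ?g (k y)"
      unfolding t_def eq \<pi>_comp[OF P Q R f v y] \<pi>_comp[OF P Q R f v ky] fk[OF y] by (rule FM_conj_map[OF dv x(1) fy, symmetric])
    have "cj (inv t \<otimes> s) ?y = ?y"
      unfolding conj_map_comp[OF inv_closed[OF stc(2)] stc(1) yc] cu cv[symmetric] by (rule conj_map_inv(1)[OF stc(2) yc])
    then show "inv t \<otimes> s \<otimes> ?y = ?y \<otimes> (inv t \<otimes> s)" using conj_map_commute[of "inv t \<otimes> s" ?y] stc yc by simp
  qed
  then show ?thesis using stc unfolding s_def[symmetric] t_def[symmetric] by (metis inv_closed inv_equality inv_inv)
qed

lemma L_epi:
  assumes P: "centric P" and Q: "centric Q" and R: "centric R"
    and f: "f \<in> Hom L P Q" and u: "u \<in> Hom L Q R" and v: "v \<in> Hom L Q R"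
    and eq: "Comp L P Q R u f = Comp L P Q R v f"
  shows "u = v"
proof -
  let ?u = "\<pi> Q R u" and ?v = "\<pi> Q R v"
  note du = \<pi>_in(3)[OF Q R u] and dv = \<pi>_in(3)[OF Q R v] and df = \<pi>_in(3)[OF P Q f] and QS = centricD(1)[OF Q]
  define E where "E = {x \<in> Q. ?u x = ?v x}"
  have ES: "subgroup E S"
  proof (rule torsion_subgroupI)
    show "E \<subseteq> carrier S" using subgroupD(1)[OF QS] by (auto simp: E_def)
    show "\<one> \<in> E" using subgroupD(2)[OF QS] FM_one[OF du] FM_one[OF dv] by (simp add: E_def)
    show "a \<otimes> b \<in> E" if "a \<in> E" "b \<in> E" for a b using that subgroupD(3)[OF QS] FMD(5)[OF du] FMD(5)[OF dv] by (simp add: E_def)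
  qed
  have EQ: "E \<subseteq> Q" by (auto simp: E_def)
  have fE: "\<pi> P Q f ` P \<subseteq> E"
  proof (rule image_subsetI)
    fix x assume x: "x \<in> P"
    have "?u (\<pi> P Q f x) = ?v (\<pi> P Q f x)" using \<pi>_comp[OF P Q R f u x] \<pi>_comp[OF P Q R f v x] eq by simp
    then show "\<pi> P Q f x \<in> E" using \<pi>_in(5)[OF P Q f x] by (simp add: E_def)
  qed
  have E: "centric E" by (rule centric_overgroup[OF centric_image[OF P df] ES fE])
  obtain i where i: "i \<in> Hom L E Q" "\<And>x. x \<in> E \<Longrightarrow> \<pi> E Q i x = x"
    by (rule lift[OF E Q FM_id[OF ES]]) (use EQ in auto)
  have "\<exists>f'. f' \<in> Hom L P E \<and> (\<forall>x\<in>P. \<pi> P E f' x = \<pi> P Q f x)" by (rule lift[OF P E df fE]) blast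
  then obtain f0 where f0: "f0 \<in> Hom L P E" "\<And>x. x \<in> P \<Longrightarrow> \<pi> P E f0 x = \<pi> P Q f x" by blast
  obtain z where z: "z \<in> Z P" "f = Comp L P P Q (Comp L P E Q i f0) (\<delta> P z)"
  proof (rule \<pi>_eq[OF P Q L_Comp[OF P E Q f0(1) i(1)] f])
    fix x assume x: "x \<in> P"
    show "\<pi> P Q (Comp L P E Q i f0) x = \<pi> P Q f x"
      unfolding \<pi>_comp[OF P E Q f0(1) i(1) x] using f0(2)[OF x] i(2) fE x by auto
  qed (rule that)
  have zP: "z \<in> P" using z(1) by blast
  define f' where "f' = Comp L P P E f0 (\<delta> P z)"
  have f': "f' \<in> Hom L P E" unfolding f'_def by (rule L_Comp[OF P P E \<delta>_in(1)[OF P zP] f0(1)])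
  have fi: "f = Comp L P E Q i f'" unfolding z(2) f'_def by (rule L_assoc[OF P P E Q \<delta>_in(1)[OF P zP] f0(1) i(1)])
  have ui: "Comp L E Q R u i = Comp L E Q R v i"
  proof (rule epi_if_\<pi>_eq[OF P E R f' L_Comp[OF E Q R i(1) u] L_Comp[OF E Q R i(1) v]])
    show "Comp L P E R (Comp L E Q R u i) f' = Comp L P E R (Comp L E Q R v i) f'"
      using eq unfolding L_assoc[OF P E Q R f' i(1) u] L_assoc[OF P E Q R f' i(1) v] fi[symmetric] .
    show "\<pi> E R (Comp L E Q R u i) x = \<pi> E R (Comp L E Q R v i) x" if x: "x \<in> E" for x
      unfolding \<pi>_comp[OF E Q R i(1) u x] \<pi>_comp[OF E Q R i(1) v x] i(2)[OF x] using x by (simp add: E_def)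
  qed
  have iE: "\<pi> E Q i ` E = E" using i(2) by simp
  have "E = Q"
  proof (rule ccontr)
    assume "E \<noteq> Q"
    then have "E \<subset> Q" using EQ by blast
    from normalizer_grows[OF ES QS this] obtain x where x: "x \<in> Q" "x \<notin> E" "\<And>h. h \<in> E \<Longrightarrow> x \<otimes> h \<otimes> inv x \<in> E" by metis
    have "?u x = ?v x"
      by (rule epi_normalizer[OF E Q R i(1) u v ui x(1)]) (unfold iE, use x(3) in \<open>auto simp: conj_map_def\<close>)
    then show False using x(1,2) by (simp add: E_def)
  qed
  then have "\<And>x. x \<in> Q \<Longrightarrow> ?u x = ?v x" by (auto simp: E_def)
  then show ?thesis by (rule epi_if_\<pi>_eq[OF P Q R f u v eq])
qed

lemma thin_coslice: assumes P: "centric P" shows "thin (coslice L P A)"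
  unfolding thin_def
proof (intro conjI ballI)
  show "category (coslice L P A)" by (rule category_coslice[OF category_L]) (use P in simp)
  fix X Y f g assume "X \<in> Obj (coslice L P A)" "Y \<in> Obj (coslice L P A)" "f \<in> Hom (coslice L P A) X Y" "g \<in> Hom (coslice L P A) X Y"
  then have a: "centric (fst X)" "centric (fst Y)" "snd X \<in> Hom L P (fst X)" "f \<in> Hom L (fst X) (fst Y)"
      "g \<in> Hom L (fst X) (fst Y)" "Comp L P (fst X) (fst Y) f (snd X) = snd Y" "Comp L P (fst X) (fst Y) g (snd X) = snd Y" by auto
  show "f = g" by (rule L_epi[OF P a(1-5)]) (simp only: a(6,7))
qed

definition pr where "pr P X = \<pi> P (fst X) (snd X)"

lemma coslice_le:
  assumes P: "centric P" and X: "X \<in> Obj (coslice L P A)" and Y: "Y \<in> Obj (coslice L P B)"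
  shows "Hom (coslice L P C) X Y \<noteq> {} \<longleftrightarrow> (\<exists>k. FM (fst X) k \<and> k ` fst X \<subseteq> fst Y \<and> (\<forall>x\<in>P. k (pr P X x) = pr P Y x))"
  using factor_iff[OF P, of "fst X" "fst Y" "snd X" "snd Y"] X Y unfolding pr_def by auto

lemma coslice_ObjD:
  assumes P: "centric P" and X: "X \<in> Obj (coslice L P A)"
  shows "centric (fst X)" "fst X \<in> A" "snd X \<in> Hom L P (fst X)" "FM P (pr P X)" "pr P X ` P \<subseteq> fst X" "subgroup (fst X) S"
proof -
  show 1: "centric (fst X)" "fst X \<in> A" "snd X \<in> Hom L P (fst X)" using X by auto
  show "FM P (pr P X)" "pr P X ` P \<subseteq> fst X" unfolding pr_def by (rule \<pi>_in(3,4)[OF P 1(1,3)])+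
  show "subgroup (fst X) S" by (rule centricD(1)[OF 1(1)])
qed

definition ob where "ob P R a = (R, SOME g. g \<in> Hom L P R \<and> (\<forall>x\<in>P. \<pi> P R g x = a x))"

lemma ob:
  assumes P: "centric P" and a: "FM P a" and R: "centric R" "a ` P \<subseteq> R" "R \<in> A"
  shows "ob P R a \<in> Obj (coslice L P A)" "fst (ob P R a) = R" "x \<in> P \<Longrightarrow> pr P (ob P R a) x = a x"
proof -
  obtain g where "g \<in> Hom L P R" "\<And>x. x \<in> P \<Longrightarrow> \<pi> P R g x = a x" by (rule lift[OF P R(1) a R(2)]) (rule that)
  then have "\<exists>g. g \<in> Hom L P R \<and> (\<forall>x\<in>P. \<pi> P R g x = a x)" by blast
  from someI_ex[OF this] show "ob P R a \<in> Obj (coslice L P A)" "fst (ob P R a) = R" "x \<in> P \<Longrightarrow> pr P (ob P R a) x = a x"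
    using R by (simp_all add: ob_def pr_def)
qed

end

lemma thin_full_subcategory: "thin C \<Longrightarrow> thin (full C A)"
  by (auto simp: thin_def category_full_subcategory)

context linking
begin

lemma bullet_unique:
  assumes P: "centric P" and k: "FM (bul P) k" "FM (bul P) k'" "\<And>x. x \<in> P \<Longrightarrow> k x = k' x" and y: "y \<in> bul P"
  shows "k y = k' y"
proof -
  have "FM P k" by (rule FM_restrict[OF k(1) centricD(1)[OF P] bullet_subgroup(2)[OF centricD(1)[OF P]]])
  then show ?thesis
  proof (rule bullet_extension[OF P])
    fix g assume g: "\<And>k' y. FM (bul P) k' \<Longrightarrow> (\<And>x. x \<in> P \<Longrightarrow> k' x = k x) \<Longrightarrow> y \<in> bul P \<Longrightarrow> k' y = g y"
    show "k y = k' y" using g[OF k(1) refl y] g[OF k(2) k(3)[symmetric] y] by simp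
  qed
qed

lemma contr_coslice_bullet:
  assumes P: "centric P" and H: "\<And>Q. Q \<in> H \<Longrightarrow> bul Q \<in> H" and c: "contr (coslice L (bul P) H)"
  shows "contr (coslice L P H)"
proof -
  note PS = centricD(1)[OF P] and Pb = bullet_subgroup[OF centricD(1)[OF P]]
  let ?C = "coslice L P H" and ?D = "coslice L (bul P) H"
  have bP: "centric (bul P)" by (rule centric_overgroup[OF P Pb(1,2)])
  note D = coslice_ObjD[OF P, where A = H] and Db = coslice_ObjD[OF bP, where A = H]
  let ?ok = "\<lambda>X Y. Y \<in> Obj ?D \<and> fst Y = bul (fst X) \<and> (\<forall>x\<in>P. pr (bul P) Y x = pr P X x)"
  define f where "f X = (SOME Y. ?ok X Y)" for X
  have f: "?ok X (f X)" if X: "X \<in> Obj ?C" for X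
    unfolding f_def
  proof (rule someI_ex)
    note d = D[OF X] and Qb = bullet_subgroup[OF D(6)[OF X]]
    obtain g where g: "FM (bul P) g" "\<And>x. x \<in> P \<Longrightarrow> g x = pr P X x" "\<And>Q. subgroup Q S \<Longrightarrow> pr P X ` P \<subseteq> Q \<Longrightarrow> g ` bul P \<subseteq> bul Q"
      by (rule bullet_extension[OF P d(4)]) (rule that)
    note o = ob[OF bP g(1) centric_overgroup[OF d(1) Qb(1,2)] g(3)[OF d(6,5)] H[OF d(2)]]
    have "?ok X (ob (bul P) (bul (fst X)) g)"
      using o(1,2) o(3)[OF subsetD[OF Pb(2)]] g(2) by (intro conjI ballI) (assumption | simp)+
    then show "\<exists>Y. ?ok X Y" by (rule exI)
  qed
  define g where "g Y = ob P (fst Y) (pr (bul P) Y)" for Y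
  have g: "g Y \<in> Obj ?C" "fst (g Y) = fst Y" "x \<in> P \<Longrightarrow> pr P (g Y) x = pr (bul P) Y x" if Y: "Y \<in> Obj ?D" for Y x
  proof -
    note d = Db[OF Y]
    have 1: "FM P (pr (bul P) Y)" by (rule FM_restrict[OF d(4) PS Pb(2)])
    have 2: "pr (bul P) Y ` P \<subseteq> fst Y" using d(5) Pb(2) by blast
    show "g Y \<in> Obj ?C" "fst (g Y) = fst Y" "x \<in> P \<Longrightarrow> pr P (g Y) x = pr (bul P) Y x"
      unfolding g_def by (rule ob[OF P 1 d(1) 2 d(2)], assumption?)+
  qed
  have fm: "monotone_obj ?C ?D f"
    unfolding monotone_obj_def
  proof (intro conjI ballI impI)
    show "f X \<in> Obj ?D" if "X \<in> Obj ?C" for X using f[OF that] by (rule conjunct1)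
    fix X Y assume X: "X \<in> Obj ?C" and Y: "Y \<in> Obj ?C" and "Hom ?C X Y \<noteq> {}"
    then obtain k where k: "FM (fst X) k" "k ` fst X \<subseteq> fst Y" "\<And>x. x \<in> P \<Longrightarrow> k (pr P X x) = pr P Y x"
      unfolding coslice_le[OF P X Y] by blast
    note dX = D[OF X] and dY = D[OF Y] and fX = f[OF X] and fY = f[OF Y]
    note dfX = Db[OF conjunct1[OF fX]] and dfY = Db[OF conjunct1[OF fY]]
    obtain k' where k': "FM (bul (fst X)) k'" "\<And>x. x \<in> fst X \<Longrightarrow> k' x = k x" "\<And>Q. subgroup Q S \<Longrightarrow> k ` fst X \<subseteq> Q \<Longrightarrow> k' ` bul (fst X) \<subseteq> bul Q"
      by (rule bullet_extension[OF dX(1) k(1)]) (rule that)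
    have X1: "fst (f X) = bul (fst X)" and Y1: "fst (f Y) = bul (fst Y)" using fX fY by simp_all
    have kf: "FM (bul P) (\<lambda>x. k' (pr (bul P) (f X) x))"
      by (rule FM_comp[OF dfX(4) k'(1)]) (use dfX(5) X1 in simp)
    have "k' (pr (bul P) (f X) x) = pr (bul P) (f Y) x" if x: "x \<in> bul P" for x
    proof (rule bullet_unique[OF P kf dfY(4) _ x])
      fix y assume y: "y \<in> P"
      have "pr P X y \<in> fst X" using dX(5) y by blast
      moreover have "pr (bul P) (f X) y = pr P X y" "pr (bul P) (f Y) y = pr P Y y" using fX fY y by blast+
      ultimately show "k' (pr (bul P) (f X) y) = pr (bul P) (f Y) y" using k'(2) k(3)[OF y] by simp
    qed
    moreover have "k' ` fst (f X) \<subseteq> fst (f Y)" unfolding X1 Y1 by (rule k'(3)[OF dY(6) k(2)])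
    moreover have "FM (fst (f X)) k'" unfolding X1 by (rule k'(1))
    ultimately show "Hom ?D (f X) (f Y) \<noteq> {}"
      unfolding coslice_le[OF bP conjunct1[OF fX] conjunct1[OF fY]] by (intro exI[of _ k']) simp
  qed
  have gm: "monotone_obj ?D ?C g"
    unfolding monotone_obj_def
  proof (intro conjI ballI impI)
    show "g Y \<in> Obj ?C" if "Y \<in> Obj ?D" for Y by (rule g(1)[OF that])
    fix X Y assume X: "X \<in> Obj ?D" and Y: "Y \<in> Obj ?D" and "Hom ?D X Y \<noteq> {}"
    then obtain k where k: "FM (fst X) k" "k ` fst X \<subseteq> fst Y" "\<And>x. x \<in> bul P \<Longrightarrow> k (pr (bul P) X x) = pr (bul P) Y x"
      unfolding coslice_le[OF bP X Y] by blast
    show "Hom ?C (g X) (g Y) \<noteq> {}"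
      unfolding coslice_le[OF P g(1)[OF X] g(1)[OF Y]] g(2)[OF X] g(2)[OF Y]
      using k g(3)[OF X] g(3)[OF Y] subsetD[OF Pb(2)] by (intro exI[of _ k]) simp
  qed
  have le: "Hom ?C X (g (f X)) \<noteq> {}" if X: "X \<in> Obj ?C" for X
  proof -
    have fX: "f X \<in> Obj ?D" "fst (f X) = bul (fst X)" "\<And>x. x \<in> P \<Longrightarrow> pr (bul P) (f X) x = pr P X x" using f[OF X] by blast+
    note dX = D[OF X]
    show ?thesis
      unfolding coslice_le[OF P X g(1)[OF fX(1)]] g(2)[OF fX(1)] fX(2)
      using FM_id[OF dX(6)] bullet_subgroup(2)[OF dX(6)] g(3)[OF fX(1)] fX(3) by (intro exI[of _ "\<lambda>x. x"]) simp
  qed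
  show ?thesis by (rule contr_thin_retract[OF thin_coslice[OF P] thin_coslice[OF bP] fm gm le c])
qed

text \<open>The objects \<open>(Q, f)\<close> of \<open>P \<down> L\<close> with \<open>f(P) \<noteq> Q\<close> contract through
  \<open>(Q, f) \<ge> (N\<^sub>Q(f P), f) \<le> e(Q, f) \<ge> c\<close>, where \<open>c\<close> realizes a normal subgroup \<open>O\<close> of \<open>Aut\<^sub>F(P)\<close> for
  which \<open>O/Inn(P)\<close> is a nontrivial \<open>p\<close>-group, and \<open>e(Q, f)\<close> realizes the product of \<open>O\<close> with the
  automorphisms induced by \<open>N\<^sub>Q(f P)\<close>.\<close>

abbreviation proper_over where
  "proper_over P \<equiv> full (coslice L P UNIV) {X. pr P X ` P \<noteq> fst X}"

lemma contr_proper_over: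
  assumes P: "centric P" and nr: "\<not> F_radical p S F P"
  shows "contr (proper_over P)"
proof -
  note PS = centricD(1)[OF P]
  let ?C = "coslice L P UNIV" and ?K = "proper_over P"
  interpret A: group "Aut P" by (rule group_aut_F[OF PS])
  interpret I: normal "Inn P" "Aut P" by (rule Inn_normal[OF PS])
  obtain O' where O': "O' \<lhd> Aut P" "Inn P \<subset> O'" "\<And>y. y \<in> O' \<Longrightarrow> \<exists>n. y [^]\<^bsub>Aut P\<^esub> (p ^ n :: nat) \<in> Inn P"
    using not_radical[OF PS nr] by blast
  interpret O: normal O' "Aut P" by (rule O'(1))
  have KD: "X \<in> Obj ?C" "pr P X ` P \<noteq> fst X" if "X \<in> Obj ?K" for X using that by (auto simp: full_subcategory_def)
  have KI: "X \<in> Obj ?K" if "X \<in> Obj ?C" "pr P X ` P \<noteq> fst X" for X using that by (auto simp: full_subcategory_def)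
  have le: "Hom ?K X Y \<noteq> {} \<longleftrightarrow> (\<exists>k. FM (fst X) k \<and> k ` fst X \<subseteq> fst Y \<and> (\<forall>x\<in>P. k (pr P X x) = pr P Y x))"
    if "X \<in> Obj ?K" "Y \<in> Obj ?K" for X Y
    using coslice_le[OF P KD(1)[OF that(1)] KD(1)[OF that(2)], where C = UNIV] by (simp add: full_subcategory_def)
  note D = coslice_ObjD[OF P KD(1)]
  have obK: "ob P R a \<in> Obj ?K" "fst (ob P R a) = R" "x \<in> P \<Longrightarrow> pr P (ob P R a) x = a x"
    if n: "nrm P R a" and ne: "a ` P \<noteq> R" for R a x
  proof -
    note d = nrmD[OF n]
    note o = ob[OF P d(1) centric_overgroup[OF centric_image[OF P d(1)] d(2,3)] d(3) UNIV_I]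
    have "pr P (ob P R a) ` P = a ` P" using o(3) by simp
    then show "ob P R a \<in> Obj ?K" using o(2) ne by (intro KI[OF o(1)]) simp
    show "fst (ob P R a) = R" by (rule o(2))
    show "x \<in> P \<Longrightarrow> pr P (ob P R a) x = a x" by (rule o(3))
  qed
  have ne: "a ` P \<noteq> R" if n: "nrm P R a" and O: "O' \<subseteq> pb P a ` R" for R a
  proof
    assume "a ` P = R"
    then have "pb P a ` R = (\<lambda>x. pb P a (a x)) ` P" by auto
    also have "\<dots> \<subseteq> Inn P"
    proof (rule image_subsetI)
      fix x assume x: "x \<in> P"
      show "pb P a (a x) \<in> Inn P"
        unfolding pb_inner[OF n x] conj_hom_def using x nrmD(4)[OF Inn_eq(2)[OF PS] x] by auto
    qed
    finally show False using O O'(2) by blast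
  qed
  define N where "N X = {g \<in> fst X. cj g ` pr P X ` P = pr P X ` P}" for X
  have nN: "nrm P (N X) (pr P X)" and NX: "N X \<subseteq> fst X" and Nne: "pr P X ` P \<noteq> N X" if X: "X \<in> Obj ?K" for X
  proof -
    note d = D[OF X]
    note s = conj_stabilizer[OF FMD(4)[OF d(4)] d(6,5), folded N_def]
    show "nrm P (N X) (pr P X)" unfolding nrm_def using d(4) s by (simp add: N_def)
    show "N X \<subseteq> fst X" by (auto simp: N_def)
    have "pr P X ` P \<subset> fst X" using d(5) KD(2)[OF X] by blast
    then obtain x where x: "x \<in> fst X" "x \<notin> pr P X ` P" "\<And>h. h \<in> pr P X ` P \<Longrightarrow> x \<otimes> h \<otimes> inv x \<in> pr P X ` P"
      by (rule normalizer_grows[OF FMD(4)[OF d(4)] d(6)]) (rule that)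
    have "cj x ` pr P X ` P = pr P X ` P"
      by (rule FM_endo_surj[OF FM_conj[OF FMD(4)[OF d(4)] subgroupD(1)[OF d(6) x(1)]]])
        (use x(3) in \<open>auto simp: conj_map_def\<close>)
    then show "pr P X ` P \<noteq> N X" using x(1,2) unfolding N_def by blast
  qed
  define X' where "X' X = pb P (pr P X) ` N X" for X
  have X'sub: "subgroup (X' X) (Aut P)" if X: "X \<in> Obj ?K" for X
    unfolding X'_def by (rule pb_image_subgroup[OF nN[OF X] nrmD(2)[OF nN[OF X]] order_refl])
  define XO where "XO X = O' <#>\<^bsub>Aut P\<^esub> X' X" for X
  have XO: "subgroup (XO X) (Aut P)" "O' \<subseteq> XO X" "X' X \<subseteq> XO X" if X: "X \<in> Obj ?K" for X
  proof -
    show "subgroup (XO X) (Aut P)" unfolding XO_def by (rule A.mult_norm_subgroup[OF O'(1) X'sub[OF X]])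
    note c = subgroup.subset[OF X'sub[OF X]] subgroup.one_closed[OF X'sub[OF X]]
    show "O' \<subseteq> XO X"
    proof
      fix u assume u: "u \<in> O'"
      then have "u = u \<otimes>\<^bsub>Aut P\<^esub> \<one>\<^bsub>Aut P\<^esub>" using O.subset by auto
      then show "u \<in> XO X" unfolding XO_def set_mult_def using u c(2) by blast
    qed
    show "X' X \<subseteq> XO X"
    proof
      fix u assume u: "u \<in> X' X"
      then have "u = \<one>\<^bsub>Aut P\<^esub> \<otimes>\<^bsub>Aut P\<^esub> u" using c(1) by auto
      then show "u \<in> XO X" unfolding XO_def set_mult_def using u O.one_closed by blast
    qed
  qed
  have tor: "\<exists>n. y [^]\<^bsub>Aut P\<^esub> (p ^ n :: nat) \<in> Inn P" if X: "X \<in> Obj ?K" and y: "y \<in> XO X" for X y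
  proof -
    obtain u q where uq: "u \<in> O'" "q \<in> N X" "y = u \<otimes>\<^bsub>Aut P\<^esub> pb P (pr P X) q"
      using y unfolding XO_def X'_def set_mult_def by blast
    let ?v = "pb P (pr P X) q"
    have vc: "?v \<in> carrier (Aut P)" by (rule pb_in[OF nN[OF X] uq(2)])
    have uc: "u \<in> carrier (Aut P)" using uq(1) O.subset by blast
    have yc: "y \<in> carrier (Aut P)" unfolding uq(3) by (rule A.m_closed[OF uc vc])
    interpret h: group_hom "grp (N X)" "Aut P" "pb P (pr P X)" by (rule pb_hom[OF nN[OF X]])
    obtain s where s: "q [^] (p ^ s :: nat) = \<one>" using torsion[OF nrmD(6)[OF nN[OF X] uq(2)]] by blast
    have "?v [^]\<^bsub>Aut P\<^esub> (p ^ s) = pb P (pr P X) \<one>"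
      using h.hom_nat_pow[of q "p ^ s"] uq(2) s by (simp flip: nat_pow_consistent)
    then have v1: "?v [^]\<^bsub>Aut P\<^esub> (p ^ s) = \<one>\<^bsub>Aut P\<^esub>" using h.hom_one by simp
    have "O' #>\<^bsub>Aut P\<^esub> y = O' #>\<^bsub>Aut P\<^esub> ?v"
      unfolding uq(3) using A.coset_mult_assoc[OF O.subset uc vc] A.coset_join2[OF uc O.is_subgroup uq(1)] by simp
    then have "O' #>\<^bsub>Aut P\<^esub> (y [^]\<^bsub>Aut P\<^esub> (p ^ s)) = O' #>\<^bsub>Aut P\<^esub> (?v [^]\<^bsub>Aut P\<^esub> (p ^ s))"
      using O.FactGroup_pow[OF yc, of "p ^ s"] O.FactGroup_pow[OF vc, of "p ^ s"] by simp
    also have "\<dots> = O'" unfolding v1 using A.coset_mult_one[OF O.subset] .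
    finally have "y [^]\<^bsub>Aut P\<^esub> (p ^ s) \<in> O'" using O.rcos_eq_iff[OF A.nat_pow_closed[OF yc]] by simp
    then obtain t where "(y [^]\<^bsub>Aut P\<^esub> (p ^ s)) [^]\<^bsub>Aut P\<^esub> (p ^ t :: nat) \<in> Inn P" using O'(3) by blast
    then have "y [^]\<^bsub>Aut P\<^esub> (p ^ (s + t)) \<in> Inn P" using yc by (simp add: A.nat_pow_pow power_add)
    then show ?thesis by blast
  qed
  define r where "r Y = (SOME Ra. nrm P (fst Ra) (snd Ra) \<and> pb P (snd Ra) ` fst Ra = Y)" for Y
  have r: "nrm P (fst (r Y)) (snd (r Y))" "pb P (snd (r Y)) ` fst (r Y) = Y"
    if "subgroup Y (Aut P)" "Inn P \<subseteq> Y" "\<And>y. y \<in> Y \<Longrightarrow> \<exists>n. y [^]\<^bsub>Aut P\<^esub> (p ^ n :: nat) \<in> Inn P" for Y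
  proof -
    have "\<exists>Ra. nrm P (fst Ra) (snd Ra) \<and> pb P (snd Ra) ` fst Ra = Y"
      using realize_automorphisms[OF P that] by (metis fst_conv snd_conv)
    from someI_ex[OF this] show "nrm P (fst (r Y)) (snd (r Y))" "pb P (snd (r Y)) ` fst (r Y) = Y"
      unfolding r_def by blast+
  qed
  define n where "n X = ob P (N X) (pr P X)" for X
  define e where "e X = ob P (fst (r (XO X))) (snd (r (XO X)))" for X
  define c where "c = ob P (fst (r O')) (snd (r O'))"
  note nK = obK[OF nN Nne, folded n_def]
  have rX: "nrm P (fst (r (XO X))) (snd (r (XO X)))" "pb P (snd (r (XO X))) ` fst (r (XO X)) = XO X" if X: "X \<in> Obj ?K" for X
  proof -
    have "Inn P \<subseteq> XO X" using XO(2)[OF X] O'(2) by blast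
    from r[OF XO(1)[OF X] this tor[OF X]]
    show "nrm P (fst (r (XO X))) (snd (r (XO X)))" "pb P (snd (r (XO X))) ` fst (r (XO X)) = XO X" by blast+
  qed
  have rO: "nrm P (fst (r O')) (snd (r O'))" "pb P (snd (r O')) ` fst (r O') = O'"
    using r[OF O.is_subgroup psubset_imp_subset[OF O'(2)] O'(3)] by blast+
  have neX: "snd (r (XO X)) ` P \<noteq> fst (r (XO X))" if X: "X \<in> Obj ?K" for X
    by (rule ne[OF rX(1)[OF X]]) (use rX(2)[OF X] XO(2)[OF X] in simp)
  note eK = obK[OF rX(1) neX, folded e_def]
  have neO: "snd (r O') ` P \<noteq> fst (r O')" by (rule ne[OF rO(1)]) (use rO(2) in simp)
  note cK = obK[OF rO(1) neO, folded c_def]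
  have le_ob: "Hom ?K (ob P Q a) (ob P R b) \<noteq> {}"
    if a: "nrm P Q a" "a ` P \<noteq> Q" and b: "nrm P R b" "b ` P \<noteq> R" and sub: "pb P a ` Q \<subseteq> pb P b ` R" for Q R a b
    unfolding le[OF obK(1)[OF a] obK(1)[OF b]] obK(2)[OF a] obK(2)[OF b]
    using factor_through[OF P a(1) b(1) sub] obK(3)[OF a] obK(3)[OF b] by auto
  have mono: "\<exists>k. FM (N X) k \<and> k ` N X \<subseteq> N Y \<and> (\<forall>x\<in>P. k (pr P X x) = pr P Y x)" "X' X \<subseteq> X' Y"
    if X: "X \<in> Obj ?K" and Y: "Y \<in> Obj ?K" and h: "Hom ?K X Y \<noteq> {}" for X Y
  proof -
    obtain k where k: "FM (fst X) k" "k ` fst X \<subseteq> fst Y" "\<And>x. x \<in> P \<Longrightarrow> k (pr P X x) = pr P Y x"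
      using h unfolding le[OF X Y] by blast
    note dX = D[OF X] and dY = D[OF Y]
    have conj: "cj (k g) (pr P Y x) = pr P Y (pb P (pr P X) g x)" if g: "g \<in> N X" and x: "x \<in> P" for g x
    proof -
      have gX: "g \<in> fst X" using g NX[OF X] by blast
      have fx: "pr P X x \<in> fst X" using dX(5) x by blast
      note b = pb_apply[OF nN[OF X] g x]
      have "cj (k g) (pr P Y x) = k (cj g (pr P X x))"
        unfolding k(3)[OF x, symmetric] FM_conj_map[OF k(1) gX fx] ..
      also have "\<dots> = pr P Y (pb P (pr P X) g x)" unfolding b(1)[symmetric] by (rule k(3)[OF b(2)])
      finally show ?thesis .
    qed
    have kN: "k g \<in> N Y" if g: "g \<in> N X" for g
    proof -
      have kg: "k g \<in> fst Y" using k(2) g NX[OF X] by blast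
      have "cj (k g) ` pr P Y ` P \<subseteq> pr P Y ` P" using conj[OF g] pb_apply(2)[OF nN[OF X] g] by auto
      then have "cj (k g) ` pr P Y ` P = pr P Y ` P"
        by (rule FM_endo_surj[OF FM_conj[OF FMD(4)[OF dY(4)] subgroupD(1)[OF dY(6) kg]]])
      then show ?thesis using kg by (simp add: N_def)
    qed
    have "FM (N X) k" by (rule FM_restrict[OF k(1) nrmD(2)[OF nN[OF X]] NX[OF X]])
    then show "\<exists>k. FM (N X) k \<and> k ` N X \<subseteq> N Y \<and> (\<forall>x\<in>P. k (pr P X x) = pr P Y x)"
      using kN k(3) by (intro exI[of _ k]) (simp add: image_subset_iff)
    show "X' X \<subseteq> X' Y"
    proof
      fix u assume "u \<in> X' X"
      then obtain g where g: "g \<in> N X" "u = pb P (pr P X) g" unfolding X'_def by blast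
      have "u = pb P (pr P Y) (k g)"
        unfolding g(2) by (rule pb_unique[OF nN[OF Y] kN[OF g(1)]])
          (use conj[OF g(1)] pb_apply(2)[OF nN[OF X] g(1)] in \<open>auto simp: pb_def\<close>)
      then show "u \<in> X' Y" unfolding X'_def using kN[OF g(1)] by blast
    qed
  qed
  have nm: "monotone_obj ?K ?K n"
    unfolding monotone_obj_def
  proof (intro conjI ballI impI)
    fix X Y assume X: "X \<in> Obj ?K" and Y: "Y \<in> Obj ?K" and h: "Hom ?K X Y \<noteq> {}"
    show "Hom ?K (n X) (n Y) \<noteq> {}"
      unfolding le[OF nK(1)[OF X X] nK(1)[OF Y Y]] nK(2)[OF X X] nK(2)[OF Y Y]
      using mono(1)[OF X Y h] nK(3)[OF X X] nK(3)[OF Y Y] by auto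
  qed (rule nK(1))
  have em: "monotone_obj ?K ?K e"
    unfolding monotone_obj_def
  proof (intro conjI ballI impI)
    fix X Y assume X: "X \<in> Obj ?K" and Y: "Y \<in> Obj ?K" and h: "Hom ?K X Y \<noteq> {}"
    have "XO X \<subseteq> XO Y" unfolding XO_def set_mult_def using mono(2)[OF X Y h] by blast
    then show "Hom ?K (e X) (e Y) \<noteq> {}" unfolding e_def
      by (intro le_ob rX(1) neX X Y) (simp add: rX(2)[OF X] rX(2)[OF Y])
  qed (rule eK(1))
  show ?thesis
  proof (rule contr_thin[OF thin_full_subcategory[OF thin_coslice[OF P]] nm em cK(1)])
    fix X assume X: "X \<in> Obj ?K"
    show "Hom ?K (n X) X \<noteq> {}"
      unfolding le[OF nK(1)[OF X X] X] nK(2)[OF X X]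
      using FM_id[OF nrmD(2)[OF nN[OF X]]] NX[OF X] nK(3)[OF X X] by (intro exI[of _ "\<lambda>x. x"]) simp
    show "Hom ?K (n X) (e X) \<noteq> {}" unfolding n_def e_def
      by (intro le_ob nN Nne rX(1) neX X) (use XO(3)[OF X] in \<open>simp add: rX(2)[OF X] X'_def\<close>)
    show "Hom ?K c (e X) \<noteq> {}" unfolding c_def e_def
      by (intro le_ob rO(1) neO rX(1) neX X) (use XO(2)[OF X] in \<open>simp add: rX(2)[OF X] rO(2)\<close>)
  qed
qed

lemma contr_coslice_collection:
  assumes H: "\<And>P. P \<in> H \<Longrightarrow> centric P" "\<And>P Q. P \<in> H \<Longrightarrow> isomorphic_in F P Q \<Longrightarrow> Q \<in> H"
    "\<And>P. centric P \<Longrightarrow> F_radical p S F P \<Longrightarrow> P \<in> H" "\<And>P. P \<in> H \<Longrightarrow> bul P \<in> H"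
    and P: "centric P"
  shows "contr (coslice L P H)"
proof -
  obtain B0 where B0: "\<And>P. subgroup P S \<Longrightarrow> idx (bul P) \<le> B0" using idx_bullet_bounded by blast
  define B where "B = Suc B0"
  define m where "m X = rk X * B + idx X" for X
  have mono: "m X < m Y" if X: "subgroup X S" and Y: "subgroup Y S" and sub: "X \<subset> Y" and b: "idx X < B" for X Y
    using size_strict_mono[OF X Y sub]
  proof
    assume "rk X < rk Y"
    then have "Suc (rk X) * B \<le> rk Y * B" by (intro mult_le_mono1) simp
    then show ?thesis using b by (simp add: m_def)
  qed (simp add: m_def)
  have bP: "centric (bul P)" "idx (bul P) < B" "m (bul P) < Suc (rk (carrier S)) * B" if P: "centric P" for P
  proof -
    note b = bullet_subgroup[OF centricD(1)[OF P]]
    show "centric (bul P)" by (rule centric_overgroup[OF P b(1,2)])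
    show i: "idx (bul P) < B" using B0[OF centricD(1)[OF P]] by (simp add: B_def)
    have "rk (bul P) \<le> rk (carrier S)" by (rule rk_mono[OF b(1) subgroup_self subgroup.subset[OF b(1)]])
    then have "rk (bul P) * B \<le> rk (carrier S) * B" by (rule mult_le_mono1)
    then show "m (bul P) < Suc (rk (carrier S)) * B" using i unfolding m_def mult_Suc by linarith
  qed
  have "contr (coslice L P H)" if "centric P" for P
    using that
  proof (induction "Suc (rk (carrier S)) * B - m (bul P)" arbitrary: P rule: less_induct)
    case less
    let ?P = "bul P"
    note b = bP[OF less.prems]
    have PO: "?P \<in> Obj L" using b(1) by simp
    show ?case
    proof (rule contr_coslice_bullet[OF less.prems H(4)])
      show "contr (coslice L ?P H)"
      proof (cases "?P \<in> H")
        case True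
        show ?thesis by (rule contr_coslice_self[OF category_L PO True])
      next
        case False
        let ?C = "coslice L ?P UNIV" and ?K = "proper_over ?P"
        let ?A = "{X. pr ?P X ` ?P \<noteq> fst X} \<inter> {X. fst X \<in> H}"
        have nr: "\<not> F_radical p S F ?P" using H(3)[OF b(1)] False by blast
        have catC: "category ?C" by (rule category_coslice[OF category_L PO])
        have over: "pr ?P X ` ?P \<noteq> fst X" if X: "X \<in> Obj ?C" "fst X \<in> H" for X
        proof
          note d = coslice_ObjD[OF b(1) X(1)]
          assume eq: "pr ?P X ` ?P = fst X"
          then have "isomorphic_in F ?P (fst X)" unfolding isomorphic_F using d(4) by blast
          from H(2)[OF X(2) isomorphic_sym[OF this]] False show False by blast
        qed
        have eq: "full ?K (Obj ?C \<inter> ?A) = coslice L ?P H"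
        proof -
          have "Obj ?K \<inter> (Obj ?C \<inter> ?A) = Obj (coslice L ?P H)"
            using over by (auto simp: full_subcategory_def)
          then show ?thesis by (simp add: full_subcategory_def coslice_def)
        qed
        have "contr (full ?K (Obj ?C \<inter> ?A))"
        proof (rule contr_full_subcategory[OF category_full_subcategory[OF catC] _ _ contr_proper_over[OF b(1) nr]])
          show "Obj ?C \<inter> ?A \<subseteq> Obj ?K" by (auto simp: full_subcategory_def)
          fix X assume "X \<in> Obj ?K"
          then have X: "X \<in> Obj ?C" "pr ?P X ` ?P \<noteq> fst X" by (auto simp: full_subcategory_def)
          note d = coslice_ObjD[OF b(1) X(1)]
          have Q: "contr (coslice L (fst X) H)"
          proof (rule less.hyps[OF _ d(1)])
            note q = bullet_subgroup[OF d(6)] and i = FM_invariants(2,3)[OF d(4)]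
            have sub: "pr ?P X ` ?P \<subset> bul (fst X)" using d(5) X(2) q(2) by blast
            have "m (pr ?P X ` ?P) < m (bul (fst X))"
              by (rule mono[OF FMD(4)[OF d(4)] q(1) sub]) (simp add: i(2) b(2))
            then have "m ?P < m (bul (fst X))" by (simp add: m_def i)
            then show "Suc (rk (carrier S)) * B - m (bul (fst X)) < Suc (rk (carrier S)) * B - m ?P"
              using b(3) by (intro diff_less_mono2)
          qed
          show "contr (coslice ?K X (Obj ?C \<inter> ?A))"
            unfolding coslice_full_subcategory
          proof (rule contr_coslice_coslice[OF category_L PO X(1) _ _ Q])
            show "fst Z \<in> H" if "Z \<in> {X. pr ?P X ` ?P \<noteq> fst X} \<inter> (Obj ?C \<inter> ?A)" for Z using that by blast
            fix R u assume R: "R \<in> Obj L \<inter> H" and u: "u \<in> Hom L (fst X) R"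
            let ?Y = "(R, Comp L ?P (fst X) R u (snd X))"
            have Y: "?Y \<in> Obj ?C" using R u L_Comp[OF b(1) d(1) _ d(3) u] by simp
            have ne: "pr ?P ?Y ` ?P \<noteq> fst ?Y" by (rule over[OF Y]) (use R in simp)
            then show "?Y \<in> Obj ?C \<inter> ({X. pr ?P X ` ?P \<noteq> fst X} \<inter> (Obj ?C \<inter> ?A))"
              by (intro IntI CollectI Y ne) (use R in simp)
          qed
        qed
        then show ?thesis unfolding eq .
      qed
    qed
  qed
  then show ?thesis using P .
qed

end

theorem theorem1p1:
  fixes p :: nat
    and S :: "('a, 'b) monoid_scheme"
    and F :: "('a set, 'a \<Rightarrow> 'a) cat"
    and L :: "('a set, 'm) cat"
    and \<pi> :: "'a set \<Rightarrow> 'a set \<Rightarrow> 'm \<Rightarrow> 'a \<Rightarrow> 'a"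
    and \<delta> :: "'a set \<Rightarrow> 'a \<Rightarrow> 'm"
    and \<H> :: "'a set set"
  assumes "prime p"
    and "discrete_p_toral p S"
    and "saturated_fusion_system p S F"
    and "centric_linking_system S F L \<pi> \<delta>"
    and "\<And>P. P \<in> \<H> \<Longrightarrow> F_centric S F P"
    and "\<And>P Q. \<lbrakk>P \<in> \<H>; isomorphic_in F P Q\<rbrakk> \<Longrightarrow> Q \<in> \<H>"
    and "\<And>P. \<lbrakk>F_centric S F P; F_radical p S F P\<rbrakk> \<Longrightarrow> P \<in> \<H>"
    and "bullet p S F ` \<H> \<subseteq> \<H>"
  shows "homotopy_equivalence_map
           (realization (nerve (full_subcategory L \<H>)))
           (realization (nerve L))
           (inclusion_nerve_map L)"
proof -
  interpret group S using assms(2) by (simp add: discrete_p_toral_def)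
  interpret linking S p F L \<pi> \<delta>
    by unfold_locales (use assms(1-4) in auto)
  have sub: "\<H> \<subseteq> Obj L" using assms(5) by auto
  have contr: "contr (coslice L P \<H>)" if "P \<in> Obj L" for P
  proof (rule contr_coslice_collection)
    show "F_centric S F Q" if "Q \<in> \<H>" for Q by (rule assms(5)[OF that])
    show "R \<in> \<H>" if "Q \<in> \<H>" "isomorphic_in F Q R" for Q R by (rule assms(6)[OF that])
    show "Q \<in> \<H>" if "F_centric S F Q" "F_radical p S F Q" for Q by (rule assms(7)[OF that])
    show "bul Q \<in> \<H>" if "Q \<in> \<H>" for Q using assms(8) that by blast
    show "F_centric S F P" using that by simp
  qed
  obtain r where r: "continuous_map (steps L) (steps (full L \<H>)) r"
    "\<And>p. p \<in> topspace (steps (full L \<H>)) \<Longrightarrow> r p = p"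
    "homotopic L L r id"
    by (rule quillen_A[OF category_L sub contr]) (assumption, rule that)
  show ?thesis
    by (rule homotopy_equivalence_of_deformation_retraction[OF _ _ _ _ r]) auto
qed

end
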